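(* Let $V,p$ satisfy assumptions (A) and (B) of the context. For $\varepsilon>0$ let $(\lambda_n^\varepsilon,\phi_n^\varepsilon)_{n\in\mathbb{N}}$ and $(\lambda_n^0,\phi_n^0)_{n\in\mathbb{N}}$ be the ordered eigenvalue–eigenfunction pairs of the generators $\mathcal L^\varepsilon$ and $\mathcal L^0$, respectively (i.e. $-\mathcal L^\varepsilon\phi_n^\varepsilon=\lambda_n^\varepsilon\phi_n^\varepsilon$ and $-\mathcal L^0\phi_n^0=\lambda_n^0\phi_n^0$), with $\|\phi_n^\varepsilon\|_{L^2_{\rho^\varepsilon}(\mathbb{R}^d)}=1$ and $\|\phi_n^0\|_{L^2_{\rho^0}(\mathbb{R}^d)}=1$, and with the sign of $\phi_n^\varepsilon$ chosen such that $\langle\phi_n^\varepsilon;\phi_n^0\rangle_{L^2_{\rho^0}(\mathbb{R}^d)}>0$. Then for all $n\in\mathbb{N}$, as $\varepsilon\to0$: (i) $\lambda_n^\varepsilon\to\lambda_n^0$; (ii) $\phi_n^\varepsilon\to\phi_n^0$ strongly in $L^2_{\rho^0}(\mathbb{R}^d)$; (iii) $\phi_n^\varepsilon\rightharpoonup\phi_n^0$ weakly in $H^1_{\rho^0}(\mathbb{R}^d)$.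
   Context: Let $d\ge1$, $\sigma>0$, $L>0$, $Y=[0,L]^d$, and $V,p\colon\mathbb{R}^d\to\mathbb{R}$. Assumption (A): $p\in C^\infty(\mathbb{R}^d)$ is $L$-periodic in all directions; $V\in C^\infty(\mathbb{R}^d)$ is polynomially bounded from above and is bounded from below; and there exist $a,b>0$ such that $-\nabla V(x)\cdot x\le a-b|x|^2$ for all $x\in\mathbb{R}^d$. Assumption (B): there exists $\beta>2$ such that $\lim_{|x|\to\infty}\left(\frac1\beta|\nabla V(x)|^2-\Delta V(x)\right)=+\infty$ and $\lim_{|x|\to\infty}|\nabla V(x)|=+\infty$. For $\varepsilon>0$ define the probability densities $$\rho^\varepsilon(x)=\frac{1}{C_{\rho^\varepsilon}}e^{-\frac1\sigma(V(x)+p(x/\varepsilon))},\qquad \rho^0(x)=\frac1{C_{\rho^0}}e^{-\frac1\sigma V(x)},$$ with $C_{\rho^\varepsilon},C_{\rho^0}$ the normalizing constants over $\mathbb{R}^d$. For a probability density $\rho$ on $\mathbb{R}^d$, $L^2_\rho(\mathbb{R}^d)$ is the space of measurable $u$ with $\|u\|_{L^2_\rho}^2=\int u^2\rho\,dx<\infty$, with inner product $\langle u;v\rangle_{L^2_\rho}=\int uv\rho\,dx$, and $H^1_\rho(\mathbb{R}^d)$ is the space of measurable weakly differentiable $u$ with $\|u\|_{H^1_\rho}^2=\int u^2\rho\,dx+\int|\nabla u|^2\rho\,dx<\infty$. The spaces $L^2_{\rho^\varepsilon}$ and $L^2_{\rho^0}$ (resp. $H^1_{\rho^\varepsilon}$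 and $H^1_{\rho^0}$) coincide as sets, with equivalent norms. Homogenized coefficients: $\mu(y)=\frac1{C_\mu}e^{-\frac1\sigma p(y)}$ with $C_\mu=\int_Ye^{-\frac1\sigma p(y)}dy$. Let $\Phi\colon Y\to\mathbb{R}^d$ be the unique solution, with periodic boundary conditions, of the cell problem $-\sigma\Delta\Phi(y)+\nabla\Phi(y)\nabla p(y)=-\nabla p(y)$, $y\in Y$, with $\int_Y\Phi(y)\mu(y)\,dy=0$ (here $\nabla\Phi$ is the Jacobian matrix and $\Delta\Phi$ the componentwise Laplacian). Then $K=\int_Y(I+\nabla\Phi(y))\mu(y)\,dy=\int_Y(I+\nabla\Phi(y))(I+\nabla\Phi(y))^\top\mu(y)\,dy$ is symmetric positive definite, and $\Sigma=\sigma K$. Generators: $\mathcal L^\varepsilon u=-\left(\nabla V(x)+\frac1\varepsilon\nabla p(\frac x\varepsilon)\right)\cdot\nabla u+\sigma\Delta u$ and $\mathcal L^0u=-K\nabla V\cdot\nabla u+\Sigma:\nabla^2u$ ($:$ is the Frobenius inner product). The eigenvalue equations are understood in the weak sense: $\phi\in H^1_{\rho^\varepsilon}$, $\phi\ne0$, with $\sigma\int\nabla\phi\cdot\nabla\psi\,\rho^\varepsilon dx=\lambda\int\phi\psi\,\rho^\varepsilon dx$ for all $\psi\in H^1_{\rho^\varepsilon}$, respectively $\phi\in H^1_{\rho^0}$, $\phi\neq 0$, with $\int\Sigma\nabla\phi\cdot\nabla\psi\,\rho^0dx=\lambda\int\phi\psi\,\rho^0dx$ for all $\psi\in H^1_{\rho^0}$.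 Ordered pairs: the eigenvalues of $-\mathcal L^\varepsilon$ (resp. $-\mathcal L^0$) are all simple and enumerated as $0=\lambda_0^\varepsilon<\lambda_1^\varepsilon<\lambda_2^\varepsilon<\cdots\nearrow+\infty$ (resp. $0=\lambda_0^0<\lambda_1^0<\lambda_2^0<\cdots\nearrow+\infty$), the eigenfunctions $\{\phi_n^\varepsilon\}_{n\in\mathbb{N}}$ (resp. $\{\phi_n^0\}_{n\in\mathbb{N}}$) form an orthonormal basis of $L^2_{\rho^\varepsilon}(\mathbb{R}^d)$ (resp. $L^2_{\rho^0}(\mathbb{R}^d)$), and $\phi_0^\varepsilon\equiv\phi_0^0\equiv1$. Here $\mathbb{N}=\{0,1,2,\dots\}$. *)

theory Defs
  imports "HOL-Analysis.Analysis"
begin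

definition partial :: "'d::finite \<Rightarrow> (real^'d \<Rightarrow> real) \<Rightarrow> real^'d \<Rightarrow> real" where
  "partial i f x = frechet_derivative f (at x) (axis i 1)"

definition grad :: "(real^'d \<Rightarrow> real) \<Rightarrow> real^'d \<Rightarrow> real^'d::finite" where
  "grad f x = (\<chi> i. partial i f x)"

definition laplacian :: "(real^'d::finite \<Rightarrow> real) \<Rightarrow> real^'d \<Rightarrow> real" where
  "laplacian f x = (\<Sum>i\<in>UNIV. partial i (partial i f) x)"

definition jacobian :: "(real^'d \<Rightarrow> real^'d) \<Rightarrow> real^'d \<Rightarrow> real^'d^'d::finite" where
  "jacobian F x = (\<chi> i j. partial j (\<lambda>z. F z $ i) x)"

definition vec_laplacian :: "(real^'d \<Rightarrow> real^'d) \<Rightarrow> real^'d \<Rightarrow> real^'d::finite" where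
  "vec_laplacian F x = (\<chi> i. laplacian (\<lambda>z. F z $ i) x)"

primrec C_k :: "nat \<Rightarrow> (real^'d::finite \<Rightarrow> real) \<Rightarrow> bool" where
  "C_k 0 f \<longleftrightarrow> continuous_on UNIV f"
| "C_k (Suc k) f \<longleftrightarrow> (\<forall>x. f differentiable (at x)) \<and> (\<forall>i. C_k k (partial i f))"

definition smooth :: "(real^'d::finite \<Rightarrow> real) \<Rightarrow> bool" where
  "smooth f \<longleftrightarrow> (\<forall>k. C_k k f)"

definition periodic :: "real \<Rightarrow> (real^'d::finite \<Rightarrow> 'b) \<Rightarrow> bool" where
  "periodic L f \<longleftrightarrow> (\<forall>x i. f (x + L *\<^sub>R axis i 1) = f x)"

definition assumption_A :: "real \<Rightarrow> (real^'d::finite \<Rightarrow> real) \<Rightarrow> (real^'d \<Rightarrow> real) \<Rightarrow> bool" where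
  "assumption_A L V p \<longleftrightarrow>
     smooth p \<and> periodic L p \<and>
     smooth V \<and>
     (\<exists>C k. \<forall>x. V x \<le> C * (1 + norm x ^ k)) \<and>
     (\<exists>c. \<forall>x. c \<le> V x) \<and>
     (\<exists>a>0. \<exists>b>0. \<forall>x. - (grad V x \<bullet> x) \<le> a - b * (norm x)\<^sup>2)"

definition assumption_B :: "(real^'d::finite \<Rightarrow> real) \<Rightarrow> bool" where
  "assumption_B V \<longleftrightarrow>
     (\<exists>\<beta>>2. filterlim (\<lambda>x. 1 / \<beta> * (norm (grad V x))\<^sup>2 - laplacian V x) at_top at_infinity) \<and>
     filterlim (\<lambda>x. norm (grad V x)) at_top at_infinity"

definition gibbs :: "(real^'d::finite) set \<Rightarrow> real \<Rightarrow> (real^'d \<Rightarrow> real) \<Rightarrow> real^'d \<Rightarrow> real" where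
  "gibbs D \<sigma> U x =
     exp (- (1 / \<sigma>) * U x) / (LINT z:D|lebesgue. exp (- (1 / \<sigma>) * U z))"

definition rho_eps ::
    "real \<Rightarrow> (real^'d::finite \<Rightarrow> real) \<Rightarrow> (real^'d \<Rightarrow> real) \<Rightarrow> real \<Rightarrow> real^'d \<Rightarrow> real" where
  "rho_eps \<sigma> V p \<epsilon> = gibbs UNIV \<sigma> (\<lambda>x. V x + p ((1 / \<epsilon>) *\<^sub>R x))"

definition rho_zero :: "real \<Rightarrow> (real^'d::finite \<Rightarrow> real) \<Rightarrow> real^'d \<Rightarrow> real" where
  "rho_zero \<sigma> V = gibbs UNIV \<sigma> V"

definition cell :: "real \<Rightarrow> (real^'d::finite) set" where
  "cell L = cbox 0 (\<chi> i. L)"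

definition mu :: "real \<Rightarrow> real \<Rightarrow> (real^'d::finite \<Rightarrow> real) \<Rightarrow> real^'d \<Rightarrow> real" where
  "mu \<sigma> L p = gibbs (cell L) \<sigma> p"

text \<open>A function on the cell with periodic boundary conditions is represented by its
  periodic extension to the whole space; solutions are classical.\<close>

definition cell_solution ::
    "real \<Rightarrow> real \<Rightarrow> (real^'d::finite \<Rightarrow> real) \<Rightarrow> (real^'d \<Rightarrow> real^'d) \<Rightarrow> bool" where
  "cell_solution \<sigma> L p \<Phi> \<longleftrightarrow>
     (\<forall>i. C_k 2 (\<lambda>y. \<Phi> y $ i)) \<and> periodic L \<Phi> \<and>
     (\<forall>y. - \<sigma> *\<^sub>R vec_laplacian \<Phi> y + jacobian \<Phi> y *v grad p y = - grad p y) \<and>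
     (LINT y:cell L|lebesgue. mu \<sigma> L p y *\<^sub>R \<Phi> y) = 0"

definition hom_K ::
    "real \<Rightarrow> real \<Rightarrow> (real^'d \<Rightarrow> real) \<Rightarrow> (real^'d \<Rightarrow> real^'d) \<Rightarrow> real^'d^'d::finite" where
  "hom_K \<sigma> L p \<Phi> = (LINT y:cell L|lebesgue. mu \<sigma> L p y *\<^sub>R (mat 1 + jacobian \<Phi> y))"

definition hom_Sigma ::
    "real \<Rightarrow> real \<Rightarrow> (real^'d \<Rightarrow> real) \<Rightarrow> (real^'d \<Rightarrow> real^'d) \<Rightarrow> real^'d^'d::finite" where
  "hom_Sigma \<sigma> L p \<Phi> = \<sigma> *\<^sub>R hom_K \<sigma> L p \<Phi>"

text \<open>Elements of the spaces are represented by functions; identities between elements are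
  almost-everywhere identities.\<close>

definition L2 :: "(real^'d::finite \<Rightarrow> real) \<Rightarrow> (real^'d \<Rightarrow> real) \<Rightarrow> bool" where
  "L2 \<rho> u \<longleftrightarrow> u \<in> borel_measurable lebesgue \<and> integrable lebesgue (\<lambda>x. (u x)\<^sup>2 * \<rho> x)"

definition L2_inner ::
    "(real^'d::finite \<Rightarrow> real) \<Rightarrow> (real^'d \<Rightarrow> real) \<Rightarrow> (real^'d \<Rightarrow> real) \<Rightarrow> real" where
  "L2_inner \<rho> u v = (LINT x|lebesgue. u x * v x * \<rho> x)"

definition L2_norm :: "(real^'d::finite \<Rightarrow> real) \<Rightarrow> (real^'d \<Rightarrow> real) \<Rightarrow> real" where
  "L2_norm \<rho> u = sqrt (L2_inner \<rho> u u)"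

definition locally_integrable :: "(real^'d::finite \<Rightarrow> 'b::euclidean_space) \<Rightarrow> bool" where
  "locally_integrable f \<longleftrightarrow> (\<forall>S. compact S \<longrightarrow> set_integrable lebesgue S f)"

definition test_function :: "(real^'d::finite \<Rightarrow> real) \<Rightarrow> bool" where
  "test_function \<eta> \<longleftrightarrow> smooth \<eta> \<and> compact (closure {x. \<eta> x \<noteq> 0})"

definition has_weak_grad :: "(real^'d \<Rightarrow> real) \<Rightarrow> (real^'d \<Rightarrow> real^'d::finite) \<Rightarrow> bool" where
  "has_weak_grad u g \<longleftrightarrow>
     locally_integrable u \<and> locally_integrable g \<and>
     (\<forall>\<eta> i. test_function \<eta> \<longrightarrow>
        (LINT x|lebesgue. u x * partial i \<eta> x) = - (LINT x|lebesgue. g x $ i * \<eta> x))"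

text \<open>A weak gradient is unique up to null sets, so the choice of representative does not
  affect any of the integrals below.\<close>

definition weak_grad :: "(real^'d \<Rightarrow> real) \<Rightarrow> real^'d \<Rightarrow> real^'d::finite" where
  "weak_grad u = (SOME g. has_weak_grad u g)"

definition H1 :: "(real^'d::finite \<Rightarrow> real) \<Rightarrow> (real^'d \<Rightarrow> real) \<Rightarrow> bool" where
  "H1 \<rho> u \<longleftrightarrow> L2 \<rho> u \<and> (\<exists>g. has_weak_grad u g) \<and>
     integrable lebesgue (\<lambda>x. (norm (weak_grad u x))\<^sup>2 * \<rho> x)"

definition H1_inner ::
    "(real^'d::finite \<Rightarrow> real) \<Rightarrow> (real^'d \<Rightarrow> real) \<Rightarrow> (real^'d \<Rightarrow> real) \<Rightarrow> real" where
  "H1_inner \<rho> u v =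
     L2_inner \<rho> u v + (LINT x|lebesgue. (weak_grad u x \<bullet> weak_grad v x) * \<rho> x)"

definition L2_strong_lim ::
    "(real^'d::finite \<Rightarrow> real) \<Rightarrow> ('a \<Rightarrow> real^'d \<Rightarrow> real) \<Rightarrow> (real^'d \<Rightarrow> real) \<Rightarrow> 'a filter \<Rightarrow> bool" where
  "L2_strong_lim \<rho> u v F \<longleftrightarrow>
     (\<forall>\<^sub>F a in F. L2 \<rho> (u a)) \<and> L2 \<rho> v \<and>
     ((\<lambda>a. L2_norm \<rho> (\<lambda>x. u a x - v x)) \<longlongrightarrow> 0) F"

text \<open>Weak convergence in the Hilbert space \<open>H1 \<rho>\<close>: convergence of the inner products with
  every fixed element.\<close>

definition H1_weak_lim ::
    "(real^'d::finite \<Rightarrow> real) \<Rightarrow> ('a \<Rightarrow> real^'d \<Rightarrow> real) \<Rightarrow> (real^'d \<Rightarrow> real) \<Rightarrow> 'a filter \<Rightarrow> bool" where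
  "H1_weak_lim \<rho> u v F \<longleftrightarrow>
     (\<forall>\<^sub>F a in F. H1 \<rho> (u a)) \<and> H1 \<rho> v \<and>
     (\<forall>\<psi>. H1 \<rho> \<psi> \<longrightarrow> ((\<lambda>a. H1_inner \<rho> (u a) \<psi>) \<longlongrightarrow> H1_inner \<rho> v \<psi>) F)"

text \<open>Integrating by parts against the invariant density turns \<open>-\<L> \<phi> = l \<phi>\<close> into the
  following weak equation, with \<open>A = \<sigma> I\<close>, \<open>\<rho> = \<rho>\<^sup>\<epsilon>\<close> for the multiscale
  generator and \<open>A = \<Sigma>\<close>, \<open>\<rho> = \<rho>\<^sup>0\<close> for the homogenized one.\<close>

definition weak_eigenpair ::
    "real^'d^'d \<Rightarrow> (real^'d::finite \<Rightarrow> real) \<Rightarrow> real \<Rightarrow> (real^'d \<Rightarrow> real) \<Rightarrow> bool" where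
  "weak_eigenpair A \<rho> l \<phi> \<longleftrightarrow>
     H1 \<rho> \<phi> \<and> \<not> (AE x in lebesgue. \<phi> x = 0) \<and>
     (\<forall>\<psi>. H1 \<rho> \<psi> \<longrightarrow>
        (LINT x|lebesgue. ((A *v weak_grad \<phi> x) \<bullet> weak_grad \<psi> x) * \<rho> x)
        = l * (LINT x|lebesgue. \<phi> x * \<psi> x * \<rho> x))"

definition orthonormal_basis_L2 ::
    "(real^'d::finite \<Rightarrow> real) \<Rightarrow> (nat \<Rightarrow> real^'d \<Rightarrow> real) \<Rightarrow> bool" where
  "orthonormal_basis_L2 \<rho> \<phi> \<longleftrightarrow>
     (\<forall>n. L2 \<rho> (\<phi> n)) \<and>
     (\<forall>m n. L2_inner \<rho> (\<phi> m) (\<phi> n) = (if m = n then 1 else 0)) \<and>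
     (\<forall>u. L2 \<rho> u \<longrightarrow>
        (\<lambda>N. L2_norm \<rho> (\<lambda>x. u x - (\<Sum>n<N. L2_inner \<rho> u (\<phi> n) * \<phi> n x))) \<longlonglongrightarrow> 0)"

definition ordered_eigenpairs ::
    "real^'d^'d \<Rightarrow> (real^'d::finite \<Rightarrow> real) \<Rightarrow> (nat \<Rightarrow> real) \<Rightarrow> (nat \<Rightarrow> real^'d \<Rightarrow> real) \<Rightarrow> bool" where
  "ordered_eigenpairs A \<rho> l \<phi> \<longleftrightarrow>
     l 0 = 0 \<and> strict_mono l \<and> filterlim l at_top sequentially \<and>
     {k. \<exists>\<psi>. weak_eigenpair A \<rho> k \<psi>} = range l \<and>
     (\<forall>k \<psi> \<psi>'. weak_eigenpair A \<rho> k \<psi> \<and> weak_eigenpair A \<rho> k \<psi>' \<longrightarrow>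
        (\<exists>c. AE x in lebesgue. \<psi>' x = c * \<psi> x)) \<and>
     (\<forall>n. weak_eigenpair A \<rho> (l n) (\<phi> n)) \<and>
     orthonormal_basis_L2 \<rho> \<phi> \<and>
     (AE x in lebesgue. \<phi> 0 x = 1)"

end

theory Submission
  imports Defs
begin

text \<open>
  Write \<open>\<rho>\<^sup>0\<close> for the homogenized density, \<open>\<rho>\<^sup>\<epsilon> = m\<^sub>\<epsilon> \<rho>\<^sup>0\<close> for the multiscale one,
  \<open>a\<^sub>\<epsilon>, b\<^sub>\<epsilon>\<close> for the energy \<open>\<sigma> \<integral> \<nabla>u \<bullet> \<nabla>v \<rho>\<^sup>\<epsilon>\<close> and the mass \<open>\<integral> u v \<rho>\<^sup>\<epsilon>\<close>, and \<open>a\<^sub>0, b\<^sub>0\<close> for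
  their homogenized counterparts. The ratio \<open>m\<^sub>\<epsilon>\<close> lies between two positive constants, so both
  problems live in one weighted Sobolev space.

  The link between them is the corrector \<open>\<psi>\<^sup>\<epsilon>(x) = \<psi>(x) + \<epsilon> \<Phi>(x/\<epsilon>) \<bullet> \<nabla>\<psi>(x)\<close> of a test function.
  Its gradient is \<open>(I + \<nabla>\<Phi>(x/\<epsilon>))\<^sup>T \<nabla>\<psi>\<close> up to \<open>O(\<epsilon>)\<close>, and the cell problem says precisely that the
  rows of \<open>e\<^sup>-\<^sup>p\<^sup>/\<^sup>\<sigma> (I + \<nabla>\<Phi>)\<close> are divergence free. Integrating \<open>a\<^sub>\<epsilon>(u, \<psi>\<^sup>\<epsilon>)\<close> by parts therefore
  moves all derivatives onto slowly varying factors (\<open>flux\<close>). What remains is \<open>u\<close> times an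
  oscillating periodic factor times a fixed function. Periodic functions of \<open>x/\<epsilon>\<close> converge weakly
  to their means (\<open>periodic_averaging\<close>), and this suffices if the family \<open>u = u\<^sub>\<epsilon>\<close> is asymptotically
  totally bounded in \<open>L\<^sup>2\<close> (\<open>oscillation\<close>). Hence \<open>a\<^sub>\<epsilon>(u\<^sub>\<epsilon>, \<psi>\<^sup>\<epsilon>) - a\<^sub>0(u\<^sub>\<epsilon>, \<psi>)\<close> and
  \<open>b\<^sub>\<epsilon>(u\<^sub>\<epsilon>, \<psi>\<^sup>\<epsilon>) - b\<^sub>0(u\<^sub>\<epsilon>, \<psi>)\<close> tend to zero (\<open>form_convergence\<close>, \<open>mass_convergence\<close>). Applied to the
  correctors themselves this also shows that \<open>a\<^sub>0\<close> is symmetric and nonnegative.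

  Compactness comes from the spectral decomposition of the limit problem: since its
  eigenvalues tend to infinity, a bound on \<open>a\<^sub>0(u, u)\<close> makes the high modes of \<open>u\<close> uniformly small
  (\<open>spectral_tail\<close>), so bounded families in \<open>H\<^sup>1\<close> are totally bounded in \<open>L\<^sup>2\<close>.

  Upper bound for the eigenvalues (\<open>eigenvalue_upper\<close>): the correctors of approximations to the
  first \<open>n + 1\<close> limit eigenfunctions are trial functions for the min-max principle. In particular
  the multiscale eigenfunctions are bounded in \<open>H\<^sup>1\<close>. Testing their equation with correctors gives
  \<open>(\<lambda>\<^sub>k\<^sup>\<epsilon> - \<lambda>\<^sub>i\<^sup>0) b\<^sub>0(\<phi>\<^sub>k\<^sup>\<epsilon>, \<phi>\<^sub>i\<^sup>0) \<rightarrow> 0\<close> for all \<open>k\<close> and \<open>i\<close> (\<open>coefficient_limit\<close>). Lower bound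
  (\<open>eigenvalue_lower\<close>): if \<open>\<lambda>\<^sub>n\<^sup>\<epsilon>\<close> stayed below \<open>\<lambda>\<^sub>n\<^sup>0 - d\<close>, the first \<open>n + 1\<close> multiscale eigenfunctions would
  asymptotically lie in the span of only \<open>n\<close> limit eigenfunctions, against their orthonormality.
  With \<open>\<lambda>\<^sub>n\<^sup>\<epsilon> \<rightarrow> \<lambda>\<^sub>n\<^sup>0\<close>, the same coefficient limits leave \<open>\<phi>\<^sub>n\<^sup>0\<close> as the only mode of \<open>\<phi>\<^sub>n\<^sup>\<epsilon>\<close> that survives,
  because the limit eigenvalues are distinct. Normalization and the choice of sign make
  its coefficient tend to one, which is strong convergence in \<open>L\<^sup>2\<close>; weak convergence in \<open>H\<^sup>1\<close>
  follows from it by integrating by parts against test functions, which are dense.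
\<close>

section \<open>Calculus of smooth functions\<close>

lemma partial_eqI: "(f has_derivative f') (at x) \<Longrightarrow> partial i f x = f' (axis i 1)"
  unfolding partial_def using frechet_derivative_at by metis

lemma has_derivative_partials:
  fixes f :: "real^'d::finite \<Rightarrow> real"
  assumes "f differentiable (at x)"
  shows "(f has_derivative (\<lambda>h. \<Sum>i\<in>UNIV. h $ i * partial i f x)) (at x)"
proof -
  have d: "(f has_derivative frechet_derivative f (at x)) (at x)"
    using assms by (simp add: frechet_derivative_works)
  then have lin: "linear (frechet_derivative f (at x))"
    by (rule has_derivative_linear)
  have "frechet_derivative f (at x) h = (\<Sum>i\<in>UNIV. h $ i * partial i f x)" for h
  proof -
    have "frechet_derivative f (at x) h = frechet_derivative f (at x) (\<Sum>i\<in>UNIV. (h $ i) *\<^sub>R axis i 1)"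
      using basis_expansion[of h] by (simp add: scalar_mult_eq_scaleR)
    also have "\<dots> = (\<Sum>i\<in>UNIV. h $ i * partial i f x)"
      by (simp add: linear_sum[OF lin] linear_scale[OF lin] partial_def)
    finally show ?thesis .
  qed
  then have "frechet_derivative f (at x) = (\<lambda>h. \<Sum>i\<in>UNIV. h $ i * partial i f x)" by auto
  with d show ?thesis by simp
qed

lemma C_k_partial: "C_k (Suc k) f \<Longrightarrow> C_k k (partial i f)"
  by simp

lemma C_k_continuous: "C_k k f \<Longrightarrow> continuous_on UNIV f"
proof (cases k)
  case (Suc m)
  assume "C_k k f"
  then have "\<forall>x. f differentiable (at x)" using Suc by simp
  then show ?thesis
    by (simp add: continuous_at_imp_continuous_on differentiable_imp_continuous_within)
qed simp

lemma C_k_SucD: "C_k (Suc k) f \<Longrightarrow> C_k k f"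
proof (induction k arbitrary: f)
  case 0
  then show ?case using C_k_continuous[OF 0] by simp
next
  case (Suc k)
  then show ?case by simp
qed

lemma C_k_mono: "C_k k f \<Longrightarrow> m \<le> k \<Longrightarrow> C_k m f"
proof (induction k)
  case (Suc k)
  then show ?case by (cases "m = Suc k") (auto simp del: C_k.simps dest: C_k_SucD)
qed simp

lemma partial_const: "partial i (\<lambda>x::real^'d::finite. c) x = 0"
  using partial_eqI[OF has_derivative_const[of c "at x"], of i] by simp

lemma C_k_const: "C_k k (\<lambda>x::real^'d::finite. c)"
proof (induction k arbitrary: c)
  case (Suc k)
  have "partial i (\<lambda>x::real^'d. c) = (\<lambda>x. 0)" for i by (auto simp: partial_const)
  then show ?case using Suc by simp
qed simp

lemma partial_add:
  assumes "f differentiable (at x)" "g differentiable (at x)"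
  shows "partial i (\<lambda>x. f x + g x) x = partial i f x + partial i g x"
  using partial_eqI[OF has_derivative_add] assms
  unfolding partial_def by (simp add: frechet_derivative_works)

lemma partial_mult:
  fixes f g :: "real^'d::finite \<Rightarrow> real"
  assumes "f differentiable (at x)" "g differentiable (at x)"
  shows "partial i (\<lambda>x. f x * g x) x = f x * partial i g x + partial i f x * g x"
  using partial_eqI[OF has_derivative_mult] assms
  unfolding partial_def by (simp add: frechet_derivative_works)

lemma C_k_add: "C_k k f \<Longrightarrow> C_k k g \<Longrightarrow> C_k k (\<lambda>x. f x + g x)"
proof (induction k arbitrary: f g)
  case 0 then show ?case by (auto intro: continuous_intros)
next
  case (Suc k)
  then have "partial i (\<lambda>x. f x + g x) = (\<lambda>x. partial i f x + partial i g x)" for i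
    by (auto simp: partial_add)
  with Suc show ?case by (auto)
qed

lemma C_k_mult: "C_k k f \<Longrightarrow> C_k k g \<Longrightarrow> C_k k (\<lambda>x. f x * g x)"
proof (induction k arbitrary: f g)
  case 0 then show ?case by (auto intro: continuous_intros)
next
  case (Suc k)
  have "partial i (\<lambda>x. f x * g x) = (\<lambda>x. f x * partial i g x + partial i f x * g x)" for i
    using Suc.prems by (auto simp: partial_mult)
  moreover have "C_k k (\<lambda>x. f x * partial i g x + partial i f x * g x)" for i
    using Suc.prems by (intro C_k_add Suc.IH) (auto intro: C_k_SucD simp del: C_k.simps dest: C_k_partial)
  moreover have "(\<lambda>x. f x * g x) differentiable (at x)" for x
    using Suc.prems by (intro differentiable_mult) auto
  ultimately show ?case by simp
qed

lemma C_k_cmult: "C_k k f \<Longrightarrow> C_k k (\<lambda>x. c * f x)"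
  by (rule C_k_mult[OF C_k_const])

lemma C_k_uminus: "C_k k f \<Longrightarrow> C_k k (\<lambda>x. - f x)"
  using C_k_cmult[of k f "-1"] by simp

lemma C_k_diff: "C_k k f \<Longrightarrow> C_k k g \<Longrightarrow> C_k k (\<lambda>x. f x - g x)"
  using C_k_add[OF _ C_k_uminus, of k f g] by simp

lemma C_k_sum: "(\<And>i. i \<in> I \<Longrightarrow> C_k k (f i)) \<Longrightarrow> C_k k (\<lambda>x. \<Sum>i\<in>I. f i x)"
  by (induction I rule: infinite_finite_induct) (auto intro: C_k_const C_k_add simp del: C_k.simps)

lemma partial_cmult:
  fixes f :: "real^'d::finite \<Rightarrow> real"
  assumes "f differentiable (at x)"
  shows "partial i (\<lambda>x. c * f x) x = c * partial i f x"
  using partial_mult[of "\<lambda>x. c" x f i] assms by (simp add: partial_const)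

lemma partial_uminus:
  fixes f :: "real^'d::finite \<Rightarrow> real"
  assumes "f differentiable (at x)"
  shows "partial i (\<lambda>x. - f x) x = - partial i f x"
  using partial_cmult[OF assms, of i "-1"] by simp

lemma partial_sum:
  fixes f :: "'a \<Rightarrow> real^'d::finite \<Rightarrow> real"
  assumes "\<And>i. i \<in> I \<Longrightarrow> f i differentiable (at x)"
  shows "partial j (\<lambda>x. \<Sum>i\<in>I. f i x) x = (\<Sum>i\<in>I. partial j (f i) x)"
  using assms
proof (induction I rule: infinite_finite_induct)
  case (insert a I)
  have "(\<lambda>x. \<Sum>i\<in>I. f i x) differentiable at x"
    using insert by (intro differentiable_sum) auto
  with insert show ?case by (simp add: partial_add)
qed (simp_all add: partial_const)

lemma has_derivative_affine:
  fixes f :: "real^'d::finite \<Rightarrow> real"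
  assumes "f differentiable (at (c *\<^sub>R x + a))"
  shows "((\<lambda>x. f (c *\<^sub>R x + a)) has_derivative (\<lambda>h. frechet_derivative f (at (c *\<^sub>R x + a)) (c *\<^sub>R h))) (at x)"
proof -
  have "(f has_derivative frechet_derivative f (at (c *\<^sub>R x + a))) (at (c *\<^sub>R x + a))"
    using assms frechet_derivative_works by blast
  moreover have "((\<lambda>x. c *\<^sub>R x + a) has_derivative (\<lambda>h. c *\<^sub>R h)) (at x)"
    by (auto intro!: derivative_eq_intros)
  ultimately show ?thesis
    using has_derivative_compose[of "\<lambda>x. c *\<^sub>R x + a" "\<lambda>h. c *\<^sub>R h" x UNIV f] by simp
qed

lemma partial_affine:
  fixes f :: "real^'d::finite \<Rightarrow> real"
  assumes "f differentiable (at (c *\<^sub>R x + a))"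
  shows "partial i (\<lambda>x. f (c *\<^sub>R x + a)) x = c * partial i f (c *\<^sub>R x + a)"
proof -
  have "linear (frechet_derivative f (at (c *\<^sub>R x + a)))"
    using assms has_derivative_linear frechet_derivative_works by blast
  then show ?thesis
    unfolding partial_eqI[OF has_derivative_affine[OF assms]] by (simp add: partial_def linear_scale)
qed

lemma C_k_affine: "C_k k f \<Longrightarrow> C_k k (\<lambda>x. f (c *\<^sub>R x + a))"
proof (induction k arbitrary: f)
  case 0 then show ?case
    by (auto intro!: continuous_on_compose2[of UNIV f] continuous_intros)
next
  case (Suc k)
  then have "partial i (\<lambda>x. f (c *\<^sub>R x + a)) = (\<lambda>x. c * partial i f (c *\<^sub>R x + a))" for i
    by (auto simp: partial_affine)
  moreover have "(\<lambda>x. f (c *\<^sub>R x + a)) differentiable (at x)" for x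
    using Suc.prems has_derivative_affine[of f c x a] differentiableI by fastforce
  ultimately show ?case using Suc by (auto intro!: C_k_cmult)
qed

lemma partial_chain:
  fixes g :: "real^'d::finite \<Rightarrow> real"
  assumes "(F has_real_derivative F') (at (g x))" "g differentiable (at x)"
  shows "partial i (\<lambda>x. F (g x)) x = F' * partial i g x"
    and "(\<lambda>x. F (g x)) differentiable (at x)"
proof -
  have g: "(g has_derivative frechet_derivative g (at x)) (at x)"
    using assms(2) frechet_derivative_works by blast
  have "((\<lambda>x. F (g x)) has_derivative (\<lambda>h. F' * frechet_derivative g (at x) h)) (at x)"
    using has_derivative_compose[OF g, of F "(*) F'"] assms(1)
    by (simp add: has_field_derivative_def)
  then show "partial i (\<lambda>x. F (g x)) x = F' * partial i g x" "(\<lambda>x. F (g x)) differentiable (at x)"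
    by (auto simp: partial_def[symmetric] dest: partial_eqI differentiableI)
qed

text \<open>Recursions with two terms cover both the exponential function (\<open>a = 1\<close>, \<open>b = 0\<close>) and the
  functions \<open>e\<^sup>-\<^sup>1\<^sup>/\<^sup>t / t\<^sup>n\<close>, whose derivatives are combinations of the next two members.\<close>

lemma C_k_compose_family:
  fixes F :: "nat \<Rightarrow> real \<Rightarrow> real"
  assumes F: "\<And>n t. (F n has_real_derivative (a n * F (n + 1) t + b n * F (n + 2) t)) (at t)"
    and g: "\<And>k. C_k k g"
  shows "C_k k (\<lambda>x. F n (g x))"
proof (induction k arbitrary: n)
  case 0
  have "continuous_on UNIV (F n)"
    using F by (meson DERIV_isCont continuous_at_imp_continuous_on)
  then show ?case using C_k_continuous[OF g]
    by (auto intro!: continuous_on_compose2[of UNIV "F n"])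
next
  case (Suc k)
  have gd: "g differentiable (at x)" for x using g[of 1] by simp
  have gp: "C_k k (partial i g)" for i using g[of "Suc k"] by simp
  have "partial i (\<lambda>x. F n (g x)) = (\<lambda>x. (a n * F (n + 1) (g x) + b n * F (n + 2) (g x)) * partial i g x)" for i
    by (auto simp: partial_chain(1)[OF F gd])
  then show ?case
    using partial_chain(2)[OF F gd] by (auto intro!: C_k_mult C_k_add C_k_const Suc gp)
qed

lemma smooth_exp: "(\<And>k. C_k k g) \<Longrightarrow> C_k k (\<lambda>x. exp (g x))"
  by (rule C_k_compose_family[where F="\<lambda>_. exp" and a="\<lambda>_. 1" and b="\<lambda>_. 0"])
     (auto intro!: derivative_eq_intros)

text \<open>The numerator is the standard smooth function that is flat at the origin; dividing it by
  powers gives a family that is closed under differentiation up to linear combinations.\<close>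
definition flat_exp :: "nat \<Rightarrow> real \<Rightarrow> real" where
  "flat_exp n t = (if t > 0 then exp (- 1 / t) / t ^ n else 0)"

lemma flat_exp_tendsto_0: "(flat_exp n \<longlongrightarrow> 0) (at 0)"
proof -
  have "((\<lambda>s::real. s ^ n / exp s) \<longlongrightarrow> 0) at_top" by (rule tendsto_power_div_exp_0)
  then have "((\<lambda>t. (inverse t) ^ n / exp (inverse t)) \<longlongrightarrow> 0) (at_right (0::real))"
    by (rule filterlim_compose[OF _ filterlim_inverse_at_top_right])
  then have r: "(flat_exp n \<longlongrightarrow> 0) (at_right 0)"
    by (rule Lim_transform_eventually)
       (auto simp: eventually_at_filter flat_exp_def exp_minus field_simps)
  have l: "(flat_exp n \<longlongrightarrow> 0) (at_left 0)"
    by (rule tendsto_eventually) (auto simp: eventually_at_filter flat_exp_def)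
  show ?thesis using l r by (simp add: filterlim_at_split)
qed

text \<open>At the origin the difference quotient of one member is the next member, which tends to zero
  because the exponential function dominates all powers.\<close>

lemma flat_exp_deriv:
  "(flat_exp n has_real_derivative (- real n * flat_exp (n + 1) t + 1 * flat_exp (n + 2) t)) (at t)"
proof -
  consider "t > 0" | "t < 0" | "t = 0" by linarith
  then show ?thesis
  proof cases
    case 1
    have d1: "((\<lambda>t. exp (- 1 / t)) has_real_derivative exp (- 1 / t) * (1 / t\<^sup>2)) (at t)"
      using 1 by (auto intro!: derivative_eq_intros simp: power2_eq_square)
    have d2: "((\<lambda>t. t ^ n) has_real_derivative real n * t ^ (n - 1)) (at t)"
      using DERIV_pow[of n t UNIV] by simp
    have "(exp (- 1 / t) * (1 / t\<^sup>2) * t ^ n - exp (- 1 / t) * (real n * t ^ (n - 1))) / (t ^ n * t ^ n)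
        = - real n * flat_exp (n + 1) t + 1 * flat_exp (n + 2) t"
      using 1 by (cases n) (simp_all add: flat_exp_def field_simps power2_eq_square)
    then have "((\<lambda>t. exp (- 1 / t) / t ^ n) has_real_derivative (- real n * flat_exp (n + 1) t + 1 * flat_exp (n + 2) t)) (at t)"
      using DERIV_divide[OF d1 d2] 1 by simp
    then show ?thesis
      by (rule has_field_derivative_transform_within_open[where S="{0<..}"]) (use 1 in \<open>auto simp: flat_exp_def\<close>)
  next
    case 2
    have "((\<lambda>t. 0) has_real_derivative (- real n * flat_exp (n + 1) t + 1 * flat_exp (n + 2) t)) (at t)"
      using 2 by (simp add: flat_exp_def)
    then show ?thesis
      by (rule has_field_derivative_transform_within_open[where S="{..<0}"]) (use 2 in \<open>auto simp: flat_exp_def\<close>)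
  next
    case 3
    have "((\<lambda>h. (flat_exp n (0 + h) - flat_exp n 0) / h) \<longlongrightarrow> 0) (at 0)"
      by (rule Lim_transform_eventually[OF flat_exp_tendsto_0[of "Suc n"]])
         (auto simp: eventually_at_filter flat_exp_def)
    then show ?thesis using 3 by (simp add: DERIV_def flat_exp_def)
  qed
qed

lemma C_k_norm2: "C_k k (\<lambda>x::real^'d::finite. x \<bullet> x)"
proof -
  have c: "C_k k (\<lambda>x::real^'d. x $ i)" for i k
  proof (cases k)
    case (Suc m)
    have "((\<lambda>x::real^'d. x $ i) has_derivative (\<lambda>h. h $ i)) (at x)" for x
      by (rule bounded_linear_imp_has_derivative) (rule bounded_linear_vec_nth)
    then have "partial j (\<lambda>x::real^'d. x $ i) = (\<lambda>x. axis j 1 $ i)" "(\<lambda>x::real^'d. x $ i) differentiable (at x)" for j x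
      by (auto dest: partial_eqI differentiableI)
    then show ?thesis using Suc by (simp add: C_k_const)
  qed (auto intro!: continuous_intros)
  show ?thesis unfolding inner_vec_def by (auto intro!: C_k_sum C_k_mult c)
qed

lemma test_functionI:
  assumes "\<And>k. C_k k f" "\<And>x. norm x > R \<Longrightarrow> f x = 0"
  shows "test_function f"
proof -
  have "{x. f x \<noteq> 0} \<subseteq> cball 0 R" using assms(2) by (force simp: not_less[symmetric])
  then have "bounded {x. f x \<noteq> 0}" using bounded_cball bounded_subset by blast
  then show ?thesis using assms(1) unfolding test_function_def smooth_def
    by (simp add: compact_closure)
qed

lemma test_function_support:
  assumes "test_function f"
  obtains R where "R > 0" "\<And>x. norm x > R \<Longrightarrow> f x = 0"
proof -
  have "bounded (closure {x. f x \<noteq> 0})"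
    using assms compact_imp_bounded unfolding test_function_def by blast
  then have "bounded {x. f x \<noteq> 0}" using bounded_subset closure_subset by blast
  then obtain R where "R > 0" "\<forall>x\<in>{x. f x \<noteq> 0}. norm x \<le> R"
    unfolding bounded_pos by auto
  then show ?thesis using that by force
qed

lemma test_function_C_k: "test_function f \<Longrightarrow> C_k k f"
  unfolding test_function_def smooth_def by simp

lemma partial_outside:
  fixes f :: "real^'d::finite \<Rightarrow> real"
  assumes "\<And>x. norm x > R \<Longrightarrow> f x = 0" "norm x > R"
  shows "partial i f x = 0"
proof -
  have "((\<lambda>x. 0) has_derivative (\<lambda>h. 0)) (at x)" by simp
  then have "(f has_derivative (\<lambda>h. 0)) (at x)"
    by (rule has_derivative_transform_within_open[where s="- cball 0 R"]) (use assms in auto)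
  then show ?thesis using partial_eqI by blast
qed

lemma test_function_partial: "test_function f \<Longrightarrow> test_function (partial i f)"
proof -
  assume f: "test_function f"
  obtain R where R: "\<And>x. norm x > R \<Longrightarrow> f x = 0" using test_function_support[OF f] by blast
  show ?thesis
    by (rule test_functionI[where R=R])
       (use test_function_C_k[OF f, of "Suc _"] partial_outside[OF R] in auto)
qed

lemma test_function_bounded_support_mult:
  assumes "test_function f" "\<And>k. C_k k g"
  shows "test_function (\<lambda>x. g x * f x)"
proof -
  obtain R where R: "\<And>x. norm x > R \<Longrightarrow> f x = 0" using test_function_support[OF assms(1)] by blast
  show ?thesis by (rule test_functionI[where R=R])
    (use R C_k_mult[OF assms(2) test_function_C_k[OF assms(1)]] in auto)
qed

lemma bounded_support_bounded:
  fixes f :: "real^'d::finite \<Rightarrow> real"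
  assumes "continuous_on UNIV f" "\<And>x. norm x > R \<Longrightarrow> f x = 0"
  obtains B where "B > 0" "\<And>x. \<bar>f x\<bar> \<le> B"
proof -
  have "compact (f ` cball 0 R)"
    using assms(1) by (intro compact_continuous_image) (auto intro: continuous_on_subset)
  then obtain B where B: "B > 0" "\<forall>y\<in>f ` cball 0 R. norm y \<le> B"
    using compact_imp_bounded bounded_pos by metis
  have "\<bar>f x\<bar> \<le> B" for x
  proof (cases "norm x > R")
    case False then show ?thesis using B(2) by (simp add: not_less)
  qed (use B assms in auto)
  with B that show ?thesis by blast
qed

lemma integrable_bounded_support:
  fixes f :: "real^'d::finite \<Rightarrow> real"
  assumes "continuous_on UNIV f" "\<And>x. norm x > R \<Longrightarrow> f x = 0"
  shows "integrable lebesgue f" "integrable lborel f"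
proof -
  have m: "f \<in> borel_measurable borel" using assms(1) by (rule borel_measurable_continuous_onI)
  have "integrable lborel (\<lambda>x. indicator (cball 0 R) x *\<^sub>R f x)"
    by (rule borel_integrable_compact) (auto intro: continuous_on_subset[OF assms(1)])
  moreover have "(\<lambda>x. indicator (cball 0 R) x *\<^sub>R f x) = f"
    using assms(2) by (fastforce simp: indicator_def not_le)
  ultimately show "integrable lborel f" by simp
  then show "integrable lebesgue f" using integrable_completion[of f lborel] m by simp
qed

text \<open>Evenness allows one to write \<open>k (y - x)\<close> for \<open>k (x - y)\<close>, so that a convolution becomes
  an average over translations.\<close>
definition mollifier :: "real \<Rightarrow> (real^'d::finite \<Rightarrow> real) \<Rightarrow> bool" where
  "mollifier \<delta> k \<longleftrightarrow> test_function k \<and> (\<forall>x. k x \<ge> 0) \<and> (\<forall>x. k (- x) = k x) \<and>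
     (\<forall>x. norm x \<ge> \<delta> \<longrightarrow> k x = 0) \<and> (LINT x|lborel. k x) = 1"

lemma mollifier_mono: "mollifier \<delta> k \<Longrightarrow> \<delta> \<le> \<delta>' \<Longrightarrow> mollifier \<delta>' k"
  unfolding mollifier_def by (auto intro: order_trans)

lemma mollifier_exists:
  assumes "\<delta> > 0"
  shows "\<exists>k :: real^'d::finite \<Rightarrow> real. mollifier \<delta> k"
proof -
  define g :: "real^'d \<Rightarrow> real" where "g x = flat_exp 0 (\<delta>\<^sup>2 - x \<bullet> x)" for x
  have C: "C_k k g" for k
    unfolding g_def by (rule C_k_compose_family[OF flat_exp_deriv])
      (intro C_k_diff C_k_const C_k_norm2)
  have supp: "g x = 0" if "norm x \<ge> \<delta>" for x
    using that assms power_mono[of \<delta> "norm x" 2] by (simp add: g_def flat_exp_def power2_norm_eq_inner)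
  have pos: "g x > 0" if "norm x < \<delta>" for x
    using that assms power_strict_mono[of "norm x" \<delta> 2] by (simp add: g_def flat_exp_def power2_norm_eq_inner)
  have nonneg: "g x \<ge> 0" for x by (simp add: g_def flat_exp_def)
  have int: "integrable lborel g"
    by (rule integrable_bounded_support[OF C_k_continuous[OF C], of \<delta>]) (use supp in auto)
  have "(LINT x|lborel. g x) \<noteq> 0"
  proof
    assume "(LINT x|lborel. g x) = 0"
    then have "AE x in lborel. g x = 0"
      using integral_nonneg_eq_0_iff_AE[OF int] nonneg by simp
    then have "AE x in lborel. (x::real^'d) \<notin> ball 0 \<delta>" using pos by (elim eventually_mono) (force simp: less_le)
    then have "emeasure lborel (ball 0 \<delta> :: (real^'d) set) = 0"
      by (subst (asm) AE_iff_measurable[of "ball 0 \<delta>"]) auto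
    then show False using assms
      using emeasure_lborel_ball_finite content_ball_pos[of \<delta> "0::real^'d"]
      by (simp add: measure_def)
  qed
  then have I: "(LINT x|lborel. g x) > 0"
    using Bochner_Integration.integral_nonneg[of lborel g] nonneg by (simp add: order_le_less)
  have "test_function (\<lambda>x. (1 / (LINT x|lborel. g x)) * g x)"
  proof (rule test_functionI[where R=\<delta>])
    show "C_k k (\<lambda>x. (1 / (LINT x|lborel. g x)) * g x)" for k by (rule C_k_cmult[OF C])
  qed (use supp in auto)
  moreover have "g (- x) = g x" for x by (simp add: g_def)
  ultimately have "mollifier \<delta> (\<lambda>x. (1 / (LINT x|lborel. g x)) * g x)"
    unfolding mollifier_def using I nonneg supp by auto
  then show ?thesis by blast
qed

section \<open>Continuity of translations\<close>

lemma lebesgue_shift: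
  fixes a :: "'a::euclidean_space"
  shows "(\<lambda>x. a + x) \<in> lebesgue \<rightarrow>\<^sub>M lebesgue"
    and "lebesgue = distr lebesgue lebesgue (\<lambda>x. a + x)"
  using lebesgue_affine_measurable[of "\<lambda>_. 1" a] lebesgue_affine_euclidean[of "\<lambda>_. 1" a]
  by (auto simp: euclidean_representation density_1)

lemma lebesgue_measurable_shift:
  fixes f :: "'a::euclidean_space \<Rightarrow> 'b::topological_space"
  shows "f \<in> borel_measurable lebesgue \<Longrightarrow> (\<lambda>x. f (x + a)) \<in> borel_measurable lebesgue"
  using measurable_compose[OF lebesgue_shift(1)[of a]] by (simp add: add.commute)

lemma lebesgue_integrable_shift:
  fixes f :: "'a::euclidean_space \<Rightarrow> real"
  assumes "integrable lebesgue f"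
  shows "integrable lebesgue (\<lambda>x. f (x + a))"
    and "(LINT x|lebesgue. f (x + a)) = (LINT x|lebesgue. f x)"
proof -
  have m: "f \<in> borel_measurable lebesgue" using assms by auto
  have "integrable (distr lebesgue lebesgue (\<lambda>x. a + x)) f"
    using assms lebesgue_shift(2)[of a] by simp
  then show "integrable lebesgue (\<lambda>x. f (x + a))"
    using integrable_distr[OF lebesgue_shift(1)[of a], of f] by (simp add: add.commute[of _ a])
  show "(LINT x|lebesgue. f (x + a)) = (LINT x|lebesgue. f x)"
    using integral_distr[OF lebesgue_shift(1) m, of a] lebesgue_shift(2)[of a]
    by (simp add: add.commute[of _ a])
qed

lemma continuous_lebesgue_measurable:
  fixes f :: "'a::euclidean_space \<Rightarrow> 'b::real_normed_vector"
  assumes "continuous_on UNIV f"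
  shows "f \<in> borel_measurable lebesgue" "f \<in> borel_measurable borel"
proof -
  show b: "f \<in> borel_measurable borel" using assms by (rule borel_measurable_continuous_onI)
  then have "f \<in> borel_measurable lborel" by simp
  then show "f \<in> borel_measurable lebesgue" by (rule measurable_completion)
qed

lemma integrable_indicator_cball:
  "integrable lebesgue (\<lambda>x::'a::euclidean_space. c * indicator (cball 0 r) x :: real)"
  using emeasure_lborel_cball_finite[of "0::'a" r] by (intro integrable_mult_right integrable_real_indicator) auto

lemma L1_approx_truncate:
  fixes f :: "real^'d::finite \<Rightarrow> real"
  assumes f: "integrable lebesgue f" and e: "e > 0"
  shows "\<exists>r g. r > 0 \<and> g \<in> borel_measurable lebesgue \<and> (\<forall>x. \<bar>g x\<bar> \<le> r) \<and>
    (\<forall>x. norm x \<ge> r \<longrightarrow> g x = 0) \<and> integrable lebesgue g \<and> (LINT x|lebesgue. \<bar>g x - f x\<bar>) < e"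
proof -
  define s where "s n x = indicator (ball 0 (real n)) x * max (- real n) (min (real n) (f x))" for n and x :: "real^'d"
  have fm[measurable]: "f \<in> borel_measurable lebesgue" using f by auto
  have sm[measurable]: "s n \<in> borel_measurable lebesgue" for n
    unfolding s_def
    by (intro borel_measurable_times borel_measurable_indicator borel_measurable_max borel_measurable_min) auto
  have le: "\<bar>s n x\<bar> \<le> \<bar>f x\<bar>" for n x unfolding s_def by (auto simp: indicator_def)
  have lim: "(\<lambda>n. s n x) \<longlonglongrightarrow> f x" for x
  proof (rule tendsto_eventually)
    obtain N where N: "real N > norm x" "real N > \<bar>f x\<bar>"
      using reals_Archimedean2[of "max (norm x) \<bar>f x\<bar>"] by auto
    have "s n x = f x" if "n \<ge> N" for n
    proof -
      have "real n \<ge> real N" using that by simp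
      then show ?thesis using N unfolding s_def by auto
    qed
    then show "\<forall>\<^sub>F n in sequentially. s n x = f x" by (auto simp: eventually_sequentially)
  qed
  have "(\<lambda>n. LINT x|lebesgue. \<bar>s n x - f x\<bar>) \<longlonglongrightarrow> (LINT x|(lebesgue :: (real^'d) measure). (0::real))"
  proof (rule integral_dominated_convergence[where w="\<lambda>x. 2 * \<bar>f x\<bar>"])
    show "AE x in lebesgue. (\<lambda>n. \<bar>s n x - f x\<bar>) \<longlonglongrightarrow> 0"
      using lim LIM_zero tendsto_rabs_zero by (intro AE_I2) blast
    show "AE x in lebesgue. norm \<bar>s n x - f x\<bar> \<le> 2 * \<bar>f x\<bar>" for n
      by (intro AE_I2) (use le[of n] in \<open>auto intro: order_trans[OF abs_triangle_ineq4] simp: \<open>\<And>x. \<bar>s n x\<bar> \<le> \<bar>f x\<bar>\<close>\<close>)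
  qed (use f in auto)
  then have "\<forall>\<^sub>F n in sequentially. (LINT x|lebesgue. \<bar>s n x - f x\<bar>) < e"
    using e by (simp add: order_tendstoD)
  then obtain n where n: "n \<ge> 1" "(LINT x|lebesgue. \<bar>s n x - f x\<bar>) < e"
    unfolding eventually_sequentially by (metis le_cases)
  have "integrable lebesgue (s n)"
    by (rule Bochner_Integration.integrable_bound[OF f]) (use le in auto)
  then show ?thesis
    using n by (intro exI[of _ "real n"] exI[of _ "s n"]) (auto simp: s_def indicator_def)
qed

text \<open>A measurable function is a pointwise almost everywhere limit of continuous functions. If it is
  bounded and vanishes far away, clamping the approximants and multiplying them by a cutoff
  makes the convergence dominated.\<close>

lemma L1_approx_Cc:
  fixes f :: "real^'d::finite \<Rightarrow> real"
  assumes f: "integrable lebesgue f" and e: "e > 0"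
  obtains h R where "continuous_on UNIV h" "\<And>x. norm x > R \<Longrightarrow> h x = 0"
    "integrable lebesgue h" "(LINT x|lebesgue. \<bar>h x - f x\<bar>) < e"
proof -
  obtain g r where r: "r > 0" and gm[measurable]: "g \<in> borel_measurable lebesgue" and gb: "\<And>x. \<bar>g x\<bar> \<le> r"
    and g0: "\<And>x. norm x \<ge> r \<Longrightarrow> g x = 0" and gi: "integrable lebesgue g" and gf: "(LINT x|lebesgue. \<bar>g x - f x\<bar>) < e / 2"
    using L1_approx_truncate[OF f half_gt_zero[OF e]] by blast
  have "g measurable_on UNIV"
    by (rule lebesgue_measurable_imp_measurable_on[OF gm]) simp
  then obtain N F where N: "negligible N" and F: "\<And>n. continuous_on UNIV (F n)"
    and lim: "\<And>x. x \<notin> N \<Longrightarrow> (\<lambda>n. F n x) \<longlonglongrightarrow> g x"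
    by (auto simp: measurable_on_def)
  define \<theta> where "\<theta> x = max 0 (min 1 (r + 1 - norm x))" for x :: "real^'d"
  define h where "h n x = \<theta> x * max (- r) (min r (F n x))" for n x
  have hc: "continuous_on UNIV (h n)" for n
    unfolding h_def \<theta>_def by (intro continuous_intros F)
  have h0: "h n x = 0" if "norm x > r + 1" for n x using that by (simp add: h_def \<theta>_def)
  have hi: "integrable lebesgue (h n)" for n
    by (rule integrable_bounded_support[OF hc h0])
  have hb: "\<bar>h n x\<bar> \<le> r * indicator (cball 0 (r + 1)) x" for n x
  proof (cases "norm x > r + 1")
    case False
    have "\<bar>h n x\<bar> \<le> 1 * r" unfolding h_def abs_mult
      by (intro mult_mono) (use r in \<open>auto simp: \<theta>_def\<close>)
    then show ?thesis using False by (auto simp: indicator_def)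
  qed (simp add: h0)
  have AEN: "AE x in lebesgue. x \<notin> N"
    using N by (intro AE_not_in) (simp add: negligible_iff_null_sets)
  have "(\<lambda>n. LINT x|lebesgue. \<bar>h n x - g x\<bar>) \<longlonglongrightarrow> (LINT x|(lebesgue :: (real^'d) measure). (0::real))"
  proof (rule integral_dominated_convergence[where w="\<lambda>x. r * indicator (cball 0 (r + 1)) x + \<bar>g x\<bar>"])
    show "AE x in lebesgue. (\<lambda>n. \<bar>h n x - g x\<bar>) \<longlonglongrightarrow> 0"
      using AEN
    proof eventually_elim
      case (elim x)
      have "(\<lambda>n. h n x) \<longlonglongrightarrow> \<theta> x * max (- r) (min r (g x))"
        unfolding h_def by (intro tendsto_intros lim elim)
      moreover have "max (- r) (min r (g x)) = g x" using gb[of x] by auto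
      moreover have "\<theta> x * g x = g x" using g0[of x] by (cases "norm x \<ge> r") (auto simp: \<theta>_def)
      ultimately have "(\<lambda>n. h n x) \<longlonglongrightarrow> g x" by simp
      then show ?case using LIM_zero tendsto_rabs_zero by blast
    qed
    show "AE x in lebesgue. norm \<bar>h n x - g x\<bar> \<le> r * indicator (cball 0 (r + 1)) x + \<bar>g x\<bar>" for n
      using hb by (intro AE_I2) (auto intro: order_trans[OF abs_triangle_ineq4])
    show "integrable lebesgue (\<lambda>x. r * indicator (cball 0 (r + 1)) x + \<bar>g x\<bar>)"
      using gi by (intro Bochner_Integration.integrable_add integrable_indicator_cball) auto
    show "(\<lambda>x. \<bar>h n x - g x\<bar>) \<in> borel_measurable lebesgue" for n using hi gi by auto
  qed simp
  then have "\<forall>\<^sub>F n in sequentially. (LINT x|lebesgue. \<bar>h n x - g x\<bar>) < e / 2"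
    using order_tendstoD(2)[of _ 0 sequentially "e / 2"] e by simp
  then obtain n where n: "(LINT x|lebesgue. \<bar>h n x - g x\<bar>) < e / 2"
    unfolding eventually_sequentially by blast
  have "(LINT x|lebesgue. \<bar>h n x - f x\<bar>) \<le> (LINT x|lebesgue. \<bar>h n x - g x\<bar> + \<bar>g x - f x\<bar>)"
    by (rule integral_mono) (use hi gi f in auto)
  also have "\<dots> = (LINT x|lebesgue. \<bar>h n x - g x\<bar>) + (LINT x|lebesgue. \<bar>g x - f x\<bar>)"
    by (rule Bochner_Integration.integral_add) (use hi gi f in auto)
  finally have "(LINT x|lebesgue. \<bar>h n x - f x\<bar>) < e" using n gf by simp
  with that[OF hc h0 hi] show ?thesis by blast
qed

text \<open>For continuous functions with bounded support this is uniform continuity; translations preserve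
  the \<open>L\<^sup>1\<close> norm, so the property passes to limits.\<close>

lemma L1_translation_continuous:
  fixes f :: "real^'d::finite \<Rightarrow> real"
  assumes f: "integrable lebesgue f" and e: "e > 0"
  obtains \<delta> where "\<delta> > 0" "\<And>z. norm z < \<delta> \<Longrightarrow> (LINT x|lebesgue. \<bar>f (x + z) - f x\<bar>) < e"
proof -
  obtain h R where hc: "continuous_on UNIV h" and h0: "\<And>x. norm x > R \<Longrightarrow> h x = 0"
    and hi: "integrable lebesgue h" and hf: "(LINT x|lebesgue. \<bar>h x - f x\<bar>) < e / 4"
    using L1_approx_Cc[OF f, of "e/4"] e by auto
  define m where "m = measure lebesgue (cball 0 (R + 1) :: (real^'d) set) + 1"
  have m: "m > 0" unfolding m_def by (simp add: add_nonneg_pos)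
  have "uniformly_continuous_on (cball 0 (R + 2)) h"
    by (rule compact_uniformly_continuous[OF continuous_on_subset[OF hc]]) auto
  then obtain d where d: "d > 0" "\<And>x y. x \<in> cball 0 (R + 2) \<Longrightarrow> y \<in> cball 0 (R + 2) \<Longrightarrow> dist y x < d \<Longrightarrow> dist (h y) (h x) < e / (4 * m)"
    unfolding uniformly_continuous_on_def using e m by (metis divide_pos_pos mult_pos_pos zero_less_numeral)
  show ?thesis
  proof (rule that[of "min d 1"])
    fix z :: "real^'d" assume z: "norm z < min d 1"
    have hz: "\<bar>h (x + z) - h x\<bar> \<le> e / (4 * m) * indicator (cball 0 (R + 1)) x" for x
    proof (cases "norm x \<le> R + 1")
      case True
      have "norm (x + z) \<le> R + 2" using norm_triangle_ineq[of x z] True z by simp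
      then have "dist (h (x + z)) (h x) < e / (4 * m)" using True z d(2)[of x "x + z"] by (simp add: norm_minus_commute dist_norm[of "x + z" x])
      then show ?thesis using True by (simp add: dist_real_def)
    next
      case False
      have "norm (x + z) > R" using norm_triangle_ineq2[of x "-z"] False z by simp
      then show ?thesis using False h0 by simp
    qed
    have hzi: "integrable lebesgue (\<lambda>x. h (x + z))" by (rule lebesgue_integrable_shift[OF hi])
    have fzi: "integrable lebesgue (\<lambda>x. f (x + z))" by (rule lebesgue_integrable_shift[OF f])
    have "(LINT x|lebesgue. \<bar>h (x + z) - h x\<bar>) \<le> (LINT x|lebesgue. e / (4 * m) * indicator (cball 0 (R + 1)) (x::real^'d))"
      by (rule integral_mono[OF _ integrable_indicator_cball]) (use hz hzi hi in auto)
    also have "\<dots> = e / (4 * m) * measure lebesgue (cball 0 (R + 1) :: (real^'d) set)" by simp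
    also have "\<dots> \<le> e / (4 * m) * m" using e m unfolding m_def by (intro mult_left_mono) auto
    also have "\<dots> = e / 4" using m by simp
    finally have 1: "(LINT x|lebesgue. \<bar>h (x + z) - h x\<bar>) \<le> e / 4" .
    have 2: "(LINT x|lebesgue. \<bar>h (x + z) - f (x + z)\<bar>) = (LINT x|lebesgue. \<bar>h x - f x\<bar>)"
      by (rule lebesgue_integrable_shift(2)[of "\<lambda>x. \<bar>h x - f x\<bar>"]) (use hi f in auto)
    have "(LINT x|lebesgue. \<bar>f (x + z) - f x\<bar>)
       \<le> (LINT x|lebesgue. (\<bar>h (x + z) - f (x + z)\<bar> + \<bar>h (x + z) - h x\<bar>) + \<bar>h x - f x\<bar>)"
      by (rule integral_mono) (use hi f hzi fzi in auto)
    also have "\<dots> = ((LINT x|lebesgue. \<bar>h (x + z) - f (x + z)\<bar>) + (LINT x|lebesgue. \<bar>h (x + z) - h x\<bar>)) + (LINT x|lebesgue. \<bar>h x - f x\<bar>)"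
      using hi f hzi fzi by (subst Bochner_Integration.integral_add | force)+
    finally show "(LINT x|lebesgue. \<bar>f (x + z) - f x\<bar>) < e" using 1 2 hf e by simp
  qed (use d in auto)
qed

text \<open>This reduces \<open>L\<^sup>2\<close> continuity of translations to \<open>L\<^sup>1\<close> continuity for the squares of the positive
  and the negative part: for nonnegative \<open>s\<close> and \<open>t\<close> one has \<open>(s - t)\<^sup>2 \<le> \<bar>s\<^sup>2 - t\<^sup>2\<bar>\<close>.\<close>

lemma square_diff_parts:
  fixes a b :: real
  shows "(a - b)\<^sup>2 \<le> 2 * \<bar>(max a 0)\<^sup>2 - (max b 0)\<^sup>2\<bar> + 2 * \<bar>(max (- a) 0)\<^sup>2 - (max (- b) 0)\<^sup>2\<bar>"
proof -
  have nn: "(s - t)\<^sup>2 \<le> \<bar>s\<^sup>2 - t\<^sup>2\<bar>" if "s \<ge> 0" "t \<ge> 0" for s t :: real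
  proof -
    have "(s - t)\<^sup>2 = \<bar>s - t\<bar> * \<bar>s - t\<bar>" by (simp add: power2_eq_square)
    also have "\<dots> \<le> \<bar>s - t\<bar> * \<bar>s + t\<bar>" using that by (intro mult_left_mono) auto
    also have "\<dots> = \<bar>s\<^sup>2 - t\<^sup>2\<bar>" by (simp add: abs_mult[symmetric] power2_eq_square algebra_simps)
    finally show ?thesis .
  qed
  have two: "(s - t)\<^sup>2 \<le> 2 * s\<^sup>2 + 2 * t\<^sup>2" for s t :: real
    using zero_le_power2[of "s + t"] by (simp add: power2_diff power2_sum)
  have "(a - b)\<^sup>2 = ((max a 0 - max b 0) - (max (- a) 0 - max (- b) 0))\<^sup>2"
    by (auto simp: max_def)
  also have "\<dots> \<le> 2 * (max a 0 - max b 0)\<^sup>2 + 2 * (max (- a) 0 - max (- b) 0)\<^sup>2"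
    by (rule two)
  finally show ?thesis using nn[of "max a 0" "max b 0"] nn[of "max (-a) 0" "max (-b) 0"] by simp
qed

lemma L2_translation_continuous:
  fixes f :: "real^'d::finite \<Rightarrow> real"
  assumes fm: "f \<in> borel_measurable lebesgue" and f: "integrable lebesgue (\<lambda>x. (f x)\<^sup>2)" and e: "e > 0"
  shows "\<exists>\<delta>>0. \<forall>z. norm z < \<delta> \<longrightarrow> integrable lebesgue (\<lambda>x. (f (x + z) - f x)\<^sup>2) \<and>
     (LINT x|lebesgue. (f (x + z) - f x)\<^sup>2) < e"
proof -
  define p q where "p x = (max (f x) 0)\<^sup>2" and "q x = (max (- f x) 0)\<^sup>2" for x
  have pi: "integrable lebesgue p" unfolding p_def
    by (rule Bochner_Integration.integrable_bound[OF f]) (use fm in \<open>auto simp: max_def\<close>)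
  have qi: "integrable lebesgue q" unfolding q_def
    by (rule Bochner_Integration.integrable_bound[OF f]) (use fm in \<open>auto simp: max_def\<close>)
  obtain d1 where d1: "d1 > 0" "\<And>z. norm z < d1 \<Longrightarrow> (LINT x|lebesgue. \<bar>p (x + z) - p x\<bar>) < e / 4"
    using L1_translation_continuous[OF pi, of "e/4"] e by auto
  obtain d2 where d2: "d2 > 0" "\<And>z. norm z < d2 \<Longrightarrow> (LINT x|lebesgue. \<bar>q (x + z) - q x\<bar>) < e / 4"
    using L1_translation_continuous[OF qi, of "e/4"] e by auto
  have bnd: "(f (x + z) - f x)\<^sup>2 \<le> 2 * \<bar>p (x + z) - p x\<bar> + 2 * \<bar>q (x + z) - q x\<bar>" for x z
    unfolding p_def q_def by (rule square_diff_parts)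
  have int: "integrable lebesgue (\<lambda>x. 2 * \<bar>p (x + z) - p x\<bar> + 2 * \<bar>q (x + z) - q x\<bar>)" for z
    using pi qi lebesgue_integrable_shift(1)[OF pi, of z] lebesgue_integrable_shift(1)[OF qi, of z] by auto
  have fi: "integrable lebesgue (\<lambda>x. (f (x + z) - f x)\<^sup>2)" for z
    by (rule Bochner_Integration.integrable_bound[OF int[of z]])
       (use fm lebesgue_measurable_shift[OF fm, of z] bnd in auto)
  have "(LINT x|lebesgue. (f (x + z) - f x)\<^sup>2) < e" if z: "norm z < min d1 d2" for z
  proof -
    have "(LINT x|lebesgue. (f (x + z) - f x)\<^sup>2) \<le> (LINT x|lebesgue. 2 * \<bar>p (x + z) - p x\<bar> + 2 * \<bar>q (x + z) - q x\<bar>)"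
      by (rule integral_mono) (use fi int bnd in auto)
    also have "\<dots> = 2 * (LINT x|lebesgue. \<bar>p (x + z) - p x\<bar>) + 2 * (LINT x|lebesgue. \<bar>q (x + z) - q x\<bar>)"
      using pi qi lebesgue_integrable_shift(1)[OF pi, of z] lebesgue_integrable_shift(1)[OF qi, of z]
      by (subst Bochner_Integration.integral_add) auto
    finally show ?thesis using d1(2)[of z] d2(2)[of z] z by simp
  qed
  then show ?thesis using d1(1) d2(1) fi by (intro exI[of _ "min d1 d2"]) auto
qed

section \<open>Convolution with test functions\<close>

definition convolution :: "(real^'d::finite \<Rightarrow> real) \<Rightarrow> (real^'d \<Rightarrow> real) \<Rightarrow> real^'d \<Rightarrow> real" where
  "convolution f k x = (LINT y|lebesgue. f y * k (x - y))"

lemma lebesgue_measurable_reflect: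
  fixes k :: "real^'d::finite \<Rightarrow> real"
  assumes "continuous_on UNIV k"
  shows "(\<lambda>y. k (x - y)) \<in> borel_measurable lebesgue"
  by (rule continuous_lebesgue_measurable(1)) (auto intro!: continuous_on_compose2[OF assms] continuous_intros)

lemma integrable_mult_bounded:
  fixes f g :: "'a::euclidean_space \<Rightarrow> real"
  assumes f: "integrable lebesgue f" and g: "g \<in> borel_measurable lebesgue" and b: "\<And>x. \<bar>g x\<bar> \<le> B"
  shows "integrable lebesgue (\<lambda>x. f x * g x)"
proof (rule Bochner_Integration.integrable_bound)
  show "integrable lebesgue (\<lambda>x. B * f x)" using f by simp
  show "AE x in lebesgue. norm (f x * g x) \<le> norm (B * f x)"
  proof (rule AE_I2)
    fix x :: 'a
    have "\<bar>f x\<bar> * \<bar>g x\<bar> \<le> \<bar>f x\<bar> * \<bar>B\<bar>" using b[of x] by (intro mult_left_mono) auto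
    then show "norm (f x * g x) \<le> norm (B * f x)" by (simp add: abs_mult mult.commute)
  qed
qed (use f g in auto)

lemma integrable_conv:
  fixes f k :: "real^'d::finite \<Rightarrow> real"
  assumes "integrable lebesgue f" "continuous_on UNIV k" "\<And>x. \<bar>k x\<bar> \<le> B"
  shows "integrable lebesgue (\<lambda>y. f y * k (x - y))"
  by (rule integrable_mult_bounded[OF assms(1) lebesgue_measurable_reflect[OF assms(2)] assms(3)])

lemma conv_continuous:
  assumes f: "integrable lebesgue f" and k: "continuous_on UNIV k" "\<And>x. \<bar>k x\<bar> \<le> B"
  shows "continuous_on UNIV (convolution f k)"
  unfolding continuous_on_sequentially
proof (intro ballI allI impI, elim conjE)
  fix u :: "nat \<Rightarrow> real^'a" and a :: "real^'a"
  assume u: "u \<longlonglongrightarrow> a"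
  have k': "isCont k z" for z using k(1) by (simp add: continuous_on_eq_continuous_at)
  have "(\<lambda>n. convolution f k (u n)) \<longlonglongrightarrow> convolution f k a"
    unfolding convolution_def
  proof (rule integral_dominated_convergence[where w="\<lambda>y. B * \<bar>f y\<bar>"])
    show "AE y in lebesgue. (\<lambda>n. f y * k (u n - y)) \<longlonglongrightarrow> f y * k (a - y)"
      by (intro AE_I2 tendsto_intros isCont_tendsto_compose[OF k'] u)
    show "AE y in lebesgue. norm (f y * k (u n - y)) \<le> B * \<bar>f y\<bar>" for n
    proof (rule AE_I2)
      fix y
      show "norm (f y * k (u n - y)) \<le> B * \<bar>f y\<bar>"
        using mult_right_mono[OF k(2)[of "u n - y"] abs_ge_zero[of "f y"]] by (simp add: abs_mult mult.commute)
    qed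
    show "(\<lambda>y. f y * k (a - y)) \<in> borel_measurable lebesgue" "(\<lambda>y. f y * k (u n - y)) \<in> borel_measurable lebesgue" for n
      using integrable_conv[OF f k] by blast+
  qed (use f in auto)
  then show "((convolution f k) \<circ> u) \<longlonglongrightarrow> convolution f k a" by (simp add: o_def)
qed

lemma lipschitz_of_bounded_partials:
  fixes k :: "real^'d::finite \<Rightarrow> real"
  assumes d: "\<And>x. k differentiable (at x)" and b: "\<And>i x. \<bar>partial i k x\<bar> \<le> B"
  shows "\<bar>\<Sum>i\<in>UNIV. h $ i * partial i k z\<bar> \<le> real CARD('d) * B * norm h"
    and "\<bar>k (z + h) - k z\<bar> \<le> real CARD('d) * B * norm h"
proof -
  have *: "\<bar>\<Sum>i\<in>UNIV. h $ i * partial i k z\<bar> \<le> real CARD('d) * B * norm h" for h z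
  proof -
    have "\<bar>\<Sum>i\<in>UNIV. h $ i * partial i k z\<bar> \<le> (\<Sum>i\<in>(UNIV::'d set). norm h * B)"
      by (intro order_trans[OF sum_abs] sum_mono, unfold abs_mult)
         (use component_le_norm_cart[of h] b in \<open>auto intro!: mult_mono\<close>)
    then show ?thesis by (simp add: mult_ac)
  qed
  then show "\<bar>\<Sum>i\<in>UNIV. h $ i * partial i k z\<bar> \<le> real CARD('d) * B * norm h" .
  have "norm (k (z + h) - k z) \<le> real CARD('d) * B * norm ((z + h) - z)"
  proof (rule differentiable_bound[where S=UNIV])
    show "(k has_derivative (\<lambda>h. \<Sum>i\<in>UNIV. h $ i * partial i k x)) (at x within UNIV)" for x
      using has_derivative_partials[OF d] by simp
    show "onorm (\<lambda>h. \<Sum>i\<in>UNIV. h $ i * partial i k x) \<le> real CARD('d) * B" for x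
      by (rule onorm_le) (use * in simp)
  qed auto
  then show "\<bar>k (z + h) - k z\<bar> \<le> real CARD('d) * B * norm h" by simp
qed

text \<open>The remainder of \<open>k\<close> divided by the increment is bounded by twice a Lipschitz constant and
  tends to zero pointwise, so dominated convergence along sequences applies.\<close>

lemma conv_has_derivative:
  fixes k :: "real^'d::finite \<Rightarrow> real"
  assumes f: "integrable lebesgue f" and k: "\<And>x. k differentiable (at x)" "\<And>x. \<bar>k x\<bar> \<le> B"
    "\<And>i. continuous_on UNIV (partial i k)" "\<And>i x. \<bar>partial i k x\<bar> \<le> B"
  shows "(convolution f k has_derivative (\<lambda>h. \<Sum>i\<in>UNIV. h $ i * convolution f (partial i k) x)) (at x)"
proof -
  define D where "D z h = (\<Sum>i\<in>UNIV. h $ i * partial i k z)" for z h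
  define C where "C = real CARD('d) * B"
  have kc: "continuous_on UNIV k"
    using k(1) by (simp add: continuous_at_imp_continuous_on differentiable_imp_continuous_within)
  have intD: "integrable lebesgue (\<lambda>y. f y * (h $ i * partial i k (x - y)))" for h i x
  proof -
    have "integrable lebesgue (\<lambda>y. h $ i * (f y * partial i k (x - y)))"
      by (intro integrable_mult_right integrable_conv[OF f k(3) k(4)])
    then show ?thesis by (simp add: mult.left_commute)
  qed
  have lin: "(\<Sum>i\<in>UNIV. h $ i * convolution f (partial i k) x) = (LINT y|lebesgue. f y * D (x - y) h)" for h
  proof -
    have "(LINT y|lebesgue. f y * D (x - y) h) = (LINT y|lebesgue. (\<Sum>i\<in>UNIV. f y * (h $ i * partial i k (x - y))))"
      by (simp add: D_def sum_distrib_left)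
    also have "\<dots> = (\<Sum>i\<in>UNIV. (LINT y|lebesgue. f y * (h $ i * partial i k (x - y))))"
      using intD by (intro Bochner_Integration.integral_sum) auto
    also have "\<dots> = (\<Sum>i\<in>UNIV. h $ i * convolution f (partial i k) x)"
      unfolding convolution_def
      by (intro sum.cong refl, subst integral_mult_right_zero[symmetric]) (simp add: mult.left_commute)
    finally show ?thesis ..
  qed
  have intD2: "integrable lebesgue (\<lambda>y. f y * D (x - y) h)" for h
    unfolding D_def sum_distrib_left by (intro Bochner_Integration.integrable_sum intD)
  show ?thesis
    unfolding has_derivative_iff_norm
  proof (intro conjI)
    show "bounded_linear (\<lambda>h. \<Sum>i\<in>UNIV. h $ i * convolution f (partial i k) x)"
      by (intro bounded_linear_sum bounded_linear_mult_const bounded_linear_vec_nth)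
    show "((\<lambda>y. norm (convolution f k y - convolution f k x - (\<Sum>i\<in>UNIV. (y - x) $ i * convolution f (partial i k) x)) / norm (y - x)) \<longlongrightarrow> 0) (at x)"
      unfolding tendsto_at_iff_sequentially
    proof (intro allI impI)
      fix u :: "nat \<Rightarrow> real^'d" assume ux: "\<forall>n. u n \<in> UNIV - {x}" and lim: "u \<longlonglongrightarrow> x"
      define G where "G n y = f y * ((k (u n - y) - k (x - y) - D (x - y) (u n - x)) / norm (u n - x))" for n y
      have eq: "convolution f k (u n) - convolution f k x - (\<Sum>i\<in>UNIV. (u n - x) $ i * convolution f (partial i k) x) =
         (LINT y|lebesgue. G n y) * norm (u n - x)" for n
      proof -
        have "(LINT y|lebesgue. G n y) * norm (u n - x) = (LINT y|lebesgue. G n y * norm (u n - x))"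
          by simp
        also have "\<dots> = (LINT y|lebesgue. f y * k (u n - y) - f y * k (x - y) - f y * D (x - y) (u n - x))"
          using ux by (intro Bochner_Integration.integral_cong) (auto simp: G_def field_simps)
        also have "\<dots> = convolution f k (u n) - convolution f k x - (\<Sum>i\<in>UNIV. (u n - x) $ i * convolution f (partial i k) x)"
          unfolding lin unfolding convolution_def
          using integrable_conv[OF f kc k(2)] intD2 by (subst Bochner_Integration.integral_diff | force)+
        finally show ?thesis by simp
      qed
      have "(\<lambda>n. LINT y|lebesgue. G n y) \<longlonglongrightarrow> (LINT y|(lebesgue :: (real^'d) measure). (0::real))"
      proof (rule integral_dominated_convergence[where w="\<lambda>y. 2 * C * \<bar>f y\<bar>"])
        show "AE y in lebesgue. (\<lambda>n. G n y) \<longlonglongrightarrow> 0"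
        proof (rule AE_I2)
          fix y
          have "((\<lambda>z. norm (k z - k (x - y) - D (x - y) (z - (x - y))) / norm (z - (x - y))) \<longlongrightarrow> 0) (at (x - y))"
            using has_derivative_partials[OF k(1), of "x - y"] unfolding has_derivative_iff_norm D_def by simp
          moreover have "filterlim (\<lambda>n. u n - y) (at (x - y)) sequentially"
            unfolding filterlim_at using ux lim by (auto intro!: tendsto_intros)
          ultimately have "(\<lambda>n. norm (k (u n - y) - k (x - y) - D (x - y) (u n - y - (x - y))) / norm (u n - y - (x - y))) \<longlonglongrightarrow> 0"
            by (rule filterlim_compose)
          then have "(\<lambda>n. \<bar>(k (u n - y) - k (x - y) - D (x - y) (u n - x)) / norm (u n - x)\<bar>) \<longlonglongrightarrow> 0"
            by (simp add: abs_divide)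
          then have "(\<lambda>n. (k (u n - y) - k (x - y) - D (x - y) (u n - x)) / norm (u n - x)) \<longlonglongrightarrow> 0"
            by (rule tendsto_rabs_zero_cancel)
          then show "(\<lambda>n. G n y) \<longlonglongrightarrow> 0" unfolding G_def by (rule tendsto_mult_right_zero)
        qed
        show "AE y in lebesgue. norm (G n y) \<le> 2 * C * \<bar>f y\<bar>" for n
        proof (rule AE_I2)
          fix y
          have "\<bar>k (u n - y) - k (x - y)\<bar> \<le> C * norm (u n - x)"
            using lipschitz_of_bounded_partials(2)[OF k(1) k(4), of "x - y" "u n - x"] by (simp add: C_def)
          moreover have "\<bar>D (x - y) (u n - x)\<bar> \<le> C * norm (u n - x)"
            using lipschitz_of_bounded_partials(1)[OF k(1) k(4), of "u n - x" "x - y"] by (simp add: C_def D_def)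
          ultimately have "\<bar>k (u n - y) - k (x - y) - D (x - y) (u n - x)\<bar> \<le> 2 * C * norm (u n - x)"
            by linarith
          then have "\<bar>(k (u n - y) - k (x - y) - D (x - y) (u n - x)) / norm (u n - x)\<bar> \<le> 2 * C"
            using ux by (simp add: abs_divide divide_le_eq)
          then show "norm (G n y) \<le> 2 * C * \<bar>f y\<bar>"
            unfolding G_def real_norm_def abs_mult[of "f y"]
            using mult_left_mono[OF _ abs_ge_zero[of "f y"]] by (metis mult.commute)
        qed
        show "G n \<in> borel_measurable lebesgue" for n
        proof -
          have "G n = (\<lambda>y. (f y * k (u n - y) - f y * k (x - y) - f y * D (x - y) (u n - x)) / norm (u n - x))"
            using ux by (auto simp: G_def field_simps)
          then show ?thesis
            using integrable_conv[OF f kc k(2)] intD2 by (auto intro!: borel_measurable_divide borel_measurable_diff)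
        qed
      qed (use f in auto)
      then have "(\<lambda>n. \<bar>LINT y|lebesgue. G n y\<bar>) \<longlonglongrightarrow> 0"
        using tendsto_rabs_zero by simp
      then show "((\<lambda>y. norm (convolution f k y - convolution f k x - (\<Sum>i\<in>UNIV. (y - x) $ i * convolution f (partial i k) x)) / norm (y - x)) \<circ> u) \<longlonglongrightarrow> 0"
        unfolding o_def eq using ux by (simp add: abs_mult)
    qed
  qed
qed

lemma test_function_bounds:
  fixes k :: "real^'d::finite \<Rightarrow> real"
  assumes "test_function k"
  shows "\<exists>B>0. (\<forall>x. \<bar>k x\<bar> \<le> B) \<and> (\<forall>i x. \<bar>partial i k x\<bar> \<le> B)"
proof -
  obtain R where R: "\<And>x. norm x > R \<Longrightarrow> k x = 0" using test_function_support[OF assms] by blast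
  obtain B0 where B0: "B0 > 0" "\<And>x. \<bar>k x\<bar> \<le> B0"
    using bounded_support_bounded[OF C_k_continuous[OF test_function_C_k[OF assms, of 0]] R] by blast
  have "\<exists>B. \<forall>x. \<bar>partial i k x\<bar> \<le> B" for i
  proof -
    have "continuous_on UNIV (partial i k)"
      using C_k_continuous[OF test_function_C_k[OF test_function_partial[OF assms], of 0]] .
    moreover have "partial i k x = 0" if "norm x > R" for x by (rule partial_outside[OF R that])
    ultimately show ?thesis using bounded_support_bounded by metis
  qed
  then obtain b where b: "\<And>i x. \<bar>partial i k x\<bar> \<le> b i" by metis
  have nn: "b i \<ge> 0" for i using b[of i 0] by linarith
  have "b i \<le> (\<Sum>i\<in>UNIV. b i)" for i using nn by (intro member_le_sum) auto
  moreover have sn: "sum b UNIV \<ge> 0" using nn by (intro sum_nonneg) auto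
  ultimately have p: "\<bar>partial i k x\<bar> \<le> B0 + sum b UNIV" for i x
    using b[of i x] B0(1) by (meson add_increasing less_imp_le order_trans)
  show ?thesis
    by (rule exI[of _ "B0 + sum b UNIV"]) (use p B0 sn in \<open>auto intro: add_pos_nonneg add_increasing2\<close>)
qed

lemma
  fixes k :: "real^'d::finite \<Rightarrow> real"
  assumes f: "integrable lebesgue f" and k: "test_function k"
  shows partial_conv: "partial i (convolution f k) = convolution f (partial i k)"
    and conv_differentiable: "convolution f k differentiable (at x)"
proof -
  obtain B where B: "\<And>x. \<bar>k x\<bar> \<le> B" "\<And>i x. \<bar>partial i k x\<bar> \<le> B"
    using test_function_bounds[OF k] by blast
  have "C_k (Suc 0) k" using test_function_C_k[OF k] .
  then have d: "k differentiable (at x)" and pc: "continuous_on UNIV (partial i k)" for x i by auto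
  have *: "(convolution f k has_derivative (\<lambda>h. \<Sum>i\<in>UNIV. h $ i * convolution f (partial i k) x)) (at x)" for x
    by (rule conv_has_derivative[OF f d B(1) pc B(2)])
  show "convolution f k differentiable (at x)" using * differentiableI by blast
  show "partial i (convolution f k) = convolution f (partial i k)"
  proof
    fix x
    have "partial i (convolution f k) x = (\<Sum>j\<in>UNIV. axis i 1 $ j * convolution f (partial j k) x)"
      using partial_eqI[OF *] by blast
    also have "\<dots> = (\<Sum>j\<in>UNIV. if j = i then convolution f (partial j k) x else 0)"
      by (intro sum.cong) (auto simp: axis_def)
    finally show "partial i (convolution f k) x = convolution f (partial i k) x" by simp
  qed
qed

lemma C_k_conv:
  assumes f: "integrable lebesgue f" and k: "test_function k"
  shows "C_k n (convolution f k)"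
  using k
proof (induction n arbitrary: k)
  case 0
  obtain B where B: "\<And>x. \<bar>k x\<bar> \<le> B" using test_function_bounds[OF 0] by blast
  then show ?case using conv_continuous[OF f C_k_continuous[OF test_function_C_k[OF 0, of 0]] B] by simp
next
  case (Suc n)
  then show ?case using partial_conv[OF f Suc.prems] conv_differentiable[OF f Suc.prems]
    by (simp add: test_function_partial)
qed

lemma conv_outside:
  assumes f0: "\<And>x. norm x > R \<Longrightarrow> f x = 0" and k0: "\<And>x. norm x \<ge> \<delta> \<Longrightarrow> k x = 0" and x: "norm x > R + \<delta>"
  shows "convolution f k x = 0"
proof -
  have "f y * k (x - y) = 0" for y
  proof (cases "norm y > R")
    case False
    have "norm (x - y) \<ge> \<delta>" using norm_triangle_ineq2[of x y] False x by simp
    then show ?thesis using k0 by simp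
  qed (use f0 in simp)
  then have eq: "(\<lambda>y. f y * k (x - y)) = (\<lambda>_. 0)" by blast
  show ?thesis unfolding convolution_def eq by simp
qed

lemma test_function_conv:
  assumes f: "integrable lebesgue f" and k: "test_function k"
    and f0: "\<And>x. norm x > R \<Longrightarrow> f x = 0" and k0: "\<And>x. norm x \<ge> \<delta> \<Longrightarrow> k x = 0"
  shows "test_function (convolution f k)"
  by (rule test_functionI[where R="R + \<delta>"]) (use C_k_conv[OF f k] conv_outside[of R f \<delta> k] f0 k0 in auto)

section \<open>Mollification and cutoffs\<close>

lemma AE_lebesgue_shift:
  assumes "AE x in lebesgue. P (x :: 'a::euclidean_space)"
  shows "AE x in lebesgue. P (a + x)"
proof -
  have "AE x in distr lebesgue lebesgue (\<lambda>x. a + x). P x"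
    using assms unfolding lebesgue_shift(2)[of a, symmetric] .
  then show ?thesis by (rule AE_distrD[OF lebesgue_shift(1)])
qed

lemma mollifierD:
  assumes "mollifier \<delta> k"
  shows "test_function k" "k x \<ge> 0" "k (- x) = k x" "norm x \<ge> \<delta> \<Longrightarrow> k x = 0" "(LINT x|lborel. k x) = 1"
    "continuous_on UNIV k" "k \<in> borel_measurable borel" "integrable lborel k"
proof -
  show 1: "test_function k" "k x \<ge> 0" "k (- x) = k x" "norm x \<ge> \<delta> \<Longrightarrow> k x = 0" "(LINT x|lborel. k x) = 1"
    using assms unfolding mollifier_def by auto
  show c: "continuous_on UNIV k" using C_k_continuous[OF test_function_C_k[OF 1(1), of 0]] .
  then show "k \<in> borel_measurable borel" by (rule borel_measurable_continuous_onI)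
  have "k x = 0" if "norm x > \<delta>" for x using assms that unfolding mollifier_def by auto
  then show "integrable lborel k" by (rule integrable_bounded_support[OF c])
qed

text \<open>The value \<open>convolution f k x - f x\<close> is the average of the differences \<open>f (x + z) - f x\<close> under the
  probability density \<open>k\<close>. Jensen's inequality for \<open>P\<close> (the absolute value or the square below) and
  an exchange of the two integrations reduce it to the translations in \<open>sh\<close>.\<close>

lemma mollify:
  fixes f k :: "real^'d::finite \<Rightarrow> real" and P :: "real \<Rightarrow> real"
  assumes f: "integrable lebesgue f" and k: "mollifier \<delta> k"
    and P[measurable]: "P \<in> borel_measurable borel" and P0: "\<And>t. P t \<ge> 0"
    and J: "\<And>g :: real^'d \<Rightarrow> real. g \<in> borel_measurable borel \<Longrightarrow> integrable lborel (\<lambda>z. g z * k z) \<Longrightarrow> integrable lborel (\<lambda>z. P (g z) * k z) \<Longrightarrow>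
         P (LINT z|lborel. g z * k z) \<le> (LINT z|lborel. P (g z) * k z)"
    and sh: "\<And>z. norm z < \<delta> \<Longrightarrow> integrable lebesgue (\<lambda>x. P (f (x + z) - f x))"
       "\<And>z. norm z < \<delta> \<Longrightarrow> (LINT x|lebesgue. P (f (x + z) - f x)) \<le> e"
    and e: "e \<ge> 0"
  shows "integrable lebesgue (\<lambda>x. P (convolution f k x - f x))" "(LINT x|lebesgue. P (convolution f k x - f x)) \<le> e"
proof -
  note km[measurable] = mollifierD(7)[OF k] and k0 = mollifierD(2)[OF k] and ki = mollifierD(8)[OF k]
  obtain B where B: "\<And>x. \<bar>k x\<bar> \<le> B" using test_function_bounds[OF mollifierD(1)[OF k]] by blast
  \<comment> \<open>Fubini's theorem is applied on Borel product spaces, hence to a Borel representative of f.\<close>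
  obtain f' where f'b: "f' \<in> borel_measurable lborel" and ff': "AE x in lebesgue. f x = f' x"
    using completion_ex_borel_measurable_real[of f lborel] f by (auto simp: AE_completion_iff)
  have f'm[measurable]: "f' \<in> borel_measurable borel" using f'b by simp
  have f'm'[measurable]: "f' \<in> borel_measurable lebesgue" using f'b by (rule measurable_completion)
  have f'i: "integrable lebesgue f'"
    using f integrable_cong_AE[of f lebesgue f'] ff' by auto
  then have f'il: "integrable lborel f'" using integrable_completion[OF f'b] by simp
  have shm: "(\<lambda>z. f' (z + x)) \<in> borel_measurable borel" for x by measurable
  have shi: "integrable lborel (\<lambda>z. f' (z + x))" for x
    using lebesgue_integrable_shift(1)[OF f'i, of x] integrable_completion[of "\<lambda>z. f' (z + x)" lborel] by simp
  have gki: "integrable lborel (\<lambda>z. f' (z + x) * k z)" for x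
    using integrable_mult_bounded[OF lebesgue_integrable_shift(1)[OF f'i, of x], of k B] B
      continuous_lebesgue_measurable(1)[OF mollifierD(6)[OF k]] integrable_completion[of "\<lambda>z. f' (z + x) * k z" lborel]
    by simp
  have cv: "convolution f k x = (LINT z|lborel. f' (z + x) * k z)" for x
  proof -
    have i1: "integrable lebesgue (\<lambda>y. f' y * k (x - y))" "integrable lebesgue (\<lambda>y. f y * k (x - y))"
      by (rule integrable_conv[OF _ mollifierD(6)[OF k] B], rule f'i) (rule integrable_conv[OF f mollifierD(6)[OF k] B])
    have "convolution f k x = (LINT y|lebesgue. f' y * k (x - y))"
      unfolding convolution_def
      by (rule integral_cong_AE) (use i1 ff' in \<open>auto elim!: eventually_mono\<close>)
    also have "\<dots> = (LINT z|lebesgue. f' (z + x) * k (x - (z + x)))"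
      using lebesgue_integrable_shift(2)[OF i1(1), of x] by simp
    also have "\<dots> = (LINT z|lebesgue. f' (z + x) * k z)"
      using mollifierD(3)[OF k] by simp
    also have "\<dots> = (LINT z|lborel. f' (z + x) * k z)" by (rule integral_completion) measurable
    finally show ?thesis .
  qed
  define q where "q z x = P (f' (z + x) - f' x) * k z" for z x
  have qm[measurable]: "(\<lambda>(z, x). q z x) \<in> borel_measurable (lborel \<Otimes>\<^sub>M lborel)"
    unfolding q_def by measurable
  have q0: "q z x \<ge> 0" for z x unfolding q_def using P0 k0 by simp
  have qx: "integrable lborel (\<lambda>x. q z x) \<and> (LINT x|lborel. q z x) \<le> e * k z" for z
  proof (cases "norm z < \<delta>")
    case True
    have AEs: "AE x in lebesgue. P (f (x + z) - f x) = P (f' (z + x) - f' x)"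
      using AE_lebesgue_shift[OF ff', of z] ff' by eventually_elim (simp add: add.commute)
    have m1: "(\<lambda>x. P (f' (z + x) - f' x)) \<in> borel_measurable borel" by measurable
    then have m2: "(\<lambda>x. P (f' (z + x) - f' x)) \<in> borel_measurable lebesgue" by (auto intro: measurable_completion)
    have i: "integrable lebesgue (\<lambda>x. P (f' (z + x) - f' x))"
      using integrable_cong_AE[OF _ m2 AEs] sh(1)[OF True] by auto
    have "(LINT x|lebesgue. P (f' (z + x) - f' x)) = (LINT x|lebesgue. P (f (x + z) - f x))"
      by (rule integral_cong_AE) (use AEs m2 sh(1)[OF True] in \<open>auto elim!: eventually_mono\<close>)
    then have le: "(LINT x|lborel. P (f' (z + x) - f' x)) \<le> e"
      using integral_completion[of "\<lambda>x. P (f' (z + x) - f' x)" lborel] m1 sh(2)[OF True] by simp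
    have i': "integrable lborel (\<lambda>x. P (f' (z + x) - f' x))"
      using i integrable_completion[of "\<lambda>x. P (f' (z + x) - f' x)" lborel] m1 by simp
    show ?thesis unfolding q_def
      using i' le k0[of z] mult_right_mono[OF le k0] by simp
  next
    case False
    then have "k z = 0" using mollifierD(4)[OF k] by simp
    then show ?thesis unfolding q_def by simp
  qed
  have iz: "integrable lborel (\<lambda>z. LINT x|lborel. q z x)"
  proof (rule Bochner_Integration.integrable_bound)
    show "integrable lborel (\<lambda>z. e * k z)" using ki by simp
    show "AE z in lborel. norm (LINT x|lborel. q z x) \<le> norm (e * k z)"
      using qx q0 e k0 by (intro AE_I2) (simp add: Bochner_Integration.integral_nonneg)
  qed measurable
  have Q: "integrable (lborel \<Otimes>\<^sub>M lborel) (\<lambda>(z, x). q z x)"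
    by (rule lborel_pair.Fubini_integrable) (use qx q0 iz in \<open>auto simp: abs_of_nonneg\<close>)
  have AEx: "AE x in lborel. integrable lborel (\<lambda>z. q z x)"
    using lborel_pair.AE_integrable_snd[OF Q] by simp
  have Sx: "integrable lborel (\<lambda>x. LINT z|lborel. q z x)"
    using lborel_pair.integrable_snd[OF Q] by simp
  have "(LINT x|lborel. LINT z|lborel. q z x) = (LINT z|lborel. LINT x|lborel. q z x)"
    by (rule lborel_pair.Fubini_integral[OF Q])
  also have "\<dots> \<le> (LINT z|lborel. e * k z)"
    by (rule integral_mono[OF iz]) (use ki qx in auto)
  also have "\<dots> = e" using mollifierD(5)[OF k] by simp
  finally have tot: "(LINT x|lborel. LINT z|lborel. q z x) \<le> e" .
  define G where "G x = P (convolution f k x - f' x)" for x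
  have Gm: "G \<in> borel_measurable borel"
    using conv_continuous[OF f mollifierD(6)[OF k] B] unfolding G_def
    by (intro measurable_compose[OF _ P] borel_measurable_diff f'm borel_measurable_continuous_onI)
  have Gle: "AE x in lborel. G x \<le> (LINT z|lborel. q z x)"
    using AEx
  proof eventually_elim
    case (elim x)
    have i2: "integrable lborel (\<lambda>z. (f' (z + x) - f' x) * k z)"
      using gki[of x] ki by (simp add: left_diff_distrib)
    have "(LINT z|lborel. (f' (z + x) - f' x) * k z) = convolution f k x - f' x"
      using gki[of x] ki mollifierD(5)[OF k] by (simp add: left_diff_distrib cv)
    then have "G x = P (LINT z|lborel. (f' (z + x) - f' x) * k z)" by (simp add: G_def)
    also have "\<dots> \<le> (LINT z|lborel. P (f' (z + x) - f' x) * k z)"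
      by (rule J) (use i2 elim shm in \<open>auto simp: q_def\<close>)
    finally show ?case by (simp add: q_def)
  qed
  have Gi: "integrable lborel G"
    by (rule Bochner_Integration.integrable_bound[OF Sx]) (use Gm Gle P0 in \<open>auto elim!: eventually_mono simp: G_def\<close>)
  have Gt: "(LINT x|lborel. G x) \<le> e"
    using integral_mono_AE[OF Gi Sx Gle] tot by linarith
  have Gl: "integrable lebesgue G" "(LINT x|lebesgue. G x) \<le> e"
    using Gi Gt integrable_completion[of G lborel] integral_completion[of G lborel] Gm by auto
  have AEG: "AE x in lebesgue. G x = P (convolution f k x - f x)"
    using ff' by eventually_elim (simp add: G_def)
  have m: "(\<lambda>x. P (convolution f k x - f x)) \<in> borel_measurable lebesgue"
    using continuous_lebesgue_measurable(1)[OF conv_continuous[OF f mollifierD(6)[OF k] B]] f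
    by (intro measurable_compose[OF _ P] borel_measurable_diff) auto
  show "integrable lebesgue (\<lambda>x. P (convolution f k x - f x))"
    using integrable_cong_AE[OF _ m AEG] Gl(1) by auto
  have "(LINT x|lebesgue. P (convolution f k x - f x)) = (LINT x|lebesgue. G x)"
    by (rule integral_cong_AE) (use AEG m Gl(1) in \<open>auto elim!: eventually_mono\<close>)
  then show "(LINT x|lebesgue. P (convolution f k x - f x)) \<le> e" using Gl(2) by simp
qed

lemma mollify_L1:
  fixes f :: "real^'d::finite \<Rightarrow> real"
  assumes f: "integrable lebesgue f" and e: "e > 0"
  shows "\<exists>\<delta>>0. \<forall>k. mollifier \<delta> k \<longrightarrow> (LINT x|lebesgue. \<bar>convolution f k x - f x\<bar>) \<le> e"
proof -
  obtain \<delta> where \<delta>: "\<delta> > 0" "\<And>z. norm z < \<delta> \<Longrightarrow> (LINT x|lebesgue. \<bar>f (x + z) - f x\<bar>) < e"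
    using L1_translation_continuous[OF f e] by blast
  have "(LINT x|lebesgue. \<bar>convolution f k x - f x\<bar>) \<le> e" if k: "mollifier \<delta> k" for k
  proof (rule mollify(2)[OF f k, of abs])
    fix g :: "real^'d \<Rightarrow> real"
    have "\<bar>LINT z|lborel. g z * k z\<bar> \<le> (LINT z|lborel. \<bar>g z * k z\<bar>)" by (rule integral_abs_bound)
    then show "\<bar>LINT z|lborel. g z * k z\<bar> \<le> (LINT z|lborel. \<bar>g z\<bar> * k z)"
      using mollifierD(2)[OF k] by (simp add: abs_mult)
  next
    fix z :: "real^'d"
    show "integrable lebesgue (\<lambda>x. \<bar>f (x + z) - f x\<bar>)"
      using f lebesgue_integrable_shift(1)[OF f, of z] by auto
  qed (use \<delta> e in \<open>auto intro: less_imp_le\<close>)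
  with \<delta>(1) show ?thesis by blast
qed

lemma mollify_L2:
  fixes f :: "real^'d::finite \<Rightarrow> real"
  assumes f: "integrable lebesgue f" and f2: "integrable lebesgue (\<lambda>x. (f x)\<^sup>2)" and e: "e > 0"
  shows "\<exists>\<delta>>0. \<forall>k. mollifier \<delta> k \<longrightarrow> integrable lebesgue (\<lambda>x. (convolution f k x - f x)\<^sup>2) \<and>
     (LINT x|lebesgue. (convolution f k x - f x)\<^sup>2) \<le> e"
proof -
  have fm: "f \<in> borel_measurable lebesgue" using f by auto
  obtain \<delta> where \<delta>: "\<delta> > 0" "\<And>z. norm z < \<delta> \<Longrightarrow> integrable lebesgue (\<lambda>x. (f (x + z) - f x)\<^sup>2)"
     "\<And>z. norm z < \<delta> \<Longrightarrow> (LINT x|lebesgue. (f (x + z) - f x)\<^sup>2) < e"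
    using L2_translation_continuous[OF fm f2 e] by blast
  \<comment> \<open>Jensen's inequality for the square: the variance of g under k is nonnegative.\<close>
  have J: "(LINT z|lborel. g z * k z)\<^sup>2 \<le> (LINT z|lborel. (g z)\<^sup>2 * k z)"
    if k: "mollifier \<delta> k" and gk: "integrable lborel (\<lambda>z. g z * k z)" and g2k: "integrable lborel (\<lambda>z. (g z)\<^sup>2 * k z)"
    for k g :: "real^'d \<Rightarrow> real"
  proof -
    define m where "m = (LINT z|lborel. g z * k z)"
    note ki = mollifierD(8)[OF k]
    have eq: "(g z - m)\<^sup>2 * k z = (g z)\<^sup>2 * k z - 2 * m * (g z * k z) + m\<^sup>2 * k z" for z
      by (simp add: power2_diff algebra_simps)
    have "0 \<le> (LINT z|lborel. (g z - m)\<^sup>2 * k z)"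
      using mollifierD(2)[OF k] by (intro Bochner_Integration.integral_nonneg) simp
    also have "\<dots> = (LINT z|lborel. (g z)\<^sup>2 * k z) - 2 * m * m + m\<^sup>2 * 1"
      unfolding eq using gk g2k ki mollifierD(5)[OF k] by (simp add: m_def)
    finally show ?thesis by (simp add: m_def power2_eq_square)
  qed
  have "integrable lebesgue (\<lambda>x. (convolution f k x - f x)\<^sup>2) \<and> (LINT x|lebesgue. (convolution f k x - f x)\<^sup>2) \<le> e"
    if k: "mollifier \<delta> k" for k
    using mollify[OF f k, of "\<lambda>t. t\<^sup>2" e] J[OF k] \<delta> e by (auto intro: less_imp_le)
  with \<delta>(1) show ?thesis by blast
qed

text \<open>The bound \<open>C\<close> on the first derivatives is kept separate from the radius because it will not
  depend on it.\<close>
definition cutoff :: "real \<Rightarrow> real \<Rightarrow> (real^'d::finite \<Rightarrow> real) \<Rightarrow> bool" where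
  "cutoff C R \<theta> \<longleftrightarrow> test_function \<theta> \<and> (\<forall>x. norm x \<le> R \<longrightarrow> \<theta> x = 1) \<and>
    (\<forall>x. \<bar>\<theta> x\<bar> \<le> 1) \<and> (\<forall>x. norm x > R + 2 \<longrightarrow> \<theta> x = 0) \<and> (\<forall>i x. \<bar>partial i \<theta> x\<bar> \<le> C) \<and>
    (\<forall>i x. norm x < R \<longrightarrow> partial i \<theta> x = 0)"

text \<open>Mollify the indicator of a ball with one fixed kernel. The derivative is then bounded by the
  \<open>L\<^sup>1\<close> norm of the derivative of the kernel, whatever the radius.\<close>

lemma cutoff_exists:
  shows "\<exists>C>0. \<forall>R>0. \<exists>\<theta>::real^'d::finite \<Rightarrow> real. cutoff C R \<theta>"
proof -
  obtain k :: "real^'d \<Rightarrow> real" where k: "mollifier 1 k" using mollifier_exists[of 1] by auto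
  note kc = mollifierD(6)[OF k] and kt = mollifierD(1)[OF k]
  have shiftint: "integrable lebesgue (\<lambda>y. g (x - y)) \<and> (LINT y|lebesgue. g (x - y)) = (LINT y|lebesgue. g (- y))"
    if gt: "test_function g" for g :: "real^'d \<Rightarrow> real" and x
  proof -
    obtain R where R: "\<And>x. norm x > R \<Longrightarrow> g x = 0" using test_function_support[OF gt] by blast
    have "continuous_on UNIV (\<lambda>y. g (- y))"
      using C_k_continuous[OF test_function_C_k[OF gt, of 0]] by (auto intro!: continuous_on_compose2[of UNIV g] continuous_intros)
    then have i: "integrable lebesgue (\<lambda>y. g (- y))"
      by (rule integrable_bounded_support[of _ R]) (use R in auto)
    show ?thesis using lebesgue_integrable_shift[OF i, of "- x"] by simp
  qed
  define C where "C = 1 + (\<Sum>i\<in>UNIV. LINT y|lebesgue. \<bar>partial i k (- y)\<bar>)"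
  have C: "C > 0" unfolding C_def by (intro add_pos_nonneg sum_nonneg Bochner_Integration.integral_nonneg) auto
  have "\<exists>\<theta>::real^'d \<Rightarrow> real. cutoff C R \<theta>" if R: "R > 0" for R
  proof -
    define I :: "real^'d \<Rightarrow> real" where "I = (\<lambda>x. 1 * indicator (cball 0 (R + 1)) x)"
    have Ii: "integrable lebesgue I" unfolding I_def by (rule integrable_indicator_cball)
    have I1: "0 \<le> I x" "I x \<le> 1" for x unfolding I_def by (auto simp: indicator_def)
    have out: "convolution I k x = 0" if "norm x > R + 2" for x
      by (rule conv_outside[where R="R+1" and \<delta>=1]) (use that mollifierD(4)[OF k] in \<open>auto simp: I_def\<close>)
    have ki1: "(LINT y|lebesgue. k (x - y)) = 1" for x
    proof -
      have "(LINT y|lebesgue. k (x - y)) = (LINT y|lebesgue. k y)"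
        using shiftint[OF kt, of x] mollifierD(3)[OF k] by simp
      also have "\<dots> = (LINT y|lborel. k y)" by (rule integral_completion) (use mollifierD(7)[OF k] in simp)
      finally show ?thesis using mollifierD(5)[OF k] by simp
    qed
    obtain B where B: "\<And>x. \<bar>k x\<bar> \<le> B" "\<And>i x. \<bar>partial i k x\<bar> \<le> B" using test_function_bounds[OF kt] by blast
    have inn: "convolution I k x = 1" if "norm x \<le> R" for x
    proof -
      have "I y * k (x - y) = k (x - y)" for y
      proof (cases "norm y \<le> R + 1")
        case False
        have "norm (x - y) \<ge> 1" using norm_triangle_ineq2[of y x] False that by (simp add: norm_minus_commute)
        then show ?thesis using mollifierD(4)[OF k] by simp
      qed (simp add: I_def)
      then have eq: "(\<lambda>y. I y * k (x - y)) = (\<lambda>y. k (x - y))" by blast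
      show ?thesis unfolding convolution_def eq using ki1 by simp
    qed
    have le1: "\<bar>convolution I k x\<bar> \<le> 1" for x
    proof -
      have "\<bar>convolution I k x\<bar> \<le> (LINT y|lebesgue. \<bar>I y * k (x - y)\<bar>)" unfolding convolution_def by (rule integral_abs_bound)
      also have "\<dots> \<le> (LINT y|lebesgue. k (x - y))"
      proof (rule integral_mono)
        show "\<bar>I y * k (x - y)\<bar> \<le> k (x - y)" for y
          using I1[of y] mollifierD(2)[OF k, of "x - y"] by (auto simp: abs_mult intro!: mult_left_le_one_le)
      qed (use integrable_conv[OF Ii kc B(1)] shiftint[OF kt] in auto)
      finally show ?thesis using ki1 by simp
    qed
    have pb: "\<bar>partial i (convolution I k) x\<bar> \<le> C" for i x
    proof -
      have pt: "test_function (partial i k)" by (rule test_function_partial[OF kt])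
      have pc: "continuous_on UNIV (partial i k)" using C_k_continuous[OF test_function_C_k[OF pt, of 0]] .
      obtain S where S: "\<And>x. norm x > S \<Longrightarrow> partial i k x = 0" using test_function_support[OF pt] by blast
      have ac: "continuous_on UNIV (\<lambda>y. \<bar>partial i k (- y)\<bar>)"
        using pc by (auto intro!: continuous_on_compose2[of UNIV "partial i k"] continuous_intros)
      have ai: "integrable lebesgue (\<lambda>y. \<bar>partial i k (- y)\<bar>)"
        by (rule integrable_bounded_support[OF ac, of S]) (use S in auto)
      note as = lebesgue_integrable_shift[OF ai, of "- x"]
      have "\<bar>partial i (convolution I k) x\<bar> \<le> (LINT y|lebesgue. \<bar>I y * partial i k (x - y)\<bar>)"
        unfolding partial_conv[OF Ii kt] convolution_def by (rule integral_abs_bound)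
      also have "\<dots> \<le> (LINT y|lebesgue. \<bar>partial i k (x - y)\<bar>)"
      proof (rule integral_mono)
        show "\<bar>I y * partial i k (x - y)\<bar> \<le> \<bar>partial i k (x - y)\<bar>" for y
          using I1[of y] by (auto simp: abs_mult intro!: mult_left_le_one_le)
      qed (use integrable_conv[OF Ii pc B(2)] as in auto)
      also have "\<dots> = (LINT y|lebesgue. \<bar>partial i k (- y)\<bar>)" using as by simp
      also have "\<dots> \<le> (\<Sum>i\<in>UNIV. LINT y|lebesgue. \<bar>partial i k (- y)\<bar>)"
        by (rule member_le_sum[of i UNIV "\<lambda>i. LINT y|lebesgue. \<bar>partial i k (- y)\<bar>"]) auto
      finally show ?thesis unfolding C_def by simp
    qed
    have pz: "partial i (convolution I k) x = 0" if "norm x < R" for i x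
    proof -
      have "((\<lambda>x. 1::real) has_derivative (\<lambda>h. 0)) (at x)" by simp
      then have "(convolution I k has_derivative (\<lambda>h. 0)) (at x)"
        by (rule has_derivative_transform_within_open[where s="ball 0 R"]) (use that inn in auto)
      then show ?thesis using partial_eqI by blast
    qed
    have "test_function (convolution I k)"
      by (rule test_function_conv[OF Ii kt, where R="R+1" and \<delta>=1]) (use mollifierD(4)[OF k] in \<open>auto simp: I_def\<close>)
    then have "cutoff C R (convolution I k)" unfolding cutoff_def using out inn le1 pb pz by blast
    then show ?thesis by blast
  qed
  then show ?thesis using C by blast
qed

section \<open>Weak gradients\<close>

lemma locally_integrable_times_bounded_support:
  fixes f \<eta> :: "real^'d::finite \<Rightarrow> real"
  assumes f: "locally_integrable f" and c: "continuous_on UNIV \<eta>" and s: "\<And>x. norm x > R \<Longrightarrow> \<eta> x = 0"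
  shows "integrable lebesgue (\<lambda>x. f x * \<eta> x)"
proof -
  obtain B where B: "\<And>x. \<bar>\<eta> x\<bar> \<le> B" using bounded_support_bounded[OF c s] by blast
  have "integrable lebesgue (\<lambda>x. indicator (cball 0 R) x *\<^sub>R f x)"
    using f unfolding locally_integrable_def set_integrable_def by auto
  then have "integrable lebesgue (\<lambda>x. (indicator (cball 0 R) x *\<^sub>R f x) * \<eta> x)"
    by (rule integrable_mult_bounded[OF _ continuous_lebesgue_measurable(1)[OF c] B])
  moreover have "(\<lambda>x. (indicator (cball 0 R) x *\<^sub>R f x) * \<eta> x) = (\<lambda>x. f x * \<eta> x)"
    using s by (fastforce simp: indicator_def not_le)
  ultimately show ?thesis by simp
qed

lemma test_function_continuous: "test_function \<eta> \<Longrightarrow> continuous_on UNIV \<eta>"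
  using C_k_continuous[OF test_function_C_k[of \<eta> 0]] .

lemma locally_integrable_times_test:
  fixes f \<eta> :: "real^'d::finite \<Rightarrow> real"
  assumes f: "locally_integrable f" and \<eta>: "test_function \<eta>"
  shows "integrable lebesgue (\<lambda>x. f x * \<eta> x)"
proof -
  obtain R where "\<And>x. norm x > R \<Longrightarrow> \<eta> x = 0" using test_function_support[OF \<eta>] by blast
  then show ?thesis using locally_integrable_times_bounded_support[OF f test_function_continuous[OF \<eta>]] by blast
qed

lemma locally_integrable_component:
  fixes g :: "real^'d::finite \<Rightarrow> real^'d"
  assumes "locally_integrable g"
  shows "locally_integrable (\<lambda>x. g x $ i)"
  unfolding locally_integrable_def
proof (intro allI impI)
  fix S :: "(real^'d) set" assume "compact S"
  then have "integrable lebesgue (\<lambda>x. indicator S x *\<^sub>R g x)"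
    using assms unfolding locally_integrable_def set_integrable_def by auto
  then have "integrable lebesgue (\<lambda>x. (indicator S x *\<^sub>R g x) $ i)"
    by (rule integrable_bounded_linear[OF bounded_linear_vec_nth])
  then show "set_integrable lebesgue S (\<lambda>x. g x $ i)"
    unfolding set_integrable_def by simp
qed

lemma locally_integrable_measurable:
  fixes f :: "real^'d::finite \<Rightarrow> real"
  assumes "locally_integrable f"
  shows "f \<in> borel_measurable lebesgue"
proof -
  define s where "s n x = indicator (cball 0 (real n)) x *\<^sub>R f x" for n x
  have "s n \<in> borel_measurable lebesgue" for n
  proof -
    have "integrable lebesgue (s n)"
      using assms unfolding locally_integrable_def set_integrable_def s_def using compact_cball by blast
    then show ?thesis by auto
  qed
  moreover have "(\<lambda>n. s n x) \<longlonglongrightarrow> f x" for x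
  proof (rule tendsto_eventually)
    obtain N where N: "real N > norm x" using reals_Archimedean2 by blast
    have "s n x = f x" if "n \<ge> N" for n
    proof -
      have "real n \<ge> real N" using that by simp
      then show ?thesis using N unfolding s_def by auto
    qed
    then show "\<forall>\<^sub>F n in sequentially. s n x = f x" by (auto simp: eventually_sequentially)
  qed
  ultimately show ?thesis by (rule borel_measurable_LIMSEQ_metric)
qed

text \<open>After multiplication by a cutoff, convolution with a mollifier is an integral against a test
  function, so it vanishes identically; on the other hand it converges in \<open>L\<^sup>1\<close>.\<close>

lemma vanishing_against_test_functions:
  fixes f :: "real^'d::finite \<Rightarrow> real"
  assumes f: "locally_integrable f" and z: "\<And>\<eta>. test_function \<eta> \<Longrightarrow> (LINT x|lebesgue. f x * \<eta> x) = 0"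
  shows "AE x in lebesgue. f x = 0"
proof -
  obtain C where C: "\<And>R. R > 0 \<Longrightarrow> \<exists>\<theta>::real^'d \<Rightarrow> real. cutoff C R \<theta>"
    using cutoff_exists[where 'd='d] by blast
  have "AE x in lebesgue. norm x \<le> real n + 1 \<longrightarrow> f x = 0" for n
  proof -
    obtain \<theta> where \<theta>: "test_function (\<theta> :: real^'d \<Rightarrow> real)" "\<And>x. norm x \<le> real n + 1 \<Longrightarrow> \<theta> x = 1"
      using C[of "real n + 1"] by (auto simp: cutoff_def)
    define F where "F x = f x * \<theta> x" for x
    have Fi: "integrable lebesgue F" unfolding F_def by (rule locally_integrable_times_test[OF f \<theta>(1)])
    have cz: "convolution F k x = 0" if k: "test_function k" for k x
    proof -
      have "test_function (\<lambda>y. k (x - y) * \<theta> y)"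
        using C_k_affine[OF test_function_C_k[OF k], of _ "-1" x]
        by (intro test_function_bounded_support_mult[OF \<theta>(1)]) simp
      then have "(LINT y|lebesgue. f y * (k (x - y) * \<theta> y)) = 0" by (rule z)
      then show ?thesis unfolding convolution_def F_def by (simp add: mult_ac)
    qed
    have "(LINT x|lebesgue. \<bar>F x\<bar>) \<le> e" if e: "e > 0" for e
    proof -
      obtain \<delta> where \<delta>: "\<delta> > 0" "\<And>k. mollifier \<delta> k \<Longrightarrow> (LINT x|lebesgue. \<bar>convolution F k x - F x\<bar>) \<le> e"
        using mollify_L1[OF Fi e] by blast
      obtain k :: "real^'d \<Rightarrow> real" where k: "mollifier \<delta> k" using mollifier_exists[OF \<delta>(1)] by blast
      show ?thesis using \<delta>(2)[OF k] by (simp add: cz[OF mollifierD(1)[OF k]])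
    qed
    then have "(LINT x|lebesgue. \<bar>F x\<bar>) \<le> 0" by (rule field_le_epsilon[of _ 0, simplified])
    moreover have "0 \<le> (LINT x|lebesgue. \<bar>F x\<bar>)" by (rule Bochner_Integration.integral_nonneg) simp
    ultimately have "(LINT x|lebesgue. \<bar>F x\<bar>) = 0" by linarith
    then have "AE x in lebesgue. F x = 0"
      using integral_nonneg_eq_0_iff_AE[of lebesgue "\<lambda>x. \<bar>F x\<bar>"] Fi by auto
    then show ?thesis by eventually_elim (use \<theta> in \<open>auto simp: F_def\<close>)
  qed
  then have "AE x in lebesgue. \<forall>n. norm x \<le> real n + 1 \<longrightarrow> f x = 0"
    unfolding AE_all_countable by blast
  then show ?thesis
  proof eventually_elim
    case (elim x)
    obtain n where "real n > norm x" using reals_Archimedean2 by blast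
    then show ?case using elim[rule_format, of n] by simp
  qed
qed

lemma has_weak_gradD:
  assumes "has_weak_grad u g"
  shows "locally_integrable u" "locally_integrable (\<lambda>x. g x $ i)"
    "test_function \<eta> \<Longrightarrow> (LINT x|lebesgue. u x * partial i \<eta> x) = - (LINT x|lebesgue. g x $ i * \<eta> x)"
  using assms locally_integrable_component unfolding has_weak_grad_def by auto

lemma locally_integrable_linear:
  fixes f g :: "real^'d::finite \<Rightarrow> 'b::euclidean_space"
  assumes "locally_integrable f" "locally_integrable g"
  shows "locally_integrable (\<lambda>x. a *\<^sub>R f x + b *\<^sub>R g x)"
  unfolding locally_integrable_def set_integrable_def
proof (intro allI impI)
  fix S :: "(real^'d) set" assume "compact S"
  then have "integrable lebesgue (\<lambda>x. indicator S x *\<^sub>R f x)" "integrable lebesgue (\<lambda>x. indicator S x *\<^sub>R g x)"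
    using assms unfolding locally_integrable_def set_integrable_def by auto
  then have "integrable lebesgue (\<lambda>x. a *\<^sub>R (indicator S x *\<^sub>R f x) + b *\<^sub>R (indicator S x *\<^sub>R g x))"
    by (intro Bochner_Integration.integrable_add integrable_scaleR_right)
  then show "integrable lebesgue (\<lambda>x. indicator S x *\<^sub>R (a *\<^sub>R f x + b *\<^sub>R g x))"
    by (simp add: scaleR_add_right mult.commute)
qed

lemma has_weak_grad_unique:
  assumes g: "has_weak_grad u g" and h: "has_weak_grad u h"
  shows "AE x in lebesgue. g x = h x"
proof -
  have "AE x in lebesgue. g x $ i - h x $ i = 0" for i
  proof (rule vanishing_against_test_functions)
    show "locally_integrable (\<lambda>x. g x $ i - h x $ i)"
      using locally_integrable_linear[OF has_weak_gradD(2)[OF g, of i] has_weak_gradD(2)[OF h, of i], of 1 "-1"] by simp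
    fix \<eta> :: "real^'a \<Rightarrow> real" assume \<eta>: "test_function \<eta>"
    show "(LINT x|lebesgue. (g x $ i - h x $ i) * \<eta> x) = 0"
      using has_weak_gradD(3)[OF g \<eta>, of i] has_weak_gradD(3)[OF h \<eta>, of i]
        locally_integrable_times_test[OF has_weak_gradD(2)[OF g, of i] \<eta>] locally_integrable_times_test[OF has_weak_gradD(2)[OF h, of i] \<eta>]
      by (simp add: left_diff_distrib)
  qed
  then have "AE x in lebesgue. \<forall>i\<in>UNIV. g x $ i = h x $ i"
    by (subst AE_finite_all) auto
  then show ?thesis by eventually_elim (simp add: vec_eq_iff)
qed

lemma has_weak_grad_weak_grad: "has_weak_grad u g \<Longrightarrow> has_weak_grad u (weak_grad u)"
  using someI[of "has_weak_grad u" g] by (simp add: weak_grad_def)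

lemma has_weak_grad_linear:
  assumes u: "has_weak_grad u g" and v: "has_weak_grad v h"
  shows "has_weak_grad (\<lambda>x. a * u x + b * v x) (\<lambda>x. a *\<^sub>R g x + b *\<^sub>R h x)"
  unfolding has_weak_grad_def
proof (intro conjI allI impI)
  show "locally_integrable (\<lambda>x. a * u x + b * v x)"
    using locally_integrable_linear[of u v a b] u v unfolding has_weak_grad_def by auto
  show "locally_integrable (\<lambda>x. a *\<^sub>R g x + b *\<^sub>R h x)"
    using locally_integrable_linear[of g h a b] u v unfolding has_weak_grad_def by auto
  fix \<eta> :: "real^'a \<Rightarrow> real" and i assume \<eta>: "test_function \<eta>"
  note p = test_function_partial[OF \<eta>, of i]
  note ints = locally_integrable_times_test[OF has_weak_gradD(1)[OF u] p] locally_integrable_times_test[OF has_weak_gradD(1)[OF v] p]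
    locally_integrable_times_test[OF has_weak_gradD(2)[OF u, of i] \<eta>] locally_integrable_times_test[OF has_weak_gradD(2)[OF v, of i] \<eta>]
  show "(LINT x|lebesgue. (a * u x + b * v x) * partial i \<eta> x) = - (LINT x|lebesgue. (a *\<^sub>R g x + b *\<^sub>R h x) $ i * \<eta> x)"
    using ints has_weak_gradD(3)[OF u \<eta>, of i] has_weak_gradD(3)[OF v \<eta>, of i]
    by (simp add: distrib_right mult.assoc)
qed

text \<open>By translation invariance the difference quotients of \<open>f\<close> in the direction \<open>i\<close> have integral
  zero, and they converge boundedly to the derivative.\<close>

lemma integral_partial_zero:
  fixes f :: "real^'d::finite \<Rightarrow> real"
  assumes f: "C_k (Suc 0) f" and s: "\<And>x. norm x > R \<Longrightarrow> f x = 0"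
  shows "(LINT x|lebesgue. partial i f x) = 0"
proof -
  have d: "f differentiable (at x)" for x using f by simp
  have fc: "continuous_on UNIV f" by (rule C_k_continuous[OF f])
  have pc: "continuous_on UNIV (partial i f)" for i using f by simp
  have p0: "partial i f x = 0" if "norm x > R" for i x by (rule partial_outside[OF s that])
  have fi: "integrable lebesgue f" by (rule integrable_bounded_support[OF fc s])
  have "\<exists>B. \<forall>x. \<bar>partial i f x\<bar> \<le> B" for i using bounded_support_bounded[OF pc p0] by metis
  then obtain b where b: "\<And>i x. \<bar>partial i f x\<bar> \<le> b i" by metis
  define B where "B = (\<Sum>i\<in>UNIV. b i)"
  have nn: "b i \<ge> 0" for i using b[of i 0] by linarith
  have "b i \<le> B" for i unfolding B_def using nn by (intro member_le_sum) auto
  then have B: "\<bar>partial i f x\<bar> \<le> B" for i x using b order_trans by blast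
  define C where "C = real CARD('d) * B"
  define u where "u n = inverse (real (Suc n))" for n
  have u: "u n > 0" "u n \<le> 1" for n unfolding u_def by (auto simp: inverse_le_1_iff)
  have u0: "u \<longlonglongrightarrow> 0" unfolding u_def by (rule LIMSEQ_inverse_real_of_nat)
  define q where "q n x = (f (x + u n *\<^sub>R axis i 1) - f x) / u n" for n x
  have shi: "integrable lebesgue (\<lambda>x. f (x + u n *\<^sub>R axis i 1))" for n by (rule lebesgue_integrable_shift(1)[OF fi])
  have "(LINT x|lebesgue. q n x) = 0" for n
    unfolding q_def using shi fi lebesgue_integrable_shift(2)[OF fi] by simp
  moreover have "(\<lambda>n. LINT x|lebesgue. q n x) \<longlonglongrightarrow> (LINT x|lebesgue. partial i f x)"
  proof (rule integral_dominated_convergence[where w="\<lambda>x. C * indicator (cball 0 (R + 1)) x"])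
    show "AE x in lebesgue. (\<lambda>n. q n x) \<longlonglongrightarrow> partial i f x"
    proof (rule AE_I2)
      fix x
      have "((\<lambda>t. f (x + t *\<^sub>R axis i 1)) has_derivative (\<lambda>t. frechet_derivative f (at x) (t *\<^sub>R axis i 1))) (at 0)"
        using has_derivative_compose[of "\<lambda>t. x + t *\<^sub>R axis i 1" "\<lambda>t. t *\<^sub>R axis i 1" 0 UNIV f "frechet_derivative f (at x)"]
          d[of x] frechet_derivative_works by (force intro!: derivative_eq_intros)
      moreover have "frechet_derivative f (at x) (t *\<^sub>R axis i 1) = partial i f x * t" for t
      proof -
        have "linear (frechet_derivative f (at x))"
          using d[of x] frechet_derivative_works has_derivative_linear by blast
        then show ?thesis by (simp add: partial_def linear_scale)
      qed
      ultimately have "((\<lambda>t. f (x + t *\<^sub>R axis i 1)) has_real_derivative partial i f x) (at 0)"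
        unfolding has_field_derivative_def by simp
      then have "((\<lambda>t. (f (x + t *\<^sub>R axis i 1) - f x) / t) \<longlongrightarrow> partial i f x) (at 0)"
        unfolding DERIV_def by simp
      moreover have "filterlim u (at 0) sequentially"
        unfolding filterlim_at using u0 u(1) by (auto simp: less_imp_neq[symmetric] intro!: always_eventually)
      ultimately show "(\<lambda>n. q n x) \<longlonglongrightarrow> partial i f x"
        unfolding q_def by (rule filterlim_compose)
    qed
    show "AE x in lebesgue. norm (q n x) \<le> C * indicator (cball 0 (R + 1)) x" for n
    proof (rule AE_I2)
      fix x
      have "\<bar>f (x + u n *\<^sub>R axis i 1) - f x\<bar> \<le> C * norm (u n *\<^sub>R axis i (1::real))"
        unfolding C_def by (rule lipschitz_of_bounded_partials(2)[OF d B])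
      then have 1: "\<bar>q n x\<bar> \<le> C" unfolding q_def using u[of n]
        by (simp add: abs_divide divide_le_eq)
      show "norm (q n x) \<le> C * indicator (cball 0 (R + 1)) x"
      proof (cases "norm x \<le> R + 1")
        case False
        have "norm (x + u n *\<^sub>R axis i 1) > R"
          using norm_triangle_ineq2[of x "- (u n *\<^sub>R axis i 1)"] False u[of n] by simp
        then show ?thesis using False s unfolding q_def by simp
      qed (use 1 in simp)
    qed
    show "partial i f \<in> borel_measurable lebesgue" by (rule continuous_lebesgue_measurable(1)[OF pc])
    show "q n \<in> borel_measurable lebesgue" for n
      unfolding q_def using shi fi by (auto intro!: borel_measurable_divide borel_measurable_diff)
  qed (rule integrable_indicator_cball)
  ultimately show ?thesis by (simp add: LIMSEQ_const_iff)
qed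

lemma locally_integrable_continuous:
  fixes f :: "real^'d::finite \<Rightarrow> 'b::euclidean_space"
  assumes "continuous_on UNIV f"
  shows "locally_integrable f"
  unfolding locally_integrable_def set_integrable_def
proof (intro allI impI)
  fix S :: "(real^'d) set" assume S: "compact S"
  have "integrable lborel (\<lambda>x. indicator S x *\<^sub>R f x)"
    using borel_integrable_compact[OF S continuous_on_subset[OF assms]] by simp
  then show "integrable lebesgue (\<lambda>x. indicator S x *\<^sub>R f x)"
    using integrable_completion[of "\<lambda>x. indicator S x *\<^sub>R f x" lborel] by auto
qed

lemma has_weak_grad_C1:
  fixes u :: "real^'d::finite \<Rightarrow> real"
  assumes u: "C_k (Suc 0) u"
  shows "has_weak_grad u (grad u)"
  unfolding has_weak_grad_def
proof (intro conjI allI impI)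
  show "locally_integrable u" by (rule locally_integrable_continuous[OF C_k_continuous[OF u]])
  have pc: "continuous_on UNIV (partial i u)" for i using u by simp
  then have "continuous_on UNIV (grad u)" unfolding grad_def by (intro continuous_intros)
  then show "locally_integrable (grad u)" by (rule locally_integrable_continuous)
  fix \<eta> :: "real^'d \<Rightarrow> real" and i assume \<eta>: "test_function \<eta>"
  obtain R where R: "\<And>x. norm x > R \<Longrightarrow> \<eta> x = 0" using test_function_support[OF \<eta>] by blast
  have C1: "C_k (Suc 0) \<eta>" by (rule test_function_C_k[OF \<eta>])
  have "(LINT x|lebesgue. partial i (\<lambda>x. u x * \<eta> x) x) = 0"
    by (rule integral_partial_zero[OF C_k_mult[OF u C1], where R=R]) (use R in simp)
  moreover have "partial i (\<lambda>x. u x * \<eta> x) = (\<lambda>x. u x * partial i \<eta> x + partial i u x * \<eta> x)"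
    using u C1 by (auto simp: partial_mult)
  moreover note locally_integrable_times_test[OF locally_integrable_continuous[OF C_k_continuous[OF u]] test_function_partial[OF \<eta>, of i]]
    locally_integrable_times_test[OF locally_integrable_continuous[OF pc[of i]] \<eta>]
  ultimately show "(LINT x|lebesgue. u x * partial i \<eta> x) = - (LINT x|lebesgue. grad u x $ i * \<eta> x)"
    by (simp add: grad_def)
qed

lemma weak_grad_times_test:
  assumes u: "has_weak_grad u g" and \<theta>: "test_function \<theta>" and \<eta>: "test_function \<eta>"
  shows "(LINT x|lebesgue. (\<theta> x * u x) * partial i \<eta> x) =
     - (LINT x|lebesgue. (\<theta> x * g x $ i + u x * partial i \<theta> x) * \<eta> x)"
proof -
  have t: "test_function (\<lambda>x. \<theta> x * \<eta> x)"
    by (rule test_function_bounded_support_mult[OF \<eta> test_function_C_k[OF \<theta>]])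
  have t1: "test_function (\<lambda>x. \<theta> x * partial i \<eta> x)"
    by (rule test_function_bounded_support_mult[OF test_function_partial[OF \<eta>] test_function_C_k[OF \<theta>]])
  have t2: "test_function (\<lambda>x. partial i \<theta> x * \<eta> x)"
    by (rule test_function_bounded_support_mult[OF \<eta> test_function_C_k[OF test_function_partial[OF \<theta>]]])
  have p: "partial i (\<lambda>x. \<theta> x * \<eta> x) = (\<lambda>x. \<theta> x * partial i \<eta> x + partial i \<theta> x * \<eta> x)"
    using test_function_C_k[OF \<theta>, of "Suc 0"] test_function_C_k[OF \<eta>, of "Suc 0"] by (auto simp: partial_mult)
  note i1 = locally_integrable_times_test[OF has_weak_gradD(1)[OF u] t1]
  note i2 = locally_integrable_times_test[OF has_weak_gradD(1)[OF u] t2]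
  note i3 = locally_integrable_times_test[OF has_weak_gradD(2)[OF u, of i] t]
  have "(LINT x|lebesgue. u x * (\<theta> x * partial i \<eta> x) + u x * (partial i \<theta> x * \<eta> x)) = - (LINT x|lebesgue. g x $ i * (\<theta> x * \<eta> x))"
    using has_weak_gradD(3)[OF u t, of i] unfolding p by (simp add: distrib_left)
  then have "(LINT x|lebesgue. u x * (\<theta> x * partial i \<eta> x)) = - ((LINT x|lebesgue. g x $ i * (\<theta> x * \<eta> x)) + (LINT x|lebesgue. u x * (partial i \<theta> x * \<eta> x)))"
    using i1 i2 by simp
  also have "\<dots> = - (LINT x|lebesgue. g x $ i * (\<theta> x * \<eta> x) + u x * (partial i \<theta> x * \<eta> x))"
    using i2 i3 by simp
  finally show ?thesis by (simp add: algebra_simps)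
qed

section \<open>Weighted Lebesgue and Sobolev spaces\<close>

text \<open>The assumptions on a density that the function spaces rely on: it is bounded, so \<open>L\<^sup>2\<close>
  convergence implies weighted convergence, and it is bounded away from zero on bounded
  sets, so functions of bounded support can be treated without weight.\<close>
locale weight =
  fixes \<rho> :: "real^'d::finite \<Rightarrow> real" and rho_max :: real
  assumes rho_continuous: "continuous_on UNIV \<rho>" and rho_pos: "\<And>x. 0 < \<rho> x" and rho_le: "\<And>x. \<rho> x \<le> rho_max"
begin

lemma rho_max_pos: "rho_max > 0" using rho_pos[of 0] rho_le[of 0] by linarith

lemma rho_measurable: "\<rho> \<in> borel_measurable lebesgue" by (rule continuous_lebesgue_measurable(1)[OF rho_continuous])

lemma L2_D: "L2 \<rho> u \<Longrightarrow> u \<in> borel_measurable lebesgue" "L2 \<rho> u \<Longrightarrow> integrable lebesgue (\<lambda>x. (u x)\<^sup>2 * \<rho> x)"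
  unfolding L2_def by auto

lemma L2_prod:
  assumes u: "L2 \<rho> u" and v: "L2 \<rho> v"
  shows "integrable lebesgue (\<lambda>x. u x * v x * \<rho> x)"
proof (rule Bochner_Integration.integrable_bound)
  show "integrable lebesgue (\<lambda>x. (u x)\<^sup>2 * \<rho> x + (v x)\<^sup>2 * \<rho> x)" using u v L2_D by auto
  have "\<bar>u x * v x * \<rho> x\<bar> \<le> (u x)\<^sup>2 * \<rho> x + (v x)\<^sup>2 * \<rho> x" for x
  proof -
    have "\<bar>u x * v x\<bar> \<le> (u x)\<^sup>2 + (v x)\<^sup>2"
    proof -
      have "2 * (\<bar>u x\<bar> * \<bar>v x\<bar>) \<le> (u x)\<^sup>2 + (v x)\<^sup>2" using sum_squares_bound[of "\<bar>u x\<bar>" "\<bar>v x\<bar>"] by simp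
      moreover have "0 \<le> \<bar>u x\<bar> * \<bar>v x\<bar>" by simp
      ultimately show ?thesis unfolding abs_mult by linarith
    qed
    then have "\<bar>u x * v x\<bar> * \<rho> x \<le> ((u x)\<^sup>2 + (v x)\<^sup>2) * \<rho> x" using rho_pos[of x] by (intro mult_right_mono) auto
    then show ?thesis using rho_pos[of x] by (simp add: abs_mult distrib_right)
  qed
  then show "AE x in lebesgue. norm (u x * v x * \<rho> x) \<le> norm ((u x)\<^sup>2 * \<rho> x + (v x)\<^sup>2 * \<rho> x)"
    by (intro AE_I2) (metis abs_ge_self order_trans real_norm_def)
qed (use u v L2_D rho_measurable in auto)

lemma L2_cmult: "L2 \<rho> u \<Longrightarrow> L2 \<rho> (\<lambda>x. c * u x)"
  unfolding L2_def by (auto simp: power_mult_distrib mult.assoc)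

lemma L2_add:
  assumes u: "L2 \<rho> u" and v: "L2 \<rho> v"
  shows "L2 \<rho> (\<lambda>x. u x + v x)"
proof -
  have "(u x + v x)\<^sup>2 * \<rho> x = (u x)\<^sup>2 * \<rho> x + 2 * (u x * v x * \<rho> x) + (v x)\<^sup>2 * \<rho> x" for x
    by (simp add: power2_sum algebra_simps)
  then show ?thesis using u v L2_prod[OF u v] unfolding L2_def by auto
qed

lemma L2_diff: "L2 \<rho> u \<Longrightarrow> L2 \<rho> v \<Longrightarrow> L2 \<rho> (\<lambda>x. u x - v x)"
  using L2_add[OF _ L2_cmult, of u v "-1"] by simp

lemma L2_zero: "L2 \<rho> (\<lambda>x. 0)" unfolding L2_def by simp

lemma L2_sum: "(\<And>i. i \<in> I \<Longrightarrow> L2 \<rho> (f i)) \<Longrightarrow> L2 \<rho> (\<lambda>x. \<Sum>i\<in>I. f i x)"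
  by (induction I rule: infinite_finite_induct) (auto intro: L2_add L2_zero)

lemma L2_mult_bounded:
  assumes u: "L2 \<rho> u" and g: "g \<in> borel_measurable lebesgue" and B: "\<And>x. \<bar>g x\<bar> \<le> B"
  shows "L2 \<rho> (\<lambda>x. g x * u x)" "L2_norm \<rho> (\<lambda>x. g x * u x) \<le> B * L2_norm \<rho> u"
proof -
  have B0: "B \<ge> 0" using B[of 0] by linarith
  have le: "(g x * u x)\<^sup>2 * \<rho> x \<le> B\<^sup>2 * ((u x)\<^sup>2 * \<rho> x)" for x
  proof -
    have "(g x)\<^sup>2 \<le> B\<^sup>2" using B[of x] by (metis abs_le_square_iff abs_of_nonneg B0)
    then have "(g x)\<^sup>2 * ((u x)\<^sup>2 * \<rho> x) \<le> B\<^sup>2 * ((u x)\<^sup>2 * \<rho> x)" using rho_pos[of x] by (intro mult_right_mono) auto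
    then show ?thesis by (simp add: power_mult_distrib mult.assoc)
  qed
  have i: "integrable lebesgue (\<lambda>x. (g x * u x)\<^sup>2 * \<rho> x)"
  proof (rule Bochner_Integration.integrable_bound)
    show "integrable lebesgue (\<lambda>x. B\<^sup>2 * ((u x)\<^sup>2 * \<rho> x))" using u L2_D by auto
    show "AE x in lebesgue. norm ((g x * u x)\<^sup>2 * \<rho> x) \<le> norm (B\<^sup>2 * ((u x)\<^sup>2 * \<rho> x))"
    proof (rule AE_I2)
      fix x show "norm ((g x * u x)\<^sup>2 * \<rho> x) \<le> norm (B\<^sup>2 * ((u x)\<^sup>2 * \<rho> x))"
        using le[of x] rho_pos[of x] by (simp add: abs_mult)
    qed
  qed (use u g L2_D rho_measurable in auto)
  then show "L2 \<rho> (\<lambda>x. g x * u x)" unfolding L2_def using u g L2_D by auto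
  have "L2_inner \<rho> (\<lambda>x. g x * u x) (\<lambda>x. g x * u x) = (LINT x|lebesgue. (g x * u x)\<^sup>2 * \<rho> x)"
    by (simp add: L2_inner_def power2_eq_square)
  also have "\<dots> \<le> (LINT x|lebesgue. B\<^sup>2 * ((u x)\<^sup>2 * \<rho> x))"
    by (rule integral_mono[OF i]) (use le u L2_D in auto)
  also have "\<dots> = B\<^sup>2 * L2_inner \<rho> u u" by (simp add: L2_inner_def power2_eq_square)
  finally show "L2_norm \<rho> (\<lambda>x. g x * u x) \<le> B * L2_norm \<rho> u"
    unfolding L2_norm_def using B0 by (metis real_sqrt_abs abs_of_nonneg real_sqrt_le_iff real_sqrt_mult)
qed

lemma L2_inner_commute: "L2_inner \<rho> u v = L2_inner \<rho> v u"
  by (simp add: L2_inner_def mult.commute)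

lemma L2_inner_add_left:
  "L2 \<rho> u \<Longrightarrow> L2 \<rho> v \<Longrightarrow> L2 \<rho> w \<Longrightarrow> L2_inner \<rho> (\<lambda>x. u x + v x) w = L2_inner \<rho> u w + L2_inner \<rho> v w"
  unfolding L2_inner_def using L2_prod[of u w] L2_prod[of v w] by (simp add: distrib_right)

lemma L2_inner_cmult_left: "L2_inner \<rho> (\<lambda>x. c * u x) w = c * L2_inner \<rho> u w"
  unfolding L2_inner_def by (simp add: mult.assoc)

lemma L2_inner_diff_left:
  "L2 \<rho> u \<Longrightarrow> L2 \<rho> v \<Longrightarrow> L2 \<rho> w \<Longrightarrow> L2_inner \<rho> (\<lambda>x. u x - v x) w = L2_inner \<rho> u w - L2_inner \<rho> v w"
  unfolding L2_inner_def using L2_prod[of u w] L2_prod[of v w] by (simp add: left_diff_distrib)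

lemma L2_inner_zero_left: "L2_inner \<rho> (\<lambda>x. 0) w = 0" by (simp add: L2_inner_def)

lemma L2_inner_sum_left:
  "(\<And>i. i \<in> I \<Longrightarrow> L2 \<rho> (f i)) \<Longrightarrow> L2 \<rho> w \<Longrightarrow> L2_inner \<rho> (\<lambda>x. \<Sum>i\<in>I. f i x) w = (\<Sum>i\<in>I. L2_inner \<rho> (f i) w)"
  by (induction I rule: infinite_finite_induct) (auto simp: L2_inner_zero_left L2_inner_add_left L2_sum)

lemma L2_inner_sum_right:
  "(\<And>i. i \<in> I \<Longrightarrow> L2 \<rho> (f i)) \<Longrightarrow> L2 \<rho> w \<Longrightarrow> L2_inner \<rho> w (\<lambda>x. \<Sum>i\<in>I. f i x) = (\<Sum>i\<in>I. L2_inner \<rho> w (f i))"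
  using L2_inner_sum_left[of I f w] by (simp add: L2_inner_commute)

lemma L2_inner_add_right:
  "L2 \<rho> u \<Longrightarrow> L2 \<rho> v \<Longrightarrow> L2 \<rho> w \<Longrightarrow> L2_inner \<rho> w (\<lambda>x. u x + v x) = L2_inner \<rho> w u + L2_inner \<rho> w v"
  using L2_inner_add_left[of u v w] by (simp add: L2_inner_commute)

lemma L2_inner_diff_right:
  "L2 \<rho> u \<Longrightarrow> L2 \<rho> v \<Longrightarrow> L2 \<rho> w \<Longrightarrow> L2_inner \<rho> w (\<lambda>x. u x - v x) = L2_inner \<rho> w u - L2_inner \<rho> w v"
  using L2_inner_diff_left[of u v w] by (simp add: L2_inner_commute)

lemma L2_inner_cmult_right: "L2_inner \<rho> w (\<lambda>x. c * u x) = c * L2_inner \<rho> w u"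
  using L2_inner_cmult_left[of c u w] by (simp add: L2_inner_commute)

lemma L2_inner_nonneg: "0 \<le> L2_inner \<rho> u u"
  unfolding L2_inner_def using rho_pos by (intro Bochner_Integration.integral_nonneg) (simp add: less_imp_le)

lemma L2_norm_nonneg: "0 \<le> L2_norm \<rho> u"
  unfolding L2_norm_def by (simp add: L2_inner_nonneg)

lemma L2_norm_sq: "(L2_norm \<rho> u)\<^sup>2 = L2_inner \<rho> u u"
  unfolding L2_norm_def by (simp add: L2_inner_nonneg)

lemma L2_inner_expand:
  assumes "L2 \<rho> u" "L2 \<rho> v"
  shows "L2_inner \<rho> (\<lambda>x. u x + v x) (\<lambda>x. u x + v x) = L2_inner \<rho> u u + 2 * L2_inner \<rho> u v + L2_inner \<rho> v v"
  using assms by (simp add: L2_inner_add_left L2_inner_add_right L2_add L2_inner_commute[of v u])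

lemma L2_CS:
  assumes u: "L2 \<rho> u" and v: "L2 \<rho> v"
  shows "\<bar>L2_inner \<rho> u v\<bar> \<le> L2_norm \<rho> u * L2_norm \<rho> v"
proof -
  define a b c where "a = L2_inner \<rho> u u" and "b = L2_inner \<rho> u v" and "c = L2_inner \<rho> v v"
  have q: "0 \<le> a + 2 * t * b + t\<^sup>2 * c" for t
    using L2_inner_nonneg[of "\<lambda>x. u x + t * v x"] L2_inner_expand[OF u L2_cmult[OF v, of t]]
    by (simp add: L2_inner_cmult_left L2_inner_cmult_right a_def b_def c_def power2_eq_square mult.assoc)
  have c0: "c \<ge> 0" unfolding c_def by (rule L2_inner_nonneg)
  have "b\<^sup>2 \<le> a * c"
  proof (cases "c = 0")
    case True
    have "b = 0"
    proof (rule ccontr)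
      assume "b \<noteq> 0"
      then show False using q[of "- (a + 1) / (2 * b)"] True by (simp add: field_simps)
    qed
    then show ?thesis using True by simp
  next
    case False
    then have "c > 0" using c0 by simp
    have "0 \<le> (a + 2 * (- b / c) * b + (- b / c)\<^sup>2 * c) * c" using q[of "- b / c"] c0 by simp
    also have "\<dots> = a * c - b\<^sup>2" using False by (simp add: field_simps power2_eq_square)
    finally show ?thesis by simp
  qed
  then have "\<bar>b\<bar> \<le> sqrt (a * c)" by (metis real_sqrt_abs real_sqrt_le_iff)
  then show ?thesis by (simp add: L2_norm_def real_sqrt_mult a_def b_def c_def)
qed

lemma L2_norm_triangle:
  assumes u: "L2 \<rho> u" and v: "L2 \<rho> v"
  shows "L2_norm \<rho> (\<lambda>x. u x + v x) \<le> L2_norm \<rho> u + L2_norm \<rho> v"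
proof (rule power2_le_imp_le)
  show "(L2_norm \<rho> (\<lambda>x. u x + v x))\<^sup>2 \<le> (L2_norm \<rho> u + L2_norm \<rho> v)\<^sup>2"
    using L2_CS[OF u v] L2_inner_expand[OF u v] by (simp add: L2_norm_sq power2_sum abs_le_iff)
qed (simp add: L2_norm_nonneg)

lemma L2_norm_cmult: "L2_norm \<rho> (\<lambda>x. c * u x) = \<bar>c\<bar> * L2_norm \<rho> u"
  by (simp add: L2_norm_def L2_inner_cmult_left L2_inner_cmult_right real_sqrt_mult flip: mult.assoc power2_eq_square)

lemma L2_norm_minus_commute: "L2_norm \<rho> (\<lambda>x. u x - v x) = L2_norm \<rho> (\<lambda>x. v x - u x)"
  by (simp add: L2_norm_def L2_inner_def algebra_simps)

lemma L2_norm_triangle_diff: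
  assumes u: "L2 \<rho> u" and v: "L2 \<rho> v" and w: "L2 \<rho> w"
  shows "L2_norm \<rho> (\<lambda>x. u x - w x) \<le> L2_norm \<rho> (\<lambda>x. u x - v x) + L2_norm \<rho> (\<lambda>x. v x - w x)"
  using L2_norm_triangle[OF L2_diff[OF u v] L2_diff[OF v w]] by simp

lemma L2_cong_AE:
  assumes "L2 \<rho> u" "v \<in> borel_measurable lebesgue" "AE x in lebesgue. u x = v x"
  shows "L2 \<rho> v"
proof -
  have "AE x in lebesgue. (u x)\<^sup>2 * \<rho> x = (v x)\<^sup>2 * \<rho> x" using assms(3) by eventually_elim simp
  then show ?thesis
    using assms rho_measurable integrable_cong_AE[of "\<lambda>x. (u x)\<^sup>2 * \<rho> x" lebesgue "\<lambda>x. (v x)\<^sup>2 * \<rho> x"] unfolding L2_def by auto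
qed

lemma L2_inner_cong_AE:
  assumes "L2 \<rho> u" "L2 \<rho> u'" "L2 \<rho> v" "L2 \<rho> v'" "AE x in lebesgue. u x = u' x" "AE x in lebesgue. v x = v' x"
  shows "L2_inner \<rho> u v = L2_inner \<rho> u' v'"
  unfolding L2_inner_def
proof (rule integral_cong_AE)
  show "AE x in lebesgue. u x * v x * \<rho> x = u' x * v' x * \<rho> x"
    using assms(5,6) by eventually_elim simp
qed (use L2_D assms rho_measurable in auto)

lemma L2_norm_cong_AE:
  assumes "L2 \<rho> u" "L2 \<rho> u'" "AE x in lebesgue. u x = u' x"
  shows "L2_norm \<rho> u = L2_norm \<rho> u'"
  unfolding L2_norm_def using L2_inner_cong_AE[OF assms(1,2,1,2,3,3)] by simp

lemma L2_of_square_integrable: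
  assumes m: "f \<in> borel_measurable lebesgue" and i: "integrable lebesgue (\<lambda>x. (f x)\<^sup>2)"
  shows "L2 \<rho> f" "(L2_norm \<rho> f)\<^sup>2 \<le> rho_max * (LINT x|lebesgue. (f x)\<^sup>2)"
proof -
  have le: "(f x)\<^sup>2 * \<rho> x \<le> rho_max * (f x)\<^sup>2" for x
    using mult_left_mono[OF rho_le[of x], of "(f x)\<^sup>2"] by (simp add: mult.commute)
  have i2: "integrable lebesgue (\<lambda>x. (f x)\<^sup>2 * \<rho> x)"
  proof (rule Bochner_Integration.integrable_bound)
    show "integrable lebesgue (\<lambda>x. rho_max * (f x)\<^sup>2)" using i by simp
    show "AE x in lebesgue. norm ((f x)\<^sup>2 * \<rho> x) \<le> norm (rho_max * (f x)\<^sup>2)"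
    proof (rule AE_I2)
      fix x show "norm ((f x)\<^sup>2 * \<rho> x) \<le> norm (rho_max * (f x)\<^sup>2)"
        using le[of x] rho_pos[of x] rho_max_pos by (simp add: abs_mult)
    qed
  qed (use m rho_measurable in auto)
  then show "L2 \<rho> f" using m unfolding L2_def by simp
  have "(L2_norm \<rho> f)\<^sup>2 = (LINT x|lebesgue. (f x)\<^sup>2 * \<rho> x)"
    unfolding L2_norm_sq L2_inner_def by (simp add: power2_eq_square)
  also have "\<dots> \<le> (LINT x|lebesgue. rho_max * (f x)\<^sup>2)" by (rule integral_mono[OF i2]) (use i le in auto)
  finally show "(L2_norm \<rho> f)\<^sup>2 \<le> rho_max * (LINT x|lebesgue. (f x)\<^sup>2)" by simp
qed

lemma rho_lower:
  obtains c where "c > 0" "\<And>x. norm x \<le> R \<Longrightarrow> c \<le> \<rho> x"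
proof (cases "R \<ge> 0")
  case True
  then obtain z where "z \<in> cball 0 R" "\<And>x. x \<in> cball 0 R \<Longrightarrow> \<rho> z \<le> \<rho> x"
    using continuous_attains_inf[OF compact_cball _ continuous_on_subset[OF rho_continuous], of "0::real^'d" R] by auto
  then show ?thesis using that[of "\<rho> z"] rho_pos by auto
next
  case False
  then show ?thesis using that[of 1] by (metis norm_ge_zero order_trans zero_less_one)
qed

lemma square_integrable_of_L2:
  assumes u: "L2 \<rho> u" and s: "\<And>x. norm x > R \<Longrightarrow> u x = 0"
  shows "integrable lebesgue (\<lambda>x. (u x)\<^sup>2)" "integrable lebesgue u"
proof -
  obtain c where c: "c > 0" "\<And>x. norm x \<le> R \<Longrightarrow> c \<le> \<rho> x" using rho_lower[of R] by blast
  have um: "u \<in> borel_measurable lebesgue" using u L2_D by blast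
  show 1: "integrable lebesgue (\<lambda>x. (u x)\<^sup>2)"
  proof (rule Bochner_Integration.integrable_bound)
    show "integrable lebesgue (\<lambda>x. (1 / c) * ((u x)\<^sup>2 * \<rho> x))" using u L2_D by auto
    show "AE x in lebesgue. norm ((u x)\<^sup>2) \<le> norm ((1 / c) * ((u x)\<^sup>2 * \<rho> x))"
    proof (rule AE_I2)
      fix x show "norm ((u x)\<^sup>2) \<le> norm ((1 / c) * ((u x)\<^sup>2 * \<rho> x))"
      proof (cases "norm x > R")
        case False
        then have "(u x)\<^sup>2 * c \<le> (u x)\<^sup>2 * \<rho> x" using c by (intro mult_left_mono) auto
        then show ?thesis using c rho_pos[of x] by (simp add: field_simps abs_mult)
      qed (use s in simp)
    qed
  qed (use um in auto)
  show "integrable lebesgue u"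
  proof (rule Bochner_Integration.integrable_bound)
    show "integrable lebesgue (\<lambda>x. (u x)\<^sup>2 + 1 * indicator (cball 0 R) x)"
      by (intro Bochner_Integration.integrable_add 1 integrable_indicator_cball)
    show "AE x in lebesgue. norm (u x) \<le> norm ((u x)\<^sup>2 + 1 * indicator (cball 0 R) x)"
    proof (rule AE_I2)
      fix x show "norm (u x) \<le> norm ((u x)\<^sup>2 + 1 * indicator (cball 0 R) x)"
      proof (cases "norm x > R")
        case False
        have "\<bar>u x\<bar> \<le> (u x)\<^sup>2 + 1" using sum_squares_bound[of "\<bar>u x\<bar>" 1] abs_ge_zero[of "u x"] by (simp add: power2_abs del: abs_ge_zero)
        then show ?thesis using False by simp
      qed (use s in simp)
    qed
  qed (use um in auto)
qed

lemma L2_continuous_bounded_support: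
  assumes "continuous_on UNIV f" "\<And>x. norm x > R \<Longrightarrow> f x = 0"
  shows "L2 \<rho> f"
proof -
  have "integrable lebesgue (\<lambda>x. (f x)\<^sup>2)"
    by (rule integrable_bounded_support(1)[of _ R]) (use assms in \<open>auto intro: continuous_intros\<close>)
  then show ?thesis using L2_of_square_integrable(1) continuous_lebesgue_measurable(1)[OF assms(1)] by blast
qed

abbreviation wpartial :: "'d \<Rightarrow> (real^'d \<Rightarrow> real) \<Rightarrow> real^'d \<Rightarrow> real" where
  "wpartial i u \<equiv> (\<lambda>x. weak_grad u x $ i)"

lemma H1_D:
  assumes "H1 \<rho> u"
  shows "L2 \<rho> u" "has_weak_grad u (weak_grad u)" "L2 \<rho> (wpartial i u)"
proof -
  show "L2 \<rho> u" using assms unfolding H1_def by auto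
  show w: "has_weak_grad u (weak_grad u)" using assms has_weak_grad_weak_grad unfolding H1_def by auto
  have m: "wpartial i u \<in> borel_measurable lebesgue" by (rule locally_integrable_measurable[OF has_weak_gradD(2)[OF w]])
  have "integrable lebesgue (\<lambda>x. (wpartial i u x)\<^sup>2 * \<rho> x)"
  proof (rule Bochner_Integration.integrable_bound)
    show "integrable lebesgue (\<lambda>x. (norm (weak_grad u x))\<^sup>2 * \<rho> x)" using assms unfolding H1_def by auto
    show "AE x in lebesgue. norm ((wpartial i u x)\<^sup>2 * \<rho> x) \<le> norm ((norm (weak_grad u x))\<^sup>2 * \<rho> x)"
    proof (rule AE_I2)
      fix x
      have "(wpartial i u x)\<^sup>2 \<le> (norm (weak_grad u x))\<^sup>2"
        using component_le_norm_cart[of "weak_grad u x" i] by (metis abs_le_square_iff abs_norm_cancel)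
      then show "norm ((wpartial i u x)\<^sup>2 * \<rho> x) \<le> norm ((norm (weak_grad u x))\<^sup>2 * \<rho> x)"
        using rho_pos[of x] by (simp add: abs_mult)
    qed
  qed (use m rho_measurable in auto)
  then show "L2 \<rho> (wpartial i u)" using m unfolding L2_def by auto
qed

lemma H1_I:
  assumes u: "L2 \<rho> u" and g: "has_weak_grad u g" and g2: "\<And>i. L2 \<rho> (\<lambda>x. g x $ i)"
  shows "H1 \<rho> u" "AE x in lebesgue. weak_grad u x = g x"
proof -
  have w: "has_weak_grad u (weak_grad u)" by (rule has_weak_grad_weak_grad[OF g])
  show AE: "AE x in lebesgue. weak_grad u x = g x" by (rule has_weak_grad_unique[OF w g])
  have m: "wpartial i u \<in> borel_measurable lebesgue" for i by (rule locally_integrable_measurable[OF has_weak_gradD(2)[OF w]])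
  have "L2 \<rho> (wpartial i u)" for i
    by (rule L2_cong_AE[OF g2[of i] m]) (use AE in \<open>auto elim!: eventually_mono\<close>)
  then have "integrable lebesgue (\<lambda>x. \<Sum>i\<in>UNIV. (wpartial i u x)\<^sup>2 * \<rho> x)"
    using L2_D by (intro Bochner_Integration.integrable_sum) blast
  moreover have "(\<Sum>i\<in>UNIV. (wpartial i u x)\<^sup>2 * \<rho> x) = (norm (weak_grad u x))\<^sup>2 * \<rho> x" for x
    unfolding power2_norm_eq_inner inner_vec_def by (simp add: power2_eq_square sum_distrib_right)
  ultimately show "H1 \<rho> u" unfolding H1_def using u g by auto
qed

lemma H1_linear:
  assumes u: "H1 \<rho> u" and v: "H1 \<rho> v"
  shows "H1 \<rho> (\<lambda>x. a * u x + b * v x)"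
    "AE x in lebesgue. wpartial i (\<lambda>x. a * u x + b * v x) x = a * wpartial i u x + b * wpartial i v x"
proof -
  have 1: "L2 \<rho> (\<lambda>x. a * u x + b * v x)" by (intro L2_add L2_cmult H1_D(1)[OF u] H1_D(1)[OF v])
  have 2: "has_weak_grad (\<lambda>x. a * u x + b * v x) (\<lambda>x. a *\<^sub>R weak_grad u x + b *\<^sub>R weak_grad v x)"
    by (rule has_weak_grad_linear[OF H1_D(2)[OF u] H1_D(2)[OF v]])
  have 3: "L2 \<rho> (\<lambda>x. (a *\<^sub>R weak_grad u x + b *\<^sub>R weak_grad v x) $ i)" for i
    using L2_add[OF L2_cmult[OF H1_D(3)[OF u, of i], of a] L2_cmult[OF H1_D(3)[OF v, of i], of b]] by simp
  show "H1 \<rho> (\<lambda>x. a * u x + b * v x)" by (rule H1_I(1)[OF 1 2 3])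
  show "AE x in lebesgue. wpartial i (\<lambda>x. a * u x + b * v x) x = a * wpartial i u x + b * wpartial i v x"
    using H1_I(2)[OF 1 2 3] by eventually_elim simp
qed

lemma H1_C1:
  assumes u: "C_k (Suc 0) u" and s: "\<And>x. norm x > R \<Longrightarrow> u x = 0"
  shows "H1 \<rho> u" "AE x in lebesgue. wpartial i u x = partial i u x"
proof -
  have 1: "L2 \<rho> u" by (rule L2_continuous_bounded_support[OF C_k_continuous[OF u] s])
  have pc: "continuous_on UNIV (partial i u)" for i using u by simp
  have "L2 \<rho> (partial i u)" for i
    by (rule L2_continuous_bounded_support[OF pc partial_outside[OF s]])
  then have 3: "L2 \<rho> (\<lambda>x. grad u x $ i)" for i by (simp add: grad_def)
  show "H1 \<rho> u" by (rule H1_I(1)[OF 1 has_weak_grad_C1[OF u] 3])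
  show "AE x in lebesgue. wpartial i u x = partial i u x"
    using H1_I(2)[OF 1 has_weak_grad_C1[OF u] 3] by eventually_elim (simp add: grad_def)
qed

lemma L2_test:
  assumes "test_function \<psi>"
  shows "L2 \<rho> \<psi>"
proof -
  obtain R where R: "\<And>x. norm x > R \<Longrightarrow> \<psi> x = 0" using test_function_support[OF assms] by blast
  show ?thesis by (rule L2_continuous_bounded_support[OF test_function_continuous[OF assms] R])
qed

lemma H1_test:
  assumes "test_function \<psi>"
  shows "H1 \<rho> \<psi>" "AE x in lebesgue. wpartial i \<psi> x = partial i \<psi> x"
proof -
  obtain R where R: "\<And>x. norm x > R \<Longrightarrow> \<psi> x = 0" using test_function_support[OF assms] by blast
  show "H1 \<rho> \<psi>" "AE x in lebesgue. wpartial i \<psi> x = partial i \<psi> x"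
    using H1_C1[OF test_function_C_k[OF assms] R] by blast+
qed

end

section \<open>Density of test functions\<close>

context weight
begin

text \<open>The term \<open>u \<nabla>\<theta>\<close> of the product rule lives outside a growing ball, and there it is dominated by
  a multiple of \<open>u\<close> because the derivatives of the cutoffs are uniformly bounded.\<close>

lemma cutoff_approximation:
  assumes u: "H1 \<rho> u" and e: "e > 0"
  shows "\<exists>\<theta>. test_function \<theta> \<and> L2_norm \<rho> (\<lambda>x. u x - \<theta> x * u x) < e \<and>
     (\<forall>i. L2_norm \<rho> (\<lambda>x. wpartial i u x - (\<theta> x * wpartial i u x + u x * partial i \<theta> x)) < e)"
proof -
  note u2 = H1_D(1)[OF u] and g2 = H1_D(3)[OF u]
  obtain C :: real where C: "C > 0" "\<And>R. R > 0 \<Longrightarrow> \<exists>\<theta>::real^'d \<Rightarrow> real. cutoff C R \<theta>"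
    using cutoff_exists[where 'd='d] by blast
  have "\<exists>\<theta>::real^'d \<Rightarrow> real. cutoff C (real n + 1) \<theta>" for n using C(2)[of "real n + 1"] by simp
  then obtain \<theta> :: "nat \<Rightarrow> real^'d \<Rightarrow> real" where \<theta>: "\<And>n. cutoff C (real n + 1) (\<theta> n)" by metis
  have t: "test_function (\<theta> n)" and b1: "\<bar>\<theta> n x\<bar> \<le> 1" and b2: "\<bar>partial i (\<theta> n) x\<bar> \<le> C"
    and one: "norm x < real n + 1 \<Longrightarrow> \<theta> n x = 1" and zero: "norm x < real n + 1 \<Longrightarrow> partial i (\<theta> n) x = 0" for n i x
    using \<theta>[of n] unfolding cutoff_def by auto
  have tm[measurable]: "\<theta> n \<in> borel_measurable lebesgue" for n
    by (rule continuous_lebesgue_measurable(1)[OF test_function_continuous[OF t]])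
  have pm[measurable]: "partial i (\<theta> n) \<in> borel_measurable lebesgue" for n i
    by (rule continuous_lebesgue_measurable(1)[OF test_function_continuous[OF test_function_partial[OF t]]])
  have um[measurable]: "u \<in> borel_measurable lebesgue" and gm[measurable]: "wpartial i u \<in> borel_measurable lebesgue" for i
    using u2 g2 L2_D by auto
  note rho_measurable[measurable]
  have lim1: "\<forall>\<^sub>F n in sequentially. \<theta> n x = 1 \<and> (\<forall>i. partial i (\<theta> n) x = 0)" for x
  proof -
    obtain N where N: "real N > norm x" using reals_Archimedean2 by blast
    have "norm x < real n + 1" if "n \<ge> N" for n
      using N that by (smt (verit) of_nat_mono)
    then show ?thesis using one zero unfolding eventually_sequentially by blast
  qed
  have A: "\<forall>\<^sub>F n in sequentially. L2_norm \<rho> (\<lambda>x. u x - \<theta> n x * u x) < e"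
  proof -
    have "(\<lambda>n. LINT x|lebesgue. (u x - \<theta> n x * u x) * (u x - \<theta> n x * u x) * \<rho> x) \<longlonglongrightarrow> (LINT x|(lebesgue :: (real^'d) measure). (0::real))"
    proof (rule integral_dominated_convergence[where w="\<lambda>x. 4 * ((u x)\<^sup>2 * \<rho> x)"])
      show "AE x in lebesgue. (\<lambda>n. (u x - \<theta> n x * u x) * (u x - \<theta> n x * u x) * \<rho> x) \<longlonglongrightarrow> 0"
      proof (rule AE_I2)
        fix x show "(\<lambda>n. (u x - \<theta> n x * u x) * (u x - \<theta> n x * u x) * \<rho> x) \<longlonglongrightarrow> 0"
          by (rule tendsto_eventually, rule eventually_mono[OF lim1[of x]]) simp
      qed
      show "AE x in lebesgue. norm ((u x - \<theta> n x * u x) * (u x - \<theta> n x * u x) * \<rho> x) \<le> 4 * ((u x)\<^sup>2 * \<rho> x)" for n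
      proof (rule AE_I2)
        fix x
        have "\<bar>1 - \<theta> n x\<bar> \<le> 2" using b1[of n x] by linarith
        then have "(1 - \<theta> n x)\<^sup>2 \<le> 2\<^sup>2" by (metis abs_le_square_iff abs_numeral)
        then have "(1 - \<theta> n x)\<^sup>2 * ((u x)\<^sup>2 * \<rho> x) \<le> 4 * ((u x)\<^sup>2 * \<rho> x)" using rho_pos[of x] by (intro mult_right_mono) auto
        moreover have "(u x - \<theta> n x * u x) * (u x - \<theta> n x * u x) * \<rho> x = (1 - \<theta> n x)\<^sup>2 * ((u x)\<^sup>2 * \<rho> x)"
          by (simp add: power2_eq_square algebra_simps)
        moreover have "0 \<le> (1 - \<theta> n x)\<^sup>2 * ((u x)\<^sup>2 * \<rho> x)" using rho_pos[of x] by simp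
        ultimately show "norm ((u x - \<theta> n x * u x) * (u x - \<theta> n x * u x) * \<rho> x) \<le> 4 * ((u x)\<^sup>2 * \<rho> x)"
          by (metis abs_of_nonneg real_norm_def)
      qed
    qed (use u2 L2_D in \<open>auto intro!: borel_measurable_times borel_measurable_diff\<close>)
    then have "(\<lambda>n. L2_norm \<rho> (\<lambda>x. u x - \<theta> n x * u x)) \<longlonglongrightarrow> 0"
      unfolding L2_norm_def L2_inner_def using tendsto_real_sqrt by fastforce
    then show ?thesis using e by (rule order_tendstoD)
  qed
  have B: "\<forall>\<^sub>F n in sequentially. L2_norm \<rho> (\<lambda>x. wpartial i u x - (\<theta> n x * wpartial i u x + u x * partial i (\<theta> n) x)) < e" for i
  proof -
    define q where "q n x = wpartial i u x - (\<theta> n x * wpartial i u x + u x * partial i (\<theta> n) x)" for n x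
    have "(\<lambda>n. LINT x|lebesgue. q n x * q n x * \<rho> x) \<longlonglongrightarrow> (LINT x|(lebesgue :: (real^'d) measure). (0::real))"
    proof (rule integral_dominated_convergence[where w="\<lambda>x. 8 * ((wpartial i u x)\<^sup>2 * \<rho> x) + 2 * C\<^sup>2 * ((u x)\<^sup>2 * \<rho> x)"])
      show "AE x in lebesgue. (\<lambda>n. q n x * q n x * \<rho> x) \<longlonglongrightarrow> 0"
      proof (rule AE_I2)
        fix x show "(\<lambda>n. q n x * q n x * \<rho> x) \<longlonglongrightarrow> 0"
          by (rule tendsto_eventually, rule eventually_mono[OF lim1[of x]]) (simp add: q_def)
      qed
      show "AE x in lebesgue. norm (q n x * q n x * \<rho> x) \<le> 8 * ((wpartial i u x)\<^sup>2 * \<rho> x) + 2 * C\<^sup>2 * ((u x)\<^sup>2 * \<rho> x)" for n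
      proof (rule AE_I2)
        fix x
        have "\<bar>1 - \<theta> n x\<bar> \<le> 2" using b1[of n x] by linarith
        then have "(1 - \<theta> n x)\<^sup>2 \<le> 2\<^sup>2" by (metis abs_le_square_iff abs_numeral)
        then have 1: "(1 - \<theta> n x)\<^sup>2 * (wpartial i u x)\<^sup>2 \<le> 4 * (wpartial i u x)\<^sup>2" by (intro mult_right_mono) auto
        have "(partial i (\<theta> n) x)\<^sup>2 \<le> C\<^sup>2" using b2[of i n x] C(1) by (metis abs_le_square_iff abs_of_pos)
        then have 2: "(partial i (\<theta> n) x)\<^sup>2 * (u x)\<^sup>2 \<le> C\<^sup>2 * (u x)\<^sup>2" by (intro mult_right_mono) auto
        have two: "(s - t)\<^sup>2 \<le> 2 * s\<^sup>2 + 2 * t\<^sup>2" for s t :: real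
          using zero_le_power2[of "s + t"] by (simp add: power2_diff power2_sum)
        have "q n x = (1 - \<theta> n x) * wpartial i u x - partial i (\<theta> n) x * u x" by (simp add: q_def algebra_simps)
        then have "(q n x)\<^sup>2 \<le> 2 * ((1 - \<theta> n x) * wpartial i u x)\<^sup>2 + 2 * (partial i (\<theta> n) x * u x)\<^sup>2"
          using two by simp
        also have "\<dots> \<le> 8 * (wpartial i u x)\<^sup>2 + 2 * C\<^sup>2 * (u x)\<^sup>2" using 1 2 by (simp add: power_mult_distrib)
        finally have "(q n x)\<^sup>2 * \<rho> x \<le> (8 * (wpartial i u x)\<^sup>2 + 2 * C\<^sup>2 * (u x)\<^sup>2) * \<rho> x"
          using rho_pos[of x] by (intro mult_right_mono) auto
        then show "norm (q n x * q n x * \<rho> x) \<le> 8 * ((wpartial i u x)\<^sup>2 * \<rho> x) + 2 * C\<^sup>2 * ((u x)\<^sup>2 * \<rho> x)"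
          using rho_pos[of x] by (simp add: abs_mult power2_eq_square distrib_right mult.assoc)
      qed
      show "(\<lambda>x. q n x * q n x * \<rho> x) \<in> borel_measurable lebesgue" for n unfolding q_def by measurable
      show "integrable lebesgue (\<lambda>x. 8 * ((wpartial i u x)\<^sup>2 * \<rho> x) + 2 * C\<^sup>2 * ((u x)\<^sup>2 * \<rho> x))"
        using L2_D(2)[OF u2] L2_D(2)[OF g2[of i]] by simp
    qed simp
    then have "(\<lambda>n. L2_norm \<rho> (q n)) \<longlonglongrightarrow> 0"
      unfolding L2_norm_def L2_inner_def using tendsto_real_sqrt by fastforce
    then have "\<forall>\<^sub>F n in sequentially. L2_norm \<rho> (q n) < e" using e by (rule order_tendstoD)
    then show ?thesis by (simp add: q_def[abs_def])
  qed
  have "\<forall>\<^sub>F n in sequentially. \<forall>i. L2_norm \<rho> (\<lambda>x. wpartial i u x - (\<theta> n x * wpartial i u x + u x * partial i (\<theta> n) x)) < e"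
    using B by (rule eventually_all_finite)
  with A have "\<forall>\<^sub>F n in sequentially. L2_norm \<rho> (\<lambda>x. u x - \<theta> n x * u x) < e \<and>
     (\<forall>i. L2_norm \<rho> (\<lambda>x. wpartial i u x - (\<theta> n x * wpartial i u x + u x * partial i (\<theta> n) x)) < e)"
    by (rule eventually_conj)
  then obtain n where "L2_norm \<rho> (\<lambda>x. u x - \<theta> n x * u x) < e \<and>
     (\<forall>i. L2_norm \<rho> (\<lambda>x. wpartial i u x - (\<theta> n x * wpartial i u x + u x * partial i (\<theta> n) x)) < e)"
    unfolding eventually_sequentially by blast
  then show ?thesis using t by blast
qed

lemma mollify_weighted:
  assumes f: "L2 \<rho> f" and s: "\<And>x. norm x > R \<Longrightarrow> f x = 0" and e: "e > 0"
  shows "\<exists>\<delta>>0. \<forall>k. mollifier \<delta> k \<longrightarrow> L2 \<rho> (convolution f k) \<and> L2_norm \<rho> (\<lambda>x. f x - convolution f k x) < e"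
proof -
  have i: "integrable lebesgue (\<lambda>x. (f x)\<^sup>2)" "integrable lebesgue f"
    using square_integrable_of_L2[of f R] f s by auto
  define c where "c = e\<^sup>2 / (2 * rho_max)"
  have c: "c > 0" unfolding c_def using e rho_max_pos by simp
  obtain \<delta> where \<delta>: "\<delta> > 0" "\<And>k. mollifier \<delta> k \<Longrightarrow> integrable lebesgue (\<lambda>x. (convolution f k x - f x)\<^sup>2) \<and>
     (LINT x|lebesgue. (convolution f k x - f x)\<^sup>2) \<le> c"
    using mollify_L2[OF i(2,1) c] by blast
  have "L2 \<rho> (convolution f k) \<and> L2_norm \<rho> (\<lambda>x. f x - convolution f k x) < e" if k: "mollifier \<delta> k" for k
  proof -
    have cm: "convolution f k \<in> borel_measurable lebesgue"
      by (rule continuous_lebesgue_measurable(1)) (use C_k_continuous[OF C_k_conv[OF i(2) mollifierD(1)[OF k], of 0]] in simp)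
    then have m: "(\<lambda>x. convolution f k x - f x) \<in> borel_measurable lebesgue" using f L2_D by auto
    have L: "L2 \<rho> (\<lambda>x. convolution f k x - f x)" "(L2_norm \<rho> (\<lambda>x. convolution f k x - f x))\<^sup>2 \<le> rho_max * (LINT x|lebesgue. (convolution f k x - f x)\<^sup>2)"
      using L2_of_square_integrable[OF m] \<delta>(2)[OF k] by auto
    have "(L2_norm \<rho> (\<lambda>x. convolution f k x - f x))\<^sup>2 \<le> rho_max * c"
      using L(2) mult_left_mono[of _ c rho_max] \<delta>(2)[OF k] rho_max_pos by (meson less_imp_le order_trans)
    also have "\<dots> < e\<^sup>2" unfolding c_def using rho_max_pos e by simp
    finally have "L2_norm \<rho> (\<lambda>x. convolution f k x - f x) < e" using e power2_less_imp_less less_imp_le by metis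
    then show ?thesis using L2_add[OF L(1) f] L2_norm_minus_commute[of f "convolution f k"] by simp
  qed
  then show ?thesis using \<delta>(1) by blast
qed

text \<open>First cut off, then mollify. The mollified function has the mollified weak gradient as its
  gradient: this is the weak gradient equation tested with the kernel itself.\<close>

lemma test_functions_dense:
  assumes u: "H1 \<rho> u" and e: "e > 0"
  shows "\<exists>\<psi>. test_function \<psi> \<and> L2_norm \<rho> (\<lambda>x. u x - \<psi> x) < e \<and> (\<forall>i. L2_norm \<rho> (\<lambda>x. wpartial i u x - partial i \<psi> x) < e)"
proof -
  have e2: "e / 2 > 0" using e by simp
  obtain \<theta> where t: "test_function \<theta>" and n1: "L2_norm \<rho> (\<lambda>x. u x - \<theta> x * u x) < e / 2"
     and n2: "\<And>i. L2_norm \<rho> (\<lambda>x. wpartial i u x - (\<theta> x * wpartial i u x + u x * partial i \<theta> x)) < e / 2"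
    using cutoff_approximation[OF u e2] by blast
  define v where "v x = \<theta> x * u x" for x
  define G where "G i x = \<theta> x * wpartial i u x + u x * partial i \<theta> x" for i x
  obtain R where R: "\<And>x. norm x > R \<Longrightarrow> \<theta> x = 0" using test_function_support[OF t] by blast
  obtain B where B: "\<And>x. \<bar>\<theta> x\<bar> \<le> B" "\<And>i x. \<bar>partial i \<theta> x\<bar> \<le> B" using test_function_bounds[OF t] by blast
  have tm: "\<theta> \<in> borel_measurable lebesgue" by (rule continuous_lebesgue_measurable(1)[OF test_function_continuous[OF t]])
  have pm: "partial i \<theta> \<in> borel_measurable lebesgue" for i
    by (rule continuous_lebesgue_measurable(1)[OF test_function_continuous[OF test_function_partial[OF t]]])
  have v2: "L2 \<rho> v" unfolding v_def[abs_def] by (rule L2_mult_bounded(1)[OF H1_D(1)[OF u] tm B(1)])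
  have G2: "L2 \<rho> (G i)" for i
    using L2_add[OF L2_mult_bounded(1)[OF H1_D(3)[OF u, of i] tm B(1)] L2_mult_bounded(1)[OF H1_D(1)[OF u] pm B(2)], of i]
    by (simp add: G_def[abs_def] mult.commute)
  have vs: "v x = 0" if "norm x > R" for x using R[OF that] by (simp add: v_def)
  have Gs: "G i x = 0" if "norm x > R" for i x using R[OF that] partial_outside[OF R that] by (simp add: G_def)
  have vi: "integrable lebesgue v" and Gi: "integrable lebesgue (G i)" for i
    by (rule square_integrable_of_L2(2)[OF v2 vs], assumption) (rule square_integrable_of_L2(2)[OF G2 Gs])
  have "\<exists>d>0. \<forall>k. mollifier d k \<longrightarrow> L2 \<rho> (convolution v k) \<and> L2_norm \<rho> (\<lambda>x. v x - convolution v k x) < e / 2"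
    by (rule mollify_weighted[OF v2 vs e2])
  then obtain d0 where d0: "d0 > 0" "\<And>k. mollifier d0 k \<Longrightarrow> L2 \<rho> (convolution v k) \<and> L2_norm \<rho> (\<lambda>x. v x - convolution v k x) < e / 2"
    by blast
  have "\<exists>d>0. \<forall>k. mollifier d k \<longrightarrow> L2 \<rho> (convolution (G i) k) \<and> L2_norm \<rho> (\<lambda>x. G i x - convolution (G i) k x) < e / 2" for i
    by (rule mollify_weighted[OF G2 Gs e2])
  then obtain d where d: "\<And>i. d i > 0" "\<And>i k. mollifier (d i) k \<Longrightarrow> L2 \<rho> (convolution (G i) k) \<and> L2_norm \<rho> (\<lambda>x. G i x - convolution (G i) k x) < e / 2"
    by metis
  define dm where "dm = Min (insert d0 (range d))"
  have dm: "dm > 0" "dm \<le> d0" "dm \<le> d i" for i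
  proof -
    show "dm > 0" unfolding dm_def using d0(1) d(1) by (auto simp: Min_gr_iff)
    show "dm \<le> d0" "dm \<le> d i" unfolding dm_def by (auto intro: Min_le simp del: Min_insert)
  qed
  obtain k :: "real^'d \<Rightarrow> real" where k: "mollifier dm k" using mollifier_exists[OF dm(1)] by blast
  note kt = mollifierD(1)[OF k]
  have test: "test_function (convolution v k)"
    by (rule test_function_conv[OF vi kt vs mollifierD(4)[OF k]])
  have pc: "partial i (convolution v k) = convolution (G i) k" for i
  proof
    fix x
    have tk: "test_function (\<lambda>y. k (x - y))"
    proof -
      obtain S where S: "\<And>y. norm y > S \<Longrightarrow> k y = 0" using test_function_support[OF kt] by blast
      show ?thesis
      proof (rule test_functionI[where R="S + norm x"])
        show "C_k n (\<lambda>y. k (x - y))" for n using C_k_affine[OF test_function_C_k[OF kt], of n "-1" x] by simp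
        fix y :: "real^'d" assume "norm y > S + norm x"
        then have "norm (x - y) > S" using norm_triangle_ineq2[of y x] by (simp add: norm_minus_commute)
        then show "k (x - y) = 0" by (rule S)
      qed
    qed
    have pk: "partial i (\<lambda>y. k (x - y)) z = - partial i k (x - z)" for z :: "real^'d"
      using partial_affine[of k "-1" z x i] test_function_C_k[OF kt, of "Suc 0"] by simp
    have "partial i (convolution v k) x = (LINT y|lebesgue. v y * partial i k (x - y))"
      unfolding partial_conv[OF vi kt] convolution_def ..
    also have "\<dots> = - (LINT y|lebesgue. (\<theta> y * u y) * partial i (\<lambda>y. k (x - y)) y)"
      by (simp add: pk v_def)
    also have "\<dots> = (LINT y|lebesgue. (\<theta> y * wpartial i u y + u y * partial i \<theta> y) * k (x - y))"
      using weak_grad_times_test[OF H1_D(2)[OF u] t tk, of i] by simp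
    finally show "partial i (convolution v k) x = convolution (G i) k x" by (simp add: convolution_def G_def)
  qed
  have a: "L2_norm \<rho> (\<lambda>x. u x - convolution v k x) < e"
    using L2_norm_triangle_diff[OF H1_D(1)[OF u] v2, of "convolution v k"] d0(2)[OF mollifier_mono[OF k dm(2)]] n1
    by (simp add: v_def)
  have b: "L2_norm \<rho> (\<lambda>x. wpartial i u x - partial i (convolution v k) x) < e" for i
    using L2_norm_triangle_diff[OF H1_D(3)[OF u, of i] G2[of i], of "convolution (G i) k"] d(2)[OF mollifier_mono[OF k dm(3)], of i] n2[of i]
    unfolding pc by (simp add: G_def)
  show ?thesis using test a b by blast
qed

text \<open>The definition of the weak gradient admits smooth test functions only. Approximating \<open>u\<close> instead
  of \<open>\<eta>\<close> reduces the claim to the integral of a derivative of a \<open>C\<^sup>1\<close> function of bounded support.\<close>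

lemma weak_grad_against_C1:
  assumes u: "H1 \<rho> u" and \<eta>: "C_k (Suc 0) \<eta>" and s: "\<And>x. norm x > R \<Longrightarrow> \<eta> x = 0"
  shows "(LINT x|lebesgue. u x * partial i \<eta> x) = - (LINT x|lebesgue. wpartial i u x * \<eta> x)"
proof -
  have \<eta>c: "continuous_on UNIV \<eta>" and pc: "continuous_on UNIV (partial i \<eta>)"
    using C_k_continuous[OF \<eta>] \<eta> by auto
  have rn: "\<rho> x \<noteq> 0" for x using rho_pos[of x] by simp
  \<comment> \<open>Dividing by the weight turns the plain integrals into weighted inner products.\<close>
  define a b where "a x = partial i \<eta> x / \<rho> x" and "b x = \<eta> x / \<rho> x" for x
  have p0: "partial i \<eta> x = 0" if "norm x > R" for x by (rule partial_outside[OF s that])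
  have a2: "L2 \<rho> a" unfolding a_def[abs_def]
    by (rule L2_continuous_bounded_support[where R=R]) (use p0 rn pc rho_continuous in \<open>auto intro!: continuous_intros\<close>)
  have b2: "L2 \<rho> b" unfolding b_def[abs_def]
    by (rule L2_continuous_bounded_support[where R=R]) (use s rn \<eta>c rho_continuous in \<open>auto intro!: continuous_intros\<close>)
  have ea: "(LINT x|lebesgue. w x * partial i \<eta> x) = L2_inner \<rho> w a" for w
    unfolding L2_inner_def a_def using rn by simp
  have eb: "(LINT x|lebesgue. w x * \<eta> x) = L2_inner \<rho> w b" for w
    unfolding L2_inner_def b_def using rn by simp
  define K where "K = L2_norm \<rho> a + L2_norm \<rho> b"
  have K: "K \<ge> 0" unfolding K_def by (simp add: L2_norm_nonneg)
  have "\<bar>L2_inner \<rho> u a + L2_inner \<rho> (wpartial i u) b\<bar> \<le> 0 + e" if e: "e > 0" for e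
  proof -
    have e': "e / (K + 1) > 0" using e K by simp
    obtain \<psi> where \<psi>: "test_function \<psi>" and n: "L2_norm \<rho> (\<lambda>x. u x - \<psi> x) < e / (K + 1)"
       "L2_norm \<rho> (\<lambda>x. wpartial i u x - partial i \<psi> x) < e / (K + 1)"
      using test_functions_dense[OF u e'] by blast
    have p2: "L2 \<rho> \<psi>" "L2 \<rho> (partial i \<psi>)" using L2_test \<psi> test_function_partial by auto
    have C1: "C_k (Suc 0) \<psi>" by (rule test_function_C_k[OF \<psi>])
    have "(LINT x|lebesgue. partial i (\<lambda>x. \<psi> x * \<eta> x) x) = 0"
      by (rule integral_partial_zero[OF C_k_mult[OF C1 \<eta>], where R=R]) (use s in simp)
    moreover have "partial i (\<lambda>x. \<psi> x * \<eta> x) = (\<lambda>x. \<psi> x * partial i \<eta> x + partial i \<psi> x * \<eta> x)"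
      using C1 \<eta> by (auto simp: partial_mult)
    moreover have "integrable lebesgue (\<lambda>x. \<psi> x * partial i \<eta> x)" "integrable lebesgue (\<lambda>x. partial i \<psi> x * \<eta> x)"
      using L2_prod[OF p2(1) a2] L2_prod[OF p2(2) b2] rn by (simp_all add: a_def b_def)
    ultimately have z: "L2_inner \<rho> \<psi> a + L2_inner \<rho> (partial i \<psi>) b = 0"
      by (simp add: ea[symmetric] eb[symmetric])
    have eq: "L2_inner \<rho> u a + L2_inner \<rho> (wpartial i u) b =
       L2_inner \<rho> (\<lambda>x. u x - \<psi> x) a + L2_inner \<rho> (\<lambda>x. wpartial i u x - partial i \<psi> x) b"
      using z H1_D(1)[OF u] H1_D(3)[OF u] p2 a2 b2 by (simp add: L2_inner_diff_left)
    have "\<bar>L2_inner \<rho> u a + L2_inner \<rho> (wpartial i u) b\<bar> \<le> L2_norm \<rho> (\<lambda>x. u x - \<psi> x) * L2_norm \<rho> a + L2_norm \<rho> (\<lambda>x. wpartial i u x - partial i \<psi> x) * L2_norm \<rho> b"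
      unfolding eq using L2_CS[OF L2_diff[OF H1_D(1)[OF u] p2(1)] a2] L2_CS[OF L2_diff[OF H1_D(3)[OF u, of i] p2(2)] b2] by linarith
    also have "\<dots> \<le> e / (K + 1) * L2_norm \<rho> a + e / (K + 1) * L2_norm \<rho> b"
      by (intro add_mono mult_right_mono L2_norm_nonneg less_imp_le[OF n(1)] less_imp_le[OF n(2)])
    also have "\<dots> = e / (K + 1) * K" unfolding K_def by (simp only: distrib_left)
    also have "\<dots> = e * (K / (K + 1))" by simp
    also have "\<dots> \<le> e * 1" using K e by (intro mult_left_mono) auto
    finally show ?thesis by simp
  qed
  then have "\<bar>L2_inner \<rho> u a + L2_inner \<rho> (wpartial i u) b\<bar> \<le> 0" by (rule field_le_epsilon)
  then show ?thesis unfolding ea eb by simp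
qed

end

section \<open>Periodic functions\<close>

lemma periodic_int_shift:
  fixes f :: "real^'d::finite \<Rightarrow> 'b"
  assumes "periodic L f"
  shows "f (x + (\<Sum>i\<in>S. (L * of_int (k i)) *\<^sub>R axis i 1)) = f x"
proof -
  have 1: "f (y + L *\<^sub>R axis i 1) = f y" for y i using assms unfolding periodic_def by blast
  have 2: "f (y + (L * of_int n) *\<^sub>R axis i 1) = f y" for y i n
  proof (induction n rule: int_induct[where k=0])
    case (step1 n)
    have "y + (L * of_int (n + 1)) *\<^sub>R axis i 1 = (y + (L * of_int n) *\<^sub>R axis i 1) + L *\<^sub>R axis i (1::real)"
      by (simp add: algebra_simps scaleR_add_left)
    then show ?case using step1 1 by metis
  next
    case (step2 n)
    have "(y + (L * of_int (n - 1)) *\<^sub>R axis i 1) + L *\<^sub>R axis i (1::real) = y + (L * of_int n) *\<^sub>R axis i 1"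
      by (simp add: algebra_simps scaleR_add_left)
    then show ?case using step2 1 by metis
  qed simp
  show ?thesis
  proof (induction S arbitrary: x rule: infinite_finite_induct)
    case (insert a S)
    have "f (x + (\<Sum>i\<in>insert a S. (L * of_int (k i)) *\<^sub>R axis i 1))
        = f ((x + (L * of_int (k a)) *\<^sub>R axis a 1) + (\<Sum>i\<in>S. (L * of_int (k i)) *\<^sub>R axis i 1))"
      using insert by (simp add: add.assoc)
    then show ?case using insert 2 by metis
  qed simp_all
qed

lemma periodic_reduce:
  fixes f :: "real^'d::finite \<Rightarrow> 'b"
  assumes p: "periodic L f" and L: "L > 0"
  shows "\<exists>a\<in>cell L. \<forall>y. f (y + x) = f (y + a)"
proof -
  define k where "k i = \<lfloor>x $ i / L\<rfloor>" for i
  define s where "s = (\<Sum>i\<in>UNIV. (L * of_int (k i)) *\<^sub>R axis i (1::real))"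
  have si: "s $ j = L * of_int (k j)" for j
  proof -
    have "s $ j = (\<Sum>i\<in>UNIV. ((L * of_int (k i)) *\<^sub>R axis i (1::real)) $ j)"
      by (simp only: s_def sum_component)
    also have "\<dots> = (\<Sum>i\<in>UNIV. if i = j then L * of_int (k i) else 0)"
      by (intro sum.cong refl) (simp add: axis_def)
    finally show ?thesis by simp
  qed
  have "0 \<le> x $ j - s $ j \<and> x $ j - s $ j \<le> L" for j
  proof -
    have "of_int (k j) \<le> x $ j / L" "x $ j / L < of_int (k j) + 1" unfolding k_def by linarith+
    then have "L * of_int (k j) \<le> x $ j" "x $ j < L * of_int (k j) + L"
      using L by (simp_all add: field_simps)
    then show ?thesis by (simp add: si)
  qed
  then have "x - s \<in> cell L" unfolding cell_def by (simp add: mem_box_cart)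
  moreover have "f (y + x) = f (y + (x - s))" for y
    using periodic_int_shift[OF p, where x="y + (x - s)" and S=UNIV and k=k] by (simp add: s_def)
  ultimately show ?thesis by blast
qed

lemma compact_cell: "compact (cell L)" unfolding cell_def by simp

lemma periodic_bounded:
  fixes f :: "real^'d::finite \<Rightarrow> real"
  assumes p: "periodic L f" and L: "L > 0" and c: "continuous_on UNIV f"
  obtains B where "B > 0" "\<And>x. \<bar>f x\<bar> \<le> B"
proof -
  have "compact (f ` cell L)" by (rule compact_continuous_image[OF continuous_on_subset[OF c] compact_cell]) simp
  then obtain B where B: "B > 0" "\<forall>y\<in>f ` cell L. norm y \<le> B" using compact_imp_bounded bounded_pos by metis
  have "\<bar>f x\<bar> \<le> B" for x
  proof -
    obtain a where "a \<in> cell L" "\<And>y. f (y + x) = f (y + a)" using periodic_reduce[OF p L, of x] by blast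
    then have "f x = f a" by (metis add_0)
    then show ?thesis using B \<open>a \<in> cell L\<close> by simp
  qed
  with B that show ?thesis by blast
qed

definition cellint :: "real \<Rightarrow> (real^'d::finite \<Rightarrow> real) \<Rightarrow> real" where
  "cellint L f = (LINT z|lebesgue. indicator (cell L) z * f z)"

lemma cell_sets: "cell L \<in> sets lborel" "cell L \<in> sets lebesgue" unfolding cell_def by auto

lemma integrable_cell:
  assumes "continuous_on UNIV f"
  shows "integrable lebesgue (\<lambda>z. indicator (cell L) z * f z :: real)"
  using locally_integrable_continuous[OF assms] compact_cell[of L]
  unfolding locally_integrable_def set_integrable_def by auto

text \<open>Moving the cell by \<open>t\<close> along one axis removes a slab on one side and adds the translate of this
  slab by a full period on the other side; coordinates are treated one after the other.\<close>

lemma cellint_shift: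
  fixes f :: "real^'d::finite \<Rightarrow> real"
  assumes p: "periodic L f" and L: "L > 0" and c: "continuous_on UNIV f"
  shows "cellint L (\<lambda>z. f (z + a)) = cellint L f"
proof -
  \<comment> \<open>For half-open cells the pieces are disjoint; the closed cell differs by a null set.\<close>
  define H where "H = {z :: real^'d. \<forall>j. 0 < z $ j \<and> z $ j \<le> L}"
  have boxH: "box 0 (\<chi> i. L) \<subseteq> H" and Hcell: "H \<subseteq> cell L"
    unfolding H_def cell_def by (auto simp: mem_box_cart less_imp_le)
  have "negligible (cell L - H)"
    by (rule negligible_subset[OF negligible_frontier_interval[of 0 "\<chi> i. L"]]) (use boxH in \<open>auto simp: cell_def\<close>)
  then have "AE z in lebesgue. z \<notin> cell L - H" by (intro AE_not_in) (simp add: negligible_iff_null_sets)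
  then have AEH: "AE z in lebesgue. indicator (cell L) z = (indicator H z :: real)"
    by eventually_elim (use Hcell in \<open>auto simp: indicator_def\<close>)
  have H_sets: "{z :: real^'d. Q z \<and> P (z $ i)} \<in> sets lebesgue"
    if "{z. Q z} \<in> sets borel" "{t. P t} \<in> sets borel" for Q :: "real^'d \<Rightarrow> bool" and P i
  proof -
    have "(\<lambda>z::real^'d. z $ i) -` {t. P t} \<inter> space borel \<in> sets borel"
      by (rule measurable_sets[OF borel_measurable_continuous_onI that(2)]) (intro continuous_intros)
    then have "{z :: real^'d. P (z $ i)} \<in> sets borel" by (simp add: vimage_def)
    then have "{z. Q z} \<inter> {z. P (z $ i)} \<in> sets borel" using that by blast
    then show ?thesis by (simp add: Collect_conj_eq)
  qed
  define F where "F a = (LINT z|lebesgue. indicator H z * f (z + a))" for a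
  have cont: "continuous_on UNIV (\<lambda>z. f (z + a))" for a
    by (rule continuous_on_compose2[OF c]) (auto intro: continuous_intros)
  have Hb: "H \<in> sets borel"
  proof -
    have "H = (\<Inter>j. {z. 0 < z $ j} \<inter> {z. z $ j \<le> L})" unfolding H_def by auto
    moreover have "{z :: real^'d. 0 < z $ j} \<in> sets borel" for j
      by (intro borel_open open_Collect_less continuous_intros)
    moreover have "{z :: real^'d. z $ j \<le> L} \<in> sets borel" for j
      by (intro borel_closed closed_Collect_le continuous_intros)
    ultimately show ?thesis by (auto intro!: sets.finite_INT)
  qed
  have FC: "cellint L (\<lambda>z. f (z + a)) = F a" for a
    unfolding cellint_def F_def
  proof (rule integral_cong_AE)
    show "(\<lambda>z. indicator (cell L) z * f (z + a)) \<in> borel_measurable lebesgue"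
      using integrable_cell[OF cont] by auto
    show "(\<lambda>z. indicator H z * f (z + a)) \<in> borel_measurable lebesgue"
      using Hb continuous_lebesgue_measurable(1)[OF cont] by (intro borel_measurable_times borel_measurable_indicator) auto
    show "AE z in lebesgue. indicator (cell L) z * f (z + a) = indicator H z * f (z + a)"
      using AEH by eventually_elim simp
  qed
  have int: "integrable lebesgue (\<lambda>z. indicator S z * f (z + a))" if "S \<in> sets lebesgue" "S \<subseteq> cball 0 r" for S a r
  proof -
    have "integrable lebesgue (\<lambda>z. indicator (cball 0 r) z *\<^sub>R f (z + a))"
      using locally_integrable_continuous[OF cont] unfolding locally_integrable_def set_integrable_def by auto
    then have "integrable lebesgue (\<lambda>z. indicator (cball 0 r) z *\<^sub>R f (z + a) * indicator S z)"
      by (rule integrable_mult_bounded[where B=1]) (use that in \<open>auto simp: indicator_def\<close>)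
    moreover have "(\<lambda>z. indicator (cball 0 r) z *\<^sub>R f (z + a) * indicator S z) = (\<lambda>z. indicator S z * f (z + a))"
      using that(2) by (force simp: indicator_def)
    ultimately show ?thesis by simp
  qed
  have step: "F (a + t *\<^sub>R axis i 1) = F a" if t: "0 \<le> t" "t \<le> L" for a t i
  proof -
    define Q where "Q z \<longleftrightarrow> (\<forall>j. j \<noteq> i \<longrightarrow> 0 < z $ j \<and> z $ j \<le> L)" for z :: "real^'d"
    define S1 S2 S3 where "S1 = {z. Q z \<and> (t < z $ i \<and> z $ i \<le> L)}" and "S2 = {z. Q z \<and> (0 < z $ i \<and> z $ i \<le> t)}"
      and "S3 = {z. Q z \<and> (L < z $ i \<and> z $ i \<le> L + t)}"
    have Qb: "{z. Q z} \<in> sets borel"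
    proof -
      have eq: "{z. Q z} = (\<Inter>j. if j = i then UNIV else {z. 0 < z $ j} \<inter> {z. z $ j \<le> L})"
      proof (rule set_eqI)
        fix z :: "real^'d"
        have "z \<in> (if j = i then UNIV else {z. 0 < z $ j} \<inter> {z. z $ j \<le> L}) \<longleftrightarrow> (j \<noteq> i \<longrightarrow> 0 < z $ j \<and> z $ j \<le> L)" for j
          by simp
        then show "z \<in> {z. Q z} \<longleftrightarrow> z \<in> (\<Inter>j. if j = i then UNIV else {z. 0 < z $ j} \<inter> {z. z $ j \<le> L})"
          unfolding Q_def INT_iff mem_Collect_eq by blast
      qed
      moreover have "{z :: real^'d. 0 < z $ j} \<in> sets borel" for j
        by (intro borel_open open_Collect_less continuous_intros)
      moreover have "{z :: real^'d. z $ j \<le> L} \<in> sets borel" for j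
        by (intro borel_closed closed_Collect_le continuous_intros)
      ultimately show ?thesis unfolding eq by (intro sets.finite_INT) auto
    qed
    have Ss: "S1 \<in> sets lebesgue" "S2 \<in> sets lebesgue" "S3 \<in> sets lebesgue"
      unfolding S1_def S2_def S3_def by (intro H_sets[OF Qb]; simp add: greaterThanAtMost_def[symmetric] greaterThan_def atMost_def Collect_conj_eq)+
    have bd: "norm z \<le> real CARD('d) * (2 * L)" if "\<And>j. 0 \<le> z $ j \<and> z $ j \<le> 2 * L" for z :: "real^'d"
    proof -
      have "norm z \<le> (\<Sum>j\<in>UNIV. \<bar>z $ j\<bar>)" by (rule norm_le_l1_cart)
      also have "\<dots> \<le> (\<Sum>j\<in>(UNIV::'d set). 2 * L)" using that by (intro sum_mono) (simp add: abs_le_iff order_trans[of "- _" 0])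
      finally show ?thesis by simp
    qed
    have Sb: "S1 \<subseteq> cball 0 (real CARD('d) * (2 * L))" "S2 \<subseteq> cball 0 (real CARD('d) * (2 * L))" "S3 \<subseteq> cball 0 (real CARD('d) * (2 * L))"
    proof -
      have "0 \<le> z $ j \<and> z $ j \<le> 2 * L" if "z \<in> S1 \<union> S2 \<union> S3" for z j
        using that t L unfolding S1_def S2_def S3_def Q_def by (cases "j = i") (auto intro: order_trans less_imp_le)
      then show "S1 \<subseteq> cball 0 (real CARD('d) * (2 * L))" "S2 \<subseteq> cball 0 (real CARD('d) * (2 * L))" "S3 \<subseteq> cball 0 (real CARD('d) * (2 * L))"
        using bd by auto
    qed
    note i1 = int[OF Ss(1) Sb(1)] and i2 = int[OF Ss(2) Sb(2)] and i3 = int[OF Ss(3) Sb(3)]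
    have Hs: "integrable lebesgue (\<lambda>z. indicator H z * f (z + a))" for a
    proof (rule int)
      show "H \<in> sets lebesgue" using Hb by simp
      show "H \<subseteq> cball 0 (real CARD('d) * (2 * L))"
      proof
        fix z assume "z \<in> H"
        then have "0 \<le> z $ j \<and> z $ j \<le> 2 * L" for j using L unfolding H_def by (auto intro: order_trans[of _ L] less_imp_le)
        then show "z \<in> cball 0 (real CARD('d) * (2 * L))" using bd by simp
      qed
    qed
    have "F (a + t *\<^sub>R axis i 1) = (LINT z|lebesgue. indicator H (z + - (t *\<^sub>R axis i 1)) * f (z + - (t *\<^sub>R axis i 1) + (a + t *\<^sub>R axis i 1)))"
      unfolding F_def using lebesgue_integrable_shift(2)[OF Hs[of "a + t *\<^sub>R axis i 1"], of "- (t *\<^sub>R axis i 1)"] by simp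
    also have "\<dots> = (LINT z|lebesgue. indicator S1 z * f (z + a) + indicator S3 z * f (z + a))"
    proof (rule Bochner_Integration.integral_cong[OF refl])
      fix z :: "real^'d"
      have "z + - (t *\<^sub>R axis i 1) \<in> H \<longleftrightarrow> Q z \<and> (t < z $ i \<and> z $ i \<le> L + t)"
        unfolding H_def Q_def by (auto simp: axis_def)
      then have "indicator H (z + - (t *\<^sub>R axis i 1)) = (indicator S1 z + indicator S3 z :: real)"
        using t L unfolding S1_def S3_def by (auto simp: indicator_def)
      then show "indicator H (z + - (t *\<^sub>R axis i 1)) * f (z + - (t *\<^sub>R axis i 1) + (a + t *\<^sub>R axis i 1))
         = indicator S1 z * f (z + a) + indicator S3 z * f (z + a)" by (simp add: distrib_right algebra_simps)
    qed
    also have "\<dots> = (LINT z|lebesgue. indicator S1 z * f (z + a)) + (LINT z|lebesgue. indicator S3 z * f (z + a))"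
      by (rule Bochner_Integration.integral_add[OF i1 i3])
    also have "(LINT z|lebesgue. indicator S3 z * f (z + a)) = (LINT z|lebesgue. indicator S3 (z + L *\<^sub>R axis i 1) * f (z + L *\<^sub>R axis i 1 + a))"
      using lebesgue_integrable_shift(2)[OF i3[of a], of "L *\<^sub>R axis i 1"] by simp
    also have "\<dots> = (LINT z|lebesgue. indicator S2 z * f (z + a))"
    proof (rule Bochner_Integration.integral_cong[OF refl])
      fix z :: "real^'d"
      have "z + L *\<^sub>R axis i 1 \<in> S3 \<longleftrightarrow> z \<in> S2"
        unfolding S2_def S3_def Q_def by (auto simp: axis_def)
      moreover have "f (z + L *\<^sub>R axis i 1 + a) = f (z + a)"
        using p unfolding periodic_def by (metis add.commute add.left_commute)
      ultimately show "indicator S3 (z + L *\<^sub>R axis i 1) * f (z + L *\<^sub>R axis i 1 + a) = indicator S2 z * f (z + a)"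
        by (simp add: indicator_def)
    qed
    also have "(LINT z|lebesgue. indicator S1 z * f (z + a)) + (LINT z|lebesgue. indicator S2 z * f (z + a))
       = (LINT z|lebesgue. indicator S1 z * f (z + a) + indicator S2 z * f (z + a))"
      by (rule Bochner_Integration.integral_add[OF i1 i2, symmetric])
    also have "\<dots> = F a" unfolding F_def
    proof (rule Bochner_Integration.integral_cong[OF refl])
      fix z :: "real^'d"
      have "z \<in> H \<longleftrightarrow> Q z \<and> (0 < z $ i \<and> z $ i \<le> L)" unfolding H_def Q_def by auto
      then have "indicator H z = (indicator S1 z + indicator S2 z :: real)"
        using t L unfolding S1_def S2_def by (auto simp: indicator_def)
      then show "indicator S1 z * f (z + a) + indicator S2 z * f (z + a) = indicator H z * f (z + a)"
        by (simp add: distrib_right)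
    qed
    finally show ?thesis .
  qed
  obtain b where b: "b \<in> cell L" "\<And>y. f (y + a) = f (y + b)" using periodic_reduce[OF p L, of a] by blast
  have bi: "0 \<le> b $ i" "b $ i \<le> L" for i using b(1) unfolding cell_def by (auto simp: mem_box_cart)
  have "F (\<Sum>i\<in>S. (b $ i) *\<^sub>R axis i 1) = F 0" for S
  proof (induction S rule: infinite_finite_induct)
    case (insert i S)
    then show ?case using step[OF bi(1)[of i] bi(2)[of i], of "\<Sum>i\<in>S. (b $ i) *\<^sub>R axis i 1" i] by (simp add: add.commute)
  qed simp_all
  then have "F b = F 0" using basis_expansion[of b] by (metis (no_types, lifting) scalar_mult_eq_scaleR sum.cong)
  moreover have "F a = F b" unfolding F_def using b(2) by simp
  ultimately show ?thesis using FC[of a] FC[of 0] by simp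
qed

section \<open>Periodic averaging\<close>

lemma cell_content_pos: "L > 0 \<Longrightarrow> cellint L (\<lambda>z::real^'d::finite. 1) > 0"
proof -
  assume L: "L > 0"
  have "cellint L (\<lambda>z::real^'d. 1) = measure lebesgue (cell L :: (real^'d) set)"
    unfolding cellint_def by simp
  also have "\<dots> = measure lborel (cell L :: (real^'d) set)" by (rule measure_completion[OF cell_sets(1)])
  also have "\<dots> = (\<Prod>i\<in>(UNIV :: 'd set). L)"
  proof -
    have "0 \<in> cbox (0::real^'d) (\<chi> i. L)" using L by (simp add: mem_box_cart)
    then have "cbox (0::real^'d) (\<chi> i. L) \<noteq> {}" by blast
    from content_cbox_cart[OF this] show ?thesis unfolding cell_def by simp
  qed
  finally show ?thesis using L by simp
qed

text \<open>Substituting \<open>x + \<epsilon> z\<close> for \<open>x\<close> does not change the integral, so it may be averaged over \<open>z\<close> in the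
  cell. The factor \<open>f\<close> becomes \<open>f (x / \<epsilon> + z)\<close>, whose average over \<open>z\<close> is the mean of \<open>f\<close> for every \<open>x\<close>,
  while replacing \<open>h (x + \<epsilon> z)\<close> by \<open>h x\<close> costs little in \<open>L\<^sup>1\<close>.\<close>

lemma periodic_averaging:
  fixes f h :: "real^'d::finite \<Rightarrow> real"
  assumes p: "periodic L f" and L: "L > 0" and c: "continuous_on UNIV f" and h: "integrable lebesgue h"
  shows "((\<lambda>\<epsilon>. LINT x|lebesgue. h x * f ((1 / \<epsilon>) *\<^sub>R x)) \<longlongrightarrow>
     cellint L f / cellint L (\<lambda>z::real^'d. 1) * (LINT x|lebesgue. h x)) (at_right 0)"
proof -
  define W where "W = cellint L (\<lambda>z::real^'d. 1)"
  have W: "W > 0" unfolding W_def by (rule cell_content_pos[OF L])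
  obtain B where B: "B > 0" "\<And>x. \<bar>f x\<bar> \<le> B" using periodic_bounded[OF p L c] by blast
  obtain D where D: "D > 0" "\<And>z::real^'d. z \<in> cell L \<Longrightarrow> norm z \<le> D"
    using compact_imp_bounded[OF compact_cell] unfolding bounded_pos by blast
  obtain h' where h'b: "h' \<in> borel_measurable lborel" and hh': "AE x in lebesgue. h x = h' x"
    using completion_ex_borel_measurable_real[of h lborel] h by (auto simp: AE_completion_iff)
  have h'm[measurable]: "h' \<in> borel_measurable borel" using h'b by simp
  have h'm2: "h' \<in> borel_measurable lebesgue" using h'b by (rule measurable_completion)
  have h'i: "integrable lebesgue h'" using h integrable_cong_AE[of h lebesgue h'] hh' h'm2 by auto
  have h'l: "integrable lborel h'" using h'i integrable_completion[OF h'b] by simp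
  have fm[measurable]: "f \<in> borel_measurable borel" by (rule continuous_lebesgue_measurable(2)[OF c])
  have cm[measurable]: "indicator (cell L) \<in> borel_measurable (borel :: (real^'d) measure)"
    using cell_sets(1)[of L] by (intro borel_measurable_indicator) simp
  define I where "I = (LINT x|lebesgue. h' x)"
  have I: "(LINT x|lebesgue. h x) = I" unfolding I_def by (rule integral_cong_AE) (use hh' h h'm2 in auto)
  show ?thesis
  proof (rule tendstoI)
    fix e :: real assume e: "e > 0"
    have eB: "e / (2 * B) > 0" using e B by simp
    obtain \<delta> where \<delta>: "\<delta> > 0" "\<And>z. norm z < \<delta> \<Longrightarrow> (LINT x|lebesgue. \<bar>h' (x + z) - h' x\<bar>) < e / (2 * B)"
      using L1_translation_continuous[OF h'i eB] by blast
    have "\<delta> / (D + 1) > 0" using \<delta> D by simp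
    then have "\<forall>\<^sub>F \<epsilon> in at_right 0. \<epsilon> \<in> {0<..<\<delta> / (D + 1)}" by (rule eventually_at_right_real)
    then show "\<forall>\<^sub>F \<epsilon> in at_right 0. dist (LINT x|lebesgue. h x * f ((1 / \<epsilon>) *\<^sub>R x))
        (cellint L f / cellint L (\<lambda>z::real^'d. 1) * (LINT x|lebesgue. h x)) < e"
    proof eventually_elim
      case (elim \<epsilon>)
      then have \<epsilon>: "\<epsilon> > 0" "\<epsilon> * (D + 1) < \<delta>" using D by (auto simp: field_simps)
      have gc: "continuous_on UNIV (\<lambda>x. f ((1 / \<epsilon>) *\<^sub>R x + z))" for z
        by (rule continuous_on_compose2[OF c]) (auto intro!: continuous_intros)
      have gm: "(\<lambda>x. f ((1 / \<epsilon>) *\<^sub>R x + z)) \<in> borel_measurable lebesgue" for z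
        by (rule continuous_lebesgue_measurable(1)[OF gc])
      have gm2: "(\<lambda>x. f ((1 / \<epsilon>) *\<^sub>R x + z)) \<in> borel_measurable borel" for z
        by (rule continuous_lebesgue_measurable(2)[OF gc])
      define J where "J = (LINT x|lebesgue. h' x * f ((1 / \<epsilon>) *\<^sub>R x))"
      have hfi: "integrable lebesgue (\<lambda>x. h' x * f ((1 / \<epsilon>) *\<^sub>R x + z))" for z
        by (rule integrable_mult_bounded[OF h'i gm B(2)])
      have J: "(LINT x|lebesgue. h x * f ((1 / \<epsilon>) *\<^sub>R x)) = J"
        unfolding J_def
      proof (rule integral_cong_AE)
        show "AE x in lebesgue. h x * f ((1 / \<epsilon>) *\<^sub>R x) = h' x * f ((1 / \<epsilon>) *\<^sub>R x)"
          using hh' by eventually_elim simp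
        show "(\<lambda>x. h x * f ((1 / \<epsilon>) *\<^sub>R x)) \<in> borel_measurable lebesgue"
          using h gm[of 0] by (intro borel_measurable_times) auto
        show "(\<lambda>x. h' x * f ((1 / \<epsilon>) *\<^sub>R x)) \<in> borel_measurable lebesgue" using hfi[of 0] by auto
      qed
      have shift: "J = (LINT x|lebesgue. h' (x + \<epsilon> *\<^sub>R z) * f ((1 / \<epsilon>) *\<^sub>R x + z))" for z
        unfolding J_def using lebesgue_integrable_shift(2)[of "\<lambda>x. h' x * f ((1 / \<epsilon>) *\<^sub>R x)" "\<epsilon> *\<^sub>R z"] hfi[of 0] \<epsilon>(1)
        by (simp add: scaleR_add_right)
      define A where "A z = (LINT x|lborel. indicator (cell L) z * (h' x * f ((1 / \<epsilon>) *\<^sub>R x + z)))" for z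
      have A: "A z = indicator (cell L) z * (LINT x|lebesgue. h' x * f ((1 / \<epsilon>) *\<^sub>R x + z))" for z
        unfolding A_def using gm2[of z] by (subst integral_completion) auto
      have hfl: "integrable lborel (\<lambda>x. h' x * f ((1 / \<epsilon>) *\<^sub>R x + z))" for z
        using hfi[of z] integrable_completion[of "\<lambda>x. h' x * f ((1 / \<epsilon>) *\<^sub>R x + z)" lborel] gm2[of z] by simp
      have cl: "integrable lborel (\<lambda>z::real^'d. indicator (cell L) z :: real)"
        using integrable_cell[of "\<lambda>_::real^'d. 1" L] integrable_completion[of "\<lambda>z::real^'d. indicator (cell L) z :: real" lborel] by simp
      have qm[measurable]: "(\<lambda>(z, x). indicator (cell L) z * (h' x * f ((1 / \<epsilon>) *\<^sub>R x + z))) \<in> borel_measurable (lborel \<Otimes>\<^sub>M lborel)"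
        by measurable
      have bnd: "(LINT x|lborel. norm (indicator (cell L) z * (h' x * f ((1 / \<epsilon>) *\<^sub>R x + z)))) \<le> (B * (LINT x|lborel. \<bar>h' x\<bar>)) * indicator (cell L) z" for z
      proof -
        have "(LINT x|lborel. norm (indicator (cell L) z * (h' x * f ((1 / \<epsilon>) *\<^sub>R x + z)))) \<le> (LINT x|lborel. indicator (cell L) z * B * \<bar>h' x\<bar>)"
        proof (rule integral_mono)
          show "norm (indicator (cell L) z * (h' x * f ((1 / \<epsilon>) *\<^sub>R x + z))) \<le> indicator (cell L) z * B * \<bar>h' x\<bar>" for x
            using mult_left_mono[OF B(2)[of "(1 / \<epsilon>) *\<^sub>R x + z"] abs_ge_zero[of "h' x"]] by (auto simp: abs_mult indicator_def mult.commute)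
        qed (use hfl h'l in auto)
        then show ?thesis by (simp add: mult_ac)
      qed
      have Q: "integrable (lborel \<Otimes>\<^sub>M lborel) (\<lambda>(z, x). indicator (cell L) z * (h' x * f ((1 / \<epsilon>) *\<^sub>R x + z)))"
      proof (rule lborel_pair.Fubini_integrable[OF qm])
        show "integrable lborel (\<lambda>z. LINT x|lborel. norm (case (z, x) of (z, x) \<Rightarrow> indicator (cell L) z * (h' x * f ((1 / \<epsilon>) *\<^sub>R x + z))))"
        proof (rule Bochner_Integration.integrable_bound)
          show "integrable lborel (\<lambda>z::real^'d. (B * (LINT x|lborel. \<bar>h' x\<bar>)) * indicator (cell L) z)" using cl by simp
          show "AE z in lborel. norm (LINT x|lborel. norm (case (z, x) of (z, x) \<Rightarrow> indicator (cell L) z * (h' x * f ((1 / \<epsilon>) *\<^sub>R x + z))))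
             \<le> norm ((B * (LINT x|lborel. \<bar>h' x\<bar>)) * indicator (cell L) z)"
          proof (rule AE_I2)
            fix z :: "real^'d"
            have "0 \<le> (LINT x|lborel. norm (indicator (cell L) z * (h' x * f ((1 / \<epsilon>) *\<^sub>R x + z))))"
              by (rule Bochner_Integration.integral_nonneg) simp
            then show "norm (LINT x|lborel. norm (case (z, x) of (z, x) \<Rightarrow> indicator (cell L) z * (h' x * f ((1 / \<epsilon>) *\<^sub>R x + z))))
             \<le> norm ((B * (LINT x|lborel. \<bar>h' x\<bar>)) * indicator (cell L) z)"
              using bnd[of z] by (simp only: real_norm_def prod.case)
          qed
        qed measurable
        show "AE z in lborel. integrable lborel (\<lambda>x. case (z, x) of (z, x) \<Rightarrow> indicator (cell L) z * (h' x * f ((1 / \<epsilon>) *\<^sub>R x + z)))"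
          using hfl by (intro AE_I2) simp
      qed
      have Ai: "integrable lborel A" unfolding A_def using lborel_pair.integrable_fst[OF Q] .
      have "(LINT z|lborel. A z) = (LINT x|lborel. LINT z|lborel. indicator (cell L) z * (h' x * f ((1 / \<epsilon>) *\<^sub>R x + z)))"
        unfolding A_def by (rule lborel_pair.Fubini_integral[OF Q, symmetric])
      also have "\<dots> = (LINT x|lborel. h' x * cellint L f)"
      proof (rule Bochner_Integration.integral_cong[OF refl])
        fix x :: "real^'d"
        have "(LINT z|lborel. indicator (cell L) z * (h' x * f ((1 / \<epsilon>) *\<^sub>R x + z))) = h' x * (LINT z|lborel. indicator (cell L) z * f (z + (1 / \<epsilon>) *\<^sub>R x))"
          by (subst integral_mult_right_zero[symmetric]) (simp add: mult.left_commute add.commute)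
        also have "(LINT z|lborel. indicator (cell L) z * f (z + (1 / \<epsilon>) *\<^sub>R x)) = cellint L (\<lambda>z. f (z + (1 / \<epsilon>) *\<^sub>R x))"
          unfolding cellint_def by (rule integral_completion[symmetric]) measurable
        also have "\<dots> = cellint L f" by (rule cellint_shift[OF p L c])
        finally show "(LINT z|lborel. indicator (cell L) z * (h' x * f ((1 / \<epsilon>) *\<^sub>R x + z))) = h' x * cellint L f" .
      qed
      also have "\<dots> = I * cellint L f" using integral_completion[OF h'b] by (simp add: I_def)
      finally have SA: "(LINT z|lborel. A z) = I * cellint L f" .
      have diff: "\<bar>indicator (cell L) z * J - A z\<bar> \<le> e / 2 * indicator (cell L) z" for z
      proof (cases "z \<in> cell L")
        case True
        have "norm (\<epsilon> *\<^sub>R z) \<le> \<epsilon> * D" using D(2)[OF True] \<epsilon> by (simp add: mult_left_mono)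
        also have "\<dots> < \<delta>" using \<epsilon> D by (simp add: distrib_left)
        finally have sm: "(LINT x|lebesgue. \<bar>h' (x + \<epsilon> *\<^sub>R z) - h' x\<bar>) < e / (2 * B)" by (rule \<delta>(2))
        note hs = lebesgue_integrable_shift(1)[OF h'i, of "\<epsilon> *\<^sub>R z"]
        have i1: "integrable lebesgue (\<lambda>x. h' (x + \<epsilon> *\<^sub>R z) * f ((1 / \<epsilon>) *\<^sub>R x + z))"
          by (rule integrable_mult_bounded[OF hs gm B(2)])
        have "J - (LINT x|lebesgue. h' x * f ((1 / \<epsilon>) *\<^sub>R x + z)) = (LINT x|lebesgue. (h' (x + \<epsilon> *\<^sub>R z) - h' x) * f ((1 / \<epsilon>) *\<^sub>R x + z))"
          unfolding shift[of z] using i1 hfi[of z] by (simp add: left_diff_distrib)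
        then have "\<bar>J - (LINT x|lebesgue. h' x * f ((1 / \<epsilon>) *\<^sub>R x + z))\<bar> \<le> (LINT x|lebesgue. \<bar>(h' (x + \<epsilon> *\<^sub>R z) - h' x) * f ((1 / \<epsilon>) *\<^sub>R x + z)\<bar>)"
          using integral_abs_bound by simp
        also have "\<dots> \<le> (LINT x|lebesgue. \<bar>h' (x + \<epsilon> *\<^sub>R z) - h' x\<bar> * B)"
        proof (rule integral_mono)
          show "\<bar>(h' (x + \<epsilon> *\<^sub>R z) - h' x) * f ((1 / \<epsilon>) *\<^sub>R x + z)\<bar> \<le> \<bar>h' (x + \<epsilon> *\<^sub>R z) - h' x\<bar> * B" for x
            unfolding abs_mult by (intro mult_left_mono B(2)) simp
        qed (use i1 hfi[of z] hs h'i in \<open>auto simp: left_diff_distrib\<close>)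
        also have "\<dots> = (LINT x|lebesgue. \<bar>h' (x + \<epsilon> *\<^sub>R z) - h' x\<bar>) * B" by simp
        also have "\<dots> \<le> e / (2 * B) * B" using sm B(1) by (intro mult_right_mono) auto
        also have "\<dots> = e / 2" using B(1) by simp
        finally show ?thesis using True by (simp add: A)
      qed (simp add: A)
      have "W * J - I * cellint L f = (LINT z|lborel. indicator (cell L) z * J - A z)"
      proof -
        have "W = (LINT z|lborel. indicator (cell L) (z::real^'d))"
          unfolding W_def cellint_def using integral_completion[of "\<lambda>z::real^'d. indicator (cell L) z :: real" lborel] by simp
        then show ?thesis using SA cl Ai by simp
      qed
      also have "\<bar>\<dots>\<bar> \<le> (LINT z|lborel. e / 2 * indicator (cell L) (z::real^'d))"
      proof (rule order_trans[OF integral_abs_bound integral_mono])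
      qed (use cl Ai diff in auto)
      also have "\<dots> = e / 2 * W"
        unfolding W_def cellint_def using integral_completion[of "\<lambda>z::real^'d. indicator (cell L) z :: real" lborel] by simp
      finally have "\<bar>W * J - I * cellint L f\<bar> \<le> e / 2 * W" .
      moreover have "W * J - I * cellint L f = W * (J - cellint L f / W * I)" using W by (simp add: field_simps)
      ultimately have "W * \<bar>J - cellint L f / W * I\<bar> \<le> W * (e / 2)" using W by (simp add: abs_mult mult.commute)
      then have "\<bar>J - cellint L f / W * I\<bar> \<le> e / 2" using W by (simp only: mult_le_cancel_left_pos)
      then have "\<bar>J - cellint L f / W * I\<bar> < e" by (rule order_le_less_trans) (use e in simp)
      then show ?case unfolding J I W_def[symmetric] dist_real_def .
    qed
  qed
qed

section \<open>Underdetermined linear systems\<close>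

text \<open>Gaussian elimination, by induction on the set of equations.\<close>

lemma underdetermined_linear_system:
  fixes M :: "'a \<Rightarrow> 'b \<Rightarrow> real"
  assumes "finite T" "finite S" "card T < card S"
  shows "\<exists>\<alpha>. (\<exists>k\<in>S. \<alpha> k \<noteq> 0) \<and> (\<forall>j\<in>T. (\<Sum>k\<in>S. \<alpha> k * M k j) = 0)"
  using assms
proof (induction T arbitrary: S M rule: finite_induct)
  case empty
  then obtain k where "k \<in> S" by fastforce
  then show ?case by (intro exI[of _ "\<lambda>_. 1"]) auto
next
  case (insert j T)
  show ?case
  proof (cases "\<forall>k\<in>S. M k j = 0")
    case True
    obtain \<alpha> where "\<exists>k\<in>S. \<alpha> k \<noteq> 0" "\<forall>j\<in>T. (\<Sum>k\<in>S. \<alpha> k * M k j) = 0"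
      using insert.IH[OF insert.prems(1), of M] insert.prems insert.hyps by auto
    with True show ?thesis by (intro exI[of _ \<alpha>]) auto
  next
    case False
    then obtain k0 where k0: "k0 \<in> S" "M k0 j \<noteq> 0" by blast
    define M' where "M' k i = M k i - M k j / M k0 j * M k0 i" for k i
    have "card T < card (S - {k0})" using insert.prems insert.hyps k0 by simp
    then obtain \<alpha> where \<alpha>: "\<exists>k\<in>S - {k0}. \<alpha> k \<noteq> 0" "\<forall>i\<in>T. (\<Sum>k\<in>S - {k0}. \<alpha> k * M' k i) = 0"
      using insert.IH[of "S - {k0}" M'] insert.prems by auto
    define t where "t = - (\<Sum>k\<in>S - {k0}. \<alpha> k * M k j) / M k0 j"
    define \<beta> where "\<beta> k = (if k = k0 then t else \<alpha> k)" for k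
    have sum\<beta>: "(\<Sum>k\<in>S. \<beta> k * M k i) = t * M k0 i + (\<Sum>k\<in>S - {k0}. \<alpha> k * M k i)" for i
      using k0(1) insert.prems(1) by (subst sum.remove[of S k0]) (auto simp: \<beta>_def intro!: sum.cong)
    have "(\<Sum>k\<in>S. \<beta> k * M k i) = 0" if "i \<in> insert j T" for i
    proof (cases "i = j")
      case True
      then show ?thesis using k0 by (simp add: sum\<beta> t_def)
    next
      case False
      then have "0 = (\<Sum>k\<in>S - {k0}. \<alpha> k * M' k i)" using \<alpha> that by auto
      also have "\<dots> = (\<Sum>k\<in>S - {k0}. \<alpha> k * M k i) - (\<Sum>k\<in>S - {k0}. \<alpha> k * M k j) / M k0 j * M k0 i"
        by (simp add: M'_def algebra_simps sum_subtractf sum_distrib_left sum_distrib_right sum_divide_distrib)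
      finally show ?thesis by (simp add: sum\<beta> t_def)
    qed
    moreover have "\<exists>k\<in>S. \<beta> k \<noteq> 0" using \<alpha>(1) by (auto simp: \<beta>_def)
    ultimately show ?thesis by blast
  qed
qed

text \<open>In the min-max arguments this provides a normalized combination of \<open>n + 1\<close> functions that is
  orthogonal to \<open>n\<close> given ones.\<close>

lemma underdetermined_unit_solution:
  fixes M :: "nat \<Rightarrow> nat \<Rightarrow> real"
  shows "\<exists>\<alpha>. (\<Sum>k\<le>n. (\<alpha> k)\<^sup>2) = 1 \<and> (\<forall>j<n. (\<Sum>k\<le>n. \<alpha> k * M k j) = 0)"
proof -
  obtain \<beta> where \<beta>: "\<exists>k\<le>n. \<beta> k \<noteq> 0" "\<forall>j<n. (\<Sum>k\<le>n. \<beta> k * M k j) = 0"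
    using underdetermined_linear_system[of "{..<n}" "{..n}" M] by (auto simp: lessThan_def atMost_def)
  define s where "s = (\<Sum>k\<le>n. (\<beta> k)\<^sup>2)"
  have s: "s > 0" unfolding s_def using \<beta>(1) by (auto intro!: sum_pos2)
  have "(\<Sum>k\<le>n. (\<beta> k / sqrt s)\<^sup>2) = 1"
    using s by (simp add: power_divide flip: sum_divide_distrib s_def)
  moreover have "(\<Sum>k\<le>n. \<beta> k / sqrt s * M k j) = 0" if "j < n" for j
    using \<beta>(2) that by (simp flip: sum_divide_distrib)
  ultimately show ?thesis by (intro exI[of _ "\<lambda>k. \<beta> k / sqrt s"]) blast
qed

section \<open>Weak forms and spectral expansions\<close>

definition wform :: "real^'d^'d \<Rightarrow> (real^'d::finite \<Rightarrow> real) \<Rightarrow> (real^'d \<Rightarrow> real) \<Rightarrow> (real^'d \<Rightarrow> real) \<Rightarrow> real" where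
  "wform A \<rho> u v = (LINT x|lebesgue. ((A *v weak_grad u x) \<bullet> weak_grad v x) * \<rho> x)"

context weight
begin

lemma wform_expand:
  assumes u: "H1 \<rho> u" and v: "H1 \<rho> v"
  shows "wform A \<rho> u v = (\<Sum>i\<in>UNIV. \<Sum>j\<in>UNIV. A $ i $ j * L2_inner \<rho> (wpartial j u) (wpartial i v))"
proof -
  have int: "integrable lebesgue (\<lambda>x. A $ i $ j * (wpartial j u x * wpartial i v x * \<rho> x))" for i j
    by (intro integrable_mult_right L2_prod H1_D(3) u v)
  have "((A *v weak_grad u x) \<bullet> weak_grad v x) * \<rho> x = (\<Sum>i\<in>UNIV. \<Sum>j\<in>UNIV. A $ i $ j * (wpartial j u x * wpartial i v x * \<rho> x))" for x
    unfolding inner_vec_def matrix_vector_mult_def by (simp add: sum_distrib_right sum_distrib_left mult_ac)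
  then have "wform A \<rho> u v = (LINT x|lebesgue. (\<Sum>i\<in>UNIV. \<Sum>j\<in>UNIV. A $ i $ j * (wpartial j u x * wpartial i v x * \<rho> x)))"
    unfolding wform_def by simp
  also have "\<dots> = (\<Sum>i\<in>UNIV. \<Sum>j\<in>UNIV. (LINT x|lebesgue. A $ i $ j * (wpartial j u x * wpartial i v x * \<rho> x)))"
    using int by (subst Bochner_Integration.integral_sum, force)+ simp
  finally show ?thesis by (simp add: L2_inner_def)
qed

lemma L2_inner_wpartial_linear:
  assumes u: "H1 \<rho> u" and v: "H1 \<rho> v" and w: "L2 \<rho> w"
  shows "L2_inner \<rho> (wpartial j (\<lambda>x. a * u x + b * v x)) w = a * L2_inner \<rho> (wpartial j u) w + b * L2_inner \<rho> (wpartial j v) w"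
proof -
  note l = H1_linear[OF u v, of a b]
  have r: "L2 \<rho> (\<lambda>x. a * wpartial j u x + b * wpartial j v x)" by (intro L2_add L2_cmult H1_D(3) u v)
  have "L2_inner \<rho> (wpartial j (\<lambda>x. a * u x + b * v x)) w = L2_inner \<rho> (\<lambda>x. a * wpartial j u x + b * wpartial j v x) w"
    by (rule L2_inner_cong_AE[OF H1_D(3)[OF l(1)] r w w l(2)]) simp
  then show ?thesis
    by (simp add: L2_inner_add_left L2_inner_cmult_left L2_cmult H1_D(3) u v w)
qed

lemma wform_linear_left:
  assumes u: "H1 \<rho> u" and v: "H1 \<rho> v" and w: "H1 \<rho> w"
  shows "wform A \<rho> (\<lambda>x. a * u x + b * v x) w = a * wform A \<rho> u w + b * wform A \<rho> v w"
  unfolding wform_expand[OF H1_linear(1)[OF u v] w] wform_expand[OF u w] wform_expand[OF v w]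
    L2_inner_wpartial_linear[OF u v H1_D(3)[OF w]]
  by (simp add: sum_distrib_left sum.distrib distrib_left mult_ac)

lemma wform_linear_right:
  assumes u: "H1 \<rho> u" and v: "H1 \<rho> v" and w: "H1 \<rho> w"
  shows "wform A \<rho> w (\<lambda>x. a * u x + b * v x) = a * wform A \<rho> w u + b * wform A \<rho> w v"
proof -
  have *: "L2_inner \<rho> (wpartial j w) (wpartial i (\<lambda>x. a * u x + b * v x)) = a * L2_inner \<rho> (wpartial j w) (wpartial i u) + b * L2_inner \<rho> (wpartial j w) (wpartial i v)" for i j
    using L2_inner_wpartial_linear[OF u v H1_D(3)[OF w]] by (simp add: L2_inner_commute)
  show ?thesis
    unfolding wform_expand[OF w H1_linear(1)[OF u v]] wform_expand[OF w u] wform_expand[OF w v] *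
    by (simp add: sum_distrib_left sum.distrib distrib_left mult_ac)
qed

lemma H1_zero: "H1 \<rho> (\<lambda>x. 0)"
  by (rule H1_test(1)) (rule test_functionI[of _ 0], auto simp: C_k_const)

lemma wform_zero: "H1 \<rho> w \<Longrightarrow> wform A \<rho> (\<lambda>x. 0) w = 0" "H1 \<rho> w \<Longrightarrow> wform A \<rho> w (\<lambda>x. 0) = 0"
  using wform_linear_left[of w w w A 0 0] wform_linear_right[of w w w A 0 0] by simp_all

lemma H1_sum: "(\<And>i. i \<in> I \<Longrightarrow> H1 \<rho> (f i)) \<Longrightarrow> H1 \<rho> (\<lambda>x. \<Sum>i\<in>I. c i * f i x)"
proof (induction I rule: infinite_finite_induct)
  case (insert a I)
  then show ?case using H1_linear(1)[of "f a" "\<lambda>x. \<Sum>i\<in>I. c i * f i x" "c a" 1] by simp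
qed (simp_all add: H1_zero)

lemma wform_sum_left:
  "(\<And>i. i \<in> I \<Longrightarrow> H1 \<rho> (f i)) \<Longrightarrow> H1 \<rho> w \<Longrightarrow>
   wform A \<rho> (\<lambda>x. \<Sum>i\<in>I. c i * f i x) w = (\<Sum>i\<in>I. c i * wform A \<rho> (f i) w)"
proof (induction I rule: infinite_finite_induct)
  case (insert a I)
  then show ?case
    using wform_linear_left[of "f a" "\<lambda>x. \<Sum>i\<in>I. c i * f i x" w A "c a" 1] H1_sum[of I f c] by simp
qed (simp_all add: wform_zero)

lemma wform_sum_right:
  "(\<And>i. i \<in> I \<Longrightarrow> H1 \<rho> (f i)) \<Longrightarrow> H1 \<rho> w \<Longrightarrow>
   wform A \<rho> w (\<lambda>x. \<Sum>i\<in>I. c i * f i x) = (\<Sum>i\<in>I. c i * wform A \<rho> w (f i))"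
proof (induction I rule: infinite_finite_induct)
  case (insert a I)
  then show ?case
    using wform_linear_right[of "f a" "\<lambda>x. \<Sum>i\<in>I. c i * f i x" w A "c a" 1] H1_sum[of I f c] by simp
qed (simp_all add: wform_zero)

lemma H1_diff: "H1 \<rho> u \<Longrightarrow> H1 \<rho> v \<Longrightarrow> H1 \<rho> (\<lambda>x. u x - v x)"
  using H1_linear(1)[of u v 1 "-1"] by simp

lemma wform_diff_left: "H1 \<rho> u \<Longrightarrow> H1 \<rho> v \<Longrightarrow> H1 \<rho> w \<Longrightarrow> wform A \<rho> (\<lambda>x. u x - v x) w = wform A \<rho> u w - wform A \<rho> v w"
  using wform_linear_left[of u v w A 1 "-1"] by simp

lemma wform_diff_right: "H1 \<rho> u \<Longrightarrow> H1 \<rho> v \<Longrightarrow> H1 \<rho> w \<Longrightarrow> wform A \<rho> w (\<lambda>x. u x - v x) = wform A \<rho> w u - wform A \<rho> w v"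
  using wform_linear_right[of u v w A 1 "-1"] by simp

definition grad_norm :: "(real^'d \<Rightarrow> real) \<Rightarrow> real" where
  "grad_norm u = (\<Sum>i\<in>UNIV. L2_norm \<rho> (wpartial i u))"

lemma grad_norm_nonneg: "grad_norm u \<ge> 0" unfolding grad_norm_def by (intro sum_nonneg L2_norm_nonneg)

lemma wpartial_le_grad_norm: "L2_norm \<rho> (wpartial i u) \<le> grad_norm u"
  unfolding grad_norm_def by (intro member_le_sum) (auto simp: L2_norm_nonneg)

lemma wform_bound:
  assumes u: "H1 \<rho> u" and v: "H1 \<rho> v"
  shows "\<bar>wform A \<rho> u v\<bar> \<le> (\<Sum>i\<in>UNIV. \<Sum>j\<in>UNIV. \<bar>A $ i $ j\<bar>) * grad_norm u * grad_norm v"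
proof -
  have "\<bar>A $ i $ j * L2_inner \<rho> (wpartial j u) (wpartial i v)\<bar> \<le> \<bar>A $ i $ j\<bar> * (grad_norm u * grad_norm v)" for i j
  proof -
    have "\<bar>L2_inner \<rho> (wpartial j u) (wpartial i v)\<bar> \<le> L2_norm \<rho> (wpartial j u) * L2_norm \<rho> (wpartial i v)"
      by (rule L2_CS[OF H1_D(3)[OF u] H1_D(3)[OF v]])
    also have "\<dots> \<le> grad_norm u * grad_norm v" by (intro mult_mono wpartial_le_grad_norm L2_norm_nonneg grad_norm_nonneg)
    finally show ?thesis by (simp add: abs_mult mult_left_mono)
  qed
  then have "\<bar>wform A \<rho> u v\<bar> \<le> (\<Sum>i\<in>UNIV. \<Sum>j\<in>UNIV. \<bar>A $ i $ j\<bar> * (grad_norm u * grad_norm v))"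
    unfolding wform_expand[OF u v] by (intro order_trans[OF sum_abs] sum_mono) auto
  then show ?thesis by (simp add: sum_distrib_right mult.assoc)
qed

lemma ordered_eigenpairsD:
  assumes "ordered_eigenpairs A \<rho> l \<phi>"
  shows "l 0 = 0" "strict_mono l" "filterlim l at_top sequentially" "H1 \<rho> (\<phi> n)" "L2 \<rho> (\<phi> n)"
    "H1 \<rho> \<psi> \<Longrightarrow> wform A \<rho> (\<phi> n) \<psi> = l n * L2_inner \<rho> (\<phi> n) \<psi>"
    "L2_inner \<rho> (\<phi> m) (\<phi> n) = (if m = n then 1 else 0)"
    "L2 \<rho> u \<Longrightarrow> (\<lambda>N. L2_norm \<rho> (\<lambda>x. u x - (\<Sum>n<N. L2_inner \<rho> u (\<phi> n) * \<phi> n x))) \<longlonglongrightarrow> 0"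
    "0 \<le> l n"
proof -
  show a: "l 0 = 0" "strict_mono l" "filterlim l at_top sequentially"
    using assms unfolding ordered_eigenpairs_def by auto
  have w: "weak_eigenpair A \<rho> (l n) (\<phi> n)" for n using assms unfolding ordered_eigenpairs_def by auto
  then show "H1 \<rho> (\<phi> n)" unfolding weak_eigenpair_def by auto
  then show "L2 \<rho> (\<phi> n)" by (rule H1_D(1))
  show "wform A \<rho> (\<phi> n) \<psi> = l n * L2_inner \<rho> (\<phi> n) \<psi>" if "H1 \<rho> \<psi>"
    using w[of n] that unfolding weak_eigenpair_def wform_def L2_inner_def by auto
  have o: "orthonormal_basis_L2 \<rho> \<phi>" using assms unfolding ordered_eigenpairs_def by auto
  then show "L2_inner \<rho> (\<phi> m) (\<phi> n) = (if m = n then 1 else 0)" unfolding orthonormal_basis_L2_def by auto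
  show "(\<lambda>N. L2_norm \<rho> (\<lambda>x. u x - (\<Sum>n<N. L2_inner \<rho> u (\<phi> n) * \<phi> n x))) \<longlonglongrightarrow> 0" if "L2 \<rho> u"
    using o that unfolding orthonormal_basis_L2_def by auto
  show "0 \<le> l n" using a(1) strict_mono_less_eq[OF a(2), of 0 n] by simp
qed

text \<open>The energy of \<open>u - P\<^sub>N u\<close> is nonnegative, which is Bessel's inequality for the energy; in it each
  mode from \<open>M\<close> on counts at least \<open>l M\<close> times. If the first \<open>M\<close> coefficients vanish, the
  statement is the min-max principle; since \<open>l M\<close> is unbounded, it also gives compactness.\<close>

lemma spectral_tail:
  assumes o: "ordered_eigenpairs A \<rho> l \<phi>"
    and sym: "\<And>u v. H1 \<rho> u \<Longrightarrow> H1 \<rho> v \<Longrightarrow> wform A \<rho> u v = wform A \<rho> v u"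
    and psd: "\<And>u. H1 \<rho> u \<Longrightarrow> 0 \<le> wform A \<rho> u u"
    and u: "H1 \<rho> u"
  shows "l M * (L2_norm \<rho> (\<lambda>x. u x - (\<Sum>n<M. L2_inner \<rho> u (\<phi> n) * \<phi> n x)))\<^sup>2 \<le> wform A \<rho> u u"
proof -
  define c where "c n = L2_inner \<rho> u (\<phi> n)" for n
  define P where "P N = (\<lambda>x. \<Sum>n<N. c n * \<phi> n x)" for N
  note D = ordered_eigenpairsD[OF o] and u2 = H1_D(1)[OF u]
  have PH: "H1 \<rho> (P N)" for N unfolding P_def by (intro H1_sum D)
  have PL: "L2 \<rho> (P N)" for N by (rule H1_D(1)[OF PH])
  have uP: "L2_inner \<rho> u (P N) = (\<Sum>n<N. (c n)\<^sup>2)" for N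
    unfolding P_def using L2_inner_sum_right[of "{..<N}" "\<lambda>n x. c n * \<phi> n x" u] D(5) u2
    by (simp add: L2_cmult L2_inner_cmult_right c_def power2_eq_square)
  have \<phi>P: "L2_inner \<rho> (\<phi> m) (P N) = (if m < N then c m else 0)" for m N
    unfolding P_def using L2_inner_sum_right[of "{..<N}" "\<lambda>n x. c n * \<phi> n x" "\<phi> m"] D(5) D(7)
    by (simp add: L2_cmult L2_inner_cmult_right if_distrib[of "(*) _"] cong: if_cong)
  have PP: "L2_inner \<rho> (P N) (P N) = (\<Sum>n<N. (c n)\<^sup>2)" for N
  proof -
    have "L2_inner \<rho> (P N) (P N) = (\<Sum>n<N. c n * L2_inner \<rho> (\<phi> n) (P N))"
      using L2_inner_sum_left[of "{..<N}" "\<lambda>n x. c n * \<phi> n x" "P N"] D(5) PL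
      by (subst P_def) (simp add: L2_cmult L2_inner_cmult_left)
    then show ?thesis by (simp add: \<phi>P power2_eq_square)
  qed
  have norm: "(L2_norm \<rho> (\<lambda>x. u x - P N x))\<^sup>2 = L2_inner \<rho> u u - (\<Sum>n<N. (c n)\<^sup>2)" for N
    unfolding L2_norm_sq using u2 PL uP PP
    by (simp add: L2_inner_diff_left L2_inner_diff_right L2_diff L2_inner_commute[of "P N" u])
  have aPu: "wform A \<rho> (P N) u = (\<Sum>n<N. l n * (c n)\<^sup>2)" for N
    unfolding P_def using wform_sum_left[of "{..<N}" \<phi> u A c] D(4) u D(6)[OF u]
    by (simp add: c_def L2_inner_commute[of u] power2_eq_square mult_ac)
  have aPP: "wform A \<rho> (P N) (P N) = (\<Sum>n<N. l n * (c n)\<^sup>2)" for N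
  proof -
    have "wform A \<rho> (P N) (P N) = (\<Sum>n<N. c n * wform A \<rho> (\<phi> n) (P N))"
      using wform_sum_left[of "{..<N}" \<phi> "P N" A c] D(4) PH by (subst P_def) simp
    then show ?thesis using D(6)[OF PH] by (simp add: \<phi>P power2_eq_square mult_ac)
  qed
  have bessel: "(\<Sum>n<N. l n * (c n)\<^sup>2) \<le> wform A \<rho> u u" for N
  proof -
    have "0 \<le> wform A \<rho> (\<lambda>x. u x - P N x) (\<lambda>x. u x - P N x)" by (intro psd H1_diff u PH)
    also have "\<dots> = wform A \<rho> u u - (\<Sum>n<N. l n * (c n)\<^sup>2)"
      using u PH[of N] aPu[of N] aPP[of N] sym[OF u PH[of N]] by (simp add: wform_diff_left wform_diff_right H1_diff)
    finally show ?thesis by simp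
  qed
  have Lim: "(\<lambda>N. (L2_norm \<rho> (\<lambda>x. u x - P N x))\<^sup>2) \<longlonglongrightarrow> 0\<^sup>2"
    using D(8)[OF u2] unfolding P_def c_def by (rule tendsto_power)
  have lim1: "(\<lambda>N. l M * ((L2_norm \<rho> (\<lambda>x. u x - P M x))\<^sup>2 - (L2_norm \<rho> (\<lambda>x. u x - P N x))\<^sup>2)) \<longlonglongrightarrow> l M * ((L2_norm \<rho> (\<lambda>x. u x - P M x))\<^sup>2 - 0\<^sup>2)"
    by (intro tendsto_mult tendsto_const tendsto_diff Lim)
  have bd: "l M * ((L2_norm \<rho> (\<lambda>x. u x - P M x))\<^sup>2 - (L2_norm \<rho> (\<lambda>x. u x - P N x))\<^sup>2) \<le> wform A \<rho> u u" if "N \<ge> M" for N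
  proof -
    have sp: "{..<N} = {..<M} \<union> {M..<N}" using that by auto
    have "(L2_norm \<rho> (\<lambda>x. u x - P M x))\<^sup>2 - (L2_norm \<rho> (\<lambda>x. u x - P N x))\<^sup>2 = (\<Sum>n\<in>{M..<N}. (c n)\<^sup>2)"
      unfolding norm sp by (subst sum.union_disjoint) auto
    then have "l M * ((L2_norm \<rho> (\<lambda>x. u x - P M x))\<^sup>2 - (L2_norm \<rho> (\<lambda>x. u x - P N x))\<^sup>2) = (\<Sum>n\<in>{M..<N}. l M * (c n)\<^sup>2)"
      by (simp add: sum_distrib_left)
    also have "\<dots> \<le> (\<Sum>n\<in>{M..<N}. l n * (c n)\<^sup>2)"
      using strict_mono_less_eq[OF D(2)] by (intro sum_mono mult_right_mono) auto
    also have "\<dots> \<le> (\<Sum>n<N. l n * (c n)\<^sup>2)" using D(9) by (intro sum_mono2) (auto simp: sp)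
    also have "\<dots> \<le> wform A \<rho> u u" by (rule bessel)
    finally show ?thesis .
  qed
  have "l M * ((L2_norm \<rho> (\<lambda>x. u x - P M x))\<^sup>2 - 0\<^sup>2) \<le> wform A \<rho> u u"
    by (rule LIMSEQ_le_const2[OF lim1]) (use bd in blast)
  then show ?thesis by (simp add: P_def c_def)
qed

end

section \<open>The multiscale and homogenized problems\<close>

lemma partial_periodic:
  fixes f :: "real^'d::finite \<Rightarrow> real"
  assumes p: "periodic L f" and d: "\<And>x. f differentiable (at x)"
  shows "periodic L (partial i f)"
  unfolding periodic_def
proof (intro allI)
  fix x and j :: 'd
  have "(\<lambda>x. f (1 *\<^sub>R x + L *\<^sub>R axis j 1)) = f" using p unfolding periodic_def by auto
  then show "partial i f (x + L *\<^sub>R axis j 1) = partial i f x"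
    using partial_affine[of f 1 x "L *\<^sub>R axis j 1" i] d by simp
qed

locale homog = weight "rho_zero \<sigma> V" rho_max
  for \<sigma> :: real and V :: "real^'d::finite \<Rightarrow> real" and rho_max :: real +
  fixes L :: real and p :: "real^'d \<Rightarrow> real" and \<Phi> :: "real^'d \<Rightarrow> real^'d"
  assumes \<sigma>: "\<sigma> > 0" and L: "L > 0" and V_smooth: "\<And>k. C_k k V" and p_smooth: "\<And>k. C_k k p" and p_periodic: "periodic L p"
    and cell_problem: "cell_solution \<sigma> L p \<Phi>"
begin

abbreviation "\<rho>0 \<equiv> rho_zero \<sigma> V"

definition E where "E x = exp (- (1 / \<sigma>) * V x)"
definition C0 where "C0 = (LINT z|lebesgue. E z)"
text \<open>The unnormalized invariant density of the fast variable.\<close>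
definition w where "w y = exp (- (1 / \<sigma>) * p y)"
definition Ceps where "Ceps \<epsilon> = (LINT z|lebesgue. E z * w ((1 / \<epsilon>) *\<^sub>R z))"
text \<open>The ratio of the multiscale to the homogenized density (see \<open>rhoe\<close>).\<close>
definition m where "m \<epsilon> x = w ((1 / \<epsilon>) *\<^sub>R x) * (C0 / Ceps \<epsilon>)"
abbreviation "\<rho>e \<epsilon> \<equiv> rho_eps \<sigma> V p \<epsilon>"
abbreviation "Sig \<equiv> hom_Sigma \<sigma> L p \<Phi>"
text \<open>The entries of \<open>I + \<nabla>\<Phi>\<close>.\<close>
definition cell_flux where "cell_flux i j y = (if i = j then 1 else 0) + partial j (\<lambda>z. \<Phi> z $ i) y"
text \<open>The expression \<open>\<partial>\<^sub>j (\<rho>\<^sup>0 \<partial>\<^sub>i \<psi>) / \<rho>\<^sup>0\<close>, which arises from integrating by parts in \<open>L\<^sup>2\<close> with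
  weight \<open>\<rho>\<^sup>0\<close>.\<close>
definition wpartial2 where "wpartial2 \<psi> i j x = partial j (partial i \<psi>) x - 1 / \<sigma> * partial i \<psi> x * partial j V x"
text \<open>The mean with respect to the invariant measure \<open>\<mu>\<close> of the cell.\<close>
definition mu_average where "mu_average f = cellint L (\<lambda>y. f y * w y) / cellint L w"
text \<open>The two-scale expansion of first order.\<close>
definition corrector where "corrector \<epsilon> \<psi> x = \<psi> x + \<epsilon> * (\<Sum>i\<in>UNIV. \<Phi> ((1 / \<epsilon>) *\<^sub>R x) $ i * partial i \<psi> x)"

lemma rho0: "\<rho>0 x = E x / C0"
  by (simp add: rho_zero_def gibbs_def E_def C0_def set_lebesgue_integral_def)

lemma E_pos: "E x > 0" by (simp add: E_def)

lemma C0_pos: "C0 > 0"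
  using rho_pos[of 0] E_pos[of 0] unfolding rho0 by (simp add: zero_less_divide_iff)

text \<open>The integral of a function that is not integrable is zero by convention, so a positive
  normalizing constant entails integrability.\<close>

lemma E_integrable: "integrable lebesgue E"
  using C0_pos not_integrable_integral_eq[of lebesgue E] unfolding C0_def by fastforce

lemma rhoe: "\<rho>e \<epsilon> x = m \<epsilon> x * \<rho>0 x"
proof -
  have e: "exp (- (1 / \<sigma>) * (V x + p y)) = E x * w y" for x y
    by (simp add: E_def w_def exp_add[symmetric] algebra_simps)
  show ?thesis
    unfolding rho_eps_def gibbs_def e set_lebesgue_integral_def m_def rho0
    using C0_pos by (simp add: Ceps_def)
qed

lemma C_k_w: "C_k k w"
  unfolding w_def[abs_def] by (rule smooth_exp) (rule C_k_cmult[OF p_smooth])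

lemma w_pos: "w y > 0" by (simp add: w_def)

lemma w_periodic: "periodic L w"
  using p_periodic unfolding periodic_def w_def by simp

lemma w_cont: "continuous_on UNIV w" using C_k_w[of 0] by simp

lemma partial_w: "partial j w y = - (1 / \<sigma>) * w y * partial j p y"
proof -
  have d: "p differentiable (at y)" using p_smooth[of "Suc 0"] by simp
  have "partial j (\<lambda>y. exp (- (1 / \<sigma>) * p y)) y = exp (- (1 / \<sigma>) * p y) * partial j (\<lambda>y. - (1 / \<sigma>) * p y) y"
    by (rule partial_chain(1)[OF DERIV_exp differentiable_mult[OF differentiable_const d]])
  also have "partial j (\<lambda>y. - (1 / \<sigma>) * p y) y = - (1 / \<sigma>) * partial j p y" by (rule partial_cmult[OF d])
  finally show ?thesis by (simp add: w_def[abs_def] mult_ac)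
qed

lemma C_k_rho0: "C_k k \<rho>0"
proof -
  have "\<rho>0 = (\<lambda>x. (1 / C0) * exp (- (1 / \<sigma>) * V x))" by (auto simp: rho0 E_def)
  moreover have "C_k k (\<lambda>x. (1 / C0) * exp (- (1 / \<sigma>) * V x))"
    by (intro C_k_cmult smooth_exp V_smooth)
  ultimately show ?thesis by simp
qed

lemma partial_rho0: "partial j \<rho>0 x = - (1 / \<sigma>) * \<rho>0 x * partial j V x"
proof -
  have d: "V differentiable (at x)" using V_smooth[of "Suc 0"] by simp
  have d2: "(\<lambda>x. exp (- (1 / \<sigma>) * V x)) differentiable (at x)"
    by (rule partial_chain(2)[OF DERIV_exp differentiable_mult[OF differentiable_const d]])
  have "partial j (\<lambda>x. exp (- (1 / \<sigma>) * V x)) x = exp (- (1 / \<sigma>) * V x) * partial j (\<lambda>y. - (1 / \<sigma>) * V y) x"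
    by (rule partial_chain(1)[OF DERIV_exp differentiable_mult[OF differentiable_const d]])
  also have "partial j (\<lambda>y. - (1 / \<sigma>) * V y) x = - (1 / \<sigma>) * partial j V x" by (rule partial_cmult[OF d])
  finally have 1: "partial j (\<lambda>x. exp (- (1 / \<sigma>) * V x)) x = exp (- (1 / \<sigma>) * V x) * (- (1 / \<sigma>) * partial j V x)" .
  have "\<rho>0 = (\<lambda>x. (1 / C0) * exp (- (1 / \<sigma>) * V x))" by (auto simp: rho0 E_def)
  then have "partial j \<rho>0 x = (1 / C0) * partial j (\<lambda>x. exp (- (1 / \<sigma>) * V x)) x"
    by (simp only: partial_cmult[OF d2])
  then show ?thesis unfolding 1 rho0 E_def by simp
qed

lemma density_ratio_bounded: "\<exists>a b. 0 < a \<and> 0 < b \<and> (\<forall>\<epsilon> x. a \<le> m \<epsilon> x \<and> m \<epsilon> x \<le> b)"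
proof -
  obtain B where B: "B > 0" "\<And>y. \<bar>p y\<bar> \<le> B" using periodic_bounded[OF p_periodic L] p_smooth[of 0] by auto
  define w1 w2 where "w1 = exp (- (1 / \<sigma>) * B)" and "w2 = exp ((1 / \<sigma>) * B)"
  have w12: "w1 > 0" "w2 > 0" unfolding w1_def w2_def by auto
  have wb: "w1 \<le> w y" "w y \<le> w2" for y
  proof -
    have "- B \<le> p y" "p y \<le> B" using B(2)[of y] by linarith+
    then have "(1 / \<sigma>) * p y \<le> (1 / \<sigma>) * B" "(1 / \<sigma>) * (- p y) \<le> (1 / \<sigma>) * B"
      using \<sigma> by (intro mult_left_mono; simp)+
    then show "w1 \<le> w y" "w y \<le> w2" unfolding w_def w1_def w2_def by auto
  qed
  have gc: "continuous_on UNIV (\<lambda>x. w ((1 / \<epsilon>) *\<^sub>R x))" for \<epsilon>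
    by (rule continuous_on_compose2[OF w_cont]) (auto intro: continuous_intros)
  have Ei: "integrable lebesgue (\<lambda>x. E x * w ((1 / \<epsilon>) *\<^sub>R x))" for \<epsilon>
    by (rule integrable_mult_bounded[OF E_integrable continuous_lebesgue_measurable(1)[OF gc], of _ w2])
       (use wb w_pos in \<open>auto simp: abs_of_pos\<close>)
  have Cb: "C0 * w1 \<le> Ceps \<epsilon>" "Ceps \<epsilon> \<le> C0 * w2" for \<epsilon>
  proof -
    have "(LINT x|lebesgue. E x * w1) \<le> Ceps \<epsilon>" unfolding Ceps_def
      by (rule integral_mono) (use Ei E_integrable wb E_pos in \<open>auto intro!: mult_left_mono simp: less_imp_le\<close>)
    then show "C0 * w1 \<le> Ceps \<epsilon>" by (simp add: C0_def)
    have "Ceps \<epsilon> \<le> (LINT x|lebesgue. E x * w2)" unfolding Ceps_def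
      by (rule integral_mono) (use Ei E_integrable wb E_pos in \<open>auto intro!: mult_left_mono simp: less_imp_le\<close>)
    then show "Ceps \<epsilon> \<le> C0 * w2" by (simp add: C0_def)
  qed
  have Cp: "Ceps \<epsilon> > 0" for \<epsilon> using Cb(1)[of \<epsilon>] C0_pos w12 by (meson less_le_trans mult_pos_pos)
  have "w1 / w2 \<le> m \<epsilon> x \<and> m \<epsilon> x \<le> w2 / w1" for \<epsilon> x
  proof
    have "1 / w2 \<le> C0 / Ceps \<epsilon>" using Cb(2)[of \<epsilon>] Cp[of \<epsilon>] w12 by (simp add: field_simps)
    then have "w1 * (1 / w2) \<le> m \<epsilon> x" unfolding m_def using wb w12 by (intro mult_mono) (auto simp: less_imp_le w_pos)
    then show "w1 / w2 \<le> m \<epsilon> x" by simp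
    have "C0 / Ceps \<epsilon> \<le> 1 / w1" using Cb(1)[of \<epsilon>] Cp[of \<epsilon>] w12 by (simp add: field_simps)
    then have "m \<epsilon> x \<le> w2 * (1 / w1)" unfolding m_def using wb w12 Cp[of \<epsilon>] C0_pos
      by (intro mult_mono) (auto simp: less_imp_le)
    then show "m \<epsilon> x \<le> w2 / w1" by simp
  qed
  then show ?thesis using w12 by (intro exI[of _ "w1 / w2"] exI[of _ "w2 / w1"]) auto
qed

text \<open>Bounds for \<open>m\<close> that are uniform in the scale and in space; they make the multiscale and the
  homogenized norms equivalent with constants independent of the scale.\<close>
definition ratio_min where "ratio_min = (SOME a. 0 < a \<and> (\<exists>b. 0 < b \<and> (\<forall>\<epsilon> x. a \<le> m \<epsilon> x \<and> m \<epsilon> x \<le> b)))"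
definition ratio_max where "ratio_max = (SOME b. 0 < b \<and> (\<forall>\<epsilon> x. ratio_min \<le> m \<epsilon> x \<and> m \<epsilon> x \<le> b))"

lemma density_ratio_bounds: "ratio_min > 0" "ratio_max > 0" "ratio_min \<le> m \<epsilon> x" "m \<epsilon> x \<le> ratio_max"
proof -
  have 1: "0 < ratio_min \<and> (\<exists>b. 0 < b \<and> (\<forall>\<epsilon> x. ratio_min \<le> m \<epsilon> x \<and> m \<epsilon> x \<le> b))"
    unfolding ratio_min_def by (rule someI_ex) (use density_ratio_bounded in blast)
  then have ex: "\<exists>b. 0 < b \<and> (\<forall>\<epsilon> x. ratio_min \<le> m \<epsilon> x \<and> m \<epsilon> x \<le> b)" by (rule conjunct2)
  have 2: "0 < ratio_max \<and> (\<forall>\<epsilon> x. ratio_min \<le> m \<epsilon> x \<and> m \<epsilon> x \<le> ratio_max)"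
    using someI_ex[OF ex] unfolding ratio_max_def[symmetric] .
  show "ratio_min > 0" by (rule conjunct1[OF 1])
  show "ratio_max > 0" by (rule conjunct1[OF 2])
  show "ratio_min \<le> m \<epsilon> x" "m \<epsilon> x \<le> ratio_max" using conjunct2[OF 2] by auto
qed

lemma m_pos: "m \<epsilon> x > 0" using density_ratio_bounds(1) density_ratio_bounds(3)[of \<epsilon> x] by linarith

lemma m_abs: "\<bar>m \<epsilon> x\<bar> \<le> ratio_max" using density_ratio_bounds(4)[of \<epsilon> x] m_pos[of \<epsilon> x] by simp

lemma scaled_cont: "continuous_on UNIV f \<Longrightarrow> continuous_on UNIV (\<lambda>x::real^'d. f (c *\<^sub>R x))"
  by (rule continuous_on_compose2[of UNIV f]) (auto intro: continuous_intros)

lemma m_cont: "continuous_on UNIV (m \<epsilon>)"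
  unfolding m_def[abs_def] by (intro continuous_intros scaled_cont[OF w_cont])

lemma m_meas: "m \<epsilon> \<in> borel_measurable lebesgue" by (rule continuous_lebesgue_measurable(1)[OF m_cont])

lemma weight_eps: "weight (\<rho>e \<epsilon>) (ratio_max * rho_max)"
proof
  show "continuous_on UNIV (\<rho>e \<epsilon>)"
    unfolding rhoe[abs_def] by (intro continuous_intros m_cont rho_continuous)
  show "0 < \<rho>e \<epsilon> x" for x unfolding rhoe using m_pos rho_pos by simp
  show "\<rho>e \<epsilon> x \<le> ratio_max * rho_max" for x
    unfolding rhoe using density_ratio_bounds(4) density_ratio_bounds(2) rho_le rho_pos by (intro mult_mono) (auto simp: less_imp_le)
qed

lemma L2_inner_eps: "L2_inner (\<rho>e \<epsilon>) u v = L2_inner \<rho>0 u (\<lambda>x. m \<epsilon> x * v x)"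
  unfolding L2_inner_def rhoe by (simp add: mult_ac)

lemma L2_eps: "L2 (\<rho>e \<epsilon>) u \<longleftrightarrow> L2 \<rho>0 u"
proof
  have eq: "(u x)\<^sup>2 * \<rho>e \<epsilon> x = ((u x)\<^sup>2 * \<rho>0 x) * m \<epsilon> x" for x by (simp add: rhoe mult_ac)
  assume "L2 \<rho>0 u"
  then show "L2 (\<rho>e \<epsilon>) u" unfolding L2_def eq
    using integrable_mult_bounded[OF _ m_meas m_abs] by auto
next
  interpret W: weight "\<rho>e \<epsilon>" "ratio_max * rho_max" by (rule weight_eps)
  have eq: "(u x)\<^sup>2 * \<rho>0 x = ((u x)\<^sup>2 * \<rho>e \<epsilon> x) * (1 / m \<epsilon> x)" for x
    using m_pos[of \<epsilon> x] by (simp add: rhoe)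
  have b: "\<bar>1 / m \<epsilon> x\<bar> \<le> 1 / ratio_min" for x
    using m_pos[of \<epsilon> x] density_ratio_bounds(1) density_ratio_bounds(3)[of \<epsilon> x] by (simp add: frac_le)
  have mm: "(\<lambda>x. 1 / m \<epsilon> x) \<in> borel_measurable lebesgue" using m_meas[of \<epsilon>] by auto
  assume "L2 (\<rho>e \<epsilon>) u"
  then show "L2 \<rho>0 u" unfolding L2_def eq
    using integrable_mult_bounded[OF _ mm b] by auto
qed

lemma H1_eps: "H1 (\<rho>e \<epsilon>) u \<longleftrightarrow> H1 \<rho>0 u"
proof -
  interpret W: weight "\<rho>e \<epsilon>" "ratio_max * rho_max" by (rule weight_eps)
  show ?thesis
  proof
    assume u: "H1 (\<rho>e \<epsilon>) u"
    show "H1 \<rho>0 u"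
      by (rule H1_I(1)[OF _ W.H1_D(2)[OF u]]) (use W.H1_D(1,3)[OF u] L2_eps in auto)
  next
    assume u: "H1 \<rho>0 u"
    show "H1 (\<rho>e \<epsilon>) u"
      by (rule W.H1_I(1)[OF _ H1_D(2)[OF u]]) (use H1_D(1,3)[OF u] L2_eps in auto)
  qed
qed

lemma wform_eps_expand:
  assumes "H1 \<rho>0 u" "H1 \<rho>0 v"
  shows "wform (mat \<sigma>) (\<rho>e \<epsilon>) u v = \<sigma> * (\<Sum>j\<in>UNIV. L2_inner \<rho>0 (wpartial j u) (\<lambda>x. m \<epsilon> x * wpartial j v x))"
proof -
  interpret W: weight "\<rho>e \<epsilon>" "ratio_max * rho_max" by (rule weight_eps)
  have "(\<Sum>j\<in>UNIV. mat \<sigma> $ i $ j * L2_inner (\<rho>e \<epsilon>) (wpartial j u) (wpartial i v)) = \<sigma> * L2_inner (\<rho>e \<epsilon>) (wpartial i u) (wpartial i v)" for i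
  proof -
    have "(\<Sum>j\<in>UNIV. mat \<sigma> $ i $ j * L2_inner (\<rho>e \<epsilon>) (wpartial j u) (wpartial i v)) = (\<Sum>j\<in>UNIV. if j = i then \<sigma> * L2_inner (\<rho>e \<epsilon>) (wpartial j u) (wpartial i v) else 0)"
      by (intro sum.cong) (auto simp: mat_def)
    then show ?thesis by simp
  qed
  then show ?thesis
    using W.wform_expand[of u v "mat \<sigma>"] assms H1_eps by (simp add: L2_inner_eps sum_distrib_left)
qed

lemma Phi_C2: "C_k 2 (\<lambda>y. \<Phi> y $ i)" using cell_problem unfolding cell_solution_def by blast

lemma Phi_comp_periodic: "periodic L (\<lambda>y. \<Phi> y $ i)"
  using cell_problem unfolding cell_solution_def periodic_def by auto

lemma C_k_cell_flux: "C_k (Suc 0) (cell_flux i j)"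
proof -
  have "C_k (Suc (Suc 0)) (\<lambda>y. \<Phi> y $ i)" using Phi_C2[of i] by (simp only: numeral_2_eq_2)
  then have "C_k (Suc 0) (partial j (\<lambda>z. \<Phi> z $ i))" by (rule C_k_partial)
  then show ?thesis unfolding cell_flux_def[abs_def] by (rule C_k_add[OF C_k_const])
qed

lemma cell_flux_continuous: "continuous_on UNIV (cell_flux i j)" by (rule C_k_continuous[OF C_k_cell_flux])

lemma cell_flux_periodic: "periodic L (cell_flux i j)"
proof -
  have "C_k (Suc 0) (\<lambda>y. \<Phi> y $ i)" by (rule C_k_mono[OF Phi_C2]) simp
  then have "periodic L (partial j (\<lambda>z. \<Phi> z $ i))"
    by (intro partial_periodic[OF Phi_comp_periodic]) simp
  then show ?thesis unfolding periodic_def cell_flux_def by simp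
qed

text \<open>This is the cell problem in divergence form, multiplied by \<open>w\<close>.\<close>

lemma divergence_free: "(\<Sum>j\<in>UNIV. partial j (\<lambda>y. w y * cell_flux i j y) y) = 0"
proof -
  have dw: "w differentiable (at y)" using C_k_w[of "Suc 0"] by simp
  have dq: "cell_flux i j differentiable (at y)" for j using C_k_cell_flux by simp
  have C2: "C_k (Suc (Suc 0)) (\<lambda>y. \<Phi> y $ i)" using Phi_C2[of i] by (simp only: numeral_2_eq_2)
  have pq: "partial j (cell_flux i j) y = partial j (partial j (\<lambda>z. \<Phi> z $ i)) y" for j
    unfolding cell_flux_def[abs_def] using C2 by (subst partial_add) (auto simp: partial_const)
  have "(- \<sigma> *\<^sub>R vec_laplacian \<Phi> y + jacobian \<Phi> y *v grad p y) $ i = (- grad p y) $ i"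
    using cell_problem unfolding cell_solution_def by simp
  then have c: "- \<sigma> * (\<Sum>j\<in>UNIV. partial j (partial j (\<lambda>z. \<Phi> z $ i)) y) + (\<Sum>j\<in>UNIV. partial j (\<lambda>z. \<Phi> z $ i) y * partial j p y) = - partial i p y"
    by (simp add: vec_laplacian_def laplacian_def jacobian_def grad_def matrix_vector_mult_def)
  have "(\<Sum>j\<in>UNIV. partial j (\<lambda>y. w y * cell_flux i j y) y) = (\<Sum>j\<in>UNIV. w y * partial j (partial j (\<lambda>z. \<Phi> z $ i)) y - (1 / \<sigma>) * w y * (partial j p y * cell_flux i j y))"
    using dw dq by (simp add: partial_mult pq partial_w mult.assoc)
  also have "\<dots> = w y * ((\<Sum>j\<in>UNIV. partial j (partial j (\<lambda>z. \<Phi> z $ i)) y) - (1 / \<sigma>) * (\<Sum>j\<in>UNIV. partial j p y * cell_flux i j y))"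
    by (simp add: sum_subtractf sum_distrib_left right_diff_distrib mult_ac)
  also have "(\<Sum>j\<in>UNIV. partial j p y * cell_flux i j y) = partial i p y + (\<Sum>j\<in>UNIV. partial j (\<lambda>z. \<Phi> z $ i) y * partial j p y)"
    unfolding cell_flux_def by (simp add: distrib_left sum.distrib mult.commute if_distrib[of "(*) _"] cong: if_cong)
  also have "\<dots> = \<sigma> * (\<Sum>j\<in>UNIV. partial j (partial j (\<lambda>z. \<Phi> z $ i)) y)" using c by simp
  finally show ?thesis using \<sigma> by simp
qed

lemma wpartial2_continuous:
  assumes "test_function \<psi>"
  shows "continuous_on UNIV (wpartial2 \<psi> i j)"
proof -
  have cV: "continuous_on UNIV (partial j V)" using C_k_continuous[of 0 "partial j V"] C_k_partial[OF V_smooth[of "Suc 0"]] by blast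
  have t: "test_function (partial i \<psi>)" "test_function (partial j (partial i \<psi>))"
    using assms test_function_partial by auto
  show ?thesis
    unfolding wpartial2_def[abs_def]
    by (intro continuous_on_diff continuous_on_mult continuous_on_const cV
        test_function_continuous[OF t(1)] test_function_continuous[OF t(2)])
qed

lemma wpartial2_support:
  assumes "\<And>x. norm x > R \<Longrightarrow> \<psi> x = 0" "norm x > R"
  shows "wpartial2 \<psi> i j x = 0"
proof -
  have 1: "partial i \<psi> x = 0" if "norm x > R" for x i by (rule partial_outside[OF assms(1) that])
  have "partial j (partial i \<psi>) x = 0" by (rule partial_outside[OF 1 assms(2)])
  then show ?thesis using 1[OF assms(2)] by (simp add: wpartial2_def)
qed

lemma partial_weighted_partial:
  assumes "test_function \<psi>"
  shows "partial j (\<lambda>x. partial i \<psi> x * \<rho>0 x) x = wpartial2 \<psi> i j x * \<rho>0 x"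
proof -
  have "partial i \<psi> differentiable (at x)" using test_function_C_k[OF test_function_partial[OF assms], of "Suc 0"] by simp
  moreover have "\<rho>0 differentiable (at x)" using C_k_rho0[of "Suc 0"] by simp
  ultimately show ?thesis by (simp add: partial_mult partial_rho0 wpartial2_def algebra_simps)
qed

lemma integration_by_parts:
  assumes u: "H1 \<rho>0 u" and \<psi>: "test_function \<psi>"
  shows "L2_inner \<rho>0 (wpartial j u) (partial i \<psi>) = - L2_inner \<rho>0 u (wpartial2 \<psi> i j)"
proof -
  obtain R where R: "\<And>x. norm x > R \<Longrightarrow> \<psi> x = 0" using test_function_support[OF \<psi>] by blast
  have C1: "C_k (Suc 0) (\<lambda>x. partial i \<psi> x * \<rho>0 x)"
    by (rule C_k_mult[OF test_function_C_k[OF test_function_partial[OF \<psi>]] C_k_rho0])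
  have s: "partial i \<psi> x * \<rho>0 x = 0" if "norm x > R" for x using partial_outside[OF R that] by simp
  have "(LINT x|lebesgue. u x * partial j (\<lambda>x. partial i \<psi> x * \<rho>0 x) x) = - (LINT x|lebesgue. wpartial j u x * (partial i \<psi> x * \<rho>0 x))"
    by (rule weak_grad_against_C1[OF u C1 s])
  then show ?thesis unfolding partial_weighted_partial[OF \<psi>] L2_inner_def by (simp add: mult.assoc)
qed

lemma wform_parts:
  assumes u: "H1 \<rho>0 u" and \<psi>: "test_function \<psi>"
  shows "wform A \<rho>0 u \<psi> = - (\<Sum>i\<in>UNIV. \<Sum>j\<in>UNIV. A $ i $ j * L2_inner \<rho>0 u (wpartial2 \<psi> i j))"
proof -
  note \<psi>1 = H1_test(1)[OF \<psi>]
  have "L2_inner \<rho>0 (wpartial j u) (wpartial i \<psi>) = L2_inner \<rho>0 (wpartial j u) (partial i \<psi>)" for i j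
    by (rule L2_inner_cong_AE[OF H1_D(3)[OF u] H1_D(3)[OF u] H1_D(3)[OF \<psi>1] L2_test[OF test_function_partial[OF \<psi>]] _ H1_test(2)[OF \<psi>]]) simp
  then show ?thesis unfolding wform_expand[OF u \<psi>1] by (simp add: integration_by_parts[OF u \<psi>] sum_negf)
qed

end

section \<open>Correctors and oscillation\<close>

context homog
begin

lemma Phi_cont: "continuous_on UNIV (\<lambda>y. \<Phi> y $ i)" by (rule C_k_continuous[OF Phi_C2])

lemma corrector_C1:
  assumes "test_function \<psi>"
  shows "C_k (Suc 0) (corrector \<epsilon> \<psi>)"
proof -
  have P: "C_k (Suc 0) (\<lambda>x. \<Phi> ((1 / \<epsilon>) *\<^sub>R x) $ i)" for i
    using C_k_affine[OF C_k_mono[OF Phi_C2[of i], of "Suc 0"], of "1 / \<epsilon>" 0] by simp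
  show ?thesis unfolding corrector_def[abs_def]
    by (intro C_k_add C_k_cmult C_k_sum C_k_mult P test_function_C_k[OF assms]
        test_function_C_k[OF test_function_partial[OF assms]])
qed

lemma corrector_support:
  assumes "\<And>x. norm x > R \<Longrightarrow> \<psi> x = 0" "norm x > R"
  shows "corrector \<epsilon> \<psi> x = 0"
  using assms(1)[OF assms(2)] partial_outside[OF assms(1) assms(2)] by (simp add: corrector_def)

lemma partial_corrector:
  assumes \<psi>: "test_function \<psi>" and \<epsilon>: "\<epsilon> > 0"
  shows "partial j (corrector \<epsilon> \<psi>) x = (\<Sum>i\<in>UNIV. cell_flux i j ((1 / \<epsilon>) *\<^sub>R x) * partial i \<psi> x) +
     \<epsilon> * (\<Sum>i\<in>UNIV. \<Phi> ((1 / \<epsilon>) *\<^sub>R x) $ i * partial j (partial i \<psi>) x)"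
proof -
  have d\<Phi>: "(\<lambda>y. \<Phi> y $ i) differentiable (at y)" for i y
    using C_k_mono[OF Phi_C2[of i], of "Suc 0"] by simp
  have ds: "(\<lambda>x. \<Phi> ((1 / \<epsilon>) *\<^sub>R x) $ i) differentiable (at x)" for i x
    using C_k_affine[OF C_k_mono[OF Phi_C2[of i], of "Suc 0"], of "1 / \<epsilon>" 0] by simp
  have p\<Phi>: "partial j (\<lambda>x. \<Phi> ((1 / \<epsilon>) *\<^sub>R x) $ i) x = (1 / \<epsilon>) * partial j (\<lambda>y. \<Phi> y $ i) ((1 / \<epsilon>) *\<^sub>R x)" for i x
    using partial_affine[of "\<lambda>y. \<Phi> y $ i" "1 / \<epsilon>" x 0 j] d\<Phi> by simp
  have d\<psi>: "\<psi> differentiable (at x)" "partial i \<psi> differentiable (at x)" for i x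
    using test_function_C_k[OF \<psi>, of "Suc 0"] test_function_C_k[OF test_function_partial[OF \<psi>], of "Suc 0"] by auto
  have dm: "(\<lambda>x. \<Phi> ((1 / \<epsilon>) *\<^sub>R x) $ i * partial i \<psi> x) differentiable (at x)" for i x
    by (rule differentiable_mult[OF ds d\<psi>(2)])
  have dsum: "(\<lambda>x. \<Sum>i\<in>UNIV. \<Phi> ((1 / \<epsilon>) *\<^sub>R x) $ i * partial i \<psi> x) differentiable (at x)" for x
    by (intro differentiable_sum ballI dm) simp
  have psum: "partial j (\<lambda>x. \<Sum>i\<in>UNIV. \<Phi> ((1 / \<epsilon>) *\<^sub>R x) $ i * partial i \<psi> x) x
      = (\<Sum>i\<in>UNIV. partial j (\<lambda>x. \<Phi> ((1 / \<epsilon>) *\<^sub>R x) $ i * partial i \<psi> x) x)"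
    by (rule partial_sum[OF dm])
  have 1: "partial j (corrector \<epsilon> \<psi>) x = partial j \<psi> x + \<epsilon> * (\<Sum>i\<in>UNIV. partial j (\<lambda>x. \<Phi> ((1 / \<epsilon>) *\<^sub>R x) $ i * partial i \<psi> x) x)"
    unfolding corrector_def[abs_def]
    using partial_add[OF d\<psi>(1) differentiable_mult[OF differentiable_const dsum]] partial_cmult[OF dsum] psum
    by simp
  have 2: "partial j (\<lambda>x. \<Phi> ((1 / \<epsilon>) *\<^sub>R x) $ i * partial i \<psi> x) x =
     \<Phi> ((1 / \<epsilon>) *\<^sub>R x) $ i * partial j (partial i \<psi>) x + (1 / \<epsilon>) * partial j (\<lambda>y. \<Phi> y $ i) ((1 / \<epsilon>) *\<^sub>R x) * partial i \<psi> x" for i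
    by (simp only: partial_mult[OF ds d\<psi>(2)] p\<Phi>)
  have 3: "(\<Sum>i\<in>UNIV. cell_flux i j ((1 / \<epsilon>) *\<^sub>R x) * partial i \<psi> x) = partial j \<psi> x + (\<Sum>i\<in>UNIV. partial j (\<lambda>y. \<Phi> y $ i) ((1 / \<epsilon>) *\<^sub>R x) * partial i \<psi> x)"
    unfolding cell_flux_def by (simp add: distrib_right sum.distrib if_distrib[of "\<lambda>t. t * _"] cong: if_cong)
  have 4: "\<epsilon> * (\<Phi> ((1 / \<epsilon>) *\<^sub>R x) $ i * partial j (partial i \<psi>) x + (1 / \<epsilon>) * partial j (\<lambda>y. \<Phi> y $ i) ((1 / \<epsilon>) *\<^sub>R x) * partial i \<psi> x)
     = \<epsilon> * (\<Phi> ((1 / \<epsilon>) *\<^sub>R x) $ i * partial j (partial i \<psi>) x) + partial j (\<lambda>y. \<Phi> y $ i) ((1 / \<epsilon>) *\<^sub>R x) * partial i \<psi> x" for i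
    using \<epsilon> by (simp add: distrib_left)
  show ?thesis unfolding 1 2 3 sum_distrib_left 4 by (simp add: sum.distrib)
qed

lemma corrector_H1:
  assumes \<psi>: "test_function \<psi>"
  shows "H1 \<rho>0 (corrector \<epsilon> \<psi>)" "AE x in lebesgue. wpartial j (corrector \<epsilon> \<psi>) x = partial j (corrector \<epsilon> \<psi>) x"
    "L2 \<rho>0 (partial j (corrector \<epsilon> \<psi>))"
proof -
  obtain R where R: "\<And>x. norm x > R \<Longrightarrow> \<psi> x = 0" using test_function_support[OF \<psi>] by blast
  have s: "corrector \<epsilon> \<psi> x = 0" if "norm x > R" for x by (rule corrector_support[OF R that])
  show "H1 \<rho>0 (corrector \<epsilon> \<psi>)" "AE x in lebesgue. wpartial j (corrector \<epsilon> \<psi>) x = partial j (corrector \<epsilon> \<psi>) x"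
    by (rule H1_C1[OF corrector_C1[OF \<psi>] s], assumption)+
  have pc: "continuous_on UNIV (partial j (corrector \<epsilon> \<psi>))" using corrector_C1[OF \<psi>] by simp
  show "L2 \<rho>0 (partial j (corrector \<epsilon> \<psi>))"
    by (rule L2_continuous_bounded_support[OF pc partial_outside[OF s]])
qed

lemma L2_cont_test:
  assumes "continuous_on UNIV f" "test_function \<psi>"
  shows "L2 \<rho>0 (\<lambda>x. f x * \<psi> x)"
proof -
  obtain R where R: "\<And>x. norm x > R \<Longrightarrow> \<psi> x = 0" using test_function_support[OF assms(2)] by blast
  show ?thesis by (rule L2_continuous_bounded_support[of _ R]) (use R assms test_function_continuous in \<open>auto intro!: continuous_intros\<close>)
qed

lemma L2_wpartial2:
  assumes \<psi>: "test_function \<psi>"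
  shows "L2 \<rho>0 (wpartial2 \<psi> i j)"
proof -
  obtain R where R: "\<And>x. norm x > R \<Longrightarrow> \<psi> x = 0" using test_function_support[OF \<psi>] by blast
  show ?thesis by (rule L2_continuous_bounded_support[OF wpartial2_continuous[OF \<psi>] wpartial2_support[OF R]])
qed

text \<open>When a derivative falls on a function of \<open>x / \<epsilon>\<close> it produces a factor \<open>1 / \<epsilon>\<close>. Summed over the
  direction \<open>j\<close> these dangerous terms form the divergence of the weighted flux and cancel.\<close>

lemma flux_parts:
  assumes u: "H1 \<rho>0 u" and \<psi>: "test_function \<psi>" and \<epsilon>: "\<epsilon> > 0"
  shows "(\<Sum>j\<in>UNIV. L2_inner \<rho>0 (wpartial j u) (\<lambda>x. cell_flux i j ((1 / \<epsilon>) *\<^sub>R x) * m \<epsilon> x * partial i \<psi> x)) =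
     - (\<Sum>j\<in>UNIV. L2_inner \<rho>0 u (\<lambda>x. cell_flux i j ((1 / \<epsilon>) *\<^sub>R x) * m \<epsilon> x * wpartial2 \<psi> i j x))"
proof -
  obtain R where R: "\<And>x. norm x > R \<Longrightarrow> \<psi> x = 0" using test_function_support[OF \<psi>] by blast
  define c where "c = C0 / Ceps \<epsilon>"
  define wq where "wq j y = w y * cell_flux i j y" for j y
  define \<eta> where "\<eta> j x = wq j ((1 / \<epsilon>) *\<^sub>R x) * (partial i \<psi> x * \<rho>0 x)" for j x
  have wqC: "C_k (Suc 0) (wq j)" for j unfolding wq_def[abs_def] by (rule C_k_mult[OF C_k_w C_k_cell_flux])
  have wqsC: "C_k (Suc 0) (\<lambda>x. wq j ((1 / \<epsilon>) *\<^sub>R x))" for j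
    using C_k_affine[OF wqC, of j "1 / \<epsilon>" 0] by simp
  have prC: "C_k (Suc 0) (\<lambda>x. partial i \<psi> x * \<rho>0 x)"
    by (rule C_k_mult[OF test_function_C_k[OF test_function_partial[OF \<psi>]] C_k_rho0])
  have \<eta>C: "C_k (Suc 0) (\<eta> j)" for j unfolding \<eta>_def[abs_def] by (rule C_k_mult[OF wqsC prC])
  have \<eta>s: "\<eta> j x = 0" if "norm x > R" for j x using partial_outside[OF R that] by (simp add: \<eta>_def)
  have p\<eta>: "partial j (\<eta> j) x = (1 / \<epsilon>) * partial j (wq j) ((1 / \<epsilon>) *\<^sub>R x) * (partial i \<psi> x * \<rho>0 x)
      + wq j ((1 / \<epsilon>) *\<^sub>R x) * (wpartial2 \<psi> i j x * \<rho>0 x)" for j x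
  proof -
    have "partial j (\<lambda>x. wq j ((1 / \<epsilon>) *\<^sub>R x)) x = (1 / \<epsilon>) * partial j (wq j) ((1 / \<epsilon>) *\<^sub>R x)"
      using partial_affine[of "wq j" "1 / \<epsilon>" x 0 j] wqC[of j] by simp
    then show ?thesis
      using partial_mult[of "\<lambda>x. wq j ((1 / \<epsilon>) *\<^sub>R x)" x "\<lambda>x. partial i \<psi> x * \<rho>0 x" j] wqsC[of j] prC partial_weighted_partial[OF \<psi>, of j i x]
      unfolding \<eta>_def[abs_def] by simp
  qed
  have sum\<eta>: "(\<Sum>j\<in>UNIV. partial j (\<eta> j) x) = (\<Sum>j\<in>UNIV. wq j ((1 / \<epsilon>) *\<^sub>R x) * (wpartial2 \<psi> i j x * \<rho>0 x))" for x
  proof -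
    have "(\<Sum>j\<in>UNIV. (1 / \<epsilon>) * partial j (wq j) ((1 / \<epsilon>) *\<^sub>R x) * (partial i \<psi> x * \<rho>0 x))
       = (1 / \<epsilon>) * (\<Sum>j\<in>UNIV. partial j (wq j) ((1 / \<epsilon>) *\<^sub>R x)) * (partial i \<psi> x * \<rho>0 x)"
      by (simp only: sum_distrib_left sum_distrib_right)
    also have "\<dots> = 0" unfolding wq_def[abs_def] divergence_free by simp
    finally show ?thesis unfolding p\<eta> sum.distrib by simp
  qed
  have lu: "locally_integrable u" by (rule has_weak_gradD(1)[OF H1_D(2)[OF u]])
  have pc: "continuous_on UNIV (partial j (\<eta> j))" for j using \<eta>C[of j] by simp
  have i1: "integrable lebesgue (\<lambda>x. u x * partial j (\<eta> j) x)" for j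
    by (rule locally_integrable_times_bounded_support[OF lu pc partial_outside[OF \<eta>s]])
  have wqc: "continuous_on UNIV (\<lambda>x. wq j ((1 / \<epsilon>) *\<^sub>R x))" for j by (rule C_k_continuous[OF wqsC])
  have i2: "integrable lebesgue (\<lambda>x. u x * (wq j ((1 / \<epsilon>) *\<^sub>R x) * (wpartial2 \<psi> i j x * \<rho>0 x)))" for j
    by (rule locally_integrable_times_bounded_support[OF lu, where R=R])
       (use wqc wpartial2_continuous[OF \<psi>] rho_continuous wpartial2_support[OF R] in \<open>auto intro!: continuous_intros\<close>)
  have L: "L2_inner \<rho>0 (wpartial j u) (\<lambda>x. cell_flux i j ((1 / \<epsilon>) *\<^sub>R x) * m \<epsilon> x * partial i \<psi> x) = c * (LINT x|lebesgue. wpartial j u x * \<eta> j x)" for j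
    unfolding L2_inner_def by (subst integral_mult_right_zero[symmetric]) (simp add: \<eta>_def wq_def m_def c_def mult_ac)
  have Rr: "L2_inner \<rho>0 u (\<lambda>x. cell_flux i j ((1 / \<epsilon>) *\<^sub>R x) * m \<epsilon> x * wpartial2 \<psi> i j x) = c * (LINT x|lebesgue. u x * (wq j ((1 / \<epsilon>) *\<^sub>R x) * (wpartial2 \<psi> i j x * \<rho>0 x)))" for j
    unfolding L2_inner_def by (subst integral_mult_right_zero[symmetric]) (simp add: wq_def m_def c_def mult_ac)
  have "(\<Sum>j\<in>UNIV. (LINT x|lebesgue. wpartial j u x * \<eta> j x)) = - (\<Sum>j\<in>UNIV. (LINT x|lebesgue. u x * partial j (\<eta> j) x))"
  proof -
    have "(LINT x|lebesgue. u x * partial j (\<eta> j) x) = - (LINT x|lebesgue. wpartial j u x * \<eta> j x)" for j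
      by (rule weak_grad_against_C1[OF u \<eta>C \<eta>s])
    then show ?thesis by (simp add: sum_negf)
  qed
  also have "(\<Sum>j\<in>UNIV. (LINT x|lebesgue. u x * partial j (\<eta> j) x)) = (LINT x|lebesgue. u x * (\<Sum>j\<in>UNIV. partial j (\<eta> j) x))"
    unfolding sum_distrib_left by (rule Bochner_Integration.integral_sum[symmetric]) (rule i1)
  also have "\<dots> = (\<Sum>j\<in>UNIV. (LINT x|lebesgue. u x * (wq j ((1 / \<epsilon>) *\<^sub>R x) * (wpartial2 \<psi> i j x * \<rho>0 x))))"
    unfolding sum\<eta> sum_distrib_left by (rule Bochner_Integration.integral_sum) (rule i2)
  finally show ?thesis unfolding L Rr by (simp add: sum_distrib_left[symmetric])
qed

lemma flux:
  assumes u: "H1 \<rho>0 u" and \<psi>: "test_function \<psi>" and \<epsilon>: "\<epsilon> > 0"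
  shows "wform (mat \<sigma>) (\<rho>e \<epsilon>) u (corrector \<epsilon> \<psi>) =
    - (\<Sum>i\<in>UNIV. \<Sum>j\<in>UNIV. \<sigma> * L2_inner \<rho>0 u (\<lambda>x. cell_flux i j ((1 / \<epsilon>) *\<^sub>R x) * m \<epsilon> x * wpartial2 \<psi> i j x))
    + \<epsilon> * (\<Sum>i\<in>UNIV. \<Sum>j\<in>UNIV. \<sigma> * L2_inner \<rho>0 (wpartial j u) (\<lambda>x. \<Phi> ((1 / \<epsilon>) *\<^sub>R x) $ i * m \<epsilon> x * partial j (partial i \<psi>) x))"
proof -
  define X where "X i j x = cell_flux i j ((1 / \<epsilon>) *\<^sub>R x) * m \<epsilon> x * partial i \<psi> x" for i j x
  define Y where "Y i j x = \<Phi> ((1 / \<epsilon>) *\<^sub>R x) $ i * m \<epsilon> x * partial j (partial i \<psi>) x" for i j x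
  have X2: "L2 \<rho>0 (X i j)" for i j unfolding X_def[abs_def]
    by (intro L2_cont_test test_function_partial \<psi> continuous_on_mult scaled_cont[OF cell_flux_continuous] m_cont)
  have Y2: "L2 \<rho>0 (Y i j)" for i j unfolding Y_def[abs_def]
    by (intro L2_cont_test test_function_partial \<psi> continuous_on_mult scaled_cont[OF Phi_cont] m_cont)
  have "L2_inner \<rho>0 (wpartial j u) (\<lambda>x. m \<epsilon> x * wpartial j (corrector \<epsilon> \<psi>) x) = (\<Sum>i\<in>UNIV. L2_inner \<rho>0 (wpartial j u) (X i j)) + \<epsilon> * (\<Sum>i\<in>UNIV. L2_inner \<rho>0 (wpartial j u) (Y i j))" for j
  proof -
    have mm: "L2 \<rho>0 (\<lambda>x. m \<epsilon> x * v x)" if "L2 \<rho>0 v" for v by (rule L2_mult_bounded(1)[OF that m_meas m_abs])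
    have "L2_inner \<rho>0 (wpartial j u) (\<lambda>x. m \<epsilon> x * wpartial j (corrector \<epsilon> \<psi>) x) = L2_inner \<rho>0 (wpartial j u) (\<lambda>x. m \<epsilon> x * partial j (corrector \<epsilon> \<psi>) x)"
      by (rule L2_inner_cong_AE[OF H1_D(3)[OF u] H1_D(3)[OF u] mm[OF H1_D(3)[OF corrector_H1(1)[OF \<psi>]]] mm[OF corrector_H1(3)[OF \<psi>]]])
         (use corrector_H1(2)[OF \<psi>, where j=j and \<epsilon>=\<epsilon>] in \<open>auto elim!: eventually_mono\<close>)
    also have "(\<lambda>x. m \<epsilon> x * partial j (corrector \<epsilon> \<psi>) x) = (\<lambda>x. (\<Sum>i\<in>UNIV. X i j x) + \<epsilon> * (\<Sum>i\<in>UNIV. Y i j x))"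
      unfolding partial_corrector[OF \<psi> \<epsilon>] X_def Y_def by (simp add: sum_distrib_left distrib_left mult_ac)
    also have "L2_inner \<rho>0 (wpartial j u) \<dots> = L2_inner \<rho>0 (wpartial j u) (\<lambda>x. \<Sum>i\<in>UNIV. X i j x) + \<epsilon> * L2_inner \<rho>0 (wpartial j u) (\<lambda>x. \<Sum>i\<in>UNIV. Y i j x)"
      using X2 Y2 H1_D(3)[OF u] by (simp add: L2_inner_add_right L2_inner_cmult_right L2_sum L2_cmult)
    finally show ?thesis
      using L2_inner_sum_right[of UNIV "\<lambda>i. X i j" "wpartial j u"] L2_inner_sum_right[of UNIV "\<lambda>i. Y i j" "wpartial j u"] X2 Y2 H1_D(3)[OF u] by simp
  qed
  then have "wform (mat \<sigma>) (\<rho>e \<epsilon>) u (corrector \<epsilon> \<psi>) = \<sigma> * (\<Sum>j\<in>UNIV. (\<Sum>i\<in>UNIV. L2_inner \<rho>0 (wpartial j u) (X i j)) + \<epsilon> * (\<Sum>i\<in>UNIV. L2_inner \<rho>0 (wpartial j u) (Y i j)))"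
    unfolding wform_eps_expand[OF u corrector_H1(1)[OF \<psi>]] by simp
  also have "\<dots> = \<sigma> * (\<Sum>j\<in>UNIV. \<Sum>i\<in>UNIV. L2_inner \<rho>0 (wpartial j u) (X i j)) + \<sigma> * (\<epsilon> * (\<Sum>j\<in>UNIV. \<Sum>i\<in>UNIV. L2_inner \<rho>0 (wpartial j u) (Y i j)))"
    by (simp add: sum.distrib sum_distrib_left distrib_left)
  also have "(\<Sum>j\<in>UNIV. \<Sum>i\<in>UNIV. L2_inner \<rho>0 (wpartial j u) (X i j)) = (\<Sum>i\<in>UNIV. \<Sum>j\<in>UNIV. L2_inner \<rho>0 (wpartial j u) (X i j))"
    by (rule sum.swap)
  also have "\<dots> = (\<Sum>i\<in>UNIV. - (\<Sum>j\<in>UNIV. L2_inner \<rho>0 u (\<lambda>x. cell_flux i j ((1 / \<epsilon>) *\<^sub>R x) * m \<epsilon> x * wpartial2 \<psi> i j x)))"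
    unfolding X_def[abs_def] by (intro sum.cong refl flux_parts u \<psi> \<epsilon>)
  also have "(\<Sum>j\<in>UNIV. \<Sum>i\<in>UNIV. L2_inner \<rho>0 (wpartial j u) (Y i j)) = (\<Sum>i\<in>UNIV. \<Sum>j\<in>UNIV. L2_inner \<rho>0 (wpartial j u) (Y i j))"
    by (rule sum.swap)
  finally show ?thesis unfolding Y_def[abs_def] by (simp add: sum_negf sum_distrib_left mult.left_commute)
qed

lemma Ceps_pos: "Ceps \<epsilon> > 0"
proof (rule ccontr)
  assume "\<not> Ceps \<epsilon> > 0"
  then have "C0 / Ceps \<epsilon> \<le> 0" using C0_pos by (simp add: divide_le_0_iff)
  then have "m \<epsilon> 0 \<le> 0" unfolding m_def using w_pos by (simp only: mult_nonneg_nonpos less_imp_le)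
  then show False using m_pos[of \<epsilon> 0] by simp
qed

lemma cellint_w_pos: "cellint L w > 0"
proof -
  define c where "c = ratio_min * (Ceps 1 / C0)"
  have c: "c > 0" unfolding c_def using density_ratio_bounds(1) Ceps_pos C0_pos by simp
  have le: "c \<le> w y" for y
  proof -
    have "ratio_min \<le> w y * (C0 / Ceps 1)" using density_ratio_bounds(3)[of 1 y] unfolding m_def by simp
    then have "ratio_min * (Ceps 1 / C0) \<le> w y * (C0 / Ceps 1) * (Ceps 1 / C0)" using Ceps_pos[of 1] C0_pos by (intro mult_right_mono) (auto simp: less_imp_le)
    then show ?thesis using Ceps_pos[of 1] C0_pos by (simp add: c_def)
  qed
  have "0 < c * cellint L (\<lambda>z::real^'d. 1)" by (rule mult_pos_pos[OF c cell_content_pos[OF L]])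
  also have "\<dots> = (LINT z|lebesgue. indicator (cell L) (z::real^'d) * c)" unfolding cellint_def by simp
  also have "\<dots> \<le> cellint L w" unfolding cellint_def
    by (rule integral_mono) (use integrable_cell[OF w_cont] integrable_cell[of "\<lambda>_::real^'d. c"] le in \<open>auto intro!: mult_left_mono\<close>)
  finally show ?thesis .
qed

text \<open>Averaging is applied to \<open>f w\<close> and also to the normalizing constant of the multiscale density; the
  quotient of the two limits is the mean with respect to \<open>\<mu>\<close>.\<close>

lemma weak_star:
  assumes f: "periodic L f" "continuous_on UNIV f" and h: "integrable lebesgue h"
  shows "((\<lambda>\<epsilon>. LINT x|lebesgue. h x * (f ((1 / \<epsilon>) *\<^sub>R x) * m \<epsilon> x)) \<longlongrightarrow> mu_average f * (LINT x|lebesgue. h x)) (at_right 0)"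
proof -
  define W where "W = cellint L (\<lambda>z::real^'d. 1)"
  have W: "W > 0" unfolding W_def by (rule cell_content_pos[OF L])
  have pf: "periodic L (\<lambda>y. f y * w y)" using f(1) w_periodic unfolding periodic_def by simp
  have cf: "continuous_on UNIV (\<lambda>y. f y * w y)" by (intro continuous_intros f w_cont)
  note 1 = periodic_averaging[OF pf L cf h]
  have 2: "(Ceps \<longlongrightarrow> cellint L w / W * C0) (at_right 0)"
    using periodic_averaging[OF w_periodic L w_cont E_integrable] unfolding Ceps_def[abs_def] C0_def W_def .
  have ne: "cellint L w / W * C0 \<noteq> 0" using cellint_w_pos W C0_pos by simp
  have "((\<lambda>\<epsilon>. C0 * (LINT x|lebesgue. h x * (f ((1 / \<epsilon>) *\<^sub>R x) * w ((1 / \<epsilon>) *\<^sub>R x))) / Ceps \<epsilon>) \<longlongrightarrow>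
      C0 * (cellint L (\<lambda>y. f y * w y) / W * (LINT x|lebesgue. h x)) / (cellint L w / W * C0)) (at_right 0)"
    using 1 2 ne unfolding W_def by (intro tendsto_divide tendsto_mult tendsto_const)
  moreover have "C0 * (cellint L (\<lambda>y. f y * w y) / W * (LINT x|lebesgue. h x)) / (cellint L w / W * C0) = mu_average f * (LINT x|lebesgue. h x)"
    using W C0_pos cellint_w_pos unfolding mu_average_def by (simp add: field_simps)
  moreover have "C0 * (LINT x|lebesgue. h x * (f ((1 / \<epsilon>) *\<^sub>R x) * w ((1 / \<epsilon>) *\<^sub>R x))) / Ceps \<epsilon> = (LINT x|lebesgue. h x * (f ((1 / \<epsilon>) *\<^sub>R x) * m \<epsilon> x))" for \<epsilon>
  proof -
    have "(LINT x|lebesgue. h x * (f ((1 / \<epsilon>) *\<^sub>R x) * m \<epsilon> x)) = (LINT x|lebesgue. (C0 / Ceps \<epsilon>) * (h x * (f ((1 / \<epsilon>) *\<^sub>R x) * w ((1 / \<epsilon>) *\<^sub>R x))))"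
      unfolding m_def by (simp add: mult_ac)
    then show ?thesis by simp
  qed
  ultimately show ?thesis by simp
qed

lemma hom_K_entry: "hom_K \<sigma> L p \<Phi> $ i $ j = mu_average (cell_flux i j)"
proof -
  define F where "F y = mu \<sigma> L p y *\<^sub>R (mat 1 + jacobian \<Phi> y)" for y
  have mu: "mu \<sigma> L p y = w y / cellint L w" for y
    by (simp add: mu_def gibbs_def w_def cellint_def set_lebesgue_integral_def)
  have Fij: "F y $ i $ j = w y / cellint L w * cell_flux i j y" for i j y
    by (simp add: F_def mu cell_flux_def jacobian_def mat_def)
  have "F = (\<lambda>y. \<chi> i j. w y / cellint L w * cell_flux i j y)" by (auto simp: vec_eq_iff Fij)
  moreover have "continuous_on UNIV (\<lambda>y. \<chi> i j. w y / cellint L w * cell_flux i j y)"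
    using cellint_w_pos by (intro continuous_intros w_cont cell_flux_continuous) simp
  ultimately have "locally_integrable F" using locally_integrable_continuous by metis
  then have int: "integrable lebesgue (\<lambda>y. indicator (cell L) y *\<^sub>R F y)"
    using compact_cell[of L] unfolding locally_integrable_def set_integrable_def by blast
  have bl: "bounded_linear (\<lambda>A::real^'d^'d. A $ i $ j)"
    using bounded_linear_compose[OF bounded_linear_vec_nth bounded_linear_vec_nth] .
  have "hom_K \<sigma> L p \<Phi> $ i $ j = (LINT y|lebesgue. indicator (cell L) y *\<^sub>R F y) $ i $ j"
    unfolding hom_K_def set_lebesgue_integral_def F_def ..
  also have "\<dots> = (LINT y|lebesgue. (indicator (cell L) y *\<^sub>R F y) $ i $ j)"
    by (rule integral_bounded_linear[OF bl int, symmetric])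
  also have "\<dots> = (LINT y|lebesgue. (1 / cellint L w) * (indicator (cell L) y * (cell_flux i j y * w y)))"
    by (simp add: Fij mult_ac)
  also have "\<dots> = mu_average (cell_flux i j)" unfolding mu_average_def by (simp add: cellint_def)
  finally show ?thesis .
qed

lemma Sig_entry: "Sig $ i $ j = \<sigma> * mu_average (cell_flux i j)"
  unfolding hom_Sigma_def by (simp add: hom_K_entry)

text \<open>A substitute for strongly convergent subsequences: for small scales the family stays, up to any
  prescribed error, among the combinations with bounded coefficients of finitely many
  functions that do not depend on the scale.\<close>
definition totally_bounded_family :: "(real \<Rightarrow> real^'d \<Rightarrow> real) \<Rightarrow> bool" where
  "totally_bounded_family u \<longleftrightarrow> (\<forall>e>0. \<exists>(N::nat) f B. (\<forall>n<N. L2 \<rho>0 (f n)) \<and> (\<forall>\<^sub>F \<epsilon> in at_right 0. L2 \<rho>0 (u \<epsilon>) \<and>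
     (\<exists>c. (\<forall>n<N. \<bar>c n\<bar> \<le> B) \<and> L2_norm \<rho>0 (\<lambda>x. u \<epsilon> x - (\<Sum>n<N. c n * f n x)) \<le> e)))"

text \<open>A product of a weakly and a strongly convergent factor: finitely many fixed functions can be
  treated by \<open>weak_star\<close>, and the oscillating factor is bounded on the remainder.\<close>

lemma oscillation:
  assumes u: "totally_bounded_family u" and f: "periodic L f" "continuous_on UNIV f" and g: "L2 \<rho>0 g"
  shows "((\<lambda>\<epsilon>. L2_inner \<rho>0 (u \<epsilon>) (\<lambda>x. f ((1 / \<epsilon>) *\<^sub>R x) * m \<epsilon> x * g x) - mu_average f * L2_inner \<rho>0 (u \<epsilon>) g) \<longlongrightarrow> 0) (at_right 0)"
proof -
  obtain Fb where Fb: "Fb > 0" "\<And>y. \<bar>f y\<bar> \<le> Fb" using periodic_bounded[OF f(1) L f(2)] by blast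
  define s where "s \<epsilon> x = f ((1 / \<epsilon>) *\<^sub>R x) * m \<epsilon> x" for \<epsilon> x
  define r where "r \<epsilon> x = (s \<epsilon> x - mu_average f) * g x" for \<epsilon> x
  define K where "K = (Fb * ratio_max + \<bar>mu_average f\<bar>) * L2_norm \<rho>0 g"
  have K0: "K \<ge> 0" unfolding K_def using Fb density_ratio_bounds(2) by (simp add: L2_norm_nonneg)
  have sc0: "continuous_on UNIV (s \<epsilon>)" for \<epsilon>
    unfolding s_def[abs_def] by (intro continuous_intros scaled_cont[OF f(2)] m_cont)
  have sc: "continuous_on UNIV (\<lambda>x. s \<epsilon> x - mu_average f)" for \<epsilon>
    unfolding s_def by (intro continuous_intros scaled_cont[OF f(2)] m_cont)
  have sb0: "\<bar>s \<epsilon> x\<bar> \<le> Fb * ratio_max" for \<epsilon> x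
    unfolding s_def abs_mult by (intro mult_mono Fb(2) m_abs) (use Fb in auto)
  have sb: "\<bar>s \<epsilon> x - mu_average f\<bar> \<le> Fb * ratio_max + \<bar>mu_average f\<bar>" for \<epsilon> x using sb0[of \<epsilon> x] by linarith
  note r2 = L2_mult_bounded[OF g continuous_lebesgue_measurable(1)[OF sc] sb, folded r_def]
  have rL: "L2 \<rho>0 (r \<epsilon>)" and rK: "L2_norm \<rho>0 (r \<epsilon>) \<le> K" for \<epsilon>
    using r2[of \<epsilon>] unfolding r_def[abs_def] K_def by auto
  have sg: "L2 \<rho>0 (\<lambda>x. s \<epsilon> x * g x)" for \<epsilon>
    by (rule L2_mult_bounded(1)[OF g continuous_lebesgue_measurable(1)[OF sc0] sb0])
  have split: "L2_inner \<rho>0 v (\<lambda>x. f ((1 / \<epsilon>) *\<^sub>R x) * m \<epsilon> x * g x) - mu_average f * L2_inner \<rho>0 v g = L2_inner \<rho>0 v (r \<epsilon>)"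
    if "L2 \<rho>0 v" for v \<epsilon>
  proof -
    have "r \<epsilon> = (\<lambda>x. s \<epsilon> x * g x - mu_average f * g x)" unfolding r_def by (simp add: left_diff_distrib)
    then show ?thesis using L2_inner_diff_right[OF sg L2_cmult[OF g] that, of \<epsilon> "mu_average f"]
      by (simp add: L2_inner_cmult_right s_def)
  qed
  have lim: "((\<lambda>\<epsilon>. L2_inner \<rho>0 v (r \<epsilon>)) \<longlongrightarrow> 0) (at_right 0)" if v: "L2 \<rho>0 v" for v
  proof -
    have "((\<lambda>\<epsilon>. LINT x|lebesgue. (v x * g x * \<rho>0 x) * (f ((1 / \<epsilon>) *\<^sub>R x) * m \<epsilon> x)) \<longlongrightarrow> mu_average f * (LINT x|lebesgue. v x * g x * \<rho>0 x)) (at_right 0)"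
      by (rule weak_star[OF f L2_prod[OF v g]])
    moreover have "(LINT x|lebesgue. (v x * g x * \<rho>0 x) * (f ((1 / \<epsilon>) *\<^sub>R x) * m \<epsilon> x)) = L2_inner \<rho>0 v (\<lambda>x. f ((1 / \<epsilon>) *\<^sub>R x) * m \<epsilon> x * g x)" for \<epsilon>
      unfolding L2_inner_def by (simp add: mult_ac)
    ultimately have "((\<lambda>\<epsilon>. L2_inner \<rho>0 v (\<lambda>x. f ((1 / \<epsilon>) *\<^sub>R x) * m \<epsilon> x * g x)) \<longlongrightarrow> mu_average f * L2_inner \<rho>0 v g) (at_right 0)"
      by (simp add: L2_inner_def)
    from LIM_zero[OF this] show ?thesis unfolding split[OF v] .
  qed
  show ?thesis
  proof (rule tendstoI)
    fix e :: real assume e: "e > 0"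
    define e' where "e' = e / (K + 2)"
    have e': "e' > 0" unfolding e'_def using e K0 by simp
    obtain N :: nat and h B where h: "\<And>n. n < N \<Longrightarrow> L2 \<rho>0 (h n)" and
      ev: "\<forall>\<^sub>F \<epsilon> in at_right 0. L2 \<rho>0 (u \<epsilon>) \<and> (\<exists>c. (\<forall>n<N. \<bar>c n\<bar> \<le> B) \<and> L2_norm \<rho>0 (\<lambda>x. u \<epsilon> x - (\<Sum>n<N. c n * h n x)) \<le> e')"
      using u e' unfolding totally_bounded_family_def by meson
    have "((\<lambda>\<epsilon>. \<Sum>n<N. \<bar>B\<bar> * \<bar>L2_inner \<rho>0 (h n) (r \<epsilon>)\<bar>) \<longlongrightarrow> (\<Sum>n<N. \<bar>B\<bar> * \<bar>0\<bar>)) (at_right 0)"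
      by (intro tendsto_sum tendsto_mult tendsto_const tendsto_rabs lim h) simp
    then have "\<forall>\<^sub>F \<epsilon> in at_right 0. (\<Sum>n<N. \<bar>B\<bar> * \<bar>L2_inner \<rho>0 (h n) (r \<epsilon>)\<bar>) < e'"
      using e' by (intro order_tendstoD(2)) auto
    with ev show "\<forall>\<^sub>F \<epsilon> in at_right 0. dist (L2_inner \<rho>0 (u \<epsilon>) (\<lambda>x. f ((1 / \<epsilon>) *\<^sub>R x) * m \<epsilon> x * g x) - mu_average f * L2_inner \<rho>0 (u \<epsilon>) g) 0 < e"
    proof eventually_elim
      case (elim \<epsilon>)
      then have uL: "L2 \<rho>0 (u \<epsilon>)" by blast
      obtain c where c: "\<And>n. n < N \<Longrightarrow> \<bar>c n\<bar> \<le> B" "L2_norm \<rho>0 (\<lambda>x. u \<epsilon> x - (\<Sum>n<N. c n * h n x)) \<le> e'"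
        using elim by blast
      define S where "S x = (\<Sum>n<N. c n * h n x)" for x
      have SL: "L2 \<rho>0 S" unfolding S_def[abs_def] using h by (intro L2_sum L2_cmult) auto
      have SI: "L2_inner \<rho>0 S (r \<epsilon>) = (\<Sum>n<N. c n * L2_inner \<rho>0 (h n) (r \<epsilon>))"
        unfolding S_def[abs_def] using L2_inner_sum_left[of "{..<N}" "\<lambda>n x. c n * h n x" "r \<epsilon>"] h rL
        by (simp add: L2_cmult L2_inner_cmult_left)
      have "\<bar>L2_inner \<rho>0 S (r \<epsilon>)\<bar> \<le> (\<Sum>n<N. \<bar>B\<bar> * \<bar>L2_inner \<rho>0 (h n) (r \<epsilon>)\<bar>)"
        unfolding SI
      proof (rule order_trans[OF sum_abs sum_mono])
        fix n assume "n \<in> {..<N}"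
        then have "\<bar>c n\<bar> \<le> \<bar>B\<bar>" using c(1)[of n] by simp
        then show "\<bar>c n * L2_inner \<rho>0 (h n) (r \<epsilon>)\<bar> \<le> \<bar>B\<bar> * \<bar>L2_inner \<rho>0 (h n) (r \<epsilon>)\<bar>"
          unfolding abs_mult by (rule mult_right_mono) simp
      qed
      then have 1: "\<bar>L2_inner \<rho>0 S (r \<epsilon>)\<bar> < e'" using elim by linarith
      have "\<bar>L2_inner \<rho>0 (\<lambda>x. u \<epsilon> x - S x) (r \<epsilon>)\<bar> \<le> L2_norm \<rho>0 (\<lambda>x. u \<epsilon> x - S x) * L2_norm \<rho>0 (r \<epsilon>)"
        by (rule L2_CS[OF L2_diff[OF uL SL] rL])
      also have "\<dots> \<le> e' * K" using c(2) e' by (intro mult_mono rK L2_norm_nonneg) (auto simp: S_def)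
      finally have 2: "\<bar>L2_inner \<rho>0 (\<lambda>x. u \<epsilon> x - S x) (r \<epsilon>)\<bar> \<le> e' * K" .
      have "L2_inner \<rho>0 (u \<epsilon>) (r \<epsilon>) = L2_inner \<rho>0 (\<lambda>x. u \<epsilon> x - S x) (r \<epsilon>) + L2_inner \<rho>0 S (r \<epsilon>)"
        using uL SL rL by (simp add: L2_inner_diff_left)
      then have "\<bar>L2_inner \<rho>0 (u \<epsilon>) (r \<epsilon>)\<bar> < e' * K + e'" using 1 2 by linarith
      also have "\<dots> \<le> e' * (K + 2)" using e' by (simp add: algebra_simps)
      also have "\<dots> = e" unfolding e'_def using K0 by simp
      finally show ?case unfolding split[OF uL] by simp
    qed
  qed
qed

end

section \<open>Convergence of the forms\<close>

context weight
begin

lemma L2_norm_sum: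
  assumes "\<And>i. i \<in> I \<Longrightarrow> L2 \<rho> (f i)"
  shows "L2_norm \<rho> (\<lambda>x. \<Sum>i\<in>I. f i x) \<le> (\<Sum>i\<in>I. L2_norm \<rho> (f i))"
  using assms
proof (induction I rule: infinite_finite_induct)
  case (insert a I)
  have "L2_norm \<rho> (\<lambda>x. f a x + (\<Sum>i\<in>I. f i x)) \<le> L2_norm \<rho> (f a) + L2_norm \<rho> (\<lambda>x. \<Sum>i\<in>I. f i x)"
    using insert by (intro L2_norm_triangle L2_sum) auto
  with insert show ?case by simp
qed (simp_all add: L2_norm_def L2_inner_zero_left)

lemma grad_norm_diff_test:
  assumes u: "H1 \<rho> u" and \<psi>: "test_function \<psi>"
  shows "grad_norm (\<lambda>x. u x - \<psi> x) = (\<Sum>i\<in>UNIV. L2_norm \<rho> (\<lambda>x. wpartial i u x - partial i \<psi> x))"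
  unfolding grad_norm_def
proof (rule sum.cong[OF refl])
  fix i
  note \<psi>1 = H1_test[OF \<psi>]
  have d: "H1 \<rho> (\<lambda>x. 1 * u x + (- 1) * \<psi> x)" "AE x in lebesgue. wpartial i (\<lambda>x. 1 * u x + (- 1) * \<psi> x) x = 1 * wpartial i u x + (- 1) * wpartial i \<psi> x"
    by (rule H1_linear[OF u \<psi>1(1)])+
  have "AE x in lebesgue. wpartial i (\<lambda>x. u x - \<psi> x) x = wpartial i u x - partial i \<psi> x"
    using d(2) \<psi>1(2)[of i] by eventually_elim simp
  then show "L2_norm \<rho> (wpartial i (\<lambda>x. u x - \<psi> x)) = L2_norm \<rho> (\<lambda>x. wpartial i u x - partial i \<psi> x)"
    by (intro L2_norm_cong_AE H1_D(3) H1_diff u \<psi>1(1) L2_diff L2_test test_function_partial \<psi>)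
qed

lemma density_grad_norm:
  assumes u: "H1 \<rho> u" and e: "e > 0"
  shows "\<exists>\<psi>. test_function \<psi> \<and> L2_norm \<rho> (\<lambda>x. u x - \<psi> x) < e \<and> grad_norm (\<lambda>x. u x - \<psi> x) < e"
proof -
  define e' where "e' = e / real (CARD('d) + 1)"
  have e': "e' > 0" unfolding e'_def using e by simp
  have le: "e' \<le> e" unfolding e'_def using e by (simp add: divide_le_eq)
  obtain \<psi> where \<psi>: "test_function \<psi>" "L2_norm \<rho> (\<lambda>x. u x - \<psi> x) < e'" "\<And>i. L2_norm \<rho> (\<lambda>x. wpartial i u x - partial i \<psi> x) < e'"
    using test_functions_dense[OF u e'] by blast
  have "grad_norm (\<lambda>x. u x - \<psi> x) \<le> (\<Sum>i\<in>(UNIV :: 'd set). e')"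
    unfolding grad_norm_diff_test[OF u \<psi>(1)] by (intro sum_mono less_imp_le \<psi>(3))
  also have "\<dots> = real CARD('d) * e'" by simp
  also have "\<dots> < real (CARD('d) + 1) * e'" using e' by simp
  also have "\<dots> = e" unfolding e'_def by simp
  finally show ?thesis using \<psi>(1,2) le by (intro exI[of _ \<psi>]) auto
qed

lemma density_sequence:
  assumes u: "H1 \<rho> u"
  shows "\<exists>\<psi>. (\<forall>n::nat. test_function (\<psi> n)) \<and> (\<lambda>n. L2_norm \<rho> (\<lambda>x. u x - \<psi> n x)) \<longlonglongrightarrow> 0 \<and>
     (\<lambda>n. grad_norm (\<lambda>x. u x - \<psi> n x)) \<longlonglongrightarrow> 0"
proof -
  have "\<exists>\<psi>. test_function \<psi> \<and> L2_norm \<rho> (\<lambda>x. u x - \<psi> x) < inverse (real (Suc n)) \<and> grad_norm (\<lambda>x. u x - \<psi> x) < inverse (real (Suc n))" for n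
    by (rule density_grad_norm[OF u]) simp
  then obtain \<psi> where \<psi>: "\<And>n. test_function (\<psi> n)" "\<And>n. L2_norm \<rho> (\<lambda>x. u x - \<psi> n x) < inverse (real (Suc n))"
      "\<And>n. grad_norm (\<lambda>x. u x - \<psi> n x) < inverse (real (Suc n))"
    by metis
  have "(\<lambda>n. L2_norm \<rho> (\<lambda>x. u x - \<psi> n x)) \<longlonglongrightarrow> 0"
    by (rule tendsto_sandwich[OF _ _ tendsto_const LIMSEQ_inverse_real_of_nat])
       (use \<psi>(2) in \<open>auto intro!: always_eventually simp: L2_norm_nonneg less_imp_le\<close>)
  moreover have "(\<lambda>n. grad_norm (\<lambda>x. u x - \<psi> n x)) \<longlonglongrightarrow> 0"
    by (rule tendsto_sandwich[OF _ _ tendsto_const LIMSEQ_inverse_real_of_nat])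
       (use \<psi>(3) in \<open>auto intro!: always_eventually simp: grad_norm_nonneg less_imp_le\<close>)
  ultimately show ?thesis using \<psi>(1) by blast
qed

lemma L2_inner_tendsto:
  assumes u: "\<forall>\<^sub>F a in F. L2 \<rho> (u a)" and v: "L2 \<rho> v" and l: "((\<lambda>a. L2_norm \<rho> (\<lambda>x. u a x - v x)) \<longlongrightarrow> 0) F" and g: "L2 \<rho> g"
  shows "((\<lambda>a. L2_inner \<rho> (u a) g) \<longlongrightarrow> L2_inner \<rho> v g) F"
proof (rule Lim_transform2[OF tendsto_const])
  have "((\<lambda>a. L2_norm \<rho> (\<lambda>x. u a x - v x) * L2_norm \<rho> g) \<longlongrightarrow> 0) F" using tendsto_mult_left_zero[OF l] .
  then have "((\<lambda>a. L2_inner \<rho> (u a) g - L2_inner \<rho> v g) \<longlongrightarrow> 0) F"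
  proof (rule Lim_null_comparison[rotated])
    show "\<forall>\<^sub>F a in F. norm (L2_inner \<rho> (u a) g - L2_inner \<rho> v g) \<le> L2_norm \<rho> (\<lambda>x. u a x - v x) * L2_norm \<rho> g"
      using u
    proof eventually_elim
      case (elim a)
      have "L2_inner \<rho> (u a) g - L2_inner \<rho> v g = L2_inner \<rho> (\<lambda>x. u a x - v x) g"
        using elim v g by (simp add: L2_inner_diff_left)
      then show ?case using L2_CS[OF L2_diff[OF elim v] g] by simp
    qed
  qed
  then show "((\<lambda>a. L2_inner \<rho> v g - L2_inner \<rho> (u a) g) \<longlongrightarrow> 0) F"
    using tendsto_minus[of "\<lambda>a. L2_inner \<rho> (u a) g - L2_inner \<rho> v g" 0 F] by simp
qed

lemma wform_tendsto:
  assumes u: "H1 \<rho> u" "\<And>n. H1 \<rho> (a n)" "((\<lambda>n. grad_norm (\<lambda>x. u x - a n x)) \<longlongrightarrow> 0) F"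
    and v: "H1 \<rho> v" "\<And>n. H1 \<rho> (b n)" "((\<lambda>n. grad_norm (\<lambda>x. v x - b n x)) \<longlongrightarrow> 0) F"
  shows "((\<lambda>n. wform A \<rho> (a n) (b n)) \<longlongrightarrow> wform A \<rho> u v) F"
proof -
  define K where "K = (\<Sum>i\<in>UNIV. \<Sum>j\<in>UNIV. \<bar>A $ i $ j\<bar>)"
  define s t where "s n = grad_norm (\<lambda>x. u x - a n x)" and "t n = grad_norm (\<lambda>x. v x - b n x)" for n
  have eq: "wform A \<rho> u v - wform A \<rho> (a n) (b n) = wform A \<rho> (\<lambda>x. u x - a n x) v + wform A \<rho> u (\<lambda>x. v x - b n x)
      - wform A \<rho> (\<lambda>x. u x - a n x) (\<lambda>x. v x - b n x)" for n
    using u v by (simp add: wform_diff_left wform_diff_right H1_diff)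
  have bd: "\<bar>wform A \<rho> u v - wform A \<rho> (a n) (b n)\<bar> \<le> K * s n * grad_norm v + K * grad_norm u * t n + K * s n * t n" for n
    unfolding eq using wform_bound[OF H1_diff[OF u(1) u(2)[of n]] v(1), of A]
      wform_bound[OF u(1) H1_diff[OF v(1) v(2)[of n]], of A]
      wform_bound[OF H1_diff[OF u(1) u(2)[of n]] H1_diff[OF v(1) v(2)[of n]], of A]
    unfolding K_def[symmetric] s_def t_def by linarith
  have "((\<lambda>n. K * s n * grad_norm v + K * grad_norm u * t n + K * s n * t n) \<longlongrightarrow> K * 0 * grad_norm v + K * grad_norm u * 0 + K * 0 * 0) F"
    using u(3) v(3) unfolding s_def t_def by (intro tendsto_intros)
  then have lim0: "((\<lambda>n. K * s n * grad_norm v + K * grad_norm u * t n + K * s n * t n) \<longlongrightarrow> 0) F" by simp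
  have "((\<lambda>n. wform A \<rho> u v - wform A \<rho> (a n) (b n)) \<longlongrightarrow> 0) F"
    by (rule Lim_null_comparison[OF _ lim0]) (use bd in \<open>auto intro!: always_eventually\<close>)
  then show ?thesis by (rule Lim_transform2[OF tendsto_const])
qed

text \<open>A limit relation that is linear in the test function extends from a dense set by uniform bounds.
  It is used with the eigenvalues for \<open>s\<close> and \<open>v = 0\<close> to pass to the limit in the eigenvalue
  equation, and with \<open>s = 0\<close> and the identity matrix to prove weak convergence.\<close>

lemma limit_equation_by_density:
  assumes u: "\<forall>\<^sub>F a in F. H1 \<rho> (u a) \<and> grad_norm (u a) \<le> G \<and> L2_norm \<rho> (u a) \<le> G \<and> \<bar>s a\<bar> \<le> G" and v: "H1 \<rho> v"
    and t: "\<And>\<psi>. test_function \<psi> \<Longrightarrow> ((\<lambda>a. wform A \<rho> (u a) \<psi> - s a * L2_inner \<rho> (u a) \<psi> - wform A \<rho> v \<psi>) \<longlongrightarrow> 0) F"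
    and \<phi>: "H1 \<rho> \<phi>"
  shows "((\<lambda>a. wform A \<rho> (u a) \<phi> - s a * L2_inner \<rho> (u a) \<phi> - wform A \<rho> v \<phi>) \<longlongrightarrow> 0) F"
proof (rule tendstoI)
  fix e :: real assume e: "e > 0"
  define K where "K = (\<Sum>i\<in>UNIV. \<Sum>j\<in>UNIV. \<bar>A $ i $ j\<bar>)"
  have K0: "K \<ge> 0" unfolding K_def by (intro sum_nonneg) auto
  define H where "H = K * \<bar>G\<bar> + \<bar>G\<bar> * \<bar>G\<bar> + K * grad_norm v"
  have H0: "H \<ge> 0" unfolding H_def using K0 by (simp add: grad_norm_nonneg)
  define e' where "e' = e / (H + 2)"
  have e': "e' > 0" unfolding e'_def using e H0 by simp
  obtain \<psi> where \<psi>: "test_function \<psi>" "L2_norm \<rho> (\<lambda>x. \<phi> x - \<psi> x) < e'" "grad_norm (\<lambda>x. \<phi> x - \<psi> x) < e'"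
    using density_grad_norm[OF \<phi> e'] by blast
  note \<psi>1 = H1_test(1)[OF \<psi>(1)]
  have dH: "H1 \<rho> (\<lambda>x. \<phi> x - \<psi> x)" by (rule H1_diff[OF \<phi> \<psi>1])
  have ev: "\<forall>\<^sub>F a in F. \<bar>wform A \<rho> (u a) \<psi> - s a * L2_inner \<rho> (u a) \<psi> - wform A \<rho> v \<psi>\<bar> < e'"
    using tendstoD[OF t[OF \<psi>(1)] e'] by simp
  show "\<forall>\<^sub>F a in F. dist (wform A \<rho> (u a) \<phi> - s a * L2_inner \<rho> (u a) \<phi> - wform A \<rho> v \<phi>) 0 < e"
    using ev u
  proof eventually_elim
    case (elim a)
    then have ua: "H1 \<rho> (u a)" by simp
    define d where "d x = \<phi> x - \<psi> x" for x
    have dH': "H1 \<rho> d" using dH by (simp add: d_def[abs_def])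
    have dn: "L2_norm \<rho> d < e'" "grad_norm d < e'" using \<psi>(2,3) by (simp_all add: d_def[abs_def])
    have e1: "wform A \<rho> (u a) d = wform A \<rho> (u a) \<phi> - wform A \<rho> (u a) \<psi>"
      unfolding d_def[abs_def] by (rule wform_diff_right[OF \<phi> \<psi>1 ua])
    have e2: "wform A \<rho> v d = wform A \<rho> v \<phi> - wform A \<rho> v \<psi>"
      unfolding d_def[abs_def] by (rule wform_diff_right[OF \<phi> \<psi>1 v])
    have e3: "L2_inner \<rho> (u a) d = L2_inner \<rho> (u a) \<phi> - L2_inner \<rho> (u a) \<psi>"
      unfolding d_def[abs_def] by (rule L2_inner_diff_right[OF H1_D(1)[OF \<phi>] H1_D(1)[OF \<psi>1] H1_D(1)[OF ua]])
    have eq: "wform A \<rho> (u a) \<phi> - s a * L2_inner \<rho> (u a) \<phi> - wform A \<rho> v \<phi> =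
       (wform A \<rho> (u a) \<psi> - s a * L2_inner \<rho> (u a) \<psi> - wform A \<rho> v \<psi>)
       + wform A \<rho> (u a) d - s a * L2_inner \<rho> (u a) d - wform A \<rho> v d"
      unfolding e1 e2 e3 by (simp add: right_diff_distrib)
    have g: "grad_norm (u a) \<le> \<bar>G\<bar>" "L2_norm \<rho> (u a) \<le> \<bar>G\<bar>" "\<bar>s a\<bar> \<le> \<bar>G\<bar>" using elim by auto
    have 1: "\<bar>wform A \<rho> (u a) d\<bar> \<le> K * \<bar>G\<bar> * e'"
    proof -
      have "\<bar>wform A \<rho> (u a) d\<bar> \<le> K * grad_norm (u a) * grad_norm d" using wform_bound[OF ua dH', of A] by (simp add: K_def)
      also have "\<dots> \<le> K * \<bar>G\<bar> * e'" using g(1) dn K0 by (intro mult_mono mult_nonneg_nonneg) (auto simp: grad_norm_nonneg)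
      finally show ?thesis .
    qed
    have 2: "\<bar>s a * L2_inner \<rho> (u a) d\<bar> \<le> \<bar>G\<bar> * \<bar>G\<bar> * e'"
    proof -
      have "\<bar>L2_inner \<rho> (u a) d\<bar> \<le> L2_norm \<rho> (u a) * L2_norm \<rho> d" by (rule L2_CS[OF H1_D(1)[OF ua] H1_D(1)[OF dH']])
      also have "\<dots> \<le> \<bar>G\<bar> * e'" using g(2) dn by (intro mult_mono) (auto simp: L2_norm_nonneg)
      finally have "\<bar>s a\<bar> * \<bar>L2_inner \<rho> (u a) d\<bar> \<le> \<bar>G\<bar> * (\<bar>G\<bar> * e')" using g(3) by (intro mult_mono) auto
      then show ?thesis by (simp add: abs_mult mult.assoc)
    qed
    have 3: "\<bar>wform A \<rho> v d\<bar> \<le> K * grad_norm v * e'"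
    proof -
      have "\<bar>wform A \<rho> v d\<bar> \<le> K * grad_norm v * grad_norm d" using wform_bound[OF v dH', of A] by (simp add: K_def)
      also have "\<dots> \<le> K * grad_norm v * e'" using dn K0 by (intro mult_left_mono mult_nonneg_nonneg) (auto simp: grad_norm_nonneg)
      finally show ?thesis .
    qed
    have "\<bar>wform A \<rho> (u a) \<phi> - s a * L2_inner \<rho> (u a) \<phi> - wform A \<rho> v \<phi>\<bar> < e' + K * \<bar>G\<bar> * e' + \<bar>G\<bar> * \<bar>G\<bar> * e' + K * grad_norm v * e'"
      unfolding eq using 1 2 3 elim by linarith
    also have "\<dots> = (H + 1) * e'" by (simp add: H_def algebra_simps)
    also have "\<dots> \<le> (H + 2) * e'" using e' by simp
    also have "\<dots> = e" unfolding e'_def using H0 by simp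
    finally show ?case by simp
  qed
qed

end

context homog
begin

lemma Phi_bound: "\<exists>b. \<forall>i y. \<bar>\<Phi> y $ i\<bar> \<le> b i"
proof -
  have "\<exists>B. \<forall>y. \<bar>\<Phi> y $ i\<bar> \<le> B" for i
    using periodic_bounded[OF Phi_comp_periodic L Phi_cont] by metis
  then show ?thesis by metis
qed

lemma cell_flux_bound: "\<exists>b. \<forall>i j y. \<bar>cell_flux i j y\<bar> \<le> b i j"
proof -
  have "\<exists>B. \<forall>y. \<bar>cell_flux i j y\<bar> \<le> B" for i j
    using periodic_bounded[OF cell_flux_periodic L cell_flux_continuous] by metis
  then show ?thesis by metis
qed

lemma eventually_small_scale: "\<forall>\<^sub>F \<epsilon> in at_right (0::real). 0 < \<epsilon> \<and> \<epsilon> < 1"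
  using eventually_at_right_real[of 0 "1::real"] by (auto elim: eventually_mono)

lemma scale_tendsto_0: "((\<lambda>\<epsilon>::real. \<epsilon> * c) \<longlongrightarrow> 0) (at_right 0)"
  by (rule tendsto_mult_left_zero) (rule tendsto_ident_at)

text \<open>In the formula \<open>flux\<close> the first sum converges by \<open>oscillation\<close>, entry by entry, to the homogenized
  form integrated by parts; the second sum is bounded and carries the factor \<open>\<epsilon>\<close>.\<close>

lemma form_convergence:
  assumes pc: "totally_bounded_family u" and u: "\<forall>\<^sub>F \<epsilon> in at_right 0. H1 \<rho>0 (u \<epsilon>) \<and> grad_norm (u \<epsilon>) \<le> G" and \<psi>: "test_function \<psi>"
  shows "((\<lambda>\<epsilon>. wform (mat \<sigma>) (\<rho>e \<epsilon>) (u \<epsilon>) (corrector \<epsilon> \<psi>) - wform Sig \<rho>0 (u \<epsilon>) \<psi>) \<longlongrightarrow> 0) (at_right 0)"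
proof -
  obtain b where b: "\<And>i y. \<bar>\<Phi> y $ i\<bar> \<le> b i" using Phi_bound by blast
  define X where "X i j \<epsilon> = L2_inner \<rho>0 (u \<epsilon>) (\<lambda>x. cell_flux i j ((1 / \<epsilon>) *\<^sub>R x) * m \<epsilon> x * wpartial2 \<psi> i j x) - mu_average (cell_flux i j) * L2_inner \<rho>0 (u \<epsilon>) (wpartial2 \<psi> i j)" for i j \<epsilon>
  define Y where "Y i j \<epsilon> = L2_inner \<rho>0 (wpartial j (u \<epsilon>)) (\<lambda>x. \<Phi> ((1 / \<epsilon>) *\<^sub>R x) $ i * m \<epsilon> x * partial j (partial i \<psi>) x)" for i j \<epsilon>
  have X: "(X i j \<longlongrightarrow> 0) (at_right 0)" for i j
    unfolding X_def[abs_def] by (rule oscillation[OF pc cell_flux_periodic cell_flux_continuous L2_wpartial2[OF \<psi>]])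
  have Y: "((\<lambda>\<epsilon>. \<epsilon> * Y i j \<epsilon>) \<longlongrightarrow> 0) (at_right 0)" for i j
  proof (rule Lim_null_comparison[OF _ scale_tendsto_0])
    show "\<forall>\<^sub>F \<epsilon> in at_right 0. norm (\<epsilon> * Y i j \<epsilon>) \<le> \<epsilon> * (\<bar>G\<bar> * (b i * ratio_max * L2_norm \<rho>0 (partial j (partial i \<psi>))))"
      using u eventually_small_scale
    proof eventually_elim
      case (elim \<epsilon>)
      have bi: "b i \<ge> 0" using b[of 0 i] by linarith
      have p2: "L2 \<rho>0 (partial j (partial i \<psi>))" using L2_test test_function_partial \<psi> by blast
      have c: "continuous_on UNIV (\<lambda>x. \<Phi> ((1 / \<epsilon>) *\<^sub>R x) $ i * m \<epsilon> x)" by (intro continuous_intros scaled_cont[OF Phi_cont] m_cont)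
      have bb: "\<bar>\<Phi> ((1 / \<epsilon>) *\<^sub>R x) $ i * m \<epsilon> x\<bar> \<le> b i * ratio_max" for x
        unfolding abs_mult using bi by (intro mult_mono b m_abs) auto
      note y = L2_mult_bounded[OF p2 continuous_lebesgue_measurable(1)[OF c] bb]
      have "\<bar>Y i j \<epsilon>\<bar> \<le> L2_norm \<rho>0 (wpartial j (u \<epsilon>)) * L2_norm \<rho>0 (\<lambda>x. \<Phi> ((1 / \<epsilon>) *\<^sub>R x) $ i * m \<epsilon> x * partial j (partial i \<psi>) x)"
        unfolding Y_def using elim y(1) by (intro L2_CS H1_D(3)) auto
      also have "\<dots> \<le> \<bar>G\<bar> * (b i * ratio_max * L2_norm \<rho>0 (partial j (partial i \<psi>)))"
        using elim wpartial_le_grad_norm[where i=j and u="u \<epsilon>"] y(2) by (intro mult_mono) (auto simp: L2_norm_nonneg)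
      finally show ?case using elim by (simp add: abs_mult)
    qed
  qed
  have lim: "((\<lambda>\<epsilon>. - (\<Sum>i\<in>UNIV. \<Sum>j\<in>UNIV. \<sigma> * X i j \<epsilon>) + (\<Sum>i\<in>UNIV. \<Sum>j\<in>UNIV. \<sigma> * (\<epsilon> * Y i j \<epsilon>))) \<longlongrightarrow>
     - (\<Sum>i\<in>(UNIV::'d set). \<Sum>j\<in>(UNIV::'d set). \<sigma> * 0) + (\<Sum>i\<in>(UNIV::'d set). \<Sum>j\<in>(UNIV::'d set). \<sigma> * 0)) (at_right 0)"
    by (intro tendsto_intros X Y)
  have "\<forall>\<^sub>F \<epsilon> in at_right 0. - (\<Sum>i\<in>UNIV. \<Sum>j\<in>UNIV. \<sigma> * X i j \<epsilon>) + (\<Sum>i\<in>UNIV. \<Sum>j\<in>UNIV. \<sigma> * (\<epsilon> * Y i j \<epsilon>)) =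
     wform (mat \<sigma>) (\<rho>e \<epsilon>) (u \<epsilon>) (corrector \<epsilon> \<psi>) - wform Sig \<rho>0 (u \<epsilon>) \<psi>"
    using u eventually_small_scale
  proof eventually_elim
    case (elim \<epsilon>)
    then have uH: "H1 \<rho>0 (u \<epsilon>)" and \<epsilon>: "\<epsilon> > 0" by auto
    have "wform (mat \<sigma>) (\<rho>e \<epsilon>) (u \<epsilon>) (corrector \<epsilon> \<psi>) = - (\<Sum>i\<in>UNIV. \<Sum>j\<in>UNIV. \<sigma> * (X i j \<epsilon> + mu_average (cell_flux i j) * L2_inner \<rho>0 (u \<epsilon>) (wpartial2 \<psi> i j))) + \<epsilon> * (\<Sum>i\<in>UNIV. \<Sum>j\<in>UNIV. \<sigma> * Y i j \<epsilon>)"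
      unfolding flux[OF uH \<psi> \<epsilon>] X_def Y_def by simp
    moreover have "wform Sig \<rho>0 (u \<epsilon>) \<psi> = - (\<Sum>i\<in>UNIV. \<Sum>j\<in>UNIV. \<sigma> * mu_average (cell_flux i j) * L2_inner \<rho>0 (u \<epsilon>) (wpartial2 \<psi> i j))"
      unfolding wform_parts[OF uH \<psi>] Sig_entry ..
    ultimately show ?case
      by (simp add: distrib_left sum.distrib sum_distrib_left mult_ac)
  qed
  then show ?thesis using lim by (simp add: tendsto_cong)
qed

definition corrector_term where "corrector_term \<epsilon> \<psi> x = (\<Sum>i\<in>UNIV. \<Phi> ((1 / \<epsilon>) *\<^sub>R x) $ i * partial i \<psi> x)"

lemma corrector_eq: "corrector \<epsilon> \<psi> x = \<psi> x + \<epsilon> * corrector_term \<epsilon> \<psi> x"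
  by (simp add: corrector_def corrector_term_def)

lemma corrector_term_bound:
  assumes \<psi>: "test_function \<psi>"
  shows "\<exists>C\<ge>0. \<forall>\<epsilon>. L2 \<rho>0 (corrector_term \<epsilon> \<psi>) \<and> L2_norm \<rho>0 (corrector_term \<epsilon> \<psi>) \<le> C"
proof -
  obtain b where b: "\<And>i y. \<bar>\<Phi> y $ i\<bar> \<le> b i" using Phi_bound by blast
  have p2: "L2 \<rho>0 (partial i \<psi>)" for i using L2_test test_function_partial \<psi> by blast
  note t = L2_mult_bounded[OF p2 continuous_lebesgue_measurable(1)[OF scaled_cont[OF Phi_cont]] b]
  define C where "C = (\<Sum>i\<in>UNIV. b i * L2_norm \<rho>0 (partial i \<psi>))"
  have bi: "b i \<ge> 0" for i using b[of 0 i] by linarith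
  have "L2 \<rho>0 (corrector_term \<epsilon> \<psi>) \<and> L2_norm \<rho>0 (corrector_term \<epsilon> \<psi>) \<le> C" for \<epsilon>
  proof
    show "L2 \<rho>0 (corrector_term \<epsilon> \<psi>)" unfolding corrector_term_def[abs_def] by (intro L2_sum t(1))
    have "L2_norm \<rho>0 (corrector_term \<epsilon> \<psi>) \<le> (\<Sum>i\<in>UNIV. L2_norm \<rho>0 (\<lambda>x. \<Phi> ((1 / \<epsilon>) *\<^sub>R x) $ i * partial i \<psi> x))"
      unfolding corrector_term_def[abs_def] by (intro L2_norm_sum t(1))
    also have "\<dots> \<le> C" unfolding C_def by (intro sum_mono t(2))
    finally show "L2_norm \<rho>0 (corrector_term \<epsilon> \<psi>) \<le> C" .
  qed
  moreover have "C \<ge> 0" unfolding C_def using bi by (intro sum_nonneg mult_nonneg_nonneg L2_norm_nonneg)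
  ultimately show ?thesis by blast
qed

lemma mu_average_one: "mu_average (\<lambda>_. 1) = 1" unfolding mu_average_def using cellint_w_pos by simp

lemma periodic_const: "periodic L (\<lambda>_. c)" unfolding periodic_def by simp

lemma mass_convergence:
  assumes pc: "totally_bounded_family u" and u: "\<forall>\<^sub>F \<epsilon> in at_right 0. L2 \<rho>0 (u \<epsilon>) \<and> L2_norm \<rho>0 (u \<epsilon>) \<le> G" and \<psi>: "test_function \<psi>"
  shows "((\<lambda>\<epsilon>. L2_inner (\<rho>e \<epsilon>) (u \<epsilon>) (corrector \<epsilon> \<psi>) - L2_inner \<rho>0 (u \<epsilon>) \<psi>) \<longlongrightarrow> 0) (at_right 0)"
proof -
  obtain C where C: "C \<ge> 0" "\<And>\<epsilon>. L2 \<rho>0 (corrector_term \<epsilon> \<psi>)" "\<And>\<epsilon>. L2_norm \<rho>0 (corrector_term \<epsilon> \<psi>) \<le> C" using corrector_term_bound[OF \<psi>] by blast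
  note md = L2_mult_bounded[OF C(2) m_meas m_abs]
  define X where "X \<epsilon> = L2_inner \<rho>0 (u \<epsilon>) (\<lambda>x. 1 * m \<epsilon> x * \<psi> x) - mu_average (\<lambda>_. 1) * L2_inner \<rho>0 (u \<epsilon>) \<psi>" for \<epsilon>
  define Y where "Y \<epsilon> = L2_inner \<rho>0 (u \<epsilon>) (\<lambda>x. m \<epsilon> x * corrector_term \<epsilon> \<psi> x)" for \<epsilon>
  have X: "(X \<longlongrightarrow> 0) (at_right 0)" unfolding X_def[abs_def]
    by (rule oscillation[OF pc periodic_const continuous_on_const L2_test[OF \<psi>]])
  have Y: "((\<lambda>\<epsilon>. \<epsilon> * Y \<epsilon>) \<longlongrightarrow> 0) (at_right 0)"
  proof (rule Lim_null_comparison[OF _ scale_tendsto_0])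
    show "\<forall>\<^sub>F \<epsilon> in at_right 0. norm (\<epsilon> * Y \<epsilon>) \<le> \<epsilon> * (\<bar>G\<bar> * (ratio_max * C))"
      using u eventually_small_scale
    proof eventually_elim
      case (elim \<epsilon>)
      have "\<bar>Y \<epsilon>\<bar> \<le> L2_norm \<rho>0 (u \<epsilon>) * L2_norm \<rho>0 (\<lambda>x. m \<epsilon> x * corrector_term \<epsilon> \<psi> x)"
        unfolding Y_def using elim md(1) by (intro L2_CS) auto
      also have "\<dots> \<le> \<bar>G\<bar> * (ratio_max * C)"
        using elim order_trans[OF md(2) mult_left_mono[OF C(3)]] density_ratio_bounds(2) by (intro mult_mono) (auto simp: L2_norm_nonneg less_imp_le)
      finally show ?case using elim by (simp add: abs_mult)
    qed
  qed
  have lim: "((\<lambda>\<epsilon>. X \<epsilon> + \<epsilon> * Y \<epsilon>) \<longlongrightarrow> 0 + 0) (at_right 0)" by (rule tendsto_add[OF X Y])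
  have "\<forall>\<^sub>F \<epsilon> in at_right 0. X \<epsilon> + \<epsilon> * Y \<epsilon> = L2_inner (\<rho>e \<epsilon>) (u \<epsilon>) (corrector \<epsilon> \<psi>) - L2_inner \<rho>0 (u \<epsilon>) \<psi>"
    using u
  proof eventually_elim
    case (elim \<epsilon>)
    have m\<psi>: "L2 \<rho>0 (\<lambda>x. m \<epsilon> x * \<psi> x)" by (rule L2_mult_bounded(1)[OF L2_test[OF \<psi>] m_meas m_abs])
    have "(\<lambda>x. m \<epsilon> x * corrector \<epsilon> \<psi> x) = (\<lambda>x. m \<epsilon> x * \<psi> x + \<epsilon> * (m \<epsilon> x * corrector_term \<epsilon> \<psi> x))"
      by (simp add: corrector_eq distrib_left mult_ac)
    then have "L2_inner (\<rho>e \<epsilon>) (u \<epsilon>) (corrector \<epsilon> \<psi>) = L2_inner \<rho>0 (u \<epsilon>) (\<lambda>x. m \<epsilon> x * \<psi> x) + \<epsilon> * Y \<epsilon>"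
      unfolding L2_inner_eps Y_def using elim m\<psi> md(1) by (simp add: L2_inner_add_right L2_cmult L2_inner_cmult_right)
    then show ?case unfolding X_def mu_average_one by simp
  qed
  then show ?thesis using lim by (simp add: tendsto_cong)
qed

lemma corrector_L2_limit:
  assumes \<psi>: "test_function \<psi>"
  shows "((\<lambda>\<epsilon>. L2_norm \<rho>0 (\<lambda>x. corrector \<epsilon> \<psi> x - \<psi> x)) \<longlongrightarrow> 0) (at_right 0)"
proof -
  obtain C where C: "C \<ge> 0" "\<And>\<epsilon>. L2 \<rho>0 (corrector_term \<epsilon> \<psi>)" "\<And>\<epsilon>. L2_norm \<rho>0 (corrector_term \<epsilon> \<psi>) \<le> C" using corrector_term_bound[OF \<psi>] by blast
  show ?thesis
  proof (rule Lim_null_comparison[OF _ scale_tendsto_0[of C]])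
    show "\<forall>\<^sub>F \<epsilon> in at_right 0. norm (L2_norm \<rho>0 (\<lambda>x. corrector \<epsilon> \<psi> x - \<psi> x)) \<le> \<epsilon> * C"
      using eventually_small_scale
    proof eventually_elim
      case (elim \<epsilon>)
      have "L2_norm \<rho>0 (\<lambda>x. corrector \<epsilon> \<psi> x - \<psi> x) = \<epsilon> * L2_norm \<rho>0 (corrector_term \<epsilon> \<psi>)"
        using elim by (simp add: corrector_eq L2_norm_cmult)
      then show ?case using elim C(3)[of \<epsilon>] by (simp add: L2_norm_nonneg abs_mult mult_left_mono)
    qed
  qed
qed

lemma corrector_bounded:
  assumes \<psi>: "test_function \<psi>"
  shows "\<exists>G. \<forall>\<^sub>F \<epsilon> in at_right 0. H1 \<rho>0 (corrector \<epsilon> \<psi>) \<and> grad_norm (corrector \<epsilon> \<psi>) \<le> G \<and> L2_norm \<rho>0 (corrector \<epsilon> \<psi>) \<le> G"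
proof -
  obtain b where b: "\<And>i y. \<bar>\<Phi> y $ i\<bar> \<le> b i" using Phi_bound by blast
  obtain c where c: "\<And>i j y. \<bar>cell_flux i j y\<bar> \<le> c i j" using cell_flux_bound by blast
  obtain C where C: "C \<ge> 0" "\<And>\<epsilon>. L2 \<rho>0 (corrector_term \<epsilon> \<psi>)" "\<And>\<epsilon>. L2_norm \<rho>0 (corrector_term \<epsilon> \<psi>) \<le> C" using corrector_term_bound[OF \<psi>] by blast
  have p2: "L2 \<rho>0 (partial i \<psi>)" "L2 \<rho>0 (partial j (partial i \<psi>))" for i j using L2_test test_function_partial \<psi> by blast+
  note tq = L2_mult_bounded[OF p2(1) continuous_lebesgue_measurable(1)[OF scaled_cont[OF cell_flux_continuous]] c]
  note t\<Phi> = L2_mult_bounded[OF p2(2) continuous_lebesgue_measurable(1)[OF scaled_cont[OF Phi_cont]] b]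
  define Gj where "Gj j = (\<Sum>i\<in>UNIV. c i j * L2_norm \<rho>0 (partial i \<psi>)) + (\<Sum>i\<in>UNIV. b i * L2_norm \<rho>0 (partial j (partial i \<psi>)))" for j
  have gj: "L2_norm \<rho>0 (wpartial j (corrector \<epsilon> \<psi>)) \<le> Gj j" if \<epsilon>: "0 < \<epsilon> \<and> \<epsilon> < 1" for \<epsilon> j
  proof -
    define X where "X x = (\<Sum>i\<in>UNIV. cell_flux i j ((1 / \<epsilon>) *\<^sub>R x) * partial i \<psi> x)" for x
    define Y where "Y x = (\<Sum>i\<in>UNIV. \<Phi> ((1 / \<epsilon>) *\<^sub>R x) $ i * partial j (partial i \<psi>) x)" for x
    have X2: "L2 \<rho>0 X" unfolding X_def[abs_def] by (intro L2_sum tq(1))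
    have Y2: "L2 \<rho>0 Y" unfolding Y_def[abs_def] by (intro L2_sum t\<Phi>(1))
    have Xn: "L2_norm \<rho>0 X \<le> (\<Sum>i\<in>UNIV. c i j * L2_norm \<rho>0 (partial i \<psi>))"
      unfolding X_def[abs_def] by (rule order_trans[OF L2_norm_sum[OF tq(1)] sum_mono[OF tq(2)]])
    have Yn: "L2_norm \<rho>0 Y \<le> (\<Sum>i\<in>UNIV. b i * L2_norm \<rho>0 (partial j (partial i \<psi>)))"
      unfolding Y_def[abs_def] by (rule order_trans[OF L2_norm_sum[OF t\<Phi>(1)] sum_mono[OF t\<Phi>(2)]])
    have "L2_norm \<rho>0 (wpartial j (corrector \<epsilon> \<psi>)) = L2_norm \<rho>0 (partial j (corrector \<epsilon> \<psi>))"
      by (rule L2_norm_cong_AE[OF H1_D(3)[OF corrector_H1(1)[OF \<psi>]] corrector_H1(3)[OF \<psi>] corrector_H1(2)[OF \<psi>]])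
    also have "partial j (corrector \<epsilon> \<psi>) = (\<lambda>x. X x + \<epsilon> * Y x)" using \<epsilon> by (intro ext) (simp add: partial_corrector[OF \<psi>] X_def Y_def)
    also have "L2_norm \<rho>0 \<dots> \<le> L2_norm \<rho>0 X + \<epsilon> * L2_norm \<rho>0 Y"
      using L2_norm_triangle[OF X2 L2_cmult[OF Y2, of \<epsilon>]] \<epsilon> by (simp add: L2_norm_cmult)
    also have "\<dots> \<le> L2_norm \<rho>0 X + 1 * L2_norm \<rho>0 Y" using \<epsilon> by (intro add_mono mult_right_mono L2_norm_nonneg) auto
    finally show ?thesis using Xn Yn by (simp add: Gj_def)
  qed
  define G where "G = max (\<Sum>j\<in>UNIV. Gj j) (L2_norm \<rho>0 \<psi> + C)"
  have "\<forall>\<^sub>F \<epsilon> in at_right 0. H1 \<rho>0 (corrector \<epsilon> \<psi>) \<and> grad_norm (corrector \<epsilon> \<psi>) \<le> G \<and> L2_norm \<rho>0 (corrector \<epsilon> \<psi>) \<le> G"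
    using eventually_small_scale
  proof eventually_elim
    case (elim \<epsilon>)
    have "grad_norm (corrector \<epsilon> \<psi>) \<le> (\<Sum>j\<in>UNIV. Gj j)" unfolding grad_norm_def by (intro sum_mono gj elim)
    moreover have "L2_norm \<rho>0 (corrector \<epsilon> \<psi>) \<le> L2_norm \<rho>0 \<psi> + C"
    proof -
      have "L2_norm \<rho>0 (\<lambda>x. \<psi> x + \<epsilon> * corrector_term \<epsilon> \<psi> x) \<le> L2_norm \<rho>0 \<psi> + \<epsilon> * L2_norm \<rho>0 (corrector_term \<epsilon> \<psi>)"
        using L2_norm_triangle[OF L2_test[OF \<psi>] L2_cmult[OF C(2)[of \<epsilon>], of \<epsilon>]] elim by (simp add: L2_norm_cmult)
      also have "\<dots> \<le> L2_norm \<rho>0 \<psi> + 1 * C" using elim C by (intro add_mono mult_mono) (auto simp: L2_norm_nonneg)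
      finally show ?thesis by (simp add: corrector_eq[abs_def])
    qed
    ultimately show ?case using corrector_H1(1)[OF \<psi>] by (auto simp: G_def)
  qed
  then show ?thesis by blast
qed

lemma corrector_totally_bounded:
  assumes \<psi>: "test_function \<psi>"
  shows "totally_bounded_family (\<lambda>\<epsilon>. corrector \<epsilon> \<psi>)"
  unfolding totally_bounded_family_def
proof (intro allI impI)
  fix e :: real assume e: "e > 0"
  have "\<forall>\<^sub>F \<epsilon> in at_right 0. L2_norm \<rho>0 (\<lambda>x. corrector \<epsilon> \<psi> x - \<psi> x) < e"
    using order_tendstoD(2)[OF corrector_L2_limit[OF \<psi>] e] .
  then have "\<forall>\<^sub>F \<epsilon> in at_right 0. L2 \<rho>0 (corrector \<epsilon> \<psi>) \<and>
     (\<exists>c. (\<forall>n<Suc 0. \<bar>c n\<bar> \<le> 1) \<and> L2_norm \<rho>0 (\<lambda>x. corrector \<epsilon> \<psi> x - (\<Sum>n<Suc 0. c n * \<psi> x)) \<le> e)"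
  proof eventually_elim
    case (elim \<epsilon>)
    then show ?case using H1_D(1)[OF corrector_H1(1)[OF \<psi>]] by (auto intro!: exI[of _ "\<lambda>_. 1"])
  qed
  then show "\<exists>(N::nat) f B. (\<forall>n<N. L2 \<rho>0 (f n)) \<and> (\<forall>\<^sub>F \<epsilon> in at_right 0. L2 \<rho>0 (corrector \<epsilon> \<psi>) \<and>
     (\<exists>c. (\<forall>n<N. \<bar>c n\<bar> \<le> B) \<and> L2_norm \<rho>0 (\<lambda>x. corrector \<epsilon> \<psi> x - (\<Sum>n<N. c n * f n x)) \<le> e))"
    using L2_test[OF \<psi>] by (intro exI[of _ "Suc 0"] exI[of _ "\<lambda>_. \<psi>"] exI[of _ 1]) auto
qed

lemma wform_L2_tendsto:
  assumes u: "\<forall>\<^sub>F a in F. H1 \<rho>0 (u a)" and v: "H1 \<rho>0 v" and l: "((\<lambda>a. L2_norm \<rho>0 (\<lambda>x. u a x - v x)) \<longlongrightarrow> 0) F" and \<psi>: "test_function \<psi>"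
  shows "((\<lambda>a. wform A \<rho>0 (u a) \<psi>) \<longlongrightarrow> wform A \<rho>0 v \<psi>) F"
proof -
  have u2: "\<forall>\<^sub>F a in F. L2 \<rho>0 (u a)" using u by eventually_elim (rule H1_D(1))
  have "((\<lambda>a. - (\<Sum>i\<in>UNIV. \<Sum>j\<in>UNIV. A $ i $ j * L2_inner \<rho>0 (u a) (wpartial2 \<psi> i j))) \<longlongrightarrow> - (\<Sum>i\<in>UNIV. \<Sum>j\<in>UNIV. A $ i $ j * L2_inner \<rho>0 v (wpartial2 \<psi> i j))) F"
    by (intro tendsto_minus tendsto_sum tendsto_mult tendsto_const L2_inner_tendsto[OF u2 H1_D(1)[OF v] l] L2_wpartial2 \<psi>)
  moreover have "\<forall>\<^sub>F a in F. - (\<Sum>i\<in>UNIV. \<Sum>j\<in>UNIV. A $ i $ j * L2_inner \<rho>0 (u a) (wpartial2 \<psi> i j)) = wform A \<rho>0 (u a) \<psi>"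
    using u by eventually_elim (simp add: wform_parts[OF _ \<psi>])
  ultimately show ?thesis by (simp add: wform_parts[OF v \<psi>] tendsto_cong)
qed

text \<open>The correctors of one test function form an admissible family in the two preceding convergence
  results, and they converge strongly in \<open>L\<^sup>2\<close>; the homogenized form is continuous along such
  families because all derivatives can be put on the second argument.\<close>

lemma corrector_form_limits:
  assumes a: "test_function a" and b: "test_function b"
  shows "((\<lambda>\<epsilon>. wform (mat \<sigma>) (\<rho>e \<epsilon>) (corrector \<epsilon> a) (corrector \<epsilon> b)) \<longlongrightarrow> wform Sig \<rho>0 a b) (at_right 0)"
    and "((\<lambda>\<epsilon>. L2_inner (\<rho>e \<epsilon>) (corrector \<epsilon> a) (corrector \<epsilon> b)) \<longlongrightarrow> L2_inner \<rho>0 a b) (at_right 0)"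
proof -
  obtain G where G: "\<forall>\<^sub>F \<epsilon> in at_right 0. H1 \<rho>0 (corrector \<epsilon> a) \<and> grad_norm (corrector \<epsilon> a) \<le> G \<and> L2_norm \<rho>0 (corrector \<epsilon> a) \<le> G"
    using corrector_bounded[OF a] by blast
  have G1: "\<forall>\<^sub>F \<epsilon> in at_right 0. H1 \<rho>0 (corrector \<epsilon> a) \<and> grad_norm (corrector \<epsilon> a) \<le> G" using G by eventually_elim simp
  have G2: "\<forall>\<^sub>F \<epsilon> in at_right 0. L2 \<rho>0 (corrector \<epsilon> a) \<and> L2_norm \<rho>0 (corrector \<epsilon> a) \<le> G"
    using G by eventually_elim (auto intro: H1_D(1))
  have H: "\<forall>\<^sub>F \<epsilon> in at_right 0. H1 \<rho>0 (corrector \<epsilon> a)" "\<forall>\<^sub>F \<epsilon> in at_right 0. L2 \<rho>0 (corrector \<epsilon> a)"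
    using corrector_H1(1)[OF a] H1_D(1) by auto
  have "((\<lambda>\<epsilon>. (wform (mat \<sigma>) (\<rho>e \<epsilon>) (corrector \<epsilon> a) (corrector \<epsilon> b) - wform Sig \<rho>0 (corrector \<epsilon> a) b) + wform Sig \<rho>0 (corrector \<epsilon> a) b) \<longlongrightarrow> 0 + wform Sig \<rho>0 a b) (at_right 0)"
    by (intro tendsto_add form_convergence[OF corrector_totally_bounded[OF a] G1 b] wform_L2_tendsto[OF H(1) H1_test(1)[OF a] corrector_L2_limit[OF a] b])
  then show "((\<lambda>\<epsilon>. wform (mat \<sigma>) (\<rho>e \<epsilon>) (corrector \<epsilon> a) (corrector \<epsilon> b)) \<longlongrightarrow> wform Sig \<rho>0 a b) (at_right 0)" by simp
  have "((\<lambda>\<epsilon>. (L2_inner (\<rho>e \<epsilon>) (corrector \<epsilon> a) (corrector \<epsilon> b) - L2_inner \<rho>0 (corrector \<epsilon> a) b) + L2_inner \<rho>0 (corrector \<epsilon> a) b) \<longlongrightarrow> 0 + L2_inner \<rho>0 a b) (at_right 0)"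
    by (intro tendsto_add mass_convergence[OF corrector_totally_bounded[OF a] G2 b] L2_inner_tendsto[OF H(2) L2_test[OF a] corrector_L2_limit[OF a] L2_test[OF b]])
  then show "((\<lambda>\<epsilon>. L2_inner (\<rho>e \<epsilon>) (corrector \<epsilon> a) (corrector \<epsilon> b)) \<longlongrightarrow> L2_inner \<rho>0 a b) (at_right 0)" by simp
qed

lemma wform_eps_sym:
  assumes "H1 \<rho>0 u" "H1 \<rho>0 v"
  shows "wform (mat \<sigma>) (\<rho>e \<epsilon>) u v = wform (mat \<sigma>) (\<rho>e \<epsilon>) v u"
proof -
  have "L2_inner \<rho>0 (wpartial j u) (\<lambda>x. m \<epsilon> x * wpartial j v x) = L2_inner \<rho>0 (wpartial j v) (\<lambda>x. m \<epsilon> x * wpartial j u x)" for j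
    unfolding L2_inner_def by (simp add: mult_ac)
  then show ?thesis using assms by (simp add: wform_eps_expand)
qed

lemma L2_inner_eps_lower:
  assumes u: "L2 \<rho>0 u"
  shows "ratio_min * L2_inner \<rho>0 u u \<le> L2_inner \<rho>0 u (\<lambda>x. m \<epsilon> x * u x)" "L2_inner \<rho>0 u (\<lambda>x. m \<epsilon> x * u x) \<le> ratio_max * L2_inner \<rho>0 u u"
proof -
  note mu = L2_mult_bounded(1)[OF u m_meas[of \<epsilon>] m_abs]
  have sq: "u x * (m \<epsilon> x * u x) * \<rho>0 x = m \<epsilon> x * (u x * u x * \<rho>0 x)" for x by simp
  have nn: "0 \<le> u x * u x * \<rho>0 x" for x using rho_pos[of x] by simp
  have i1: "integrable lebesgue (\<lambda>x. m \<epsilon> x * (u x * u x * \<rho>0 x))" using L2_prod[OF u mu] unfolding sq .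
  have i2: "integrable lebesgue (\<lambda>x. c * (u x * u x * \<rho>0 x))" for c using L2_prod[OF u u] by simp
  have "(LINT x|lebesgue. ratio_min * (u x * u x * \<rho>0 x)) \<le> (LINT x|lebesgue. m \<epsilon> x * (u x * u x * \<rho>0 x))"
    by (rule integral_mono[OF i2 i1]) (rule mult_right_mono[OF density_ratio_bounds(3) nn])
  then show "ratio_min * L2_inner \<rho>0 u u \<le> L2_inner \<rho>0 u (\<lambda>x. m \<epsilon> x * u x)" unfolding L2_inner_def sq by simp
  have "(LINT x|lebesgue. m \<epsilon> x * (u x * u x * \<rho>0 x)) \<le> (LINT x|lebesgue. ratio_max * (u x * u x * \<rho>0 x))"
    by (rule integral_mono[OF i1 i2]) (rule mult_right_mono[OF density_ratio_bounds(4) nn])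
  then show "L2_inner \<rho>0 u (\<lambda>x. m \<epsilon> x * u x) \<le> ratio_max * L2_inner \<rho>0 u u" unfolding L2_inner_def sq by simp
qed

lemma wform_eps_lower:
  assumes u: "H1 \<rho>0 u"
  shows "ratio_min * \<sigma> * (grad_norm u)\<^sup>2 \<le> real CARD('d) * wform (mat \<sigma>) (\<rho>e \<epsilon>) u u"
proof -
  have "(grad_norm u)\<^sup>2 = (\<Sum>i\<in>UNIV. L2_norm \<rho>0 (wpartial i u) * 1)\<^sup>2" by (simp add: grad_norm_def)
  also have "\<dots> \<le> (\<Sum>i\<in>UNIV. (L2_norm \<rho>0 (wpartial i u))\<^sup>2) * (\<Sum>i\<in>(UNIV :: 'd set). 1\<^sup>2)"
    by (rule Cauchy_Schwarz_ineq_sum)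
  finally have "(grad_norm u)\<^sup>2 \<le> real CARD('d) * (\<Sum>i\<in>UNIV. L2_inner \<rho>0 (wpartial i u) (wpartial i u))" by (simp add: L2_norm_sq mult.commute)
  then have "ratio_min * \<sigma> * (grad_norm u)\<^sup>2 \<le> ratio_min * \<sigma> * (real CARD('d) * (\<Sum>i\<in>UNIV. L2_inner \<rho>0 (wpartial i u) (wpartial i u)))"
    using density_ratio_bounds(1) \<sigma> by (intro mult_left_mono) auto
  also have "\<dots> = real CARD('d) * (\<sigma> * (\<Sum>i\<in>UNIV. ratio_min * L2_inner \<rho>0 (wpartial i u) (wpartial i u)))"
    by (simp add: sum_distrib_left mult_ac)
  also have "\<dots> \<le> real CARD('d) * wform (mat \<sigma>) (\<rho>e \<epsilon>) u u"
    unfolding wform_eps_expand[OF u u] using \<sigma> by (intro mult_left_mono sum_mono L2_inner_eps_lower(1) H1_D(3)[OF u]) auto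
  finally show ?thesis .
qed

lemma wform_eps_nonneg: "H1 \<rho>0 u \<Longrightarrow> 0 \<le> wform (mat \<sigma>) (\<rho>e \<epsilon>) u u"
proof -
  assume u: "H1 \<rho>0 u"
  have "0 \<le> ratio_min * \<sigma> * (grad_norm u)\<^sup>2" using density_ratio_bounds(1) \<sigma> by simp
  then have "0 \<le> real CARD('d) * wform (mat \<sigma>) (\<rho>e \<epsilon>) u u" using wform_eps_lower[OF u, of \<epsilon>] by linarith
  then show ?thesis by (simp add: zero_le_mult_iff)
qed

text \<open>The multiscale forms are symmetric; this passes to the limit along correctors, and then from
  test functions to all of \<open>H\<^sup>1\<close>. Nonnegativity is inherited in the same way.\<close>

lemma Sig_sym:
  assumes u: "H1 \<rho>0 u" and v: "H1 \<rho>0 v"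
  shows "wform Sig \<rho>0 u v = wform Sig \<rho>0 v u"
proof -
  have tests: "wform Sig \<rho>0 a b = wform Sig \<rho>0 b a" if a: "test_function a" and b: "test_function b" for a b
  proof (rule tendsto_unique[OF _ corrector_form_limits(1)[OF a b]])
    show "((\<lambda>\<epsilon>. wform (mat \<sigma>) (\<rho>e \<epsilon>) (corrector \<epsilon> a) (corrector \<epsilon> b)) \<longlongrightarrow> wform Sig \<rho>0 b a) (at_right 0)"
      using corrector_form_limits(1)[OF b a] wform_eps_sym[OF corrector_H1(1)[OF a] corrector_H1(1)[OF b]] by simp
  qed simp
  obtain a where a: "\<And>n. test_function (a n)" "(\<lambda>n. grad_norm (\<lambda>x. u x - a n x)) \<longlonglongrightarrow> 0" using density_sequence[OF u] by blast
  obtain b where b: "\<And>n. test_function (b n)" "(\<lambda>n. grad_norm (\<lambda>x. v x - b n x)) \<longlonglongrightarrow> 0" using density_sequence[OF v] by blast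
  have "(\<lambda>n. wform Sig \<rho>0 (a n) (b n)) \<longlonglongrightarrow> wform Sig \<rho>0 u v"
    by (rule wform_tendsto[OF u H1_test(1)[OF a(1)] a(2) v H1_test(1)[OF b(1)] b(2)])
  moreover have "(\<lambda>n. wform Sig \<rho>0 (a n) (b n)) \<longlonglongrightarrow> wform Sig \<rho>0 v u"
    unfolding tests[OF a(1) b(1)] by (rule wform_tendsto[OF v H1_test(1)[OF b(1)] b(2) u H1_test(1)[OF a(1)] a(2)])
  ultimately show ?thesis by (rule LIMSEQ_unique)
qed

lemma Sig_psd:
  assumes u: "H1 \<rho>0 u"
  shows "0 \<le> wform Sig \<rho>0 u u"
proof -
  have tests: "0 \<le> wform Sig \<rho>0 a a" if a: "test_function a" for a
    by (rule tendsto_lowerbound[OF corrector_form_limits(1)[OF a a]])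
       (use wform_eps_nonneg[OF corrector_H1(1)[OF a]] in \<open>auto intro!: always_eventually\<close>)
  obtain a where a: "\<And>n. test_function (a n)" "(\<lambda>n. grad_norm (\<lambda>x. u x - a n x)) \<longlonglongrightarrow> 0" using density_sequence[OF u] by blast
  have "(\<lambda>n. wform Sig \<rho>0 (a n) (a n)) \<longlonglongrightarrow> wform Sig \<rho>0 u u"
    by (rule wform_tendsto[OF u H1_test(1)[OF a(1)] a(2) u H1_test(1)[OF a(1)] a(2)])
  then show ?thesis by (rule LIMSEQ_le_const) (use tests[OF a(1)] in auto)
qed

end

section \<open>Convergence of eigenpairs\<close>

lemma quadratic_form_close:
  fixes \<alpha> D :: "nat \<Rightarrow> real"
  assumes M: "\<And>j k. j \<le> n \<Longrightarrow> k \<le> n \<Longrightarrow> \<bar>M j k - (if j = k then D j else 0)\<bar> \<le> \<eta>"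
    and \<alpha>: "(\<Sum>k\<le>n. (\<alpha> k)\<^sup>2) = 1"
  shows "\<bar>(\<Sum>j\<le>n. \<Sum>k\<le>n. \<alpha> j * \<alpha> k * M j k) - (\<Sum>j\<le>n. (\<alpha> j)\<^sup>2 * D j)\<bar> \<le> (real n + 1)\<^sup>2 * \<eta>"
proof -
  have a1: "\<bar>\<alpha> k\<bar> \<le> 1" if "k \<le> n" for k
  proof -
    have "(\<alpha> k)\<^sup>2 \<le> (\<Sum>k\<le>n. (\<alpha> k)\<^sup>2)" using that by (intro member_le_sum) auto
    then show ?thesis using \<alpha> by (simp add: abs_square_le_1)
  qed
  have "(\<Sum>j\<le>n. (\<alpha> j)\<^sup>2 * D j) = (\<Sum>j\<le>n. \<Sum>k\<le>n. \<alpha> j * \<alpha> k * (if j = k then D j else 0))"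
    by (intro sum.cong refl) (simp add: power2_eq_square if_distrib[of "(*) _"] cong: if_cong)
  then have "(\<Sum>j\<le>n. \<Sum>k\<le>n. \<alpha> j * \<alpha> k * M j k) - (\<Sum>j\<le>n. (\<alpha> j)\<^sup>2 * D j)
     = (\<Sum>j\<le>n. \<Sum>k\<le>n. \<alpha> j * \<alpha> k * (M j k - (if j = k then D j else 0)))"
    by (simp only: sum_subtractf[symmetric] right_diff_distrib)
  also have "\<bar>\<dots>\<bar> \<le> (\<Sum>j\<le>n. \<Sum>k\<le>n. \<eta>)"
  proof (intro order_trans[OF sum_abs] sum_mono)
    fix j k assume jk: "j \<in> {..n}" "k \<in> {..n}"
    have "\<bar>\<alpha> j * \<alpha> k\<bar> \<le> 1 * 1" unfolding abs_mult using jk a1 by (intro mult_mono) auto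
    then have "\<bar>\<alpha> j * \<alpha> k\<bar> * \<bar>M j k - (if j = k then D j else 0)\<bar> \<le> 1 * \<eta>"
      using M[of j k] jk by (intro mult_mono) auto
    then show "\<bar>\<alpha> j * \<alpha> k * (M j k - (if j = k then D j else 0))\<bar> \<le> \<eta>" by (simp add: abs_mult)
  qed
  also have "\<dots> = (real n + 1)\<^sup>2 * \<eta>" by (simp add: power2_eq_square add.commute)
  finally show ?thesis .
qed

context weight
begin

lemma L2_inner_tendsto2:
  assumes u: "L2 \<rho> u" "\<And>n. L2 \<rho> (a n)" "((\<lambda>n. L2_norm \<rho> (\<lambda>x. u x - a n x)) \<longlongrightarrow> 0) F"
    and v: "L2 \<rho> v" "\<And>n. L2 \<rho> (b n)" "((\<lambda>n. L2_norm \<rho> (\<lambda>x. v x - b n x)) \<longlongrightarrow> 0) F"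
  shows "((\<lambda>n. L2_inner \<rho> (a n) (b n)) \<longlongrightarrow> L2_inner \<rho> u v) F"
proof -
  define s t where "s n = L2_norm \<rho> (\<lambda>x. u x - a n x)" and "t n = L2_norm \<rho> (\<lambda>x. v x - b n x)" for n
  have eq: "L2_inner \<rho> u v - L2_inner \<rho> (a n) (b n) = L2_inner \<rho> (\<lambda>x. u x - a n x) v + L2_inner \<rho> u (\<lambda>x. v x - b n x)
      - L2_inner \<rho> (\<lambda>x. u x - a n x) (\<lambda>x. v x - b n x)" for n
    using u v by (simp add: L2_inner_diff_left L2_inner_diff_right L2_diff)
  have bd: "\<bar>L2_inner \<rho> u v - L2_inner \<rho> (a n) (b n)\<bar> \<le> s n * L2_norm \<rho> v + L2_norm \<rho> u * t n + s n * t n" for n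
    unfolding eq using L2_CS[OF L2_diff[OF u(1) u(2)[of n]] v(1)]
      L2_CS[OF u(1) L2_diff[OF v(1) v(2)[of n]]] L2_CS[OF L2_diff[OF u(1) u(2)[of n]] L2_diff[OF v(1) v(2)[of n]]]
    unfolding s_def t_def by linarith
  have "((\<lambda>n. s n * L2_norm \<rho> v + L2_norm \<rho> u * t n + s n * t n) \<longlongrightarrow> 0 * L2_norm \<rho> v + L2_norm \<rho> u * 0 + 0 * 0) F"
    using u(3) v(3) unfolding s_def t_def by (intro tendsto_intros)
  then have lim0: "((\<lambda>n. s n * L2_norm \<rho> v + L2_norm \<rho> u * t n + s n * t n) \<longlongrightarrow> 0) F" by simp
  have "((\<lambda>n. L2_inner \<rho> u v - L2_inner \<rho> (a n) (b n)) \<longlongrightarrow> 0) F"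
    by (rule Lim_null_comparison[OF _ lim0]) (use bd in \<open>auto intro!: always_eventually\<close>)
  then show ?thesis by (rule Lim_transform2[OF tendsto_const])
qed

end

locale homog_eigen = homog \<sigma> V rho_max L p \<Phi>
  for \<sigma> :: real and V :: "real^'d::finite \<Rightarrow> real" and rho_max L :: real and p :: "real^'d \<Rightarrow> real" and \<Phi> :: "real^'d \<Rightarrow> real^'d" +
  fixes lam :: "real \<Rightarrow> nat \<Rightarrow> real" and phi :: "real \<Rightarrow> nat \<Rightarrow> real^'d \<Rightarrow> real"
    and lam0 :: "nat \<Rightarrow> real" and phi0 :: "nat \<Rightarrow> real^'d \<Rightarrow> real"
  assumes eigen_eps: "\<And>\<epsilon>. \<epsilon> > 0 \<Longrightarrow> ordered_eigenpairs (mat \<sigma>) (\<rho>e \<epsilon>) (lam \<epsilon>) (phi \<epsilon>)"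
    and eigen_hom: "ordered_eigenpairs Sig \<rho>0 lam0 phi0"
begin

lemmas eigen_zero = ordered_eigenpairsD[OF eigen_hom]

text \<open>The properties of the multiscale eigenpairs, expressed in the space of the homogenized weight,
  and the min-max principle as the instance of \<open>spectral_tail\<close> in which the projection is zero.\<close>

lemma
  assumes \<epsilon>: "\<epsilon> > 0"
  shows phi_H1: "H1 \<rho>0 (phi \<epsilon> n)"
    and phi_form: "H1 \<rho>0 \<psi> \<Longrightarrow> wform (mat \<sigma>) (\<rho>e \<epsilon>) (phi \<epsilon> n) \<psi> = lam \<epsilon> n * L2_inner (\<rho>e \<epsilon>) (phi \<epsilon> n) \<psi>"
    and phi_orthonormal: "L2_inner (\<rho>e \<epsilon>) (phi \<epsilon> m') (phi \<epsilon> n) = (if m' = n then 1 else 0)"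
    and lam_nonneg: "0 \<le> lam \<epsilon> n"
    and lam_mono: "i \<le> n \<Longrightarrow> lam \<epsilon> i \<le> lam \<epsilon> n"
    and min_max: "H1 \<rho>0 v \<Longrightarrow> (\<And>j. j < n \<Longrightarrow> L2_inner (\<rho>e \<epsilon>) v (phi \<epsilon> j) = 0) \<Longrightarrow>
        lam \<epsilon> n * L2_inner (\<rho>e \<epsilon>) v v \<le> wform (mat \<sigma>) (\<rho>e \<epsilon>) v v"
proof -
  interpret W: weight "\<rho>e \<epsilon>" "ratio_max * rho_max" by (rule weight_eps)
  note D = W.ordered_eigenpairsD[OF eigen_eps[OF \<epsilon>]]
  show "H1 \<rho>0 (phi \<epsilon> n)" using D(4) H1_eps by blast
  show "wform (mat \<sigma>) (\<rho>e \<epsilon>) (phi \<epsilon> n) \<psi> = lam \<epsilon> n * L2_inner (\<rho>e \<epsilon>) (phi \<epsilon> n) \<psi>" if "H1 \<rho>0 \<psi>"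
    using D(6) that H1_eps by blast
  show "L2_inner (\<rho>e \<epsilon>) (phi \<epsilon> m') (phi \<epsilon> n) = (if m' = n then 1 else 0)" by (rule D(7))
  show "0 \<le> lam \<epsilon> n" by (rule D(9))
  show "i \<le> n \<Longrightarrow> lam \<epsilon> i \<le> lam \<epsilon> n" using strict_mono_less_eq[OF D(2)] by blast
  show "lam \<epsilon> n * L2_inner (\<rho>e \<epsilon>) v v \<le> wform (mat \<sigma>) (\<rho>e \<epsilon>) v v"
    if v: "H1 \<rho>0 v" and z: "\<And>j. j < n \<Longrightarrow> L2_inner (\<rho>e \<epsilon>) v (phi \<epsilon> j) = 0"
  proof -
    have "lam \<epsilon> n * (L2_norm (\<rho>e \<epsilon>) (\<lambda>x. v x - (\<Sum>j<n. L2_inner (\<rho>e \<epsilon>) v (phi \<epsilon> j) * phi \<epsilon> j x)))\<^sup>2 \<le> wform (mat \<sigma>) (\<rho>e \<epsilon>) v v"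
      by (rule W.spectral_tail[OF eigen_eps[OF \<epsilon>]]) (use H1_eps wform_eps_sym wform_eps_nonneg v in auto)
    then show ?thesis using z by (simp add: W.L2_norm_sq)
  qed
qed

lemma combination:
  assumes h: "\<And>k. k \<le> n \<Longrightarrow> H1 \<rho>0 (h k)" and w'_def: "w' = (\<lambda>x. \<Sum>k\<le>n. \<alpha> k * h k x)"
  shows "H1 \<rho>0 w'"
    "L2 \<rho>0 g \<Longrightarrow> L2_inner (\<rho>e \<epsilon>) w' g = (\<Sum>k\<le>n. \<alpha> k * L2_inner (\<rho>e \<epsilon>) (h k) g)"
    "L2 \<rho>0 g \<Longrightarrow> L2_inner \<rho>0 w' g = (\<Sum>k\<le>n. \<alpha> k * L2_inner \<rho>0 (h k) g)"
    "L2_inner (\<rho>e \<epsilon>) w' w' = (\<Sum>j\<le>n. \<Sum>k\<le>n. \<alpha> j * \<alpha> k * L2_inner (\<rho>e \<epsilon>) (h j) (h k))"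
    "wform (mat \<sigma>) (\<rho>e \<epsilon>) w' w' = (\<Sum>j\<le>n. \<Sum>k\<le>n. \<alpha> j * \<alpha> k * wform (mat \<sigma>) (\<rho>e \<epsilon>) (h j) (h k))"
proof -
  interpret W: weight "\<rho>e \<epsilon>" "ratio_max * rho_max" by (rule weight_eps)
  show H: "H1 \<rho>0 w'" unfolding w'_def by (intro H1_sum h) simp
  have hL: "L2 \<rho>0 (h k)" if "k \<le> n" for k by (rule H1_D(1)[OF h[OF that]])
  have hH: "H1 (\<rho>e \<epsilon>) (h k)" if "k \<le> n" for k using H1_eps h[OF that] by blast
  have wH: "H1 (\<rho>e \<epsilon>) w'" using H1_eps H by blast
  have wL: "L2 \<rho>0 w'" by (rule H1_D(1)[OF H])
  show 1: "L2_inner (\<rho>e \<epsilon>) w' g = (\<Sum>k\<le>n. \<alpha> k * L2_inner (\<rho>e \<epsilon>) (h k) g)" if "L2 \<rho>0 g" for g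
    unfolding w'_def using W.L2_inner_sum_left[of "{..n}" "\<lambda>k x. \<alpha> k * h k x" g] hL that
    by (simp add: L2_eps L2_cmult W.L2_inner_cmult_left)
  show "L2_inner \<rho>0 w' g = (\<Sum>k\<le>n. \<alpha> k * L2_inner \<rho>0 (h k) g)" if "L2 \<rho>0 g"
    unfolding w'_def using L2_inner_sum_left[of "{..n}" "\<lambda>k x. \<alpha> k * h k x" g] hL that
    by (simp add: L2_cmult L2_inner_cmult_left)
  have "L2_inner (\<rho>e \<epsilon>) w' w' = (\<Sum>j\<le>n. \<alpha> j * (\<Sum>k\<le>n. \<alpha> k * L2_inner (\<rho>e \<epsilon>) (h k) (h j)))"
    unfolding 1[OF wL] by (intro sum.cong refl) (subst W.L2_inner_commute, use 1[OF hL] in simp)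
  then show "L2_inner (\<rho>e \<epsilon>) w' w' = (\<Sum>j\<le>n. \<Sum>k\<le>n. \<alpha> j * \<alpha> k * L2_inner (\<rho>e \<epsilon>) (h j) (h k))"
    by (simp add: sum_distrib_left mult.assoc W.L2_inner_commute)
  have "wform (mat \<sigma>) (\<rho>e \<epsilon>) w' w' = (\<Sum>j\<le>n. \<alpha> j * wform (mat \<sigma>) (\<rho>e \<epsilon>) (h j) w')"
    by (subst w'_def, rule W.wform_sum_left) (use hH wH in auto)
  also have "\<dots> = (\<Sum>j\<le>n. \<alpha> j * (\<Sum>k\<le>n. \<alpha> k * wform (mat \<sigma>) (\<rho>e \<epsilon>) (h j) (h k)))"
    unfolding w'_def by (intro sum.cong refl arg_cong2[where f="(*)"] W.wform_sum_right) (use hH in auto)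
  finally show "wform (mat \<sigma>) (\<rho>e \<epsilon>) w' w' = (\<Sum>j\<le>n. \<Sum>k\<le>n. \<alpha> j * \<alpha> k * wform (mat \<sigma>) (\<rho>e \<epsilon>) (h j) (h k))"
    by (simp add: sum_distrib_left mult.assoc)
qed

lemma approximate_eigenfunctions:
  assumes \<eta>: "\<eta> > 0"
  shows "\<exists>a. (\<forall>k. test_function (a k)) \<and> (\<forall>j\<le>n. \<forall>k\<le>n.
     \<bar>wform Sig \<rho>0 (a j) (a k) - (if j = k then lam0 j else 0)\<bar> < \<eta> \<and> \<bar>L2_inner \<rho>0 (a j) (a k) - (if j = k then 1 else 0)\<bar> < \<eta>)"
proof -
  have "\<forall>k. \<exists>\<psi>. (\<forall>N::nat. test_function (\<psi> N)) \<and> (\<lambda>N. L2_norm \<rho>0 (\<lambda>x. phi0 k x - \<psi> N x)) \<longlonglongrightarrow> 0 \<and>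
     (\<lambda>N. grad_norm (\<lambda>x. phi0 k x - \<psi> N x)) \<longlonglongrightarrow> 0"
    using density_sequence[OF eigen_zero(4)] by blast
  from choice[OF this] obtain \<psi> where \<psi>': "\<forall>k. (\<forall>N::nat. test_function (\<psi> k N)) \<and> (\<lambda>N. L2_norm \<rho>0 (\<lambda>x. phi0 k x - \<psi> k N x)) \<longlonglongrightarrow> 0 \<and>
     (\<lambda>N. grad_norm (\<lambda>x. phi0 k x - \<psi> k N x)) \<longlonglongrightarrow> 0" ..
  have \<psi>: "test_function (\<psi> k N)" "(\<lambda>N. L2_norm \<rho>0 (\<lambda>x. phi0 k x - \<psi> k N x)) \<longlonglongrightarrow> 0"
     "(\<lambda>N. grad_norm (\<lambda>x. phi0 k x - \<psi> k N x)) \<longlonglongrightarrow> 0" for k N using spec[OF \<psi>', of k] by simp_all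
  have 1: "(\<lambda>N. wform Sig \<rho>0 (\<psi> j N) (\<psi> k N)) \<longlonglongrightarrow> (if j = k then lam0 j else 0)" for j k
  proof -
    have "wform Sig \<rho>0 (phi0 j) (phi0 k) = (if j = k then lam0 j else 0)" using eigen_zero(6)[OF eigen_zero(4), of j k] eigen_zero(7)[of j k] by simp
    then show ?thesis
      using wform_tendsto[OF eigen_zero(4) H1_test(1)[OF \<psi>(1)] \<psi>(3) eigen_zero(4) H1_test(1)[OF \<psi>(1)] \<psi>(3), of Sig j k] by simp
  qed
  have 2: "(\<lambda>N. L2_inner \<rho>0 (\<psi> j N) (\<psi> k N)) \<longlonglongrightarrow> (if j = k then 1 else 0)" for j k
    using L2_inner_tendsto2[OF eigen_zero(5) L2_test[OF \<psi>(1)] \<psi>(2) eigen_zero(5) L2_test[OF \<psi>(1)] \<psi>(2), of j k] eigen_zero(7)[of j k] by simp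
  have "\<forall>\<^sub>F N in sequentially. \<bar>wform Sig \<rho>0 (\<psi> j N) (\<psi> k N) - (if j = k then lam0 j else 0)\<bar> < \<eta> \<and>
       \<bar>L2_inner \<rho>0 (\<psi> j N) (\<psi> k N) - (if j = k then 1 else 0)\<bar> < \<eta>" for j k
    using tendstoD[OF 1[of j k] \<eta>] tendstoD[OF 2[of j k] \<eta>] by eventually_elim (simp add: dist_real_def)
  then have "\<forall>\<^sub>F N in sequentially. \<forall>j\<in>{..n}. \<forall>k\<in>{..n}. \<bar>wform Sig \<rho>0 (\<psi> j N) (\<psi> k N) - (if j = k then lam0 j else 0)\<bar> < \<eta> \<and>
       \<bar>L2_inner \<rho>0 (\<psi> j N) (\<psi> k N) - (if j = k then 1 else 0)\<bar> < \<eta>"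
    by (intro eventually_ball_finite ballI) auto
  then obtain N where "\<forall>j\<in>{..n}. \<forall>k\<in>{..n}. \<bar>wform Sig \<rho>0 (\<psi> j N) (\<psi> k N) - (if j = k then lam0 j else 0)\<bar> < \<eta> \<and>
       \<bar>L2_inner \<rho>0 (\<psi> j N) (\<psi> k N) - (if j = k then 1 else 0)\<bar> < \<eta>"
    unfolding eventually_sequentially by blast
  then show ?thesis using \<psi>(1) by (intro exI[of _ "\<lambda>k. \<psi> k N"]) auto
qed

text \<open>Correctors of approximate limit eigenfunctions have almost diagonal mass and energy matrices. A
  normalized combination of \<open>n + 1\<close> of them is orthogonal to the first \<open>n\<close> multiscale eigenfunctions,
  and its Rayleigh quotient is an upper bound by the min-max principle.\<close>

lemma eigenvalue_upper:
  assumes d: "d > 0"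
  shows "\<forall>\<^sub>F \<epsilon> in at_right 0. lam \<epsilon> n \<le> lam0 n + d"
proof -
  have ln: "lam0 n \<ge> 0" by (rule eigen_zero(9))
  \<comment> \<open>Chosen such that a Rayleigh quotient with energy at most lam0 n + \<kappa> and mass at least
    1 - \<kappa> does not exceed lam0 n + d.\<close>
  define \<kappa> where "\<kappa> = d / (lam0 n + d + 1)"
  have \<kappa>: "\<kappa> > 0" "\<kappa> < 1" "\<kappa> * (lam0 n + d + 1) = d" unfolding \<kappa>_def using d ln by auto
  \<comment> \<open>Each matrix entry is allowed two errors of this size, one from the density of test
    functions and one from the limit in the scale.\<close>
  define \<eta> where "\<eta> = \<kappa> / (2 * (real n + 1)\<^sup>2)"
  have \<eta>: "\<eta> > 0" "(real n + 1)\<^sup>2 * (2 * \<eta>) = \<kappa>" unfolding \<eta>_def using \<kappa>(1) by (auto simp: field_simps)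
  obtain a where a: "\<And>k. test_function (a k)"
    and aw: "\<And>j k. j \<le> n \<Longrightarrow> k \<le> n \<Longrightarrow> \<bar>wform Sig \<rho>0 (a j) (a k) - (if j = k then lam0 j else 0)\<bar> < \<eta>"
    and al: "\<And>j k. j \<le> n \<Longrightarrow> k \<le> n \<Longrightarrow> \<bar>L2_inner \<rho>0 (a j) (a k) - (if j = k then 1 else 0)\<bar> < \<eta>"
    using approximate_eigenfunctions[OF \<eta>(1), of n] by blast
  have "\<forall>\<^sub>F \<epsilon> in at_right 0. \<bar>wform (mat \<sigma>) (\<rho>e \<epsilon>) (corrector \<epsilon> (a j)) (corrector \<epsilon> (a k)) - wform Sig \<rho>0 (a j) (a k)\<bar> < \<eta> \<and>
     \<bar>L2_inner (\<rho>e \<epsilon>) (corrector \<epsilon> (a j)) (corrector \<epsilon> (a k)) - L2_inner \<rho>0 (a j) (a k)\<bar> < \<eta>" for j k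
    using tendstoD[OF corrector_form_limits(1)[OF a a] \<eta>(1), of j k] tendstoD[OF corrector_form_limits(2)[OF a a] \<eta>(1), of j k]
    by eventually_elim (simp add: dist_real_def)
  then have "\<forall>\<^sub>F \<epsilon> in at_right 0. \<forall>j\<in>{..n}. \<forall>k\<in>{..n}. \<bar>wform (mat \<sigma>) (\<rho>e \<epsilon>) (corrector \<epsilon> (a j)) (corrector \<epsilon> (a k)) - wform Sig \<rho>0 (a j) (a k)\<bar> < \<eta> \<and>
     \<bar>L2_inner (\<rho>e \<epsilon>) (corrector \<epsilon> (a j)) (corrector \<epsilon> (a k)) - L2_inner \<rho>0 (a j) (a k)\<bar> < \<eta>"
    by (intro eventually_ball_finite ballI) auto
  then show ?thesis using eventually_small_scale
  proof eventually_elim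
    case (elim \<epsilon>)
    then have \<epsilon>: "\<epsilon> > 0" by simp
    define h where "h k = corrector \<epsilon> (a k)" for k
    have hH: "H1 \<rho>0 (h k)" for k unfolding h_def by (rule corrector_H1(1)[OF a])
    have Mw: "\<bar>wform (mat \<sigma>) (\<rho>e \<epsilon>) (h j) (h k) - (if j = k then lam0 j else 0)\<bar> \<le> 2 * \<eta>" if "j \<le> n" "k \<le> n" for j k
    proof -
      have "\<bar>wform (mat \<sigma>) (\<rho>e \<epsilon>) (h j) (h k) - wform Sig \<rho>0 (a j) (a k)\<bar> < \<eta>" using elim that unfolding h_def by auto
      then show ?thesis using aw[OF that] by linarith
    qed
    have Ml: "\<bar>L2_inner (\<rho>e \<epsilon>) (h j) (h k) - (if j = k then 1 else 0)\<bar> \<le> 2 * \<eta>" if "j \<le> n" "k \<le> n" for j k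
    proof -
      have "\<bar>L2_inner (\<rho>e \<epsilon>) (h j) (h k) - L2_inner \<rho>0 (a j) (a k)\<bar> < \<eta>" using elim that unfolding h_def by auto
      then show ?thesis using al[OF that] by linarith
    qed
    obtain \<alpha> where \<alpha>: "(\<Sum>k\<le>n. (\<alpha> k)\<^sup>2) = 1" "\<And>j. j < n \<Longrightarrow> (\<Sum>k\<le>n. \<alpha> k * L2_inner (\<rho>e \<epsilon>) (h k) (phi \<epsilon> j)) = 0"
      using underdetermined_unit_solution[of n "\<lambda>k j. L2_inner (\<rho>e \<epsilon>) (h k) (phi \<epsilon> j)"] by blast
    define v where "v = (\<lambda>x. \<Sum>k\<le>n. \<alpha> k * h k x)"
    note c = combination[OF hH v_def]
    have "L2_inner (\<rho>e \<epsilon>) v (phi \<epsilon> j) = 0" if "j < n" for j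
      using c(2)[OF H1_D(1)[OF phi_H1[OF \<epsilon>]]] \<alpha>(2)[OF that] by simp
    then have mm: "lam \<epsilon> n * L2_inner (\<rho>e \<epsilon>) v v \<le> wform (mat \<sigma>) (\<rho>e \<epsilon>) v v"
      by (intro min_max[OF \<epsilon> c(1)])
    have q1: "L2_inner (\<rho>e \<epsilon>) v v \<ge> 1 - \<kappa>"
    proof -
      have "\<bar>L2_inner (\<rho>e \<epsilon>) v v - (\<Sum>j\<le>n. (\<alpha> j)\<^sup>2 * 1)\<bar> \<le> (real n + 1)\<^sup>2 * (2 * \<eta>)"
        unfolding c(4) by (rule quadratic_form_close[OF Ml \<alpha>(1)])
      then show ?thesis unfolding \<eta>(2) using \<alpha>(1) by simp
    qed
    have q2: "wform (mat \<sigma>) (\<rho>e \<epsilon>) v v \<le> lam0 n + \<kappa>"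
    proof -
      have "\<bar>wform (mat \<sigma>) (\<rho>e \<epsilon>) v v - (\<Sum>j\<le>n. (\<alpha> j)\<^sup>2 * lam0 j)\<bar> \<le> (real n + 1)\<^sup>2 * (2 * \<eta>)"
        unfolding c(5) by (rule quadratic_form_close[OF Mw \<alpha>(1)])
      moreover have "(\<Sum>j\<le>n. (\<alpha> j)\<^sup>2 * lam0 j) \<le> (\<Sum>j\<le>n. (\<alpha> j)\<^sup>2 * lam0 n)"
        using strict_mono_less_eq[OF eigen_zero(2)] by (intro sum_mono mult_left_mono) auto
      moreover have "(\<Sum>j\<le>n. (\<alpha> j)\<^sup>2 * lam0 n) = lam0 n" using \<alpha>(1) by (simp add: sum_distrib_right[symmetric])
      ultimately show ?thesis unfolding \<eta>(2) by linarith
    qed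
    have "lam \<epsilon> n * (1 - \<kappa>) \<le> lam \<epsilon> n * L2_inner (\<rho>e \<epsilon>) v v"
      using q1 lam_nonneg[OF \<epsilon>] by (intro mult_left_mono) auto
    also have "\<dots> \<le> lam0 n + \<kappa>" using mm q2 by linarith
    also have "\<dots> = (lam0 n + d) * (1 - \<kappa>)" using \<kappa>(3) by (simp add: algebra_simps)
    finally show ?case using \<kappa>(2) by (simp add: mult_le_cancel_right)
  qed
qed

lemma energy_bound:
  assumes u: "H1 \<rho>0 u" and e: "wform (mat \<sigma>) (\<rho>e \<epsilon>) u u \<le> E'" and n: "L2_inner (\<rho>e \<epsilon>) u u = 1"
  shows "grad_norm u \<le> sqrt (real CARD('d) * E' / (ratio_min * \<sigma>))" "L2_norm \<rho>0 u \<le> sqrt (1 / ratio_min)"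
proof -
  have ms: "ratio_min * \<sigma> > 0" using density_ratio_bounds(1) \<sigma> by simp
  have "ratio_min * \<sigma> * (grad_norm u)\<^sup>2 \<le> real CARD('d) * E'"
    using wform_eps_lower[OF u, of \<epsilon>] mult_left_mono[OF e, of "real CARD('d)"] by linarith
  then have "(grad_norm u)\<^sup>2 \<le> real CARD('d) * E' / (ratio_min * \<sigma>)" using ms by (simp add: pos_le_divide_eq mult.commute)
  then show "grad_norm u \<le> sqrt (real CARD('d) * E' / (ratio_min * \<sigma>))" by (rule real_le_rsqrt)
  have "ratio_min * (L2_norm \<rho>0 u)\<^sup>2 \<le> 1"
    using L2_inner_eps_lower(1)[OF H1_D(1)[OF u], of \<epsilon>] n unfolding L2_inner_eps L2_norm_sq by simp
  then have "(L2_norm \<rho>0 u)\<^sup>2 \<le> 1 / ratio_min" using density_ratio_bounds(1) by (simp add: pos_le_divide_eq mult.commute)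
  then show "L2_norm \<rho>0 u \<le> sqrt (1 / ratio_min)" by (rule real_le_rsqrt)
qed

lemma eigenfunction_bounds:
  "\<exists>G. \<forall>\<^sub>F \<epsilon> in at_right 0. H1 \<rho>0 (phi \<epsilon> n) \<and> grad_norm (phi \<epsilon> n) \<le> G \<and> L2_norm \<rho>0 (phi \<epsilon> n) \<le> G \<and> \<bar>lam \<epsilon> n\<bar> \<le> G"
proof -
  define E' where "E' = lam0 n + 1"
  define G where "G = max E' (max (sqrt (real CARD('d) * E' / (ratio_min * \<sigma>))) (sqrt (1 / ratio_min)))"
  have "\<forall>\<^sub>F \<epsilon> in at_right 0. H1 \<rho>0 (phi \<epsilon> n) \<and> grad_norm (phi \<epsilon> n) \<le> G \<and> L2_norm \<rho>0 (phi \<epsilon> n) \<le> G \<and> \<bar>lam \<epsilon> n\<bar> \<le> G"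
    using eigenvalue_upper[of 1 n, OF zero_less_one] eventually_small_scale
  proof eventually_elim
    case (elim \<epsilon>)
    then have \<epsilon>: "\<epsilon> > 0" by simp
    have f: "wform (mat \<sigma>) (\<rho>e \<epsilon>) (phi \<epsilon> n) (phi \<epsilon> n) \<le> E'"
      using elim by (simp add: phi_form[OF \<epsilon> phi_H1[OF \<epsilon>]] phi_orthonormal[OF \<epsilon>] E'_def)
    have o: "L2_inner (\<rho>e \<epsilon>) (phi \<epsilon> n) (phi \<epsilon> n) = 1" by (simp add: phi_orthonormal[OF \<epsilon>])
    show ?case using energy_bound[OF phi_H1[OF \<epsilon>] f o] phi_H1[OF \<epsilon>] lam_nonneg[OF \<epsilon>, of n] elim
      by (auto simp: G_def E'_def)
  qed
  then show ?thesis by blast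
qed

text \<open>Compactness of the embedding of \<open>H\<^sup>1\<close> into \<open>L\<^sup>2\<close>: on a bounded set the energy is bounded, so the
  remainder after \<open>M\<close> modes is small as soon as \<open>lam0 M\<close> is large.\<close>

lemma spectral_tail_small:
  assumes e: "e > 0"
  shows "\<exists>M>n. \<forall>u. H1 \<rho>0 u \<longrightarrow> grad_norm u \<le> G \<longrightarrow> L2_norm \<rho>0 (\<lambda>x. u x - (\<Sum>i<M. L2_inner \<rho>0 u (phi0 i) * phi0 i x)) \<le> e"
proof -
  define K where "K = (\<Sum>i\<in>UNIV. \<Sum>j\<in>UNIV. \<bar>Sig $ i $ j\<bar>)"
  have K0: "K \<ge> 0" unfolding K_def by (intro sum_nonneg) auto
  have "\<forall>\<^sub>F M in sequentially. lam0 M \<ge> (K * G\<^sup>2 + 1) / e\<^sup>2" using eigen_zero(3) unfolding filterlim_at_top by blast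
  moreover have "\<forall>\<^sub>F M in sequentially. M > n" by (rule eventually_gt_at_top)
  ultimately have "\<forall>\<^sub>F M in sequentially. lam0 M \<ge> (K * G\<^sup>2 + 1) / e\<^sup>2 \<and> M > n" by (rule eventually_conj)
  then obtain M where M: "lam0 M \<ge> (K * G\<^sup>2 + 1) / e\<^sup>2" "M > n" unfolding eventually_sequentially by blast
  have "L2_norm \<rho>0 (\<lambda>x. u x - (\<Sum>i<M. L2_inner \<rho>0 u (phi0 i) * phi0 i x)) \<le> e" if u: "H1 \<rho>0 u" and g: "grad_norm u \<le> G" for u
  proof -
    define N where "N = L2_norm \<rho>0 (\<lambda>x. u x - (\<Sum>i<M. L2_inner \<rho>0 u (phi0 i) * phi0 i x))"
    have "lam0 M * N\<^sup>2 \<le> wform Sig \<rho>0 u u"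
      unfolding N_def by (rule spectral_tail[OF eigen_hom Sig_sym Sig_psd u])
    also have "\<dots> \<le> K * grad_norm u * grad_norm u" using wform_bound[OF u u, of Sig] by (simp add: K_def)
    also have "\<dots> \<le> K * G * G" using g K0 by (intro mult_mono mult_nonneg_nonneg) (auto simp: grad_norm_nonneg intro: order_trans[OF grad_norm_nonneg])
    finally have 1: "lam0 M * N\<^sup>2 \<le> K * G\<^sup>2" by (simp add: power2_eq_square mult.assoc)
    have "(K * G\<^sup>2 + 1) / e\<^sup>2 * N\<^sup>2 \<le> lam0 M * N\<^sup>2" using M(1) by (intro mult_right_mono) auto
    then have "(K * G\<^sup>2 + 1) * N\<^sup>2 / e\<^sup>2 \<le> K * G\<^sup>2" using 1 by simp
    then have "(K * G\<^sup>2 + 1) * N\<^sup>2 \<le> K * G\<^sup>2 * e\<^sup>2" using e by (simp add: pos_divide_le_eq)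
    also have "\<dots> \<le> (K * G\<^sup>2 + 1) * e\<^sup>2" by (intro mult_right_mono) auto
    finally have cmp: "(K * G\<^sup>2 + 1) * N\<^sup>2 \<le> (K * G\<^sup>2 + 1) * e\<^sup>2" .
    have pos: "0 < K * G\<^sup>2 + 1" using K0 by (intro add_nonneg_pos) auto
    have "N\<^sup>2 \<le> e\<^sup>2" by (rule mult_left_le_imp_le[OF cmp pos])
    then have "N \<le> e" by (rule power2_le_imp_le) (use e in simp)
    then show ?thesis unfolding N_def .
  qed
  then show ?thesis using M(2) by blast
qed

lemma coefficient_bound: "L2 \<rho>0 u \<Longrightarrow> \<bar>L2_inner \<rho>0 u (phi0 i)\<bar> \<le> L2_norm \<rho>0 u"
  using L2_CS[of u "phi0 i"] eigen_zero(5)[of i] eigen_zero(7)[of i i] by (simp add: L2_norm_def)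

lemma bounded_imp_totally_bounded:
  assumes u: "\<forall>\<^sub>F \<epsilon> in at_right 0. H1 \<rho>0 (u \<epsilon>) \<and> grad_norm (u \<epsilon>) \<le> G \<and> L2_norm \<rho>0 (u \<epsilon>) \<le> G"
  shows "totally_bounded_family u"
  unfolding totally_bounded_family_def
proof (intro allI impI)
  fix e :: real assume e: "e > 0"
  obtain M where M: "\<And>u. H1 \<rho>0 u \<Longrightarrow> grad_norm u \<le> G \<Longrightarrow> L2_norm \<rho>0 (\<lambda>x. u x - (\<Sum>i<M. L2_inner \<rho>0 u (phi0 i) * phi0 i x)) \<le> e"
    using spectral_tail_small[OF e, of 0 G] by blast
  have "\<forall>\<^sub>F \<epsilon> in at_right 0. L2 \<rho>0 (u \<epsilon>) \<and>
     (\<exists>c. (\<forall>n<M. \<bar>c n\<bar> \<le> G) \<and> L2_norm \<rho>0 (\<lambda>x. u \<epsilon> x - (\<Sum>n<M. c n * phi0 n x)) \<le> e)"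
    using u
  proof eventually_elim
    case (elim \<epsilon>)
    then have "L2 \<rho>0 (u \<epsilon>)" using H1_D(1) by blast
    then show ?case using elim M[of "u \<epsilon>"] coefficient_bound[of "u \<epsilon>"] order_trans
      by (intro conjI exI[of _ "\<lambda>n. L2_inner \<rho>0 (u \<epsilon>) (phi0 n)"]) blast+
  qed
  then show "\<exists>(N::nat) f B. (\<forall>n<N. L2 \<rho>0 (f n)) \<and> (\<forall>\<^sub>F \<epsilon> in at_right 0. L2 \<rho>0 (u \<epsilon>) \<and>
     (\<exists>c. (\<forall>n<N. \<bar>c n\<bar> \<le> B) \<and> L2_norm \<rho>0 (\<lambda>x. u \<epsilon> x - (\<Sum>n<N. c n * f n x)) \<le> e))"
    using eigen_zero(5) by (intro exI[of _ M] exI[of _ phi0] exI[of _ G]) auto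
qed

text \<open>Testing the multiscale equation with correctors and passing to the limit shows that the
  eigenfunctions solve the homogenized equation up to a vanishing error; it is then tested with
  an eigenfunction of the limit problem.\<close>

lemma coefficient_limit:
  "((\<lambda>\<epsilon>. (lam \<epsilon> k - lam0 n) * L2_inner \<rho>0 (phi \<epsilon> k) (phi0 n)) \<longlongrightarrow> 0) (at_right 0)"
proof -
  obtain G where G: "\<forall>\<^sub>F \<epsilon> in at_right 0. H1 \<rho>0 (phi \<epsilon> k) \<and> grad_norm (phi \<epsilon> k) \<le> G \<and> L2_norm \<rho>0 (phi \<epsilon> k) \<le> G \<and> \<bar>lam \<epsilon> k\<bar> \<le> G"
    using eigenfunction_bounds by blast
  have pc: "totally_bounded_family (\<lambda>\<epsilon>. phi \<epsilon> k)"
    by (rule bounded_imp_totally_bounded[where G=G]) (use G in \<open>auto elim: eventually_mono\<close>)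
  have G1: "\<forall>\<^sub>F \<epsilon> in at_right 0. H1 \<rho>0 (phi \<epsilon> k) \<and> grad_norm (phi \<epsilon> k) \<le> G" using G by eventually_elim simp
  have G2: "\<forall>\<^sub>F \<epsilon> in at_right 0. L2 \<rho>0 (phi \<epsilon> k) \<and> L2_norm \<rho>0 (phi \<epsilon> k) \<le> G" using G by eventually_elim (auto intro: H1_D(1))
  have t: "((\<lambda>\<epsilon>. wform Sig \<rho>0 (phi \<epsilon> k) \<psi> - lam \<epsilon> k * L2_inner \<rho>0 (phi \<epsilon> k) \<psi> - wform Sig \<rho>0 (\<lambda>x. 0) \<psi>) \<longlongrightarrow> 0) (at_right 0)"
    if \<psi>: "test_function \<psi>" for \<psi>
  proof -
    define X where "X \<epsilon> = wform (mat \<sigma>) (\<rho>e \<epsilon>) (phi \<epsilon> k) (corrector \<epsilon> \<psi>) - wform Sig \<rho>0 (phi \<epsilon> k) \<psi>" for \<epsilon>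
    define Y where "Y \<epsilon> = L2_inner (\<rho>e \<epsilon>) (phi \<epsilon> k) (corrector \<epsilon> \<psi>) - L2_inner \<rho>0 (phi \<epsilon> k) \<psi>" for \<epsilon>
    have X: "(X \<longlongrightarrow> 0) (at_right 0)" unfolding X_def[abs_def] by (rule form_convergence[OF pc G1 \<psi>])
    have Y: "(Y \<longlongrightarrow> 0) (at_right 0)" unfolding Y_def[abs_def] by (rule mass_convergence[OF pc G2 \<psi>])
    have "((\<lambda>\<epsilon>. G * \<bar>Y \<epsilon>\<bar>) \<longlongrightarrow> G * \<bar>0\<bar>) (at_right 0)" by (intro tendsto_intros Y)
    then have GY: "((\<lambda>\<epsilon>. G * \<bar>Y \<epsilon>\<bar>) \<longlongrightarrow> 0) (at_right 0)" by simp
    have lY: "((\<lambda>\<epsilon>. lam \<epsilon> k * Y \<epsilon>) \<longlongrightarrow> 0) (at_right 0)"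
      by (rule Lim_null_comparison[OF _ GY]) (use G in \<open>auto elim!: eventually_mono simp: abs_mult intro!: mult_right_mono\<close>)
    have lim: "((\<lambda>\<epsilon>. lam \<epsilon> k * Y \<epsilon> - X \<epsilon>) \<longlongrightarrow> 0 - 0) (at_right 0)" by (rule tendsto_diff[OF lY X])
    have "\<forall>\<^sub>F \<epsilon> in at_right 0. lam \<epsilon> k * Y \<epsilon> - X \<epsilon> = wform Sig \<rho>0 (phi \<epsilon> k) \<psi> - lam \<epsilon> k * L2_inner \<rho>0 (phi \<epsilon> k) \<psi> - wform Sig \<rho>0 (\<lambda>x. 0) \<psi>"
      using eventually_small_scale
    proof eventually_elim
      case (elim \<epsilon>)
      then have \<epsilon>: "\<epsilon> > 0" by simp
      show ?case unfolding X_def Y_def phi_form[OF \<epsilon> corrector_H1(1)[OF \<psi>]] wform_zero(1)[OF H1_test(1)[OF \<psi>]]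
        by (simp add: algebra_simps)
    qed
    then show ?thesis using lim by (simp add: tendsto_cong)
  qed
  have "((\<lambda>\<epsilon>. wform Sig \<rho>0 (phi \<epsilon> k) (phi0 n) - lam \<epsilon> k * L2_inner \<rho>0 (phi \<epsilon> k) (phi0 n) - wform Sig \<rho>0 (\<lambda>x. 0) (phi0 n)) \<longlongrightarrow> 0) (at_right 0)"
    by (rule limit_equation_by_density[OF G H1_zero t eigen_zero(4)])
  then have "((\<lambda>\<epsilon>. - (wform Sig \<rho>0 (phi \<epsilon> k) (phi0 n) - lam \<epsilon> k * L2_inner \<rho>0 (phi \<epsilon> k) (phi0 n) - wform Sig \<rho>0 (\<lambda>x. 0) (phi0 n))) \<longlongrightarrow> - 0) (at_right 0)"
    by (rule tendsto_minus)
  moreover have "\<forall>\<^sub>F \<epsilon> in at_right 0. - (wform Sig \<rho>0 (phi \<epsilon> k) (phi0 n) - lam \<epsilon> k * L2_inner \<rho>0 (phi \<epsilon> k) (phi0 n) - wform Sig \<rho>0 (\<lambda>x. 0) (phi0 n))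
     = (lam \<epsilon> k - lam0 n) * L2_inner \<rho>0 (phi \<epsilon> k) (phi0 n)"
    using eventually_small_scale
  proof eventually_elim
    case (elim \<epsilon>)
    then have \<epsilon>: "\<epsilon> > 0" by simp
    have "wform Sig \<rho>0 (phi \<epsilon> k) (phi0 n) = lam0 n * L2_inner \<rho>0 (phi \<epsilon> k) (phi0 n)"
      using Sig_sym[OF phi_H1[OF \<epsilon>] eigen_zero(4), of k n] eigen_zero(6)[OF phi_H1[OF \<epsilon>], of n k] L2_inner_commute[of "phi0 n" "phi \<epsilon> k"] by simp
    then show ?case by (simp add: wform_zero(1)[OF eigen_zero(4)] algebra_simps)
  qed
  ultimately show ?thesis by (simp add: tendsto_cong)
qed

lemma phi0_norm: "L2_norm \<rho>0 (phi0 i) = 1"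
  unfolding L2_norm_def using eigen_zero(7)[of i i] by simp

lemma projection_norm:
  "L2_norm \<rho>0 (\<lambda>x. \<Sum>i\<in>I. c i * phi0 i x) \<le> (\<Sum>i\<in>I. \<bar>c i\<bar>)"
proof -
  have "L2_norm \<rho>0 (\<lambda>x. \<Sum>i\<in>I. c i * phi0 i x) \<le> (\<Sum>i\<in>I. L2_norm \<rho>0 (\<lambda>x. c i * phi0 i x))"
    by (rule L2_norm_sum) (intro L2_cmult eigen_zero(5))
  also have "\<dots> = (\<Sum>i\<in>I. \<bar>c i\<bar>)"
    by (simp add: L2_norm_cmult phi0_norm)
  finally show ?thesis .
qed

text \<open>If \<open>lam \<epsilon> n < lam0 n - d\<close>, then for \<open>k \<le> n \<le> i\<close> the factors \<open>lam \<epsilon> k - lam0 i\<close> in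
  \<open>coefficient_limit\<close> are at least \<open>d\<close> in absolute value, so the corresponding coefficients are small.
  A combination of the first \<open>n + 1\<close> multiscale eigenfunctions that is normalized and
  orthogonal to the first \<open>n\<close> limit modes then has only small coefficients and a small tail,
  which is impossible.\<close>

lemma eigenvalue_lower:
  assumes d: "d > 0"
  shows "\<forall>\<^sub>F \<epsilon> in at_right 0. lam0 n - d \<le> lam \<epsilon> n"
proof -
  define G where "G = sqrt (real CARD('d) * lam0 n / (ratio_min * \<sigma>))"
  \<comment> \<open>A function of unit multiscale mass has norm at least 1 / sqrt ratio_max; half of it is
    allotted to the tail and half to the low modes.\<close>
  define t where "t = 1 / (2 * sqrt ratio_max)"
  have t: "t > 0" unfolding t_def using density_ratio_bounds(2) by simp
  obtain M where M: "\<And>u. H1 \<rho>0 u \<Longrightarrow> grad_norm u \<le> G \<Longrightarrow> L2_norm \<rho>0 (\<lambda>x. u x - (\<Sum>i<M. L2_inner \<rho>0 u (phi0 i) * phi0 i x)) \<le> t"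
    using spectral_tail_small[OF t, of 0 G] by blast
  define r where "r k i \<epsilon> = (lam \<epsilon> k - lam0 i) * L2_inner \<rho>0 (phi \<epsilon> k) (phi0 i)" for k i \<epsilon>
  have "((\<lambda>\<epsilon>. \<Sum>i<M. \<Sum>k\<le>n. \<bar>r k i \<epsilon>\<bar> / d) \<longlongrightarrow> (\<Sum>i<M. \<Sum>k\<le>n. \<bar>0\<bar> / d)) (at_right 0)"
    unfolding r_def using d by (intro tendsto_intros coefficient_limit) auto
  then have "\<forall>\<^sub>F \<epsilon> in at_right 0. (\<Sum>i<M. \<Sum>k\<le>n. \<bar>r k i \<epsilon>\<bar> / d) < t"
    using t by (intro order_tendstoD(2)) auto
  then show ?thesis using eventually_small_scale
  proof eventually_elim
    case (elim \<epsilon>)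
    then have \<epsilon>: "\<epsilon> > 0" and S: "(\<Sum>i<M. \<Sum>k\<le>n. \<bar>r k i \<epsilon>\<bar> / d) < t" by auto
    show ?case
    proof (rule ccontr)
      assume "\<not> lam0 n - d \<le> lam \<epsilon> n"
      then have small: "lam \<epsilon> n < lam0 n - d" by simp
      obtain \<alpha> where \<alpha>: "(\<Sum>k\<le>n. (\<alpha> k)\<^sup>2) = 1" "\<And>j. j < n \<Longrightarrow> (\<Sum>k\<le>n. \<alpha> k * L2_inner \<rho>0 (phi \<epsilon> k) (phi0 j)) = 0"
        using underdetermined_unit_solution[of n "\<lambda>k j. L2_inner \<rho>0 (phi \<epsilon> k) (phi0 j)"] by blast
      have a1: "\<bar>\<alpha> k\<bar> \<le> 1" if "k \<le> n" for k
      proof -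
        have "(\<alpha> k)\<^sup>2 \<le> (\<Sum>k\<le>n. (\<alpha> k)\<^sup>2)" using that by (intro member_le_sum) auto
        then show ?thesis using \<alpha>(1) by (simp add: abs_square_le_1)
      qed
      define v where "v = (\<lambda>x. \<Sum>k\<le>n. \<alpha> k * phi \<epsilon> k x)"
      note c = combination[OF phi_H1[OF \<epsilon>] v_def]
      have v1: "L2_inner (\<rho>e \<epsilon>) v v = 1"
        unfolding c(4) using \<alpha>(1) by (simp add: phi_orthonormal[OF \<epsilon>] power2_eq_square if_distrib[of "(*) _"] cong: if_cong)
      have "wform (mat \<sigma>) (\<rho>e \<epsilon>) v v = (\<Sum>k\<le>n. (\<alpha> k)\<^sup>2 * lam \<epsilon> k)"
        unfolding c(5) by (simp add: phi_form[OF \<epsilon> phi_H1[OF \<epsilon>]] phi_orthonormal[OF \<epsilon>] power2_eq_square if_distrib[of "(*) _"] cong: if_cong)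
      also have "\<dots> \<le> (\<Sum>k\<le>n. (\<alpha> k)\<^sup>2 * lam \<epsilon> n)"
        using lam_mono[OF \<epsilon>] by (intro sum_mono mult_left_mono) auto
      also have "\<dots> = lam \<epsilon> n" using \<alpha>(1) by (simp add: sum_distrib_right[symmetric])
      also have "\<dots> \<le> lam0 n" using small d by simp
      finally have wv: "wform (mat \<sigma>) (\<rho>e \<epsilon>) v v \<le> lam0 n" .
      have g: "grad_norm v \<le> G" unfolding G_def by (rule energy_bound(1)[OF c(1) wv v1])
      define b where "b i = L2_inner \<rho>0 v (phi0 i)" for i
      have b: "\<bar>b i\<bar> \<le> (\<Sum>k\<le>n. \<bar>r k i \<epsilon>\<bar> / d)" for i
      proof (cases "i < n")
        case True
        then have "b i = 0" unfolding b_def c(3)[OF eigen_zero(5)] using \<alpha>(2) by simp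
        then show ?thesis using d by (simp add: sum_nonneg)
      next
        case False
        have "\<bar>b i\<bar> \<le> (\<Sum>k\<le>n. \<bar>\<alpha> k * L2_inner \<rho>0 (phi \<epsilon> k) (phi0 i)\<bar>)" unfolding b_def c(3)[OF eigen_zero(5)] by (rule sum_abs)
        also have "\<dots> \<le> (\<Sum>k\<le>n. \<bar>r k i \<epsilon>\<bar> / d)"
        proof (rule sum_mono)
          fix k assume "k \<in> {..n}"
          then have k: "k \<le> n" by simp
          have "lam0 n \<le> lam0 i" using False strict_mono_less_eq[OF eigen_zero(2)] by simp
          then have "d \<le> \<bar>lam \<epsilon> k - lam0 i\<bar>" using lam_mono[OF \<epsilon> k] small by linarith
          then have "d * \<bar>L2_inner \<rho>0 (phi \<epsilon> k) (phi0 i)\<bar> \<le> \<bar>r k i \<epsilon>\<bar>"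
            unfolding r_def abs_mult by (intro mult_right_mono) auto
          then have 1: "\<bar>L2_inner \<rho>0 (phi \<epsilon> k) (phi0 i)\<bar> \<le> \<bar>r k i \<epsilon>\<bar> / d" using d by (simp add: pos_le_divide_eq mult.commute)
          have "\<bar>\<alpha> k\<bar> * \<bar>L2_inner \<rho>0 (phi \<epsilon> k) (phi0 i)\<bar> \<le> 1 * \<bar>L2_inner \<rho>0 (phi \<epsilon> k) (phi0 i)\<bar>"
            using a1[OF k] by (intro mult_right_mono) auto
          then show "\<bar>\<alpha> k * L2_inner \<rho>0 (phi \<epsilon> k) (phi0 i)\<bar> \<le> \<bar>r k i \<epsilon>\<bar> / d" using 1 by (simp add: abs_mult)
        qed
        finally show ?thesis .
      qed
      define P where "P = (\<lambda>x. \<Sum>i<M. b i * phi0 i x)"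
      have PL: "L2 \<rho>0 P" unfolding P_def by (intro L2_sum L2_cmult eigen_zero(5))
      have "L2_norm \<rho>0 P \<le> (\<Sum>i<M. \<bar>b i\<bar>)" unfolding P_def by (rule projection_norm)
      also have "\<dots> \<le> (\<Sum>i<M. \<Sum>k\<le>n. \<bar>r k i \<epsilon>\<bar> / d)" by (intro sum_mono b)
      finally have Pn: "L2_norm \<rho>0 P < t" using S by linarith
      have "L2_norm \<rho>0 (\<lambda>x. v x - P x) \<le> t" unfolding P_def b_def by (rule M[OF c(1) g])
      moreover have "L2_norm \<rho>0 v \<le> L2_norm \<rho>0 (\<lambda>x. v x - P x) + L2_norm \<rho>0 P"
        using L2_norm_triangle[OF L2_diff[OF H1_D(1)[OF c(1)] PL] PL] by simp
      ultimately have "L2_norm \<rho>0 v < 2 * t" using Pn by linarith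
      then have "(L2_norm \<rho>0 v)\<^sup>2 < (2 * t)\<^sup>2" by (intro power_strict_mono) (auto simp: L2_norm_nonneg)
      also have "(2 * t)\<^sup>2 = 1 / ratio_max" unfolding t_def using density_ratio_bounds(2) by (simp add: power_divide)
      finally have "ratio_max * (L2_norm \<rho>0 v)\<^sup>2 < 1" using density_ratio_bounds(2) by (simp add: pos_less_divide_eq mult.commute)
      then show False
        using L2_inner_eps_lower(2)[OF H1_D(1)[OF c(1)], of \<epsilon>] v1 unfolding L2_inner_eps L2_norm_sq by linarith
    qed
  qed
qed

lemma eigenvalue_convergence: "((\<lambda>\<epsilon>. lam \<epsilon> n) \<longlongrightarrow> lam0 n) (at_right 0)"
proof (rule tendstoI)
  fix e :: real assume e: "e > 0"
  then have e2: "e / 2 > 0" by simp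
  show "\<forall>\<^sub>F \<epsilon> in at_right 0. dist (lam \<epsilon> n) (lam0 n) < e"
    using eigenvalue_upper[OF e2, of n] eigenvalue_lower[OF e2, of n]
  proof eventually_elim
    case (elim \<epsilon>)
    then have "\<bar>lam \<epsilon> n - lam0 n\<bar> \<le> e / 2" by linarith
    also have "\<dots> < e" using e by simp
    finally show ?case by (simp add: dist_real_def)
  qed
qed

lemma other_coefficients_vanish:
  assumes "i \<noteq> n"
  shows "((\<lambda>\<epsilon>. L2_inner \<rho>0 (phi \<epsilon> n) (phi0 i)) \<longlongrightarrow> 0) (at_right 0)"
proof -
  have ne: "lam0 n - lam0 i \<noteq> 0" using assms strict_mono_eq[OF eigen_zero(2)] by simp
  have l: "((\<lambda>\<epsilon>. lam \<epsilon> n - lam0 i) \<longlongrightarrow> lam0 n - lam0 i) (at_right 0)" by (intro tendsto_intros eigenvalue_convergence)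
  have "((\<lambda>\<epsilon>. (lam \<epsilon> n - lam0 i) * L2_inner \<rho>0 (phi \<epsilon> n) (phi0 i) / (lam \<epsilon> n - lam0 i)) \<longlongrightarrow> 0 / (lam0 n - lam0 i)) (at_right 0)"
    by (rule tendsto_divide[OF coefficient_limit l ne])
  moreover have "\<forall>\<^sub>F \<epsilon> in at_right 0. (lam \<epsilon> n - lam0 i) * L2_inner \<rho>0 (phi \<epsilon> n) (phi0 i) / (lam \<epsilon> n - lam0 i) = L2_inner \<rho>0 (phi \<epsilon> n) (phi0 i)"
    using tendsto_imp_eventually_ne[OF l ne] by eventually_elim simp
  ultimately show ?thesis by (simp add: tendsto_cong)
qed

text \<open>All modes except the one with index \<open>n\<close> disappear: the low ones by \<open>other_coefficients_vanish\<close>, the high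
  ones uniformly by compactness.\<close>

lemma eigenfunction_direction:
  "((\<lambda>\<epsilon>. L2_norm \<rho>0 (\<lambda>x. phi \<epsilon> n x - L2_inner \<rho>0 (phi \<epsilon> n) (phi0 n) * phi0 n x)) \<longlongrightarrow> 0) (at_right 0)"
proof (rule tendstoI)
  fix e :: real assume e: "e > 0"
  then have e2: "e / 2 > 0" by simp
  obtain G where G: "\<forall>\<^sub>F \<epsilon> in at_right 0. H1 \<rho>0 (phi \<epsilon> n) \<and> grad_norm (phi \<epsilon> n) \<le> G \<and> L2_norm \<rho>0 (phi \<epsilon> n) \<le> G \<and> \<bar>lam \<epsilon> n\<bar> \<le> G"
    using eigenfunction_bounds by blast
  obtain M where Mn: "M > n" and M: "\<And>u. H1 \<rho>0 u \<Longrightarrow> grad_norm u \<le> G \<Longrightarrow> L2_norm \<rho>0 (\<lambda>x. u x - (\<Sum>i<M. L2_inner \<rho>0 u (phi0 i) * phi0 i x)) \<le> e / 2"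
    using spectral_tail_small[OF e2, of n G] by blast
  have "((\<lambda>\<epsilon>. \<Sum>i\<in>{..<M} - {n}. \<bar>L2_inner \<rho>0 (phi \<epsilon> n) (phi0 i)\<bar>) \<longlongrightarrow> (\<Sum>i\<in>{..<M} - {n}. \<bar>0\<bar>)) (at_right 0)"
    by (intro tendsto_intros other_coefficients_vanish) auto
  then have "\<forall>\<^sub>F \<epsilon> in at_right 0. (\<Sum>i\<in>{..<M} - {n}. \<bar>L2_inner \<rho>0 (phi \<epsilon> n) (phi0 i)\<bar>) < e / 2"
    using e2 by (intro order_tendstoD(2)) auto
  then show "\<forall>\<^sub>F \<epsilon> in at_right 0. dist (L2_norm \<rho>0 (\<lambda>x. phi \<epsilon> n x - L2_inner \<rho>0 (phi \<epsilon> n) (phi0 n) * phi0 n x)) 0 < e"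
    using G
  proof eventually_elim
    case (elim \<epsilon>)
    define u where "u = phi \<epsilon> n"
    define Q where "Q = (\<lambda>x. \<Sum>i\<in>{..<M} - {n}. L2_inner \<rho>0 u (phi0 i) * phi0 i x)"
    have u: "H1 \<rho>0 u" "grad_norm u \<le> G" using elim by (auto simp: u_def)
    have QL: "L2 \<rho>0 Q" unfolding Q_def by (intro L2_sum L2_cmult eigen_zero(5))
    have cL: "L2 \<rho>0 (\<lambda>x. L2_inner \<rho>0 u (phi0 n) * phi0 n x)" by (intro L2_cmult eigen_zero(5))
    have sp: "(\<Sum>i<M. L2_inner \<rho>0 u (phi0 i) * phi0 i x) = L2_inner \<rho>0 u (phi0 n) * phi0 n x + Q x" for x
      unfolding Q_def using Mn by (subst sum.remove[of "{..<M}" n]) auto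
    have "L2_norm \<rho>0 (\<lambda>x. u x - L2_inner \<rho>0 u (phi0 n) * phi0 n x) \<le>
        L2_norm \<rho>0 (\<lambda>x. u x - (L2_inner \<rho>0 u (phi0 n) * phi0 n x + Q x)) + L2_norm \<rho>0 (\<lambda>x. (L2_inner \<rho>0 u (phi0 n) * phi0 n x + Q x) - L2_inner \<rho>0 u (phi0 n) * phi0 n x)"
      by (rule L2_norm_triangle_diff[OF H1_D(1)[OF u(1)] L2_add[OF cL QL] cL])
    also have "\<dots> = L2_norm \<rho>0 (\<lambda>x. u x - (L2_inner \<rho>0 u (phi0 n) * phi0 n x + Q x)) + L2_norm \<rho>0 Q" by simp
    also have "L2_norm \<rho>0 (\<lambda>x. u x - (L2_inner \<rho>0 u (phi0 n) * phi0 n x + Q x)) \<le> e / 2"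
      using M[OF u] unfolding sp .
    also have "L2_norm \<rho>0 Q \<le> (\<Sum>i\<in>{..<M} - {n}. \<bar>L2_inner \<rho>0 u (phi0 i)\<bar>)" unfolding Q_def by (rule projection_norm)
    also have "\<dots> < e / 2" using elim by (simp add: u_def)
    finally have "L2_norm \<rho>0 (\<lambda>x. u x - L2_inner \<rho>0 u (phi0 n) * phi0 n x) < e" by simp
    then show ?case by (simp add: u_def L2_norm_nonneg)
  qed
qed

text \<open>The eigenfunction and its projection onto the surviving mode have almost the same multiscale
  norm. That of the eigenfunction is one, and that of the mode tends to one by averaging.\<close>

lemma coefficient_abs_limit: "((\<lambda>\<epsilon>. \<bar>L2_inner \<rho>0 (phi \<epsilon> n) (phi0 n)\<bar>) \<longlongrightarrow> 1) (at_right 0)"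
proof -
  define c where "c \<epsilon> = L2_inner \<rho>0 (phi \<epsilon> n) (phi0 n)" for \<epsilon>
  define N where "N \<epsilon> = L2_norm (\<rho>e \<epsilon>) (phi0 n)" for \<epsilon>
  define \<delta> where "\<delta> \<epsilon> = L2_norm \<rho>0 (\<lambda>x. phi \<epsilon> n x - c \<epsilon> * phi0 n x)" for \<epsilon>
  have \<delta>: "(\<delta> \<longlongrightarrow> 0) (at_right 0)" unfolding \<delta>_def[abs_def] c_def[abs_def] by (rule eigenfunction_direction)
  have i: "integrable lebesgue (\<lambda>x. phi0 n x * phi0 n x * \<rho>0 x)" by (rule L2_prod[OF eigen_zero(5) eigen_zero(5)])
  have "((\<lambda>\<epsilon>. LINT x|lebesgue. (phi0 n x * phi0 n x * \<rho>0 x) * (1 * m \<epsilon> x)) \<longlongrightarrow> mu_average (\<lambda>_. 1) * (LINT x|lebesgue. phi0 n x * phi0 n x * \<rho>0 x)) (at_right 0)"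
    by (rule weak_star[OF periodic_const continuous_on_const i])
  moreover have "(LINT x|lebesgue. phi0 n x * phi0 n x * \<rho>0 x) = 1" using eigen_zero(7)[of n n] by (simp add: L2_inner_def)
  moreover have "(LINT x|lebesgue. (phi0 n x * phi0 n x * \<rho>0 x) * (1 * m \<epsilon> x)) = L2_inner (\<rho>e \<epsilon>) (phi0 n) (phi0 n)" for \<epsilon>
    unfolding L2_inner_def rhoe by (simp add: mult_ac)
  ultimately have "((\<lambda>\<epsilon>. L2_inner (\<rho>e \<epsilon>) (phi0 n) (phi0 n)) \<longlongrightarrow> 1) (at_right 0)" by (simp add: mu_average_one)
  then have "((\<lambda>\<epsilon>. sqrt (L2_inner (\<rho>e \<epsilon>) (phi0 n) (phi0 n))) \<longlongrightarrow> sqrt 1) (at_right 0)" by (rule tendsto_real_sqrt)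
  then have N: "(N \<longlongrightarrow> 1) (at_right 0)" unfolding N_def[abs_def] L2_norm_def by simp
  have cmp: "\<forall>\<^sub>F \<epsilon> in at_right 0. norm (\<bar>c \<epsilon>\<bar> * N \<epsilon> - 1) \<le> sqrt ratio_max * \<delta> \<epsilon>"
    using eventually_small_scale
  proof eventually_elim
    case (elim \<epsilon>)
    then have \<epsilon>: "\<epsilon> > 0" by simp
    interpret W: weight "\<rho>e \<epsilon>" "ratio_max * rho_max" by (rule weight_eps)
    have pL: "L2 \<rho>0 (phi \<epsilon> n)" by (rule H1_D(1)[OF phi_H1[OF \<epsilon>]])
    have cL: "L2 \<rho>0 (\<lambda>x. c \<epsilon> * phi0 n x)" by (intro L2_cmult eigen_zero(5))
    have pW: "L2 (\<rho>e \<epsilon>) (phi \<epsilon> n)" "L2 (\<rho>e \<epsilon>) (\<lambda>x. c \<epsilon> * phi0 n x)" using pL cL L2_eps by auto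
    have one: "L2_norm (\<rho>e \<epsilon>) (phi \<epsilon> n) = 1" unfolding L2_norm_def by (simp add: phi_orthonormal[OF \<epsilon>])
    have cn: "L2_norm (\<rho>e \<epsilon>) (\<lambda>x. c \<epsilon> * phi0 n x) = \<bar>c \<epsilon>\<bar> * N \<epsilon>" unfolding N_def by (rule W.L2_norm_cmult)
    define D where "D = L2_norm (\<rho>e \<epsilon>) (\<lambda>x. phi \<epsilon> n x - c \<epsilon> * phi0 n x)"
    have t1: "1 \<le> D + \<bar>c \<epsilon>\<bar> * N \<epsilon>"
      using W.L2_norm_triangle[OF W.L2_diff[OF pW] pW(2)] by (simp add: one cn D_def)
    have t2: "\<bar>c \<epsilon>\<bar> * N \<epsilon> \<le> D + 1"
      using W.L2_norm_triangle[OF W.L2_diff[OF pW(2) pW(1)] pW(1)] W.L2_norm_minus_commute[of "phi \<epsilon> n" "\<lambda>x. c \<epsilon> * phi0 n x"]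
      by (simp add: one cn D_def)
    have "D\<^sup>2 \<le> ratio_max * (\<delta> \<epsilon>)\<^sup>2"
      using L2_inner_eps_lower(2)[OF L2_diff[OF pL cL], of \<epsilon>]
      unfolding D_def \<delta>_def W.L2_norm_sq L2_norm_sq L2_inner_eps .
    also have "\<dots> = (sqrt ratio_max * \<delta> \<epsilon>)\<^sup>2" using density_ratio_bounds(2) by (simp add: power_mult_distrib)
    finally have "D \<le> sqrt ratio_max * \<delta> \<epsilon>"
      by (rule power2_le_imp_le) (use density_ratio_bounds(2) L2_norm_nonneg in \<open>auto simp: \<delta>_def\<close>)
    then show ?case using t1 t2 by simp
  qed
  have "((\<lambda>\<epsilon>. sqrt ratio_max * \<delta> \<epsilon>) \<longlongrightarrow> sqrt ratio_max * 0) (at_right 0)" by (intro tendsto_intros \<delta>)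
  then have "((\<lambda>\<epsilon>. \<bar>c \<epsilon>\<bar> * N \<epsilon> - 1) \<longlongrightarrow> 0) (at_right 0)" by (intro Lim_null_comparison[OF cmp]) simp
  then have cN: "((\<lambda>\<epsilon>. \<bar>c \<epsilon>\<bar> * N \<epsilon>) \<longlongrightarrow> 1) (at_right 0)" by (rule LIM_zero_cancel)
  have "((\<lambda>\<epsilon>. \<bar>c \<epsilon>\<bar> * N \<epsilon> / N \<epsilon>) \<longlongrightarrow> 1 / 1) (at_right 0)" by (rule tendsto_divide[OF cN N]) simp
  moreover have "\<forall>\<^sub>F \<epsilon> in at_right 0. \<bar>c \<epsilon>\<bar> * N \<epsilon> / N \<epsilon> = \<bar>c \<epsilon>\<bar>"
    using tendsto_imp_eventually_ne[OF N, of 0] by (auto elim: eventually_mono)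
  ultimately show ?thesis unfolding c_def[symmetric] by (simp add: tendsto_cong)
qed

lemma eigenfunction_convergence:
  assumes sign: "\<forall>\<^sub>F \<epsilon> in at_right 0. L2_inner \<rho>0 (phi \<epsilon> n) (phi0 n) > 0"
  shows "((\<lambda>\<epsilon>. L2_norm \<rho>0 (\<lambda>x. phi \<epsilon> n x - phi0 n x)) \<longlongrightarrow> 0) (at_right 0)"
proof -
  define c where "c \<epsilon> = L2_inner \<rho>0 (phi \<epsilon> n) (phi0 n)" for \<epsilon>
  have "\<forall>\<^sub>F \<epsilon> in at_right 0. \<bar>c \<epsilon>\<bar> = c \<epsilon>" using sign by eventually_elim (simp add: c_def)
  then have c: "(c \<longlongrightarrow> 1) (at_right 0)" using coefficient_abs_limit[of n] unfolding c_def[symmetric] by (simp add: tendsto_cong)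
  have "((\<lambda>\<epsilon>. L2_norm \<rho>0 (\<lambda>x. phi \<epsilon> n x - c \<epsilon> * phi0 n x) + \<bar>c \<epsilon> - 1\<bar>) \<longlongrightarrow> 0 + \<bar>1 - 1\<bar>) (at_right 0)"
    by (intro tendsto_intros c eigenfunction_direction[of n, folded c_def])
  then have lim: "((\<lambda>\<epsilon>. L2_norm \<rho>0 (\<lambda>x. phi \<epsilon> n x - c \<epsilon> * phi0 n x) + \<bar>c \<epsilon> - 1\<bar>) \<longlongrightarrow> 0) (at_right 0)" by simp
  show ?thesis
  proof (rule Lim_null_comparison[OF _ lim])
    show "\<forall>\<^sub>F \<epsilon> in at_right 0. norm (L2_norm \<rho>0 (\<lambda>x. phi \<epsilon> n x - phi0 n x)) \<le> L2_norm \<rho>0 (\<lambda>x. phi \<epsilon> n x - c \<epsilon> * phi0 n x) + \<bar>c \<epsilon> - 1\<bar>"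
      using eventually_small_scale
    proof eventually_elim
      case (elim \<epsilon>)
      then have \<epsilon>: "\<epsilon> > 0" by simp
      have "L2_norm \<rho>0 (\<lambda>x. phi \<epsilon> n x - phi0 n x) \<le> L2_norm \<rho>0 (\<lambda>x. phi \<epsilon> n x - c \<epsilon> * phi0 n x) + L2_norm \<rho>0 (\<lambda>x. c \<epsilon> * phi0 n x - phi0 n x)"
        by (intro L2_norm_triangle_diff H1_D(1)[OF phi_H1[OF \<epsilon>]] L2_cmult eigen_zero(5))
      also have "(\<lambda>x. c \<epsilon> * phi0 n x - phi0 n x) = (\<lambda>x. (c \<epsilon> - 1) * phi0 n x)" by (simp add: left_diff_distrib)
      also have "L2_norm \<rho>0 \<dots> = \<bar>c \<epsilon> - 1\<bar>" by (simp add: L2_norm_cmult phi0_norm)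
      finally show ?case by (simp add: L2_norm_nonneg)
    qed
  qed
qed

lemma H1_inner_wform: "H1_inner \<rho>0 u v = L2_inner \<rho>0 u v + wform (mat 1) \<rho>0 u v"
  unfolding H1_inner_def wform_def by simp

text \<open>Against a test function the \<open>H\<^sup>1\<close> inner product involves, after integrating by parts, only the
  eigenfunction itself, so strong \<open>L\<^sup>2\<close> convergence suffices; uniform \<open>H\<^sup>1\<close> bounds extend this
  to all elements.\<close>

lemma eigenpair_convergence:
  assumes sign: "\<forall>\<^sub>F \<epsilon> in at_right 0. L2_inner \<rho>0 (phi \<epsilon> n) (phi0 n) > 0"
  shows "L2_strong_lim \<rho>0 (\<lambda>\<epsilon>. phi \<epsilon> n) (phi0 n) (at_right 0)"
    and "H1_weak_lim \<rho>0 (\<lambda>\<epsilon>. phi \<epsilon> n) (phi0 n) (at_right 0)"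
proof -
  note convolution = eigenfunction_convergence[OF sign]
  have evH: "\<forall>\<^sub>F \<epsilon> in at_right 0. H1 \<rho>0 (phi \<epsilon> n)" using eventually_small_scale by eventually_elim (simp add: phi_H1)
  have evL: "\<forall>\<^sub>F \<epsilon> in at_right 0. L2 \<rho>0 (phi \<epsilon> n)" using evH by eventually_elim (rule H1_D(1))
  show "L2_strong_lim \<rho>0 (\<lambda>\<epsilon>. phi \<epsilon> n) (phi0 n) (at_right 0)"
    unfolding L2_strong_lim_def using evL eigen_zero(5) convolution by blast
  obtain G where G: "\<forall>\<^sub>F \<epsilon> in at_right 0. H1 \<rho>0 (phi \<epsilon> n) \<and> grad_norm (phi \<epsilon> n) \<le> G \<and> L2_norm \<rho>0 (phi \<epsilon> n) \<le> G \<and> \<bar>lam \<epsilon> n\<bar> \<le> G"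
    using eigenfunction_bounds by blast
  have G': "\<forall>\<^sub>F \<epsilon> in at_right 0. H1 \<rho>0 (phi \<epsilon> n) \<and> grad_norm (phi \<epsilon> n) \<le> G \<and> L2_norm \<rho>0 (phi \<epsilon> n) \<le> G \<and> \<bar>0::real\<bar> \<le> G"
    using G by eventually_elim auto
  have "((\<lambda>\<epsilon>. H1_inner \<rho>0 (phi \<epsilon> n) \<psi>) \<longlongrightarrow> H1_inner \<rho>0 (phi0 n) \<psi>) (at_right 0)" if \<psi>: "H1 \<rho>0 \<psi>" for \<psi>
  proof -
    have "((\<lambda>\<epsilon>. wform (mat 1) \<rho>0 (phi \<epsilon> n) \<psi> - 0 * L2_inner \<rho>0 (phi \<epsilon> n) \<psi> - wform (mat 1) \<rho>0 (phi0 n) \<psi>) \<longlongrightarrow> 0) (at_right 0)"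
    proof (rule limit_equation_by_density[OF G' eigen_zero(4) _ \<psi>])
      fix \<psi>' :: "real^'d \<Rightarrow> real" assume t: "test_function \<psi>'"
      have "((\<lambda>\<epsilon>. wform (mat 1) \<rho>0 (phi \<epsilon> n) \<psi>') \<longlongrightarrow> wform (mat 1) \<rho>0 (phi0 n) \<psi>') (at_right 0)"
        by (rule wform_L2_tendsto[OF evH eigen_zero(4) convolution t])
      from LIM_zero[OF this] show "((\<lambda>\<epsilon>. wform (mat 1) \<rho>0 (phi \<epsilon> n) \<psi>' - 0 * L2_inner \<rho>0 (phi \<epsilon> n) \<psi>' - wform (mat 1) \<rho>0 (phi0 n) \<psi>') \<longlongrightarrow> 0) (at_right 0)"
        by simp
    qed
    then have "((\<lambda>\<epsilon>. wform (mat 1) \<rho>0 (phi \<epsilon> n) \<psi> - wform (mat 1) \<rho>0 (phi0 n) \<psi>) \<longlongrightarrow> 0) (at_right 0)" by simp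
    then have 1: "((\<lambda>\<epsilon>. wform (mat 1) \<rho>0 (phi \<epsilon> n) \<psi>) \<longlongrightarrow> wform (mat 1) \<rho>0 (phi0 n) \<psi>) (at_right 0)"
      by (rule LIM_zero_cancel)
    show ?thesis unfolding H1_inner_wform
      by (intro tendsto_add 1 L2_inner_tendsto[OF evL eigen_zero(5) convolution H1_D(1)[OF \<psi>]])
  qed
  then show "H1_weak_lim \<rho>0 (\<lambda>\<epsilon>. phi \<epsilon> n) (phi0 n) (at_right 0)"
    unfolding H1_weak_lim_def using evH eigen_zero(4) by blast
qed

end

theorem theorem4p3:
  fixes \<sigma> L :: real
    and V p :: "real^'d::finite \<Rightarrow> real"
    and \<Phi> :: "real^'d \<Rightarrow> real^'d"
    and lam_eps :: "real \<Rightarrow> nat \<Rightarrow> real"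
    and phi_eps :: "real \<Rightarrow> nat \<Rightarrow> real^'d \<Rightarrow> real"
    and lam_zero :: "nat \<Rightarrow> real"
    and phi_zero :: "nat \<Rightarrow> real^'d \<Rightarrow> real"
  assumes "\<sigma> > 0" and "L > 0"
    and "assumption_A L V p" and "assumption_B V"
    and "cell_solution \<sigma> L p \<Phi>"
    and "\<And>\<epsilon>. \<epsilon> > 0 \<Longrightarrow>
           ordered_eigenpairs (mat \<sigma>) (rho_eps \<sigma> V p \<epsilon>) (lam_eps \<epsilon>) (phi_eps \<epsilon>)"
    and "ordered_eigenpairs (hom_Sigma \<sigma> L p \<Phi>) (rho_zero \<sigma> V) lam_zero phi_zero"
    and "\<And>n. \<forall>\<^sub>F \<epsilon> in at_right 0. L2_inner (rho_zero \<sigma> V) (phi_eps \<epsilon> n) (phi_zero n) > 0"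
  shows "\<forall>n. ((\<lambda>\<epsilon>. lam_eps \<epsilon> n) \<longlongrightarrow> lam_zero n) (at_right 0)
           \<and> L2_strong_lim (rho_zero \<sigma> V) (\<lambda>\<epsilon>. phi_eps \<epsilon> n) (phi_zero n) (at_right 0)
           \<and> H1_weak_lim (rho_zero \<sigma> V) (\<lambda>\<epsilon>. phi_eps \<epsilon> n) (phi_zero n) (at_right 0)"
proof -
  have V: "\<And>k. C_k k V" and p: "\<And>k. C_k k p" and p_periodic: "periodic L p" and low: "\<exists>c. \<forall>x. c \<le> V x"
    using assms(3) unfolding assumption_A_def smooth_def by auto
  obtain c where c: "\<And>x. c \<le> V x" using low by blast
  define Z where "Z = (LINT z|lebesgue. exp (- (1 / \<sigma>) * V z))"
  have rho: "rho_zero \<sigma> V x = exp (- (1 / \<sigma>) * V x) / Z" for x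
    by (simp add: rho_zero_def gibbs_def Z_def set_lebesgue_integral_def)
  \<comment> \<open>If Z were 0, then division by zero would make the density vanish identically, which
    contradicts the normalization of the eigenfunctions.\<close>
  have "Z \<noteq> 0"
  proof
    assume "Z = 0"
    then have "L2_inner (rho_zero \<sigma> V) (phi_zero 0) (phi_zero 0) = 0" by (simp add: L2_inner_def rho)
    moreover have "L2_inner (rho_zero \<sigma> V) (phi_zero 0) (phi_zero 0) = 1"
      using assms(7) unfolding ordered_eigenpairs_def orthonormal_basis_L2_def by simp
    ultimately show False by simp
  qed
  moreover have "Z \<ge> 0" unfolding Z_def by (rule Bochner_Integration.integral_nonneg) simp
  ultimately have Z: "Z > 0" by simp
  have w: "weight (rho_zero \<sigma> V) (exp (- (1 / \<sigma>) * c) / Z)"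
  proof
    show "continuous_on UNIV (rho_zero \<sigma> V)"
      unfolding rho[abs_def] using Z C_k_continuous[OF V] by (intro continuous_intros) auto
    show "0 < rho_zero \<sigma> V x" for x unfolding rho using Z by simp
    show "rho_zero \<sigma> V x \<le> exp (- (1 / \<sigma>) * c) / Z" for x
      unfolding rho using Z c[of x] assms(1) by (simp add: divide_right_mono)
  qed
  interpret homog_eigen \<sigma> V "exp (- (1 / \<sigma>) * c) / Z" L p \<Phi> lam_eps phi_eps lam_zero phi_zero
    by (intro homog_eigen.intro homog.intro w homog_axioms.intro homog_eigen_axioms.intro assms(1,2,5,6,7) V p p_periodic)
  show ?thesis
    using eigenvalue_convergence eigenpair_convergence[OF assms(8)] by blast
qed


end
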